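(* Let $g$ be an adapted metric on $(M;\mathcal D_1,\ldots,\mathcal D_k)$. A contorsion tensor $\mathfrak T$ is critical for the action $\bar J_{\mathcal D}$ with fixed $g$ (for all variations of $\mathfrak T$) if and only if the following equations hold: $$\langle{\rm Tr}_\mu^\bot\mathfrak T^*-\tilde H_\mu,E_{\mu,c}\rangle\langle E_{\mu,a},E_{\mu,b}\rangle+\langle{\rm Tr}_\mu^\bot\mathfrak T+\tilde H_\mu,E_{\mu,b}\rangle\langle E_{\mu,a},E_{\mu,c}\rangle=0,$$ $$\langle{\rm Tr}_\mu^\bot\mathfrak T^*+H_\mu,E_{\rho,i}\rangle\langle E_{\mu,a},E_{\mu,b}\rangle-\langle(h_\mu-T_\mu)(E_{\mu,a},E_{\mu,b}),E_{\rho,i}\rangle-\langle\mathfrak T_{E_{\rho,i}}E_{\mu,a},E_{\mu,b}\rangle=0,$$ $$\langle{\rm Tr}_\mu^\bot\mathfrak T-H_\mu,E_{\rho,i}\rangle\langle E_{\mu,a},E_{\mu,b}\rangle+\langle(h_\mu+T_\mu)(E_{\mu,b},E_{\mu,a}),E_{\rho,i}\rangle-\langle\mathfrak T_{E_{\rho,i}}E_{\mu,b},E_{\mu,a}\rangle=0,$$ $$\langle2T_\mu(E_{\mu,a},E_{\mu,b}),E_{\rho,i}\rangle+\langle\mathfrak T_{E_{\mu,a}}E_{\mu,b}+\mathfrak T^*_{E_{\mu,b}}E_{\mu,a},E_{\rho,i}\rangle=0,$$ $$\langle2\tilde T_\mu(E_{\rho,j},E_{\xi,l}),E_{\mu,a}\rangle+\langle(\tilde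 h_\xi+\tilde T_\xi)(E_{\rho,j},E_{\mu,a}),E_{\xi,l}\rangle+2\langle\mathfrak T_{E_{\xi,l}}E_{\mu,a},E_{\rho,j}\rangle-\langle(\tilde h_\rho+\tilde T_\rho)(E_{\xi,l},E_{\mu,a}),E_{\rho,j}\rangle+2\langle\mathfrak T_{E_{\rho,j}}E_{\xi,l},E_{\mu,a}\rangle=0,$$ for all $\mu,\rho,\xi\in\{1,\ldots,k\}$ such that $\rho\ne\mu$, $\xi\notin\{\mu,\rho\}$, and for all $a,b,c\in\{1,\ldots,n_\mu\}$, $i,j\in\{1,\ldots,n_\rho\}$, $l\in\{1,\ldots,n_\xi\}$ (each equation being required for all values of the indices occurring in it).
   Context: Setting. $M$ is a connected smooth manifold with $TM=\mathcal D_1+\ldots+\mathcal D_k$ a direct sum of $k\ge2$ subbundles (distributions) of ranks $n_\mu$. A pseudo-Riemannian metric $g=\langle\cdot,\cdot\rangle$ is adapted if all $\mathcal D_\mu$ are non-degenerate and pairwise orthogonal. $P_\mu,P_\mu^\bot$ are the orthoprojectors onto $\mathcal D_\mu$ and $\mathcal D_\mu^\bot=\bigoplus_{\nu\ne\mu}\mathcal D_\nu$. $\{E_{\mu,a}\}_{a\le n_\mu}$, $\{\mathcal E_{\mu,i}\}$ are local orthonormal frames of $\mathcal D_\mu$, $\mathcal D_\mu^\bot$; $\varepsilon=\pm1$ is the square of the corresponding frame vector. $\nabla$ is the Levi-Civita connection, $\bar\nabla=\nabla+\mathfrak T$ a linear connection with contorsion $(1,2)$-tensor $\mathfrak T$;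 $\langle\mathfrak T^*_XY,Z\rangle=\langle\mathfrak T_XZ,Y\rangle$; ${\rm Tr}_\mu^\bot\mathfrak T=\sum_i\varepsilon_i\mathfrak T_{\mathcal E_{\mu,i}}\mathcal E_{\mu,i}$. Mixed scalar curvature: with $\bar R_{X,Y}=[\bar\nabla_Y,\bar\nabla_X]+\bar\nabla_{[X,Y]}$, $\overline{\rm S}_{\mathcal D_1,\ldots,\mathcal D_k}=\frac12\sum_{\nu<\mu}\sum_{a,b}\varepsilon_a\varepsilon_b(\langle\bar R_{E_{\nu,a},E_{\mu,b}}E_{\nu,a},E_{\mu,b}\rangle+\langle\bar R_{E_{\mu,b},E_{\nu,a}}E_{\mu,b},E_{\nu,a}\rangle)$. The action is $\bar J_{\mathcal D}(g,\mathfrak T)=\int_M\overline{\rm S}_{\mathcal D_1,\ldots,\mathcal D_k}\,{\rm d\,vol}_g$ (over a relatively compact domain $\Omega$ containing the supports of variations if $M$ is non-compact). Critical with fixed $g$ means $\frac{d}{dt}\bar J_{\mathcal D}(g,\mathfrak T_t)|_{t=0}=0$ for all smooth families of $(1,2)$-tensors $\mathfrak T_t$ with $\mathfrak T_0=\mathfrak T$ and $\partial_t\mathfrak T_t$ supported in $\Omega$. For $X,Y\in\mathcal D_\mu$: $h_\mu(X,Y)=\frac12P_\mu^\bot(\nabla_XY+\nabla_YX)$, $T_\mu(X,Y)=\frac12P_\mu^\bot(\nabla_XY-\nabla_YX)$, $H_\mu={\rm Tr}_gh_\mu$; for $X,Y\in\mathcal D_\mu^\bot$: $\tilde h_\mu(X,Y)=\frac12P_\mu(\nabla_XY+\nabla_YX)$,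 $\tilde T_\mu(X,Y)=\frac12P_\mu(\nabla_XY-\nabla_YX)$, $\tilde H_\mu={\rm Tr}_g\tilde h_\mu$. *)

theory Defs
  imports "HOL-Analysis.Analysis"
begin

section \<open>Smooth maps on open subsets of normed spaces\<close>

fun k_smooth_on :: "nat \<Rightarrow> 'a::real_normed_vector set \<Rightarrow> ('a \<Rightarrow> 'b::real_normed_vector) \<Rightarrow> bool" where
  "k_smooth_on 0 S f \<longleftrightarrow> continuous_on S f"
| "k_smooth_on (Suc m) S f \<longleftrightarrow>
     (\<forall>x\<in>S. f differentiable (at x)) \<and> (\<forall>v. k_smooth_on m S (\<lambda>x. frechet_derivative f (at x) v))"

definition smooth_on :: "'a::real_normed_vector set \<Rightarrow> ('a \<Rightarrow> 'b::real_normed_vector) \<Rightarrow> bool" where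
  "smooth_on S f \<longleftrightarrow> (\<forall>m. k_smooth_on m S f)"

section \<open>Smooth manifolds\<close>

text \<open>The manifold is a whole type \<open>'a\<close> (Hausdorff and second countable, by its type class)
  with an atlas \<open>A\<close> of charts into \<open>real ^ 'n\<close>, a chart being a pair of a domain and a map.\<close>

type_synonym ('a, 'n) chart = "'a set \<times> ('a \<Rightarrow> real ^ 'n)"

definition chart_inv :: "('a, 'n) chart \<Rightarrow> real ^ 'n \<Rightarrow> 'a" where
  "chart_inv c = inv_into (fst c) (snd c)"

definition smooth_atlas ::
  "('a::{t2_space,second_countable_topology}, 'n::finite) chart set \<Rightarrow> bool" where
  "smooth_atlas A \<longleftrightarrow>
     (\<forall>c\<in>A. open (fst c) \<and> open (snd c ` fst c) \<and>
            homeomorphism (fst c) (snd c ` fst c) (snd c) (chart_inv c)) \<and>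
     (\<Union>c\<in>A. fst c) = UNIV \<and>
     (\<forall>c\<in>A. \<forall>d\<in>A. smooth_on (snd c ` (fst c \<inter> fst d)) (snd d \<circ> chart_inv c))"

text \<open>Fix at every point \<open>p\<close> a preferred chart \<open>chart_at A p\<close>. Its differential at \<open>p\<close> identifies the
  tangent space at \<open>p\<close> with \<open>real ^ 'n\<close>; tangent vectors at \<open>p\<close> are represented this way, so that
  a vector field is a function \<open>'a \<Rightarrow> real ^ 'n\<close>. \<open>to_coord A c p\<close> is the differential at \<open>p\<close> of
  an arbitrary chart \<open>c\<close> around \<open>p\<close>, and \<open>of_coord A c p\<close> is its inverse. No smoothness in \<open>p\<close> is
  expected of \<open>chart_at\<close>: smoothness of fields is always tested in the charts of \<open>A\<close>.\<close>

definition chart_at :: "('a, 'n) chart set \<Rightarrow> 'a \<Rightarrow> ('a, 'n) chart" where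
  "chart_at A p = (SOME c. c \<in> A \<and> p \<in> fst c)"

definition to_coord ::
  "('a, 'n::finite) chart set \<Rightarrow> ('a, 'n) chart \<Rightarrow> 'a \<Rightarrow> real ^ 'n \<Rightarrow> real ^ 'n" where
  "to_coord A c p =
     frechet_derivative (snd c \<circ> chart_inv (chart_at A p)) (at (snd (chart_at A p) p))"

definition of_coord ::
  "('a, 'n::finite) chart set \<Rightarrow> ('a, 'n) chart \<Rightarrow> 'a \<Rightarrow> real ^ 'n \<Rightarrow> real ^ 'n" where
  "of_coord A c p =
     frechet_derivative (snd (chart_at A p) \<circ> chart_inv c) (at (snd c p))"

definition smooth_fun :: "('a, 'n::finite) chart set \<Rightarrow> 'a set \<Rightarrow> ('a \<Rightarrow> real) \<Rightarrow> bool" where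
  "smooth_fun A W f \<longleftrightarrow> (\<forall>c\<in>A. smooth_on (snd c ` (fst c \<inter> W)) (f \<circ> chart_inv c))"

definition field_coord ::
  "('a, 'n::finite) chart set \<Rightarrow> ('a, 'n) chart \<Rightarrow> ('a \<Rightarrow> real ^ 'n) \<Rightarrow> real ^ 'n \<Rightarrow> real ^ 'n" where
  "field_coord A c X x = to_coord A c (chart_inv c x) (X (chart_inv c x))"

definition smooth_field ::
  "('a, 'n::finite) chart set \<Rightarrow> 'a set \<Rightarrow> ('a \<Rightarrow> real ^ 'n) \<Rightarrow> bool" where
  "smooth_field A W X \<longleftrightarrow> (\<forall>c\<in>A. smooth_on (snd c ` (fst c \<inter> W)) (field_coord A c X))"

text \<open>In the chart \<open>chart_at A p\<close> the coordinate vector of \<open>X\<close> at \<open>p\<close> is \<open>X p\<close> itself.\<close>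

definition dir_deriv ::
  "('a, 'n::finite) chart set \<Rightarrow> ('a \<Rightarrow> real ^ 'n) \<Rightarrow> ('a \<Rightarrow> real) \<Rightarrow> 'a \<Rightarrow> real" where
  "dir_deriv A X f p =
     (let c = chart_at A p in frechet_derivative (f \<circ> chart_inv c) (at (snd c p)) (X p))"

definition lie_bracket ::
  "('a, 'n::finite) chart set \<Rightarrow> ('a \<Rightarrow> real ^ 'n) \<Rightarrow> ('a \<Rightarrow> real ^ 'n) \<Rightarrow> 'a \<Rightarrow> real ^ 'n" where
  "lie_bracket A X Y p =
     (let c = chart_at A p in
        frechet_derivative (field_coord A c Y) (at (snd c p)) (X p)
      - frechet_derivative (field_coord A c X) (at (snd c p)) (Y p))"

section \<open>Tensor fields, metrics, distributions\<close>

type_synonym ('a, 'n) metric = "'a \<Rightarrow> real ^ 'n \<Rightarrow> real ^ 'n \<Rightarrow> real"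
type_synonym ('a, 'n) tensor12 = "'a \<Rightarrow> real ^ 'n \<Rightarrow> real ^ 'n \<Rightarrow> real ^ 'n"
type_synonym ('a, 'n) vfield = "'a \<Rightarrow> real ^ 'n"
type_synonym ('a, 'n) connection = "('a, 'n) vfield \<Rightarrow> ('a, 'n) vfield \<Rightarrow> ('a, 'n) vfield"

definition pseudo_riemannian_metric ::
  "('a, 'n::finite) chart set \<Rightarrow> ('a, 'n) metric \<Rightarrow> bool" where
  "pseudo_riemannian_metric A g \<longleftrightarrow>
     (\<forall>p. bilinear (g p) \<and> (\<forall>v w. g p v w = g p w v) \<and> (\<forall>v. (\<forall>w. g p v w = 0) \<longrightarrow> v = 0)) \<and>
     (\<forall>c\<in>A. \<forall>v w. smooth_on (snd c ` fst c)
        (\<lambda>x. let p = chart_inv c x in g p (of_coord A c p v) (of_coord A c p w)))"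

definition smooth_tensor12 :: "('a, 'n::finite) chart set \<Rightarrow> ('a, 'n) tensor12 \<Rightarrow> bool" where
  "smooth_tensor12 A \<TT> \<longleftrightarrow>
     (\<forall>p. bilinear (\<TT> p)) \<and>
     (\<forall>c\<in>A. \<forall>v w. smooth_on (snd c ` fst c)
        (\<lambda>x. let p = chart_inv c x in to_coord A c p (\<TT> p (of_coord A c p v) (of_coord A c p w))))"

definition smooth_tensor12_family ::
  "('a, 'n::finite) chart set \<Rightarrow> real \<Rightarrow> (real \<Rightarrow> ('a, 'n) tensor12) \<Rightarrow> bool" where
  "smooth_tensor12_family A \<epsilon> F \<longleftrightarrow>
     (\<forall>t\<in>{-\<epsilon><..<\<epsilon>}. \<forall>p. bilinear (F t p)) \<and>
     (\<forall>c\<in>A. \<forall>v w. smooth_on ({-\<epsilon><..<\<epsilon>} \<times> snd c ` fst c)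
        (\<lambda>(t, x). let p = chart_inv c x in
           to_coord A c p (F t p (of_coord A c p v) (of_coord A c p w))))"

definition distribution ::
  "('a::topological_space, 'n::finite) chart set \<Rightarrow> ('a \<Rightarrow> (real ^ 'n) set) \<Rightarrow> nat \<Rightarrow> bool" where
  "distribution A D r \<longleftrightarrow>
     (\<forall>p. subspace (D p) \<and> dim (D p) = r) \<and>
     (\<forall>p. \<exists>W e. open W \<and> p \<in> W \<and> (\<forall>a\<in>{1..r}. smooth_field A W (e a)) \<and>
        (\<forall>q\<in>W. span ((\<lambda>a. e a q) ` {1..r}) = D q))"

definition almost_multi_product ::
  "('a::topological_space, 'n::finite) chart set \<Rightarrow> nat \<Rightarrow> (nat \<Rightarrow> nat) \<Rightarrow>
   (nat \<Rightarrow> 'a \<Rightarrow> (real ^ 'n) set) \<Rightarrow> bool" where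
  "almost_multi_product A k n D \<longleftrightarrow>
     (\<forall>\<mu>\<in>{1..k}. distribution A (D \<mu>) (n \<mu>)) \<and>
     (\<forall>p v. \<exists>!u. u \<in> (\<Pi>\<^sub>E \<mu>\<in>{1..k}. D \<mu> p) \<and> v = (\<Sum>\<mu>\<in>{1..k}. u \<mu>))"

definition adapted_metric ::
  "('a, 'n::finite) chart set \<Rightarrow> nat \<Rightarrow> (nat \<Rightarrow> 'a \<Rightarrow> (real ^ 'n) set) \<Rightarrow> ('a, 'n) metric \<Rightarrow> bool" where
  "adapted_metric A k D g \<longleftrightarrow>
     pseudo_riemannian_metric A g \<and>
     (\<forall>p. \<forall>\<mu>\<in>{1..k}. \<forall>v\<in>D \<mu> p. (\<forall>w\<in>D \<mu> p. g p v w = 0) \<longrightarrow> v = 0) \<and>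
     (\<forall>p. \<forall>\<mu>\<in>{1..k}. \<forall>\<nu>\<in>{1..k}. \<mu> \<noteq> \<nu> \<longrightarrow> (\<forall>v\<in>D \<mu> p. \<forall>w\<in>D \<nu> p. g p v w = 0))"

definition perp :: "nat \<Rightarrow> (nat \<Rightarrow> 'a \<Rightarrow> (real ^ 'n::finite) set) \<Rightarrow> nat \<Rightarrow> 'a \<Rightarrow> (real ^ 'n) set" where
  "perp k D \<mu> p = span (\<Union>\<nu>\<in>{1..k} - {\<mu>}. D \<nu> p)"

definition orthoproj ::
  "('a, 'n::finite) metric \<Rightarrow> ('a \<Rightarrow> (real ^ 'n) set) \<Rightarrow> 'a \<Rightarrow> real ^ 'n \<Rightarrow> real ^ 'n" where
  "orthoproj g V p v = (THE u. u \<in> V p \<and> (\<forall>w\<in>V p. g p (v - u) w = 0))"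

section \<open>Orthonormal frames and traces\<close>

definition local_orthonormal_frame ::
  "('a::topological_space, 'n::finite) chart set \<Rightarrow> ('a, 'n) metric \<Rightarrow> ('a \<Rightarrow> (real ^ 'n) set) \<Rightarrow>
   nat \<Rightarrow> 'a set \<Rightarrow> (nat \<Rightarrow> ('a, 'n) vfield) \<Rightarrow> bool" where
  "local_orthonormal_frame A g V m W e \<longleftrightarrow>
     open W \<and> (\<forall>a\<in>{1..m}. smooth_field A W (e a)) \<and>
     (\<forall>p\<in>W. span ((\<lambda>a. e a p) ` {1..m}) = V p \<and>
        (\<forall>a\<in>{1..m}. \<bar>g p (e a p) (e a p)\<bar> = 1) \<and>
        (\<forall>a\<in>{1..m}. \<forall>b\<in>{1..m}. a \<noteq> b \<longrightarrow> g p (e a p) (e b p) = 0))"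

definition adapted_frame ::
  "('a::topological_space, 'n::finite) chart set \<Rightarrow> nat \<Rightarrow> (nat \<Rightarrow> nat) \<Rightarrow>
   (nat \<Rightarrow> 'a \<Rightarrow> (real ^ 'n) set) \<Rightarrow> ('a, 'n) metric \<Rightarrow> 'a set \<Rightarrow>
   (nat \<Rightarrow> nat \<Rightarrow> ('a, 'n) vfield) \<Rightarrow> bool" where
  "adapted_frame A k n D g W E \<longleftrightarrow>
     (\<forall>\<mu>\<in>{1..k}. local_orthonormal_frame A g (D \<mu>) (n \<mu>) W (E \<mu>))"

text \<open>The trace over the subbundle \<open>V\<close> of a vector-valued bilinear map \<open>B\<close> on vector fields: the
  common value at \<open>p\<close> of \<open>\<Sum>\<^sub>a \<epsilon>\<^sub>a B(e\<^sub>a, e\<^sub>a)\<close> for all local orthonormal frames of \<open>V\<close> around \<open>p\<close>.\<close>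

definition frame_trace ::
  "('a::topological_space, 'n::finite) chart set \<Rightarrow> ('a, 'n) metric \<Rightarrow> ('a \<Rightarrow> (real ^ 'n) set) \<Rightarrow>
   (('a, 'n) vfield \<Rightarrow> ('a, 'n) vfield \<Rightarrow> ('a, 'n) vfield) \<Rightarrow> ('a, 'n) vfield" where
  "frame_trace A g V B p =
     (THE v. \<forall>W e. p \<in> W \<and> local_orthonormal_frame A g V (dim (V p)) W e \<longrightarrow>
        v = (\<Sum>a\<in>{1..dim (V p)}. g p (e a p) (e a p) *\<^sub>R B (e a) (e a) p))"

section \<open>Connections and volume\<close>

text \<open>A connection acts on local vector fields. A field that is smooth on an open set \<open>W\<close> may be
  arbitrary outside \<open>W\<close>; that the value on \<open>W\<close> depends only on the restrictions to \<open>W\<close> follows from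
  the rules below, applied to functions \<open>f\<close> that vanish exactly on \<open>W\<close>.\<close>

definition linear_connection ::
  "('a::topological_space, 'n::finite) chart set \<Rightarrow> ('a, 'n) connection \<Rightarrow> bool" where
  "linear_connection A nabla \<longleftrightarrow>
     (\<forall>W X Y Z f. open W \<and> smooth_field A W X \<and> smooth_field A W Y \<and> smooth_field A W Z \<and>
                  smooth_fun A W f \<longrightarrow>
        smooth_field A W (nabla X Y) \<and>
        (\<forall>p\<in>W.
          nabla (\<lambda>q. X q + Z q) Y p = nabla X Y p + nabla Z Y p \<and>
          nabla (\<lambda>q. f q *\<^sub>R X q) Y p = f p *\<^sub>R nabla X Y p \<and>
          nabla X (\<lambda>q. Y q + Z q) p = nabla X Y p + nabla X Z p \<and>
          nabla X (\<lambda>q. f q *\<^sub>R Y q) p = dir_deriv A X f p *\<^sub>R Y p + f p *\<^sub>R nabla X Y p))"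

definition levi_civita ::
  "('a::topological_space, 'n::finite) chart set \<Rightarrow> ('a, 'n) metric \<Rightarrow> ('a, 'n) connection \<Rightarrow> bool" where
  "levi_civita A g nabla \<longleftrightarrow>
     linear_connection A nabla \<and>
     (\<forall>W X Y Z. open W \<and> smooth_field A W X \<and> smooth_field A W Y \<and> smooth_field A W Z \<longrightarrow>
        (\<forall>p\<in>W.
          nabla X Y p - nabla Y X p = lie_bracket A X Y p \<and>
          dir_deriv A X (\<lambda>q. g q (Y q) (Z q)) p = g p (nabla X Y p) (Z p) + g p (Y p) (nabla X Z p)))"

definition volume_measure ::
  "('a::topological_space, 'n::finite) chart set \<Rightarrow> ('a, 'n) metric \<Rightarrow> 'a measure \<Rightarrow> bool" where
  "volume_measure A g vol \<longleftrightarrow>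
     sets vol = sets borel \<and>
     (\<forall>c\<in>A. \<forall>S\<in>sets borel. S \<subseteq> fst c \<longrightarrow>
        emeasure vol S =
          (\<integral>\<^sup>+x\<in>snd c ` S. ennreal (sqrt \<bar>det (\<chi> i j. let p = chart_inv c x in
              g p (of_coord A c p (axis i 1)) (of_coord A c p (axis j 1)))\<bar>) \<partial>lborel))"

section \<open>Mixed scalar curvature of \<open>nabla + \<TT>\<close> and the action\<close>

definition nabla_bar :: "('a, 'n) connection \<Rightarrow> ('a, 'n) tensor12 \<Rightarrow> ('a, 'n::finite) connection" where
  "nabla_bar nabla \<TT> X Y p = nabla X Y p + \<TT> p (X p) (Y p)"

definition curv_bar ::
  "('a, 'n::finite) chart set \<Rightarrow> ('a, 'n) connection \<Rightarrow> ('a, 'n) tensor12 \<Rightarrow>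
   ('a, 'n) vfield \<Rightarrow> ('a, 'n) vfield \<Rightarrow> ('a, 'n) vfield \<Rightarrow> ('a, 'n) vfield" where
  "curv_bar A nabla \<TT> X Y Z p =
     nabla_bar nabla \<TT> Y (nabla_bar nabla \<TT> X Z) p
   - nabla_bar nabla \<TT> X (nabla_bar nabla \<TT> Y Z) p
   + nabla_bar nabla \<TT> (lie_bracket A X Y) Z p"

text \<open>The common value at \<open>p\<close> for all adapted local orthonormal frames \<open>E\<close> around \<open>p\<close>.\<close>

definition mixed_scalar_curv ::
  "('a::topological_space, 'n::finite) chart set \<Rightarrow> nat \<Rightarrow> (nat \<Rightarrow> nat) \<Rightarrow>
   (nat \<Rightarrow> 'a \<Rightarrow> (real ^ 'n) set) \<Rightarrow> ('a, 'n) metric \<Rightarrow> ('a, 'n) connection \<Rightarrow>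
   ('a, 'n) tensor12 \<Rightarrow> 'a \<Rightarrow> real" where
  "mixed_scalar_curv A k n D g nabla \<TT> p =
     (THE s. \<forall>W E. p \<in> W \<and> adapted_frame A k n D g W E \<longrightarrow>
        s = (1/2) * (\<Sum>\<mu>\<in>{1..k}. \<Sum>\<nu>\<in>{1..<\<mu>}. \<Sum>a\<in>{1..n \<nu>}. \<Sum>b\<in>{1..n \<mu>}.
              g p (E \<nu> a p) (E \<nu> a p) * g p (E \<mu> b p) (E \<mu> b p) *
              (g p (curv_bar A nabla \<TT> (E \<nu> a) (E \<mu> b) (E \<nu> a) p) (E \<mu> b p)
             + g p (curv_bar A nabla \<TT> (E \<mu> b) (E \<nu> a) (E \<mu> b) p) (E \<nu> a p))))"

definition action ::
  "('a::topological_space, 'n::finite) chart set \<Rightarrow> nat \<Rightarrow> (nat \<Rightarrow> nat) \<Rightarrow>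
   (nat \<Rightarrow> 'a \<Rightarrow> (real ^ 'n) set) \<Rightarrow> ('a, 'n) metric \<Rightarrow> ('a, 'n) connection \<Rightarrow>
   'a measure \<Rightarrow> 'a set \<Rightarrow> ('a, 'n) tensor12 \<Rightarrow> real" where
  "action A k n D g nabla vol \<Omega> \<TT> = (LINT p:\<Omega>|vol. mixed_scalar_curv A k n D g nabla \<TT> p)"

text \<open>If the manifold is compact, \<open>\<Omega> = UNIV\<close> is one of the relatively compact domains.\<close>

definition critical_contorsion ::
  "('a::topological_space, 'n::finite) chart set \<Rightarrow> nat \<Rightarrow> (nat \<Rightarrow> nat) \<Rightarrow>
   (nat \<Rightarrow> 'a \<Rightarrow> (real ^ 'n) set) \<Rightarrow> ('a, 'n) metric \<Rightarrow> ('a, 'n) connection \<Rightarrow>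
   'a measure \<Rightarrow> ('a, 'n) tensor12 \<Rightarrow> bool" where
  "critical_contorsion A k n D g nabla vol \<TT> \<longleftrightarrow>
     (\<forall>\<Omega> \<epsilon> F. open \<Omega> \<and> connected \<Omega> \<and> compact (closure \<Omega>) \<and> \<epsilon> > 0 \<and>
        smooth_tensor12_family A \<epsilon> F \<and> F 0 = \<TT> \<and>
        (\<forall>t\<in>{-\<epsilon><..<\<epsilon>}.
           closure {p. \<exists>v w. vector_derivative (\<lambda>s. F s p v w) (at t) \<noteq> 0} \<subseteq> \<Omega>) \<longrightarrow>
        ((\<lambda>t. action A k n D g nabla vol \<Omega> (F t)) has_real_derivative 0) (at 0))"

section \<open>Extrinsic geometry of the distributions\<close>

definition tensor_adj :: "('a, 'n::finite) metric \<Rightarrow> ('a, 'n) tensor12 \<Rightarrow> ('a, 'n) tensor12" where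
  "tensor_adj g \<TT> p x y = (THE u. \<forall>z. g p u z = g p (\<TT> p x z) y)"

definition trace_perp ::
  "('a::topological_space, 'n::finite) chart set \<Rightarrow> nat \<Rightarrow> (nat \<Rightarrow> 'a \<Rightarrow> (real ^ 'n) set) \<Rightarrow>
   ('a, 'n) metric \<Rightarrow> nat \<Rightarrow> ('a, 'n) tensor12 \<Rightarrow> ('a, 'n) vfield" where
  "trace_perp A k D g \<mu> \<TT> = frame_trace A g (perp k D \<mu>) (\<lambda>X Y p. \<TT> p (X p) (Y p))"

context
  fixes A :: "('a::topological_space, 'n::finite) chart set"
    and k :: nat
    and D :: "nat \<Rightarrow> 'a \<Rightarrow> (real ^ 'n) set"
    and g :: "('a, 'n) metric"
    and nabla :: "('a, 'n) connection"
begin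

definition sff :: "nat \<Rightarrow> ('a, 'n) vfield \<Rightarrow> ('a, 'n) vfield \<Rightarrow> ('a, 'n) vfield" where
  "sff \<mu> X Y p = (1/2) *\<^sub>R orthoproj g (perp k D \<mu>) p (nabla X Y p + nabla Y X p)"

definition integrability :: "nat \<Rightarrow> ('a, 'n) vfield \<Rightarrow> ('a, 'n) vfield \<Rightarrow> ('a, 'n) vfield" where
  "integrability \<mu> X Y p = (1/2) *\<^sub>R orthoproj g (perp k D \<mu>) p (nabla X Y p - nabla Y X p)"

definition mean_curv :: "nat \<Rightarrow> ('a, 'n) vfield" where
  "mean_curv \<mu> = frame_trace A g (D \<mu>) (sff \<mu>)"

definition sff_perp :: "nat \<Rightarrow> ('a, 'n) vfield \<Rightarrow> ('a, 'n) vfield \<Rightarrow> ('a, 'n) vfield" where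
  "sff_perp \<mu> X Y p = (1/2) *\<^sub>R orthoproj g (D \<mu>) p (nabla X Y p + nabla Y X p)"

definition integrability_perp :: "nat \<Rightarrow> ('a, 'n) vfield \<Rightarrow> ('a, 'n) vfield \<Rightarrow> ('a, 'n) vfield" where
  "integrability_perp \<mu> X Y p = (1/2) *\<^sub>R orthoproj g (D \<mu>) p (nabla X Y p - nabla Y X p)"

definition mean_curv_perp :: "nat \<Rightarrow> ('a, 'n) vfield" where
  "mean_curv_perp \<mu> = frame_trace A g (perp k D \<mu>) (sff_perp \<mu>)"

end

end

theory Submission
  imports Defs
begin

text \<open>
  In an adapted orthonormal frame \<open>e\<^sub>i\<close> with signs \<open>\<epsilon>\<^sub>i\<close>, let \<open>G\<^bsub>abc\<^esub> = g(\<nabla>\<^sub>a e\<^sub>b + \<TT>(e\<^sub>a, e\<^sub>b), e\<^sub>c)\<close> be the components of the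
  connection with contorsion. The mixed scalar curvature is a first-order expression in \<open>G\<close>, quadratic
  in its zeroth-order part, so its derivative in the direction of a tensor \<open>B\<close> is, up to the factor
  \<open>2\<close>, the sum of a divergence (of a vector field linear in \<open>B\<close>) and of
  \<open>\<Sum> \<epsilon>\<^sub>x \<epsilon>\<^sub>y \<epsilon>\<^sub>z EL\<^bsub>xyz\<^esub> B\<^bsub>xyz\<^esub>\<close>. According to which of \<open>x\<close>, \<open>y\<close>, \<open>z\<close> belong to the same distribution,
  the equations \<open>EL\<^bsub>xyz\<^esub> = 0\<close> are, up to constant factors, the five equations of the theorem.

  If they hold, the derivative of the action vanishes: cut \<open>B\<close> by bump functions into pieces supported
  in frame domains, where the integral of the divergence is zero by a computation in a chart. Conversely,
  if \<open>EL\<^bsub>xyz\<^esub>\<close> is nonzero at a point, a bump function times the frame tensor dual to the indices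
  \<open>x\<close>, \<open>y\<close>, \<open>z\<close> is a variation whose derivative has the sign of \<open>EL\<^bsub>xyz\<^esub>\<close>.
\<close>

section \<open>Calculus of smooth maps\<close>

text \<open>The mixed scalar curvature, the traces, the adjoint and the projections are definite
  descriptions, so nothing can be computed with them before adapted frames are known to exist and
  the frame sums to be independent of the frame. Existence is Gram-Schmidt for an indefinite metric,
  where a vector to be normalised must first be shown to be non-null. Independence needs the
  curvature of \<open>nabla_bar\<close> to be tensorial, because \<open>curv_bar\<close> takes
  fields, not vectors.

  The divergence comes from the frame derivatives of \<open>G\<close> inside the curvature. The
  field \<open>v * e j\<close> has divergence \<open>e j\<close> applied to \<open>v\<close>, minus
  \<open>v * (\<Sum>i. \<epsilon> i * \<Gamma> i i j)\<close>. Completing the derivative terms to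
  divergences therefore costs zeroth-order terms; these are the sums of
  \<open>\<Gamma> i i z\<close> and \<open>\<Gamma> i i y\<close> in \<open>el_coeff\<close>, the
  source of the terms with \<open>H \<mu>\<close>.

  The first variation depends on a family only through its velocity, and additively. That reduces
  every variation to a line \<open>T + t * B\<close> and allows \<open>B\<close> to be cut
  up.\<close>

lemma k_smooth_on_cong:
  assumes "open S" "\<And>x. x \<in> S \<Longrightarrow> f x = g x" "k_smooth_on m S f"
  shows "k_smooth_on m S g"
  using assms(2,3)
proof (induction m arbitrary: f g)
  case 0 then show ?case by (simp cong: continuous_on_cong)
next
  case (Suc m)
  have d: "g differentiable at x" "frechet_derivative g (at x) = frechet_derivative f (at x)" if "x \<in> S" for x
  proof -
    have fd: "f differentiable at x" using Suc that by auto
    then obtain f' where f': "(f has_derivative f') (at x)" by (auto simp: differentiable_def)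
    have g': "(g has_derivative f') (at x)"
      by (rule has_derivative_transform_within_open[OF f' assms(1) that]) (use Suc in auto)
    show "g differentiable at x" using g' by (auto simp: differentiable_def)
    show "frechet_derivative g (at x) = frechet_derivative f (at x)"
      using frechet_derivative_at[OF f'] frechet_derivative_at[OF g'] by simp
  qed
  show ?case
    using Suc.prems Suc.IH[of "\<lambda>x. frechet_derivative f (at x) v" "\<lambda>x. frechet_derivative g (at x) v" for v]
    by (auto simp: d)
qed

lemma k_smooth_onD:
  "k_smooth_on (Suc m) S f \<Longrightarrow> x \<in> S \<Longrightarrow> (f has_derivative frechet_derivative f (at x)) (at x)"
  using frechet_derivative_works by (metis k_smooth_on.simps(2))

lemma k_smooth_on_imp_continuous:
  assumes "k_smooth_on m S f" shows "continuous_on S f"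
proof (cases m)
  case (Suc l)
  with assms have "continuous (at x) f" if "x \<in> S" for x
    using differentiable_imp_continuous_within[of f x UNIV] that by simp
  then show ?thesis by (simp add: continuous_at_imp_continuous_on)
qed (use assms in simp)

text \<open>The recursion asks for order m only of the derivatives, so monotonicity in the order is
  not part of the definition; at order 0 it is the continuity of differentiable maps.\<close>

lemma k_smooth_on_Suc_imp: "k_smooth_on (Suc m) S f \<Longrightarrow> k_smooth_on m S f"
proof (induction m arbitrary: f)
  case 0 then show ?case by (metis k_smooth_on.simps(1) k_smooth_on_imp_continuous)
next
  case (Suc m)
  show ?case unfolding k_smooth_on.simps(2)[of m]
    using Suc.IH Suc.prems unfolding k_smooth_on.simps(2)[of "Suc m"] by blast
qed

lemma k_smooth_on_subset: "k_smooth_on m S f \<Longrightarrow> S' \<subseteq> S \<Longrightarrow> k_smooth_on m S' f"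
  by (induction m arbitrary: f) (auto intro: continuous_on_subset)

lemma k_smooth_on_const: "k_smooth_on m S (\<lambda>x. c)"
proof (induction m arbitrary: c)
  case (Suc m) then show ?case
    by (auto simp: frechet_derivative_const)
qed auto

lemma k_smooth_on_bounded_linear:
  assumes "open S" "bounded_linear L" "k_smooth_on m S f"
  shows "k_smooth_on m S (\<lambda>x. L (f x))"
  using assms(3)
proof (induction m arbitrary: f)
  case 0 then show ?case using assms(2) by (auto intro: bounded_linear.continuous_on)
next
  case (Suc m)
  have d: "((\<lambda>x. L (f x)) has_derivative (\<lambda>v. L (frechet_derivative f (at x) v))) (at x)" if "x \<in> S" for x
    using bounded_linear.has_derivative[OF assms(2) k_smooth_onD[OF Suc.prems that]] .
  have "k_smooth_on m S (\<lambda>x. frechet_derivative (\<lambda>x. L (f x)) (at x) v)" for v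
    by (rule k_smooth_on_cong[OF assms(1), of "\<lambda>x. L (frechet_derivative f (at x) v)"])
       (use Suc in \<open>auto simp: frechet_derivative_at[OF d, symmetric]\<close>)
  then show ?case using d by (auto simp: differentiable_def)
qed

lemma k_smooth_on_add:
  assumes "open S" "k_smooth_on m S f" "k_smooth_on m S g"
  shows "k_smooth_on m S (\<lambda>x. f x + g x)"
  using assms(2,3)
proof (induction m arbitrary: f g)
  case 0 then show ?case by (auto intro: continuous_on_add)
next
  case (Suc m)
  have d: "((\<lambda>x. f x + g x) has_derivative
     (\<lambda>v. frechet_derivative f (at x) v + frechet_derivative g (at x) v)) (at x)" if "x \<in> S" for x
    using has_derivative_add[OF k_smooth_onD[OF Suc.prems(1) that] k_smooth_onD[OF Suc.prems(2) that]] .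
  have "k_smooth_on m S (\<lambda>x. frechet_derivative (\<lambda>x. f x + g x) (at x) v)" for v
    by (rule k_smooth_on_cong[OF assms(1), of "\<lambda>x. frechet_derivative f (at x) v + frechet_derivative g (at x) v"])
       (use Suc in \<open>auto simp: frechet_derivative_at[OF d, symmetric]\<close>)
  then show ?case using d by (auto simp: differentiable_def)
qed

text \<open>The product rule leaves one factor undifferentiated; \<open>k_smooth_on_Suc_imp\<close>
  lowers its order to that of the induction hypothesis. The general bilinear form covers scaling,
  multiplication and the inner product at once.\<close>

lemma k_smooth_on_bilinear:
  assumes "open S" "bounded_bilinear P" "k_smooth_on m S f" "k_smooth_on m S g"
  shows "k_smooth_on m S (\<lambda>x. P (f x) (g x))"
  using assms(3,4)
proof (induction m arbitrary: f g)
  case 0 then show ?case using assms(2) by (auto intro: bounded_bilinear.continuous_on)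
next
  case (Suc m)
  have d: "((\<lambda>x. P (f x) (g x)) has_derivative
     (\<lambda>v. P (f x) (frechet_derivative g (at x) v) + P (frechet_derivative f (at x) v) (g x))) (at x)"
    if "x \<in> S" for x
    using bounded_bilinear.FDERIV[OF assms(2) k_smooth_onD[OF Suc.prems(1) that] k_smooth_onD[OF Suc.prems(2) that]] .
  have "k_smooth_on m S (\<lambda>x. frechet_derivative (\<lambda>x. P (f x) (g x)) (at x) v)" for v
  proof (rule k_smooth_on_cong[OF assms(1)])
    show "k_smooth_on m S (\<lambda>x. P (f x) (frechet_derivative g (at x) v) + P (frechet_derivative f (at x) v) (g x))"
      using Suc.prems k_smooth_on_Suc_imp[OF Suc.prems(1)] k_smooth_on_Suc_imp[OF Suc.prems(2)]
      by (intro k_smooth_on_add assms(1) Suc.IH) auto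
  qed (simp add: frechet_derivative_at[OF d, symmetric])
  then show ?case using d by (auto simp: differentiable_def)
qed

lemma k_smooth_on_linear: "open S \<Longrightarrow> bounded_linear L \<Longrightarrow> k_smooth_on m S L"
proof (cases m)
  case 0 assume "bounded_linear L" with 0 show ?thesis by (auto intro: linear_continuous_on)
next
  case (Suc l) assume L: "bounded_linear L"
  have d: "(L has_derivative L) (at x)" for x using L by (rule bounded_linear_imp_has_derivative)
  show ?thesis unfolding Suc using d frechet_derivative_at[OF d] 
    by (auto simp: differentiable_def k_smooth_on_const simp flip: frechet_derivative_at[OF d])
qed

lemma smooth_onD: "smooth_on S f \<Longrightarrow> x \<in> S \<Longrightarrow> (f has_derivative frechet_derivative f (at x)) (at x)"
  unfolding smooth_on_def using frechet_derivative_works k_smooth_on.simps(2) by blast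

lemma smooth_on_differentiable: "smooth_on S f \<Longrightarrow> x \<in> S \<Longrightarrow> f differentiable (at x)"
  unfolding smooth_on_def using k_smooth_on.simps(2) by blast

lemma smooth_on_deriv: "smooth_on S f \<Longrightarrow> smooth_on S (\<lambda>x. frechet_derivative f (at x) v)"
  unfolding smooth_on_def using k_smooth_on.simps(2) by blast

lemma smooth_on_continuous: "smooth_on S f \<Longrightarrow> continuous_on S f"
  unfolding smooth_on_def using k_smooth_on_imp_continuous by blast

lemma smooth_on_cong: "open S \<Longrightarrow> (\<And>x. x \<in> S \<Longrightarrow> f x = g x) \<Longrightarrow> smooth_on S f \<Longrightarrow> smooth_on S g"
  unfolding smooth_on_def using k_smooth_on_cong by blast

lemma smooth_on_subset: "smooth_on S f \<Longrightarrow> S' \<subseteq> S \<Longrightarrow> smooth_on S' f"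
  unfolding smooth_on_def using k_smooth_on_subset by blast

lemma smooth_on_const: "smooth_on S (\<lambda>x. c)"
  unfolding smooth_on_def using k_smooth_on_const by blast

lemma smooth_on_bounded_linear:
  "open S \<Longrightarrow> bounded_linear L \<Longrightarrow> smooth_on S f \<Longrightarrow> smooth_on S (\<lambda>x. L (f x))"
  unfolding smooth_on_def using k_smooth_on_bounded_linear by blast

lemma smooth_on_linear: "open S \<Longrightarrow> bounded_linear L \<Longrightarrow> smooth_on S L"
  unfolding smooth_on_def using k_smooth_on_linear by blast

lemma smooth_on_add: "open S \<Longrightarrow> smooth_on S f \<Longrightarrow> smooth_on S g \<Longrightarrow> smooth_on S (\<lambda>x. f x + g x)"
  unfolding smooth_on_def using k_smooth_on_add by blast

lemma smooth_on_bilinear: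
  "open S \<Longrightarrow> bounded_bilinear P \<Longrightarrow> smooth_on S f \<Longrightarrow> smooth_on S g \<Longrightarrow> smooth_on S (\<lambda>x. P (f x) (g x))"
  unfolding smooth_on_def using k_smooth_on_bilinear by blast

lemma smooth_on_scaleR: "open S \<Longrightarrow> smooth_on S f \<Longrightarrow> smooth_on S g \<Longrightarrow> smooth_on S (\<lambda>x. f x *\<^sub>R g x)"
  by (rule smooth_on_bilinear[OF _ bounded_bilinear_scaleR])

lemma smooth_on_mult:
  fixes f g :: "_ \<Rightarrow> real"
  shows "open S \<Longrightarrow> smooth_on S f \<Longrightarrow> smooth_on S g \<Longrightarrow> smooth_on S (\<lambda>x. f x * g x)"
  by (rule smooth_on_bilinear[OF _ bounded_bilinear_mult])

lemma smooth_on_minus: "open S \<Longrightarrow> smooth_on S f \<Longrightarrow> smooth_on S (\<lambda>x. - f x)"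
  using smooth_on_bounded_linear[OF _ bounded_linear_minus[OF bounded_linear_ident]] by blast

lemma smooth_on_diff: "open S \<Longrightarrow> smooth_on S f \<Longrightarrow> smooth_on S g \<Longrightarrow> smooth_on S (\<lambda>x. f x - g x)"
  using smooth_on_add[of S f "\<lambda>x. - g x"] smooth_on_minus[of S g] by simp

lemma smooth_on_sum:
  "open S \<Longrightarrow> (\<And>i. i \<in> I \<Longrightarrow> smooth_on S (f i)) \<Longrightarrow> smooth_on S (\<lambda>x. \<Sum>i\<in>I. f i x)"
proof (induction I rule: infinite_finite_induct)
  case (insert i I) then show ?case by (simp add: smooth_on_add)
qed (simp_all add: smooth_on_const)

lemma smooth_on_nth: "open S \<Longrightarrow> smooth_on S f \<Longrightarrow> smooth_on S (\<lambda>x. f x $ i)"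
  by (rule smooth_on_bounded_linear[OF _ bounded_linear_vec_nth])

text \<open>In the chain rule the derivative of \<open>g\<close> is taken in a direction that varies
  with \<open>x\<close>, whereas \<open>k_smooth_on\<close> tests fixed directions only. Expanding
  that direction in a basis of the Euclidean middle space leaves products of coefficients with
  derivatives of \<open>g\<close> in basis directions.\<close>

lemma k_smooth_on_compose:
  fixes f :: "'a::real_normed_vector \<Rightarrow> 'b::euclidean_space"
  assumes "open S" "open T" "f ` S \<subseteq> T" "k_smooth_on m S f" "k_smooth_on m T g"
  shows "k_smooth_on m S (\<lambda>x. g (f x))"
  using assms(4,5)
proof (induction m arbitrary: g)
  case 0 then show ?case using assms(3) by (auto intro: continuous_on_compose2)
next
  case (Suc m)
  have d: "((\<lambda>x. g (f x)) has_derivative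
     (\<lambda>v. frechet_derivative g (at (f x)) (frechet_derivative f (at x) v))) (at x)" if "x \<in> S" for x
  proof -
    have "(g has_derivative frechet_derivative g (at (f x))) (at (f x))"
      using k_smooth_onD[OF Suc.prems(2)] assms(3) that by blast
    from diff_chain_at[OF k_smooth_onD[OF Suc.prems(1) that] this]
    show ?thesis by (simp add: o_def)
  qed
  have "k_smooth_on m S (\<lambda>x. frechet_derivative (\<lambda>x. g (f x)) (at x) v)" for v
  proof (rule k_smooth_on_cong[OF assms(1)])
    let ?h = "\<lambda>x. \<Sum>b\<in>Basis. (frechet_derivative f (at x) v \<bullet> b) *\<^sub>R frechet_derivative g (at (f x)) b"
    have *: "k_smooth_on m S (\<lambda>x. \<Sum>b\<in>B. (frechet_derivative f (at x) v \<bullet> b) *\<^sub>R frechet_derivative g (at (f x)) b)" 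
       if "finite B" for B
      using that
    proof (induction B)
      case (insert b B)
      have "k_smooth_on m S (\<lambda>x. frechet_derivative f (at x) v \<bullet> b)"
        using Suc.prems by (intro k_smooth_on_bounded_linear[OF assms(1) bounded_linear_inner_left]) auto
      moreover have "k_smooth_on m S (\<lambda>x. frechet_derivative g (at (f x)) b)"
        using Suc.prems k_smooth_on_Suc_imp by (intro Suc.IH) auto
      ultimately show ?case using insert
        by (auto intro!: k_smooth_on_add k_smooth_on_bilinear[OF _ bounded_bilinear_scaleR] assms)
    qed (simp add: k_smooth_on_const)
    show "k_smooth_on m S ?h" by (rule *) simp
    fix x assume x: "x \<in> S"
    have "g differentiable at (f x)" using Suc.prems assms(3) x by auto
    then have "linear (frechet_derivative g (at (f x)))" by (rule linear_frechet_derivative)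
    then have "frechet_derivative g (at (f x)) (\<Sum>b\<in>Basis. (frechet_derivative f (at x) v \<bullet> b) *\<^sub>R b) = ?h x"
      by (simp add: linear_sum linear_scale)
    then show "?h x = frechet_derivative (\<lambda>x. g (f x)) (at x) v"
      by (simp add: frechet_derivative_at[OF d[OF x], symmetric] euclidean_representation)
  qed
  then show ?case using d by (auto simp: differentiable_def)
qed

lemma smooth_on_compose:
  fixes f :: "'a::real_normed_vector \<Rightarrow> 'b::euclidean_space"
  shows "open S \<Longrightarrow> open T \<Longrightarrow> f ` S \<subseteq> T \<Longrightarrow> smooth_on S f \<Longrightarrow> smooth_on T g \<Longrightarrow> smooth_on S (\<lambda>x. g (f x))"
  unfolding smooth_on_def using k_smooth_on_compose by blast

text \<open>The derivative of \<open>inverse\<close> is again built from products of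
  \<open>inverse\<close>, so each order follows from the one below.\<close>

lemma smooth_on_inverse_real: "smooth_on {x. x \<noteq> 0} (inverse :: real \<Rightarrow> real)"
proof -
  have o: "open {x::real. x \<noteq> 0}" by (simp add: open_Collect_neq)
  have "k_smooth_on m {x. x \<noteq> 0} (inverse :: real \<Rightarrow> real)" for m
  proof (induction m)
    case 0 then show ?case by (auto intro!: continuous_intros)
  next
    case (Suc m)
    have d: "((inverse :: real \<Rightarrow> real) has_derivative (\<lambda>v. - (inverse x * v * inverse x))) (at x)" if "x \<noteq> 0" for x
      using that has_derivative_inverse'[of x] by simp
    have "k_smooth_on m {x. x \<noteq> 0} (\<lambda>x. frechet_derivative inverse (at x) v)" for v :: real
    proof (rule k_smooth_on_cong[OF o])
      show "k_smooth_on m {x. x \<noteq> 0} (\<lambda>x. (-v) * (inverse x * inverse x))"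
        by (intro k_smooth_on_bilinear[OF o bounded_bilinear_mult] Suc k_smooth_on_const)
    qed (simp add: frechet_derivative_at[OF d, symmetric])
    then show ?case using d by (auto simp: differentiable_def)
  qed
  then show ?thesis by (simp add: smooth_on_def)
qed

lemma smooth_on_inverse:
  fixes f :: "'a::real_normed_vector \<Rightarrow> real"
  assumes "open S" "smooth_on S f" "\<And>x. x \<in> S \<Longrightarrow> f x \<noteq> 0"
  shows "smooth_on S (\<lambda>x. inverse (f x))"
  using assms by (intro smooth_on_compose[OF _ _ _ _ smooth_on_inverse_real]) (auto simp: open_Collect_neq)

lemma smooth_on_sqrt_real: "smooth_on {0<..} sqrt"
proof -
  have "k_smooth_on m {0<..} sqrt" for m
  proof (induction m)
    case 0 then show ?case by (auto intro!: continuous_intros)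
  next
    case (Suc m)
    have d: "(sqrt has_derivative (\<lambda>v. inverse (sqrt x) / 2 * v)) (at x)" if "x > 0" for x
      by (rule has_derivative_eq_rhs[OF DERIV_real_sqrt[OF that, unfolded has_field_derivative_def]])
         (auto simp: fun_eq_iff)
    have i: "k_smooth_on m {0<..} (\<lambda>x. inverse (sqrt x))"
      by (rule k_smooth_on_compose[where T="{x. x \<noteq> 0}"])
         (use Suc smooth_on_inverse_real in \<open>auto simp: smooth_on_def open_Collect_neq\<close>)
    have "k_smooth_on m {0<..} (\<lambda>x. frechet_derivative sqrt (at x) v)" for v :: real
    proof (rule k_smooth_on_cong[OF open_greaterThan])
      show "k_smooth_on m {0<..} (\<lambda>x. (v/2) * inverse (sqrt x))"
        by (intro k_smooth_on_bilinear[OF _ bounded_bilinear_mult] i k_smooth_on_const) auto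
    qed (simp add: frechet_derivative_at[OF d, symmetric])
    then show ?case using d by (auto simp: differentiable_def)
  qed
  then show ?thesis by (simp add: smooth_on_def)
qed

lemma smooth_on_sqrt:
  fixes f :: "'a::real_normed_vector \<Rightarrow> real"
  assumes "open S" "smooth_on S f" "\<And>x. x \<in> S \<Longrightarrow> f x > 0"
  shows "smooth_on S (\<lambda>x. sqrt (f x))"
  using assms by (intro smooth_on_compose[OF _ _ _ _ smooth_on_sqrt_real]) auto

text \<open>Each clause of the recursion is a condition at single points, so it may be checked in a
  neighbourhood; this glues functions defined by cases.\<close>

lemma smooth_on_local:
  assumes "\<And>x. x \<in> S \<Longrightarrow> \<exists>N. open N \<and> x \<in> N \<and> smooth_on N f"
  shows "smooth_on S f"
proof -
  have "k_smooth_on m S f" if "\<And>x. x \<in> S \<Longrightarrow> \<exists>N. open N \<and> x \<in> N \<and> k_smooth_on m N f" for m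
    using that
  proof (induction m arbitrary: f)
    case 0 then show ?case
      by (metis k_smooth_on.simps(1) continuous_at_imp_continuous_on continuous_on_eq_continuous_at)
  next
    case (Suc m)
    show ?case unfolding k_smooth_on.simps(2)
      using Suc.IH Suc.prems unfolding k_smooth_on.simps(2) by metis
  qed
  with assms show ?thesis unfolding smooth_on_def by meson
qed

section \<open>Bump functions on Euclidean space\<close>

text \<open>\<open>flat_exp 0\<close> is the classical function exp(-1/t) extended by 0; the extra
  powers of 1/t make the family closed under differentiation, up to linear combinations.\<close>

definition flat_exp :: "nat \<Rightarrow> real \<Rightarrow> real" where
  "flat_exp n t = (if t > 0 then exp (- inverse t) * inverse t ^ n else 0)"

lemma flat_exp_tendsto: "(flat_exp n \<longlongrightarrow> 0) (at 0)"
proof -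
  have "((\<lambda>x. x ^ n / exp x) \<longlongrightarrow> 0) (at_top :: real filter)" by (rule tendsto_power_div_exp_0)
  then have "((\<lambda>x. flat_exp n (inverse x)) \<longlongrightarrow> 0) at_top"
    by (rule Lim_transform_eventually)
       (auto intro!: eventually_mono[OF eventually_gt_at_top[of 0]] simp: flat_exp_def exp_minus divide_simps)
  then have r: "(flat_exp n \<longlongrightarrow> 0) (at_right 0)" by (simp add: filterlim_at_right_to_top)
  have l: "(flat_exp n \<longlongrightarrow> 0) (at_left 0)"
    by (rule Lim_transform_eventually[OF tendsto_const])
       (auto intro!: eventually_at_leftI[of "-1"] simp: flat_exp_def)
  from l r show ?thesis by (simp add: filterlim_at_split)
qed

lemma flat_exp_deriv: "(flat_exp n has_real_derivative (flat_exp (n+2) t - real n * flat_exp (n+1) t)) (at t)"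
proof (cases t "0::real" rule: linorder_cases)
  case less
  have "((\<lambda>t. 0) has_real_derivative 0) (at t)" by simp
  then have "(flat_exp n has_real_derivative 0) (at t)"
    by (rule has_field_derivative_transform_within_open[where S="{..<0}"]) (use less in \<open>auto simp: flat_exp_def\<close>)
  then show ?thesis using less by (simp add: flat_exp_def)
next
  case greater
  have "((\<lambda>t. exp (- inverse t) * inverse t ^ n) has_real_derivative
      (flat_exp (n+2) t - real n * flat_exp (n+1) t)) (at t)"
  proof -
    have "((\<lambda>t. inverse t ^ n) has_real_derivative real n * (- (inverse t ^ 2) * inverse t ^ (n - 1))) (at t)"
      using DERIV_power[OF DERIV_inverse[of t UNIV], of n] greater by (simp add: numeral_2_eq_2)
    moreover have "real n * (- (inverse t ^ 2) * inverse t ^ (n - 1)) = - (real n * inverse t ^ (n + 1))"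
      by (cases n) (simp_all add: power2_eq_square)
    ultimately have p: "((\<lambda>t. inverse t ^ n) has_real_derivative - (real n * inverse t ^ (n + 1))) (at t)" by (simp only:)
    have "((\<lambda>t. exp (- inverse t)) has_real_derivative exp (- inverse t) * inverse t ^ 2) (at t)"
      using greater by (auto intro!: derivative_eq_intros simp: power2_eq_square)
    from DERIV_mult[OF this p] show ?thesis
      using greater by (simp add: flat_exp_def algebra_simps power2_eq_square)
  qed
  then show ?thesis
    by (rule has_field_derivative_transform_within_open[where S="{0<..}"]) (use greater in \<open>auto simp: flat_exp_def\<close>)
next
  case equal
  \<comment> \<open>At 0 the difference quotient of one member is the next member of the family,
    which tends to 0.\<close>
  have "((\<lambda>h. flat_exp (Suc n) h) \<longlongrightarrow> 0) (at 0)" by (rule flat_exp_tendsto)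
  then have "((\<lambda>h. (flat_exp n (0 + h) - flat_exp n 0) / h) \<longlongrightarrow> 0) (at 0)"
    by (rule Lim_transform_eventually) (auto simp: flat_exp_def eventually_at_filter field_simps)
  then show ?thesis using equal by (simp add: DERIV_def flat_exp_def)
qed

lemma smooth_on_flat_exp: "smooth_on UNIV (flat_exp n)"
proof -
  have "k_smooth_on m UNIV (flat_exp n)" for m
  proof (induction m arbitrary: n)
    case 0
    show ?case unfolding k_smooth_on.simps
      using DERIV_isCont[OF flat_exp_deriv] by (intro continuous_at_imp_continuous_on) blast
  next
    case (Suc m)
    have d: "(flat_exp n has_derivative (\<lambda>v. (flat_exp (n+2) t - real n * flat_exp (n+1) t) * v)) (at t)" for t
      using flat_exp_deriv has_field_derivative_def by blast
    have "k_smooth_on m UNIV (\<lambda>t. frechet_derivative (flat_exp n) (at t) v)" for v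
    proof (rule k_smooth_on_cong[OF open_UNIV])
      show "k_smooth_on m UNIV (\<lambda>t. (flat_exp (n+2) t + (- real n) * flat_exp (n+1) t) * v)"
        by (intro k_smooth_on_bilinear[OF _ bounded_bilinear_mult] k_smooth_on_add Suc k_smooth_on_const) auto
    qed (simp add: frechet_derivative_at[OF d, symmetric])
    then show ?case using d by (auto simp: differentiable_def)
  qed
  then show ?thesis by (simp add: smooth_on_def)
qed

text \<open>A quotient f(u) / (f(u) + f(v)) with f the flat exponential, u = s^2 - |x-a|^2 and v =
  |x-a|^2 - r^2. Since r < s, u and v are never both nonpositive, so the denominator is positive; v
  \<le> 0 gives the value 1 and u \<le> 0 the value 0.\<close>

lemma smooth_bump_exists:
  fixes a :: "real ^ 'n::finite"
  assumes "0 < r" "r < s"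
  shows "\<exists>\<psi> :: real ^ 'n \<Rightarrow> real. smooth_on UNIV \<psi> \<and> (\<forall>x. 0 \<le> \<psi> x) \<and>
    (\<forall>x\<in>cball a r. \<psi> x = 1) \<and> (\<forall>x. x \<notin> ball a s \<longrightarrow> \<psi> x = 0)"
proof -
  let ?q = "\<lambda>x::real^'n. (x - a) \<bullet> (x - a)"
  let ?u = "\<lambda>x. s\<^sup>2 + (-1) * ?q x" and ?v = "\<lambda>x. ?q x + (- r\<^sup>2)"
  let ?p = "\<lambda>x. flat_exp 0 (?u x) * inverse (flat_exp 0 (?u x) + flat_exp 0 (?v x))"
  have rs: "r\<^sup>2 < s\<^sup>2" using assms by (simp add: power_strict_mono)
  have pos: "flat_exp 0 (?u x) + flat_exp 0 (?v x) > 0" for x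
    using rs by (auto simp: flat_exp_def add_pos_pos)
  have q: "smooth_on UNIV ?q"
    by (intro smooth_on_bilinear[OF _ bounded_bilinear_inner] smooth_on_diff smooth_on_linear smooth_on_const) auto
  have u: "smooth_on UNIV ?u" and v: "smooth_on UNIV ?v"
    by (intro smooth_on_add smooth_on_mult smooth_on_const q open_UNIV)+
  have fu: "smooth_on UNIV (\<lambda>x. flat_exp 0 (?u x))" and fv: "smooth_on UNIV (\<lambda>x. flat_exp 0 (?v x))"
    by (rule smooth_on_compose[OF _ _ _ _ smooth_on_flat_exp]; use u v in simp)+
  have dq: "?q x = (dist a x)\<^sup>2" for x by (metis dist_commute dist_norm power2_norm_eq_inner)
  show ?thesis
  proof (intro exI[of _ ?p] conjI allI ballI impI)
    show "smooth_on UNIV ?p"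
      by (intro smooth_on_mult smooth_on_inverse smooth_on_add fu fv open_UNIV) (use pos in \<open>simp add: less_imp_neq[THEN not_sym]\<close>)
    show "0 \<le> ?p x" for x using pos[of x] by (simp add: flat_exp_def)
    show "?p x = 1" if "x \<in> cball a r" for x
    proof -
      have "?q x \<le> r\<^sup>2" unfolding dq using that by (simp add: power_mono)
      then show ?thesis using rs by (simp add: flat_exp_def)
    qed
    show "?p x = 0" if "x \<notin> ball a s" for x
    proof -
      have "?q x \<ge> s\<^sup>2" unfolding dq using that assms by (simp add: power_mono)
      then show ?thesis by (simp add: flat_exp_def)
    qed
  qed
qed

section \<open>Symmetry of second derivatives\<close>

text \<open>The mean value theorem is used twice: along \<open>v\<close> for the increment in
  direction \<open>w\<close>, then along \<open>w\<close> for the derivative in direction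
  \<open>v\<close>. The bound on \<open>s\<close> keeps the whole parallelogram inside the
  ball.\<close>

lemma second_difference_mvt:
  fixes f :: "'a::real_normed_vector \<Rightarrow> real"
  assumes "smooth_on S f" "ball x r \<subseteq> S" "s > 0" "s * (norm v + norm w) < r"
  obtains \<xi> \<eta> where "0 < \<xi>" "\<xi> < s" "0 < \<eta>" "\<eta> < s"
    "f (x + s *\<^sub>R v + s *\<^sub>R w) - f (x + s *\<^sub>R v) - f (x + s *\<^sub>R w) + f x
       = s * s * frechet_derivative (\<lambda>y. frechet_derivative f (at y) v) (at (x + \<xi> *\<^sub>R v + \<eta> *\<^sub>R w)) w"
proof -
  have inS: "x + a *\<^sub>R v + b *\<^sub>R w \<in> S" if "0 \<le> a" "a \<le> s" "0 \<le> b" "b \<le> s" for a b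
  proof -
    have "norm (a *\<^sub>R v + b *\<^sub>R w) \<le> a * norm v + b * norm w"
      using norm_triangle_ineq[of "a *\<^sub>R v" "b *\<^sub>R w"] that by simp
    also have "\<dots> \<le> s * norm v + s * norm w" using that by (intro add_mono mult_right_mono) auto
    also have "\<dots> < r" using assms(4) by (simp add: algebra_simps)
    finally have "x + a *\<^sub>R v + b *\<^sub>R w \<in> ball x r"
      by (subst mem_ball, subst dist_commute) (simp add: dist_norm add.assoc)
    then show ?thesis using assms(2) by blast
  qed
  have D1: "((\<lambda>a. f (x + a *\<^sub>R v + b *\<^sub>R w)) has_real_derivative
      frechet_derivative f (at (x + a *\<^sub>R v + b *\<^sub>R w)) v) (at a)"
    if "0 \<le> a" "a \<le> s" "0 \<le> b" "b \<le> s" for a b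
  proof -
    have l: "((\<lambda>a. x + a *\<^sub>R v + b *\<^sub>R w) has_derivative (\<lambda>h. h *\<^sub>R v)) (at a)"
      by (auto intro!: derivative_eq_intros)
    have fd: "(f has_derivative frechet_derivative f (at (x + a *\<^sub>R v + b *\<^sub>R w))) (at (x + a *\<^sub>R v + b *\<^sub>R w))"
      using smooth_onD[OF assms(1) inS[OF that]] .
    have "((\<lambda>a. f (x + a *\<^sub>R v + b *\<^sub>R w)) has_derivative
       (\<lambda>h. frechet_derivative f (at (x + a *\<^sub>R v + b *\<^sub>R w)) (h *\<^sub>R v))) (at a)"
      using diff_chain_at[OF l fd] by (simp add: o_def)
    then show ?thesis
      using linear_scale[OF has_derivative_linear[OF fd]]
      by (simp add: has_field_derivative_def mult.commute[of _ "frechet_derivative f _ v"])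
  qed
  have D2: "((\<lambda>b. frechet_derivative f (at (x + a *\<^sub>R v + b *\<^sub>R w)) v) has_real_derivative
      frechet_derivative (\<lambda>y. frechet_derivative f (at y) v) (at (x + a *\<^sub>R v + b *\<^sub>R w)) w) (at b)"
    if "0 \<le> a" "a \<le> s" "0 \<le> b" "b \<le> s" for a b
  proof -
    let ?F = "\<lambda>y. frechet_derivative f (at y) v"
    have l: "((\<lambda>b. x + a *\<^sub>R v + b *\<^sub>R w) has_derivative (\<lambda>h. h *\<^sub>R w)) (at b)"
      by (auto intro!: derivative_eq_intros)
    have fd: "(?F has_derivative frechet_derivative ?F (at (x + a *\<^sub>R v + b *\<^sub>R w))) (at (x + a *\<^sub>R v + b *\<^sub>R w))"
      using smooth_onD[OF smooth_on_deriv[OF assms(1)] inS[OF that]] .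
    have "((\<lambda>b. ?F (x + a *\<^sub>R v + b *\<^sub>R w)) has_derivative
       (\<lambda>h. frechet_derivative ?F (at (x + a *\<^sub>R v + b *\<^sub>R w)) (h *\<^sub>R w))) (at b)"
      using diff_chain_at[OF l fd] by (simp add: o_def)
    then show ?thesis
      using linear_scale[OF has_derivative_linear[OF fd]]
      by (simp add: has_field_derivative_def mult.commute[of _ "frechet_derivative ?F _ w"])
  qed
  let ?u = "\<lambda>a. f (x + a *\<^sub>R v + s *\<^sub>R w) - f (x + a *\<^sub>R v + 0 *\<^sub>R w)"
  have "\<exists>\<xi>>0. \<xi> < s \<and> ?u s - ?u 0 = (s - 0) *
      (frechet_derivative f (at (x + \<xi> *\<^sub>R v + s *\<^sub>R w)) v - frechet_derivative f (at (x + \<xi> *\<^sub>R v + 0 *\<^sub>R w)) v)"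
    by (rule MVT2[OF assms(3)]) (use assms(3) in \<open>intro DERIV_diff D1; simp\<close>)
  then obtain \<xi> where \<xi>: "0 < \<xi>" "\<xi> < s" "?u s - ?u 0 = s *
      (frechet_derivative f (at (x + \<xi> *\<^sub>R v + s *\<^sub>R w)) v - frechet_derivative f (at (x + \<xi> *\<^sub>R v + 0 *\<^sub>R w)) v)"
    by auto
  have "\<exists>\<eta>>0. \<eta> < s \<and> frechet_derivative f (at (x + \<xi> *\<^sub>R v + s *\<^sub>R w)) v - frechet_derivative f (at (x + \<xi> *\<^sub>R v + 0 *\<^sub>R w)) v
     = (s - 0) * frechet_derivative (\<lambda>y. frechet_derivative f (at y) v) (at (x + \<xi> *\<^sub>R v + \<eta> *\<^sub>R w)) w"
    by (rule MVT2[OF assms(3)]) (use \<xi> in \<open>intro D2; simp\<close>)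
  then obtain \<eta> where \<eta>: "0 < \<eta>" "\<eta> < s"
    "frechet_derivative f (at (x + \<xi> *\<^sub>R v + s *\<^sub>R w)) v - frechet_derivative f (at (x + \<xi> *\<^sub>R v + 0 *\<^sub>R w)) v
     = s * frechet_derivative (\<lambda>y. frechet_derivative f (at y) v) (at (x + \<xi> *\<^sub>R v + \<eta> *\<^sub>R w)) w"
    by auto
  show thesis by (rule that[OF \<xi>(1,2) \<eta>(1,2)]) (use \<xi>(3) \<eta>(3) in simp)
qed

text \<open>The second difference is symmetric in \<open>v\<close> and \<open>w\<close>, so both
  mixed derivatives take a common value, each at some point close to \<open>x\<close>. By continuity
  each of them is within \<open>e\<close> of its value at \<open>x\<close>, and \<open>e\<close> is
  half the assumed gap.\<close>

lemma second_deriv_symmetric: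
  fixes f :: "'a::real_normed_vector \<Rightarrow> real"
  assumes S: "open S" "x \<in> S" and f: "smooth_on S f"
  shows "frechet_derivative (\<lambda>y. frechet_derivative f (at y) v) (at x) w
       = frechet_derivative (\<lambda>y. frechet_derivative f (at y) w) (at x) v" (is "?A x = ?B x")
proof (rule ccontr)
  assume ne: "?A x \<noteq> ?B x"
  define e where "e = \<bar>?A x - ?B x\<bar> / 2"
  have e: "e > 0" using ne by (simp add: e_def)
  have cont: "isCont ?A x" "isCont ?B x"
    using smooth_on_continuous[OF smooth_on_deriv[OF smooth_on_deriv[OF f]]] S
    by (simp_all add: continuous_on_eq_continuous_at)
  obtain r0 where r0: "r0 > 0" "ball x r0 \<subseteq> S" using S openE by blast
  obtain r1 where r1: "r1 > 0" "\<And>y. dist y x < r1 \<Longrightarrow> \<bar>?A y - ?A x\<bar> < e"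
    using cont(1) e unfolding continuous_at_eps_delta dist_real_def by metis
  obtain r2 where r2: "r2 > 0" "\<And>y. dist y x < r2 \<Longrightarrow> \<bar>?B y - ?B x\<bar> < e"
    using cont(2) e unfolding continuous_at_eps_delta dist_real_def by metis
  define r where "r = min r0 (min r1 r2)"
  \<comment> \<open>The summand 1 keeps the denominator positive when \<open>v\<close> and
    \<open>w\<close> both vanish, and the factor 1/2 makes the later bound by \<open>r\<close>
    strict.\<close>
  define s where "s = r / (norm v + norm w + 1) / 2"
  have r: "r > 0" using r0 r1 r2 by (simp add: r_def)
  have n: "norm v + norm w + 1 > 0" by (smt (verit) norm_ge_zero)
  have s: "s > 0" using r n by (simp add: s_def)
  have "s * (norm v + norm w) \<le> s * (norm v + norm w + 1)" using s by simp
  also have "\<dots> = r / 2" using n unfolding s_def by (simp only: divide_divide_eq_left) (simp add: field_simps)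
  finally have sr: "s * (norm v + norm w) < r" using r by simp
  have near: "dist (x + (\<xi> *\<^sub>R v + \<eta> *\<^sub>R w)) x < r" if "0 < \<xi>" "\<xi> < s" "0 < \<eta>" "\<eta> < s" for \<xi> \<eta>
  proof -
    have "norm (\<xi> *\<^sub>R v + \<eta> *\<^sub>R w) \<le> \<xi> * norm v + \<eta> * norm w"
      using norm_triangle_ineq[of "\<xi> *\<^sub>R v" "\<eta> *\<^sub>R w"] that by simp
    also have "\<dots> \<le> s * norm v + s * norm w" using that by (intro add_mono mult_right_mono) auto
    finally show ?thesis using sr by (simp add: dist_norm algebra_simps)
  qed
  have sub: "ball x r \<subseteq> S" using r0(2) by (auto simp: r_def)
  obtain \<xi> \<eta> where 1: "0 < \<xi>" "\<xi> < s" "0 < \<eta>" "\<eta> < s"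
    "f (x + s *\<^sub>R v + s *\<^sub>R w) - f (x + s *\<^sub>R v) - f (x + s *\<^sub>R w) + f x = s * s * ?A (x + \<xi> *\<^sub>R v + \<eta> *\<^sub>R w)"
    using second_difference_mvt[OF f sub s sr] .
  have sr': "s * (norm w + norm v) < r" using sr by (simp add: add.commute)
  obtain \<xi>' \<eta>' where 2: "0 < \<xi>'" "\<xi>' < s" "0 < \<eta>'" "\<eta>' < s"
    "f (x + s *\<^sub>R w + s *\<^sub>R v) - f (x + s *\<^sub>R w) - f (x + s *\<^sub>R v) + f x = s * s * ?B (x + \<xi>' *\<^sub>R w + \<eta>' *\<^sub>R v)"
    using second_difference_mvt[OF f sub s sr'] .
  have swap: "x + s *\<^sub>R w + s *\<^sub>R v = x + s *\<^sub>R v + s *\<^sub>R w" by simp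
  have "s * s * ?A (x + \<xi> *\<^sub>R v + \<eta> *\<^sub>R w) = s * s * ?B (x + \<xi>' *\<^sub>R w + \<eta>' *\<^sub>R v)"
    using 1(5) 2(5)[unfolded swap] by linarith
  then have eq: "?A (x + \<xi> *\<^sub>R v + \<eta> *\<^sub>R w) = ?B (x + \<xi>' *\<^sub>R w + \<eta>' *\<^sub>R v)" using s by simp
  have "\<bar>?A (x + \<xi> *\<^sub>R v + \<eta> *\<^sub>R w) - ?A x\<bar> < e"
    using near[OF 1(1-4)] by (intro r1(2)) (simp add: r_def add.assoc)
  moreover have "\<bar>?B (x + \<xi>' *\<^sub>R w + \<eta>' *\<^sub>R v) - ?B x\<bar> < e"
    using near[OF 2(3,4,1,2)] by (intro r2(2)) (simp add: r_def add_ac)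
  ultimately show False using eq by (simp add: e_def abs_if split: if_splits)
qed

section \<open>Charts, fields and derivatives\<close>

lemma linear_axis_expansion:
  fixes f :: "real ^ 'n::finite \<Rightarrow> 'b::real_vector"
  assumes "linear f" shows "f v = (\<Sum>i\<in>UNIV. v $ i *\<^sub>R f (axis i 1))"
proof -
  have "f v = f (\<Sum>i\<in>UNIV. v $ i *\<^sub>R axis i 1)"
    by (simp flip: scalar_mult_eq_scaleR add: basis_expansion)
  then show ?thesis using assms by (simp add: linear_sum linear_scale)
qed

text \<open>The direction \<open>u z\<close> moves with the point, while smoothness of
  \<open>F\<close> speaks of fixed directions; expansion along the axes reduces one to the
  other.\<close>

lemma smooth_on_deriv_apply:
  fixes F :: "real ^ 'n::finite \<Rightarrow> 'b::real_normed_vector"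
  assumes "open S" "smooth_on S F" "smooth_on S u"
  shows "smooth_on S (\<lambda>z. frechet_derivative F (at z) (u z))"
proof (rule smooth_on_cong[OF assms(1)])
  show "smooth_on S (\<lambda>z. \<Sum>i\<in>UNIV. u z $ i *\<^sub>R frechet_derivative F (at z) (axis i 1))"
    by (intro smooth_on_sum smooth_on_scaleR smooth_on_nth smooth_on_deriv assms)
  show "(\<Sum>i\<in>UNIV. u z $ i *\<^sub>R frechet_derivative F (at z) (axis i 1)) = frechet_derivative F (at z) (u z)"
    if "z \<in> S" for z
    by (rule linear_axis_expansion[OF linear_frechet_derivative[OF smooth_on_differentiable[OF assms(2) that]], symmetric])
qed

lemma frechet_derivative_cong_open:
  assumes "open S" "x \<in> S" "\<And>y. y \<in> S \<Longrightarrow> f y = g y" "f differentiable at x"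
  shows "frechet_derivative g (at x) = frechet_derivative f (at x)"
  using frechet_derivative_transform_within_open[OF assms(4,1,2,3)] by simp

text \<open>The second-order part is kept as a coordinate sum, so that it can be cancelled in a
  commutator by symmetry of second derivatives.\<close>

lemma frechet_derivative_apply:
  fixes F :: "real ^ 'n::finite \<Rightarrow> real"
  assumes "open S" "smooth_on S F" "smooth_on S u" "x \<in> S"
  shows "frechet_derivative (\<lambda>z. frechet_derivative F (at z) (u z)) (at x) v =
     frechet_derivative F (at x) (frechet_derivative u (at x) v) +
     (\<Sum>i\<in>UNIV. u x $ i * frechet_derivative (\<lambda>z. frechet_derivative F (at z) (axis i 1)) (at x) v)"
proof -
  let ?F = "\<lambda>i z. frechet_derivative F (at z) (axis i 1)"
  have lin: "linear (frechet_derivative F (at z))" if "z \<in> S" for z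
    using linear_frechet_derivative smooth_on_differentiable[OF assms(2) that] by blast
  have "((\<lambda>z. \<Sum>i\<in>UNIV. u z $ i * ?F i z) has_derivative
     (\<lambda>v. \<Sum>i\<in>UNIV. u x $ i * frechet_derivative (?F i) (at x) v + frechet_derivative u (at x) v $ i * ?F i x)) (at x)"
    by (intro has_derivative_sum has_derivative_mult bounded_linear.has_derivative[OF bounded_linear_vec_nth]
        smooth_onD[OF assms(3,4)] smooth_onD[OF smooth_on_deriv[OF assms(2)] assms(4)])
  then have "((\<lambda>z. frechet_derivative F (at z) (u z)) has_derivative
     (\<lambda>v. \<Sum>i\<in>UNIV. u x $ i * frechet_derivative (?F i) (at x) v + frechet_derivative u (at x) v $ i * ?F i x)) (at x)"
    by (rule has_derivative_transform_within_open[OF _ assms(1,4)])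
       (simp add: linear_axis_expansion[OF lin, of _ "u _"])
  from frechet_derivative_at[OF this, symmetric] show ?thesis
    by (simp add: sum.distrib linear_axis_expansion[OF lin[OF assms(4)], of "frechet_derivative u (at x) v"])
qed

section \<open>Charts, tangent coordinates and smooth fields\<close>

locale atlas =
  fixes A :: "('a::{t2_space,second_countable_topology}, 'n::finite) chart set"
  assumes atlas: "smooth_atlas A"
begin

lemma
  assumes "c \<in> A"
  shows chart_dom_open: "open (fst c)"
    and chart_image_open: "open (snd c ` fst c)"
    and chart_inv_left: "\<And>p. p \<in> fst c \<Longrightarrow> chart_inv c (snd c p) = p"
    and chart_inv_right: "\<And>x. x \<in> snd c ` fst c \<Longrightarrow> snd c (chart_inv c x) = x"
    and chart_inv_in: "\<And>x. x \<in> snd c ` fst c \<Longrightarrow> chart_inv c x \<in> fst c"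
    and chart_continuous: "continuous_on (fst c) (snd c)"
    and chart_inv_continuous: "continuous_on (snd c ` fst c) (chart_inv c)"
proof -
  have h: "open (fst c)" "open (snd c ` fst c)" "homeomorphism (fst c) (snd c ` fst c) (snd c) (chart_inv c)"
    using atlas assms unfolding smooth_atlas_def by auto
  then show "open (fst c)" "open (snd c ` fst c)" "continuous_on (fst c) (snd c)"
    "continuous_on (snd c ` fst c) (chart_inv c)"
    by (auto simp: homeomorphism_def)
  show "chart_inv c (snd c p) = p" if "p \<in> fst c" for p using h(3) that by (auto simp: homeomorphism_def)
  show "snd c (chart_inv c x) = x" "chart_inv c x \<in> fst c" if "x \<in> snd c ` fst c" for x
    using h(3) that by (auto simp: homeomorphism_def)
qed

lemma chart_at: "chart_at A p \<in> A" "p \<in> fst (chart_at A p)"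
proof -
  have "\<exists>c. c \<in> A \<and> p \<in> fst c" using atlas unfolding smooth_atlas_def by blast
  from someI_ex[OF this] show "chart_at A p \<in> A" "p \<in> fst (chart_at A p)" by (auto simp: chart_at_def)
qed

lemma open_chart_image:
  assumes "c \<in> A" "open W" shows "open (snd c ` (fst c \<inter> W))"
proof -
  have "snd c ` (fst c \<inter> W) = snd c ` fst c \<inter> chart_inv c -` W"
    using chart_inv_left[OF assms(1)] by force
  then show ?thesis
    using continuous_open_preimage[OF chart_inv_continuous[OF assms(1)] chart_image_open[OF assms(1)] assms(2)]
    by (simp add: Int_commute)
qed

lemma open_chart_preimage:
  assumes "c \<in> A" "open V" "V \<subseteq> snd c ` fst c" shows "open (chart_inv c ` V)"
proof -
  have "chart_inv c ` V = fst c \<inter> snd c -` V"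
    using assms(3) chart_inv_left[OF assms(1)] chart_inv_right[OF assms(1)] chart_inv_in[OF assms(1)]
    by (auto simp: image_iff subset_iff) metis
  then show ?thesis
    using continuous_open_preimage[OF chart_continuous[OF assms(1)] chart_dom_open[OF assms(1)] assms(2)]
    by (simp add: Int_commute)
qed

lemma transition_smooth:
  "c \<in> A \<Longrightarrow> d \<in> A \<Longrightarrow> smooth_on (snd c ` (fst c \<inter> fst d)) (snd d \<circ> chart_inv c)"
  using atlas unfolding smooth_atlas_def by blast

lemma transition_deriv:
  assumes "c \<in> A" "d \<in> A" "p \<in> fst c" "p \<in> fst d"
  shows "((snd d \<circ> chart_inv c) has_derivative frechet_derivative (snd d \<circ> chart_inv c) (at (snd c p))) (at (snd c p))"
  by (rule smooth_onD[OF transition_smooth]) (use assms in auto)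

text \<open>Near \<open>snd d p\<close> the coordinate expression in \<open>d\<close> is the one in
  \<open>c\<close> composed with the transition map.\<close>

lemma deriv_change_chart:
  fixes f :: "'a \<Rightarrow> 'b::real_normed_vector"
  assumes "c \<in> A" "d \<in> A" "p \<in> fst c" "p \<in> fst d"
    and "(f \<circ> chart_inv c) differentiable (at (snd c p))"
  shows "((f \<circ> chart_inv d) has_derivative (\<lambda>v. frechet_derivative (f \<circ> chart_inv c) (at (snd c p))
       (frechet_derivative (snd c \<circ> chart_inv d) (at (snd d p)) v))) (at (snd d p))"
proof -
  have e: "(snd c \<circ> chart_inv d) (snd d p) = snd c p" using assms by (simp add: chart_inv_left)
  have f: "((f \<circ> chart_inv c) has_derivative frechet_derivative (f \<circ> chart_inv c) (at (snd c p)))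
      (at ((snd c \<circ> chart_inv d) (snd d p)))"
    using assms(5) frechet_derivative_works e by metis
  from diff_chain_at[OF transition_deriv[OF assms(2,1,4,3)] f]
  have "((f \<circ> chart_inv c \<circ> (snd c \<circ> chart_inv d)) has_derivative (\<lambda>v. frechet_derivative (f \<circ> chart_inv c) (at (snd c p))
       (frechet_derivative (snd c \<circ> chart_inv d) (at (snd d p)) v))) (at (snd d p))"
    by (simp add: o_def)
  then show ?thesis
  proof (rule has_derivative_transform_within_open)
    show "open (snd d ` (fst d \<inter> fst c))" using assms open_chart_image chart_dom_open by blast
    show "snd d p \<in> snd d ` (fst d \<inter> fst c)" using assms by blast
    show "(f \<circ> chart_inv c \<circ> (snd c \<circ> chart_inv d)) y = (f \<circ> chart_inv d) y" if "y \<in> snd d ` (fst d \<inter> fst c)" for y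
      using that assms by (auto simp: chart_inv_left[OF assms(1)] chart_inv_left[OF assms(2)])
  qed
qed

lemma transition_deriv_self:
  assumes "c \<in> A" "p \<in> fst c"
  shows "frechet_derivative (snd c \<circ> chart_inv c) (at (snd c p)) v = v"
proof -
  have "((snd c \<circ> chart_inv c) has_derivative (\<lambda>v. v)) (at (snd c p))"
    by (rule has_derivative_transform_within_open[OF has_derivative_ident chart_image_open[OF assms(1)]])
       (use assms chart_inv_right[OF assms(1)] in auto)
  from frechet_derivative_at[OF this] show ?thesis by metis
qed

lemma linear_to_coord: "c \<in> A \<Longrightarrow> p \<in> fst c \<Longrightarrow> linear (to_coord A c p)"
  unfolding to_coord_def using transition_deriv chart_at has_derivative_linear by blast

lemma linear_of_coord: "c \<in> A \<Longrightarrow> p \<in> fst c \<Longrightarrow> linear (of_coord A c p)"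
  unfolding of_coord_def using transition_deriv chart_at has_derivative_linear by blast

lemma transition_deriv_compose:
  assumes "b \<in> A" "c \<in> A" "d \<in> A" "p \<in> fst b" "p \<in> fst c" "p \<in> fst d"
  shows "frechet_derivative (snd d \<circ> chart_inv b) (at (snd b p)) v =
    frechet_derivative (snd d \<circ> chart_inv c) (at (snd c p)) (frechet_derivative (snd c \<circ> chart_inv b) (at (snd b p)) v)"
  using frechet_derivative_at[OF deriv_change_chart[OF assms(2,1,5,4)
      differentiableI[OF transition_deriv[OF assms(2,3,5,6)]]]] by metis

lemma to_of_coord: "c \<in> A \<Longrightarrow> p \<in> fst c \<Longrightarrow> to_coord A c p (of_coord A c p v) = v"
  unfolding to_coord_def of_coord_def
  using transition_deriv_compose[OF _ chart_at(1)] transition_deriv_self chart_at(2) by metis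

lemma of_to_coord: "c \<in> A \<Longrightarrow> p \<in> fst c \<Longrightarrow> of_coord A c p (to_coord A c p v) = v"
  unfolding to_coord_def of_coord_def
  using transition_deriv_compose[OF chart_at(1)] transition_deriv_self chart_at by metis

lemma to_coord_chart_at: "to_coord A (chart_at A p) p v = v"
  unfolding to_coord_def using transition_deriv_self chart_at by blast

lemma field_coord_add:
  "c \<in> A \<Longrightarrow> x \<in> snd c ` fst c \<Longrightarrow> field_coord A c (\<lambda>q. X q + Y q) x = field_coord A c X x + field_coord A c Y x"
  unfolding field_coord_def by (simp add: linear_add[OF linear_to_coord] chart_inv_in)

lemma field_coord_scaleR:
  "c \<in> A \<Longrightarrow> x \<in> snd c ` fst c \<Longrightarrow> field_coord A c (\<lambda>q. f q *\<^sub>R X q) x = f (chart_inv c x) *\<^sub>R field_coord A c X x"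
  unfolding field_coord_def by (simp add: linear_scale[OF linear_to_coord] chart_inv_in)

lemma smooth_fieldD: "smooth_field A W X \<Longrightarrow> c \<in> A \<Longrightarrow> smooth_on (snd c ` (fst c \<inter> W)) (field_coord A c X)"
  by (auto simp: smooth_field_def)

lemma smooth_funD: "smooth_fun A W f \<Longrightarrow> c \<in> A \<Longrightarrow> smooth_on (snd c ` (fst c \<inter> W)) (f \<circ> chart_inv c)"
  by (auto simp: smooth_fun_def)

lemma smooth_field_subset: "smooth_field A W X \<Longrightarrow> W' \<subseteq> W \<Longrightarrow> smooth_field A W' X"
  unfolding smooth_field_def by (meson Int_mono image_mono smooth_on_subset subset_refl)

lemma smooth_fun_subset: "smooth_fun A W f \<Longrightarrow> W' \<subseteq> W \<Longrightarrow> smooth_fun A W' f"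
  unfolding smooth_fun_def by (meson Int_mono image_mono smooth_on_subset subset_refl)

lemma smooth_field_cong:
  assumes "open W" "\<And>q. q \<in> W \<Longrightarrow> X q = Y q" "smooth_field A W X" shows "smooth_field A W Y"
  unfolding smooth_field_def
proof
  fix c assume c: "c \<in> A"
  show "smooth_on (snd c ` (fst c \<inter> W)) (field_coord A c Y)"
    by (rule smooth_on_cong[OF open_chart_image[OF c assms(1)] _ smooth_fieldD[OF assms(3) c]])
       (use assms(2) in \<open>auto simp: field_coord_def chart_inv_left[OF c]\<close>)
qed

lemma smooth_fun_cong:
  assumes "open W" "\<And>q. q \<in> W \<Longrightarrow> f q = g q" "smooth_fun A W f" shows "smooth_fun A W g"
  unfolding smooth_fun_def
proof
  fix c assume c: "c \<in> A"
  show "smooth_on (snd c ` (fst c \<inter> W)) (g \<circ> chart_inv c)"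
    by (rule smooth_on_cong[OF open_chart_image[OF c assms(1)] _ smooth_funD[OF assms(3) c]])
       (use assms(2) in \<open>auto simp: chart_inv_left[OF c]\<close>)
qed

lemma smooth_fun_const: "smooth_fun A W (\<lambda>q. a)"
  unfolding smooth_fun_def by (simp add: o_def smooth_on_const)

lemma smooth_fun_add: "open W \<Longrightarrow> smooth_fun A W f \<Longrightarrow> smooth_fun A W g \<Longrightarrow> smooth_fun A W (\<lambda>q. f q + g q)"
  unfolding smooth_fun_def by (auto simp: o_def intro!: smooth_on_add open_chart_image)

lemma smooth_fun_mult: "open W \<Longrightarrow> smooth_fun A W f \<Longrightarrow> smooth_fun A W g \<Longrightarrow> smooth_fun A W (\<lambda>q. f q * g q)"
  unfolding smooth_fun_def by (auto simp: o_def intro!: smooth_on_mult open_chart_image)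

lemma smooth_fun_diff: "open W \<Longrightarrow> smooth_fun A W f \<Longrightarrow> smooth_fun A W g \<Longrightarrow> smooth_fun A W (\<lambda>q. f q - g q)"
  unfolding smooth_fun_def by (auto simp: o_def intro!: smooth_on_diff open_chart_image)

lemma smooth_fun_sum: "open W \<Longrightarrow> (\<And>i. i \<in> I \<Longrightarrow> smooth_fun A W (f i)) \<Longrightarrow> smooth_fun A W (\<lambda>q. \<Sum>i\<in>I. f i q)"
  unfolding smooth_fun_def by (auto simp: o_def intro!: smooth_on_sum open_chart_image)

lemma smooth_fun_inverse:
  assumes "open W" "smooth_fun A W f" "\<And>q. q \<in> W \<Longrightarrow> f q \<noteq> 0" shows "smooth_fun A W (\<lambda>q. inverse (f q))"
  unfolding smooth_fun_def o_def
proof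
  fix c assume c: "c \<in> A"
  show "smooth_on (snd c ` (fst c \<inter> W)) (\<lambda>x. inverse (f (chart_inv c x)))"
    by (rule smooth_on_inverse[OF open_chart_image[OF c assms(1)] smooth_funD[OF assms(2) c, unfolded o_def]])
       (use assms(3) chart_inv_left[OF c] in auto)
qed

lemma smooth_fun_sqrt:
  assumes "open W" "smooth_fun A W f" "\<And>q. q \<in> W \<Longrightarrow> f q > 0" shows "smooth_fun A W (\<lambda>q. sqrt (f q))"
  unfolding smooth_fun_def o_def
proof
  fix c assume c: "c \<in> A"
  show "smooth_on (snd c ` (fst c \<inter> W)) (\<lambda>x. sqrt (f (chart_inv c x)))"
    by (rule smooth_on_sqrt[OF open_chart_image[OF c assms(1)] smooth_funD[OF assms(2) c, unfolded o_def]])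
       (use assms(3) chart_inv_left[OF c] in auto)
qed

lemma smooth_field_add:
  assumes "open W" "smooth_field A W X" "smooth_field A W Y" shows "smooth_field A W (\<lambda>q. X q + Y q)"
  unfolding smooth_field_def
proof
  fix c assume c: "c \<in> A"
  have o: "open (snd c ` (fst c \<inter> W))" by (rule open_chart_image[OF c assms(1)])
  show "smooth_on (snd c ` (fst c \<inter> W)) (field_coord A c (\<lambda>q. X q + Y q))"
    by (rule smooth_on_cong[OF o _ smooth_on_add[OF o smooth_fieldD[OF assms(2) c] smooth_fieldD[OF assms(3) c]]])
       (rule field_coord_add[OF c, symmetric], blast)
qed

lemma smooth_field_scaleR:
  assumes "open W" "smooth_fun A W f" "smooth_field A W X" shows "smooth_field A W (\<lambda>q. f q *\<^sub>R X q)"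
  unfolding smooth_field_def
proof
  fix c assume c: "c \<in> A"
  have o: "open (snd c ` (fst c \<inter> W))" by (rule open_chart_image[OF c assms(1)])
  show "smooth_on (snd c ` (fst c \<inter> W)) (field_coord A c (\<lambda>q. f q *\<^sub>R X q))"
    by (rule smooth_on_cong[OF o _ smooth_on_scaleR[OF o smooth_funD[OF assms(2) c] smooth_fieldD[OF assms(3) c]]])
       (unfold o_def, rule field_coord_scaleR[OF c, symmetric], blast)
qed

lemma smooth_field_zero: "open W \<Longrightarrow> smooth_field A W (\<lambda>q. 0)"
  unfolding smooth_field_def field_coord_def
proof
  fix c assume W: "open W" and c: "c \<in> A"
  show "smooth_on (snd c ` (fst c \<inter> W)) (\<lambda>x. to_coord A c (chart_inv c x) 0)"
    by (rule smooth_on_cong[OF open_chart_image[OF c W] _ smooth_on_const[of _ 0]])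
       (auto simp: chart_inv_left[OF c] linear_0[OF linear_to_coord[OF c]])
qed

lemma smooth_field_sum:
  "open W \<Longrightarrow> (\<And>i. i \<in> I \<Longrightarrow> smooth_field A W (X i)) \<Longrightarrow> smooth_field A W (\<lambda>q. \<Sum>i\<in>I. X i q)"
  by (induction I rule: infinite_finite_induct) (simp_all add: smooth_field_zero smooth_field_add)

lemma smooth_field_diff:
  assumes "open W" "smooth_field A W X" "smooth_field A W Y" shows "smooth_field A W (\<lambda>q. X q - Y q)"
  using smooth_field_add[OF assms(1,2) smooth_field_scaleR[OF assms(1) smooth_fun_const[of W "-1"] assms(3)]] by simp

lemma smooth_fun_local:
  assumes "\<And>p. p \<in> W \<Longrightarrow> \<exists>N. open N \<and> p \<in> N \<and> smooth_fun A N f" shows "smooth_fun A W f"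
  unfolding smooth_fun_def
proof (intro ballI smooth_on_local)
  fix c x assume c: "c \<in> A" and x: "x \<in> snd c ` (fst c \<inter> W)"
  then obtain p where p: "p \<in> fst c" "p \<in> W" "x = snd c p" by auto
  from assms[OF p(2)] obtain N where N: "open N" "p \<in> N" "smooth_fun A N f" by blast
  show "\<exists>N. open N \<and> x \<in> N \<and> smooth_on N (f \<circ> chart_inv c)"
    using open_chart_image[OF c N(1)] smooth_funD[OF N(3) c] p N(2) by blast
qed

section \<open>Directional derivatives and the Lie bracket\<close>

lemma smooth_fun_differentiable:
  assumes "smooth_fun A W f" "p \<in> W" "c \<in> A" "p \<in> fst c"
  shows "(f \<circ> chart_inv c) differentiable (at (snd c p))"
  using smooth_on_differentiable[OF smooth_funD[OF assms(1,3)]] assms by auto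

lemma smooth_fun_has_derivative:
  assumes "smooth_fun A W f" "p \<in> W" "c \<in> A" "p \<in> fst c"
  shows "((f \<circ> chart_inv c) has_derivative frechet_derivative (f \<circ> chart_inv c) (at (snd c p))) (at (snd c p))"
  using smooth_fun_differentiable[OF assms] frechet_derivative_works by blast

text \<open>\<open>dir_deriv\<close> is defined through the preferred chart of each point, which
  need not vary continuously; this formula in one fixed chart is what makes smoothness of the
  derivative accessible.\<close>

lemma dir_deriv_chart:
  assumes "smooth_fun A W f" "p \<in> W" "c \<in> A" "p \<in> fst c"
  shows "dir_deriv A X f p = frechet_derivative (f \<circ> chart_inv c) (at (snd c p)) (to_coord A c p (X p))"
  unfolding dir_deriv_def Let_def to_coord_def
  using frechet_derivative_at[OF deriv_change_chart[OF assms(3) chart_at(1) assms(4) chart_at(2)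
      smooth_fun_differentiable[OF assms]]] by metis

lemma smooth_fun_dir_deriv:
  assumes "open W" "smooth_fun A W f" "smooth_field A W X"
  shows "smooth_fun A W (dir_deriv A X f)"
  unfolding smooth_fun_def
proof
  fix c assume c: "c \<in> A"
  have o: "open (snd c ` (fst c \<inter> W))" by (rule open_chart_image[OF c assms(1)])
  show "smooth_on (snd c ` (fst c \<inter> W)) (dir_deriv A X f \<circ> chart_inv c)"
    by (rule smooth_on_cong[OF o _ smooth_on_deriv_apply[OF o smooth_funD[OF assms(2) c] smooth_fieldD[OF assms(3) c]]])
       (use dir_deriv_chart[OF assms(2) _ c] in \<open>auto simp: chart_inv_left[OF c] field_coord_def\<close>)
qed

lemma dir_deriv_cong:
  assumes "open W" "p \<in> W" "\<And>q. q \<in> W \<Longrightarrow> f q = g q" "smooth_fun A W f" "X p = Y p"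
  shows "dir_deriv A X f p = dir_deriv A Y g p"
proof -
  let ?c = "chart_at A p"
  have "frechet_derivative (g \<circ> chart_inv ?c) (at (snd ?c p)) = frechet_derivative (f \<circ> chart_inv ?c) (at (snd ?c p))"
    by (rule frechet_derivative_cong_open[OF open_chart_image[OF chart_at(1) assms(1)] _ _
          smooth_fun_differentiable[OF assms(4,2) chart_at]])
       (use assms chart_at(2) in \<open>auto simp: chart_inv_left[OF chart_at(1)]\<close>)
  then show ?thesis using assms(5) by (simp add: dir_deriv_def Let_def)
qed

lemma dir_deriv_const: "dir_deriv A X (\<lambda>q. a) p = 0"
  by (simp add: dir_deriv_def Let_def o_def frechet_derivative_const)

lemma dir_deriv_add:
  assumes "smooth_fun A W f" "smooth_fun A W g" "p \<in> W"
  shows "dir_deriv A X (\<lambda>q. f q + g q) p = dir_deriv A X f p + dir_deriv A X g p"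
proof -
  let ?c = "chart_at A p"
  have "(((\<lambda>q. f q + g q) \<circ> chart_inv ?c) has_derivative (\<lambda>v. frechet_derivative (f \<circ> chart_inv ?c) (at (snd ?c p)) v
       + frechet_derivative (g \<circ> chart_inv ?c) (at (snd ?c p)) v)) (at (snd ?c p))"
    using has_derivative_add[OF smooth_fun_has_derivative[OF assms(1,3) chart_at] smooth_fun_has_derivative[OF assms(2,3) chart_at]]
    by (simp add: o_def)
  from frechet_derivative_at[OF this, symmetric] show ?thesis by (simp add: dir_deriv_def Let_def)
qed

lemma dir_deriv_mult:
  assumes "smooth_fun A W f" "smooth_fun A W g" "p \<in> W"
  shows "dir_deriv A X (\<lambda>q. f q * g q) p = f p * dir_deriv A X g p + dir_deriv A X f p * g p"
proof -
  let ?c = "chart_at A p"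
  have "(((\<lambda>q. f q * g q) \<circ> chart_inv ?c) has_derivative (\<lambda>v. f p * frechet_derivative (g \<circ> chart_inv ?c) (at (snd ?c p)) v
       + frechet_derivative (f \<circ> chart_inv ?c) (at (snd ?c p)) v * g p)) (at (snd ?c p))"
    using has_derivative_mult[OF smooth_fun_has_derivative[OF assms(1,3) chart_at] smooth_fun_has_derivative[OF assms(2,3) chart_at]]
    by (simp add: o_def chart_inv_left[OF chart_at])
  from frechet_derivative_at[OF this, symmetric] show ?thesis by (simp add: dir_deriv_def Let_def)
qed

lemma dir_deriv_sum:
  assumes "open W" "p \<in> W" "\<And>i. i \<in> I \<Longrightarrow> smooth_fun A W (f i)"
  shows "dir_deriv A X (\<lambda>q. \<Sum>i\<in>I. f i q) p = (\<Sum>i\<in>I. dir_deriv A X (f i) p)"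
  using assms(3)
proof (induction I rule: infinite_finite_induct)
  case (insert i I)
  then show ?case
    using dir_deriv_add[OF _ smooth_fun_sum[OF assms(1)] assms(2), of "f i" I f X] by simp
qed (simp_all add: dir_deriv_const)

lemma dir_deriv_cmult:
  assumes "smooth_fun A W f" "p \<in> W"
  shows "dir_deriv A X (\<lambda>q. a * f q) p = a * dir_deriv A X f p"
  using dir_deriv_mult[OF smooth_fun_const assms] by (simp add: dir_deriv_const)

text \<open>In coordinates, \<open>X\<close> applied to \<open>Y f\<close> is a first-order term
  plus the Hessian of \<open>f\<close> on \<open>X\<close> and \<open>Y\<close>. The Hessian parts
  cancel, and the first-order parts form the bracket.\<close>

lemma lie_bracket_commutator:
  assumes W: "open W" "p \<in> W" and X: "smooth_field A W X" and Y: "smooth_field A W Y" and f: "smooth_fun A W f"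
  shows "dir_deriv A (lie_bracket A X Y) f p = dir_deriv A X (dir_deriv A Y f) p - dir_deriv A Y (dir_deriv A X f) p"
proof -
  let ?c = "chart_at A p"
  let ?S = "snd ?c ` (fst ?c \<inter> W)" and ?x = "snd ?c p" and ?F = "f \<circ> chart_inv ?c"
  have S: "open ?S" "?x \<in> ?S" using open_chart_image[OF chart_at(1)] chart_at(2) W by auto
  have F: "smooth_on ?S ?F" by (rule smooth_funD[OF f chart_at(1)])
  have key: "dir_deriv A U (dir_deriv A V f) p = frechet_derivative ?F (at ?x) (frechet_derivative (field_coord A ?c V) (at ?x) (U p))
      + (\<Sum>i\<in>UNIV. \<Sum>j\<in>UNIV. V p $ i * U p $ j * frechet_derivative (\<lambda>z. frechet_derivative ?F (at z) (axis i 1)) (at ?x) (axis j 1))"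
    if V: "smooth_field A W V" for U V
  proof -
    have v: "smooth_on ?S (field_coord A ?c V)" by (rule smooth_fieldD[OF V chart_at(1)])
    have vx: "field_coord A ?c V ?x = V p"
      by (simp add: field_coord_def chart_inv_left[OF chart_at] to_coord_chart_at)
    have "frechet_derivative (dir_deriv A V f \<circ> chart_inv ?c) (at ?x)
        = frechet_derivative (\<lambda>z. frechet_derivative ?F (at z) (field_coord A ?c V z)) (at ?x)"
      by (rule frechet_derivative_cong_open[OF S _ smooth_on_differentiable[OF smooth_on_deriv_apply[OF S(1) F v] S(2)]])
         (use dir_deriv_chart[OF f _ chart_at(1)] chart_inv_left[OF chart_at(1)] in \<open>auto simp: field_coord_def\<close>)
    moreover have "linear (frechet_derivative (\<lambda>z. frechet_derivative ?F (at z) (axis i 1)) (at ?x))" for i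
      using linear_frechet_derivative smooth_on_differentiable[OF smooth_on_deriv[OF F] S(2)] by blast
    ultimately show ?thesis
      by (simp add: dir_deriv_def[of A U] Let_def frechet_derivative_apply[OF S(1) F v S(2)] vx
          linear_axis_expansion[of "frechet_derivative (\<lambda>z. frechet_derivative ?F (at z) (axis _ 1)) (at ?x)" "U p"] sum_distrib_left mult.assoc)
  qed
  have sym: "frechet_derivative (\<lambda>z. frechet_derivative ?F (at z) (axis i 1)) (at ?x) (axis j 1)
      = frechet_derivative (\<lambda>z. frechet_derivative ?F (at z) (axis j 1)) (at ?x) (axis i 1)" for i j
    by (rule second_deriv_symmetric[OF S F])
  have "(\<Sum>i\<in>UNIV. \<Sum>j\<in>UNIV. Y p $ i * X p $ j * frechet_derivative (\<lambda>z. frechet_derivative ?F (at z) (axis i 1)) (at ?x) (axis j 1))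
    = (\<Sum>i\<in>UNIV. \<Sum>j\<in>UNIV. X p $ i * Y p $ j * frechet_derivative (\<lambda>z. frechet_derivative ?F (at z) (axis i 1)) (at ?x) (axis j 1))"
    by (subst sum.swap, intro sum.cong refl) (subst sym, simp add: mult_ac)
  moreover have "linear (frechet_derivative ?F (at ?x))"
    using linear_frechet_derivative smooth_on_differentiable[OF F S(2)] by blast
  ultimately show ?thesis
    by (simp add: key[OF X] key[OF Y] dir_deriv_def[of A "lie_bracket A X Y"] Let_def lie_bracket_def linear_diff)
qed

lemma smooth_fun_chart: "c \<in> A \<Longrightarrow> smooth_fun A (fst c) (\<lambda>q. snd c q $ i)"
  unfolding smooth_fun_def o_def
proof
  fix d assume c: "c \<in> A" and d: "d \<in> A"
  show "smooth_on (snd d ` (fst d \<inter> fst c)) (\<lambda>x. snd c (chart_inv d x) $ i)"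
    using smooth_on_nth[OF open_chart_image[OF d chart_dom_open[OF c]] transition_smooth[OF d c]] by (simp add: o_def)
qed

lemma dir_deriv_chart_component:
  assumes "c \<in> A" "p \<in> fst c"
  shows "dir_deriv A X (\<lambda>q. snd c q $ i) p = to_coord A c p (X p) $ i"
proof -
  have "(((\<lambda>q. snd c q $ i) \<circ> chart_inv c) has_derivative (\<lambda>v. v $ i)) (at (snd c p))"
    by (rule has_derivative_transform_within_open[OF bounded_linear_imp_has_derivative[OF bounded_linear_vec_nth] chart_image_open[OF assms(1)]])
       (use assms chart_inv_right[OF assms(1)] in auto)
  from frechet_derivative_at[OF this, symmetric] show ?thesis
    by (simp add: dir_deriv_chart[OF smooth_fun_chart assms(2,1,2)] assms)
qed

text \<open>\<open>lie_bracket\<close> is computed in the preferred chart. Applying the commutator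
  identity, which mentions no chart, to the coordinate functions of \<open>c\<close> gives the
  formula in every chart.\<close>

lemma lie_bracket_chart:
  assumes W: "open W" "p \<in> W" and X: "smooth_field A W X" and Y: "smooth_field A W Y" and c: "c \<in> A" "p \<in> fst c"
  shows "to_coord A c p (lie_bracket A X Y p) =
      frechet_derivative (field_coord A c Y) (at (snd c p)) (to_coord A c p (X p))
    - frechet_derivative (field_coord A c X) (at (snd c p)) (to_coord A c p (Y p))"
proof -
  \<comment> \<open>The coordinate functions of \<open>c\<close> are smooth only on the domain of
    \<open>c\<close>, hence the restriction of the fields to it.\<close>
  let ?W = "W \<inter> fst c"
  have W': "open ?W" "p \<in> ?W" using W c chart_dom_open[OF c(1)] by auto
  have X': "smooth_field A ?W X" and Y': "smooth_field A ?W Y" using X Y smooth_field_subset by blast+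
  have comp: "dir_deriv A U (dir_deriv A V (\<lambda>q. snd c q $ i)) p
      = frechet_derivative (field_coord A c V) (at (snd c p)) (to_coord A c p (U p)) $ i"
    if V: "smooth_field A ?W V" for U V i
  proof -
    let ?S = "snd c ` (fst c \<inter> ?W)"
    have S: "open ?S" "snd c p \<in> ?S" using open_chart_image[OF c(1) W'(1)] W' c by auto
    have f: "smooth_fun A ?W (dir_deriv A V (\<lambda>q. snd c q $ i))"
      by (rule smooth_fun_dir_deriv[OF W'(1) smooth_fun_subset[OF smooth_fun_chart[OF c(1)]] V]) auto
    have v: "(field_coord A c V has_derivative frechet_derivative (field_coord A c V) (at (snd c p))) (at (snd c p))"
      by (rule smooth_onD[OF smooth_fieldD[OF V c(1)] S(2)])
    have "((dir_deriv A V (\<lambda>q. snd c q $ i) \<circ> chart_inv c) has_derivative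
        (\<lambda>v. frechet_derivative (field_coord A c V) (at (snd c p)) v $ i)) (at (snd c p))"
      by (rule has_derivative_transform_within_open[OF bounded_linear.has_derivative[OF bounded_linear_vec_nth v] S])
         (use dir_deriv_chart_component[OF c(1)] chart_inv_left[OF c(1)] in \<open>auto simp: field_coord_def\<close>)
    from frechet_derivative_at[OF this, symmetric] show ?thesis
      by (simp add: dir_deriv_chart[OF f W'(2) c])
  qed
  show ?thesis
    using lie_bracket_commutator[OF W' X' Y' smooth_fun_subset[OF smooth_fun_chart[OF c(1)]]]
    by (simp add: vec_eq_iff comp X' Y' dir_deriv_chart_component[OF c])
qed

lemma continuous_on_smooth_fun:
  assumes "open W" "smooth_fun A W f" shows "continuous_on W f"
proof (rule continuous_at_imp_continuous_on, rule ballI)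
  fix p assume p: "p \<in> W"
  let ?c = "chart_at A p"
  let ?N = "fst ?c \<inter> W"
  have "continuous_on ?N (\<lambda>q. (f \<circ> chart_inv ?c) (snd ?c q))"
    by (rule continuous_on_compose2[OF smooth_on_continuous[OF smooth_funD[OF assms(2) chart_at(1)]]
          continuous_on_subset[OF chart_continuous[OF chart_at(1)]]]) auto
  then have "continuous_on ?N f"
    by (rule continuous_on_eq) (simp add: chart_inv_left[OF chart_at(1)])
  moreover have "open ?N" "p \<in> ?N" using chart_at chart_dom_open[OF chart_at(1)] assms p by auto
  ultimately show "isCont f p" by (simp add: continuous_on_eq_continuous_at)
qed

section \<open>Bump functions on the manifold\<close>

text \<open>A Euclidean bump function is transported by the chart and extended by 0. Smoothness of
  the extension outside the chart domain rests on \<open>?K\<close> being closed in the manifold: it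
  is compact, and the manifold is Hausdorff.\<close>

lemma bump_exists:
  assumes c: "c \<in> A" and r: "0 < r" "r < s" and sub: "cball x s \<subseteq> snd c ` fst c"
  obtains \<psi> where "smooth_fun A UNIV \<psi>" "\<And>q. 0 \<le> \<psi> q" "\<And>q. q \<in> chart_inv c ` cball x r \<Longrightarrow> \<psi> q = 1"
    "\<And>q. q \<notin> chart_inv c ` cball x s \<Longrightarrow> \<psi> q = 0"
proof -
  obtain \<phi> :: "real ^ 'n \<Rightarrow> real" where \<phi>: "smooth_on UNIV \<phi>" "\<And>y. 0 \<le> \<phi> y" "\<And>y. y \<in> cball x r \<Longrightarrow> \<phi> y = 1"
      "\<And>y. y \<notin> ball x s \<Longrightarrow> \<phi> y = 0"
    using smooth_bump_exists[OF r, of x] by metis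
  define \<psi> where "\<psi> = (\<lambda>q. if q \<in> fst c then \<phi> (snd c q) else 0)"
  let ?K = "chart_inv c ` cball x s"
  have "compact ?K"
    by (rule compact_continuous_image[OF continuous_on_subset[OF chart_inv_continuous[OF c] sub] compact_cball])
  then have K: "closed ?K" by (rule compact_imp_closed)
  have inK: "\<psi> q = 0" if "q \<notin> ?K" for q
  proof (cases "q \<in> fst c")
    case True
    then have "snd c q \<notin> cball x s" using that chart_inv_left[OF c True] by (metis imageI)
    then show ?thesis using \<phi>(4) by (auto simp: \<psi>_def)
  qed (simp add: \<psi>_def)
  show thesis
  proof
    show "smooth_fun A UNIV \<psi>"
    proof (rule smooth_fun_local)
      fix p
      show "\<exists>N. open N \<and> p \<in> N \<and> smooth_fun A N \<psi>"
      proof (cases "p \<in> fst c")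
        case True
        have "smooth_fun A (fst c) \<psi>"
          unfolding smooth_fun_def
        proof
          fix d assume d: "d \<in> A"
          have o: "open (snd d ` (fst d \<inter> fst c))" by (rule open_chart_image[OF d chart_dom_open[OF c]])
          have s: "smooth_on (snd d ` (fst d \<inter> fst c)) (\<lambda>y. \<phi> ((snd c \<circ> chart_inv d) y))"
            by (rule smooth_on_compose[OF o open_UNIV subset_UNIV transition_smooth[OF d c] \<phi>(1)])
          show "smooth_on (snd d ` (fst d \<inter> fst c)) (\<psi> \<circ> chart_inv d)"
            by (rule smooth_on_cong[OF o _ s]) (auto simp: \<psi>_def chart_inv_left[OF d])
        qed
        then show ?thesis using True chart_dom_open[OF c] by blast
      next
        case False
        have "p \<in> - ?K" using False sub chart_inv_in[OF c] by auto
        moreover have "smooth_fun A (- ?K) \<psi>"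
          by (rule smooth_fun_cong[OF _ _ smooth_fun_const[of _ 0]]) (use K inK in auto)
        ultimately show ?thesis using K by blast
      qed
    qed
    show "0 \<le> \<psi> q" for q using \<phi>(2) by (simp add: \<psi>_def)
    show "\<psi> q = 1" if "q \<in> chart_inv c ` cball x r" for q
    proof -
      have "cball x r \<subseteq> snd c ` fst c" using sub r by (meson less_imp_le order.trans subset_cball)
      then show ?thesis using that \<phi>(3) chart_inv_in[OF c] chart_inv_right[OF c] by (auto simp: \<psi>_def subset_iff)
    qed
  qed (rule inK)
qed

end

section \<open>Metrics, connections and orthonormal frames\<close>

lemma bilinear_axis_expansion:
  fixes B :: "real ^ 'n::finite \<Rightarrow> real ^ 'n \<Rightarrow> 'b::real_vector"
  assumes "bilinear B"
  shows "B u w = (\<Sum>i\<in>UNIV. \<Sum>j\<in>UNIV. (u $ i * w $ j) *\<^sub>R B (axis i 1) (axis j 1))"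
proof -
  have 1: "B u w = (\<Sum>i\<in>UNIV. u $ i *\<^sub>R B (axis i 1) w)"
    using linear_axis_expansion[of "\<lambda>v. B v w" u] assms by (simp add: bilinear_def)
  have 2: "B (axis i 1) w = (\<Sum>j\<in>UNIV. w $ j *\<^sub>R B (axis i 1) (axis j 1))" for i
    by (rule linear_axis_expansion) (use assms in \<open>simp add: bilinear_def\<close>)
  show ?thesis unfolding 1 by (subst 2) (simp add: scaleR_sum_right)
qed

lemma bilinear_sum_left: "bilinear B \<Longrightarrow> B (\<Sum>i\<in>I. f i) y = (\<Sum>i\<in>I. B (f i) y)"
  unfolding bilinear_def using linear_sum by blast

lemma bilinear_sum_right: "bilinear B \<Longrightarrow> B x (\<Sum>i\<in>I. f i) = (\<Sum>i\<in>I. B x (f i))"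
  unfolding bilinear_def using linear_sum by blast

lemma bilinear_compose_linear: "bilinear B \<Longrightarrow> linear L \<Longrightarrow> bilinear (\<lambda>u w. B (L u) (L w))"
  unfolding bilinear_def using linear_compose[unfolded o_def] by blast

text \<open>Linearity over functions, tested at the point \<open>p\<close> and on fields smooth on
  \<open>W\<close>: the condition under which an expression in a field depends on it only through
  the value at \<open>p\<close>.\<close>

definition tensorial :: "('a::topological_space, 'n::finite) chart set \<Rightarrow> 'a set \<Rightarrow> 'a \<Rightarrow> (('a, 'n) vfield \<Rightarrow> 'b::real_vector) \<Rightarrow> bool" where
  "tensorial A W p \<Phi> \<longleftrightarrow>
     (\<forall>X Y. smooth_field A W X \<longrightarrow> smooth_field A W Y \<longrightarrow> \<Phi> (\<lambda>q. X q + Y q) = \<Phi> X + \<Phi> Y) \<and>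
     (\<forall>X f. smooth_field A W X \<longrightarrow> smooth_fun A W f \<longrightarrow> \<Phi> (\<lambda>q. f q *\<^sub>R X q) = f p *\<^sub>R \<Phi> X)"

context atlas
begin

lemma smooth_fun_cutoff: "open W \<Longrightarrow> smooth_fun A W (\<lambda>q. if q \<in> W then 0 else 1)"
  by (rule smooth_fun_cong[OF _ _ smooth_fun_const[of W 0]]) auto

text \<open>Locality: the difference of two fields that agree on \<open>W\<close> equals \<open>f\<close> times itself for the
  function \<open>f\<close> that is \<open>0\<close> on \<open>W\<close> and \<open>1\<close> elsewhere, and \<open>f\<close> is smooth on \<open>W\<close>.\<close>

lemma tensorial_local:
  assumes \<Phi>: "tensorial A W p \<Phi>" and W: "open W" "p \<in> W"
    and X: "smooth_field A W X" and Y: "smooth_field A W Y" and eq: "\<And>q. q \<in> W \<Longrightarrow> X q = Y q"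
  shows "\<Phi> X = \<Phi> Y"
proof -
  let ?f = "\<lambda>q. if q \<in> W then 0 else 1::real" and ?Z = "\<lambda>q. X q - Y q"
  have Z: "smooth_field A W ?Z" by (rule smooth_field_diff[OF W(1) X Y])
  have "?Z = (\<lambda>q. ?f q *\<^sub>R ?Z q)" using eq by auto
  moreover have "\<Phi> (\<lambda>q. ?f q *\<^sub>R ?Z q) = ?f p *\<^sub>R \<Phi> ?Z"
    using \<Phi> Z smooth_fun_cutoff[OF W(1)] unfolding tensorial_def by blast
  ultimately have "\<Phi> ?Z = 0" using W(2) by simp
  moreover have "\<Phi> (\<lambda>q. Y q + ?Z q) = \<Phi> Y + \<Phi> ?Z"
    using \<Phi> Z Y unfolding tensorial_def by blast
  ultimately show ?thesis by simp
qed

lemma tensorial_sum: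
  assumes \<Phi>: "tensorial A W p \<Phi>" and W: "open W" "p \<in> W"
    and "\<And>i. i \<in> I \<Longrightarrow> smooth_fun A W (f i)" "\<And>i. i \<in> I \<Longrightarrow> smooth_field A W (X i)"
  shows "\<Phi> (\<lambda>q. \<Sum>i\<in>I. f i q *\<^sub>R X i q) = (\<Sum>i\<in>I. f i p *\<^sub>R \<Phi> (X i))"
proof -
  have "\<Phi> (\<lambda>q. 0 *\<^sub>R (0::real^'n)) = 0 *\<^sub>R \<Phi> (\<lambda>q. 0)"
    using \<Phi> smooth_field_zero[OF W(1)] smooth_fun_const[of W 0] unfolding tensorial_def by blast
  then have zero: "\<Phi> (\<lambda>q. 0) = 0" by simp
  show ?thesis using assms(4,5)
  proof (induction I rule: infinite_finite_induct)
    case (insert i I)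
    have "smooth_field A W (\<lambda>q. f i q *\<^sub>R X i q)" "smooth_field A W (\<lambda>q. \<Sum>i\<in>I. f i q *\<^sub>R X i q)"
      using insert by (auto intro!: smooth_field_sum smooth_field_scaleR W)
    then have "\<Phi> (\<lambda>q. f i q *\<^sub>R X i q + (\<Sum>i\<in>I. f i q *\<^sub>R X i q))
        = \<Phi> (\<lambda>q. f i q *\<^sub>R X i q) + \<Phi> (\<lambda>q. \<Sum>i\<in>I. f i q *\<^sub>R X i q)"
      using \<Phi> unfolding tensorial_def by blast
    moreover have "\<Phi> (\<lambda>q. f i q *\<^sub>R X i q) = f i p *\<^sub>R \<Phi> (X i)"
      using \<Phi> insert unfolding tensorial_def by blast
    ultimately show ?case using insert by simp
  qed (simp_all add: zero)
qed

end

locale atlas_connection = atlas A for A :: "('a::{t2_space,second_countable_topology}, 'n::finite) chart set" +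
  fixes nb :: "('a, 'n) connection"
  assumes connection: "linear_connection A nb"
begin

lemma smooth_field_conn:
  "open W \<Longrightarrow> smooth_field A W X \<Longrightarrow> smooth_field A W Y \<Longrightarrow> smooth_field A W (nb X Y)"
  using connection smooth_fun_const[of W 0] unfolding linear_connection_def by blast

lemma
  assumes "open W" "smooth_field A W X" "smooth_field A W Y" "p \<in> W"
  shows conn_add_left: "smooth_field A W Z \<Longrightarrow> nb (\<lambda>q. X q + Z q) Y p = nb X Y p + nb Z Y p"
    and conn_scaleR_left: "smooth_fun A W f \<Longrightarrow> nb (\<lambda>q. f q *\<^sub>R X q) Y p = f p *\<^sub>R nb X Y p"
    and conn_add_right: "smooth_field A W Z \<Longrightarrow> nb X (\<lambda>q. Y q + Z q) p = nb X Y p + nb X Z p"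
    and conn_scaleR_right: "smooth_fun A W f \<Longrightarrow> nb X (\<lambda>q. f q *\<^sub>R Y q) p = dir_deriv A X f p *\<^sub>R Y p + f p *\<^sub>R nb X Y p"
  using connection smooth_fun_const[of W 0] assms unfolding linear_connection_def by blast+

lemma tensorial_conn:
  assumes "open W" "smooth_field A W Y" "p \<in> W" shows "tensorial A W p (\<lambda>X. nb X Y p)"
  unfolding tensorial_def using conn_add_left conn_scaleR_left assms by blast

lemma conn_zero_right:
  assumes "open W" "p \<in> W" "smooth_field A W X" shows "nb X (\<lambda>q. 0) p = 0"
  using conn_scaleR_right[OF assms(1,3) smooth_field_zero[OF assms(1)] assms(2) smooth_fun_const[of W 0]]
  by (simp add: dir_deriv_const)

lemma conn_sum_right:
  assumes W: "open W" "p \<in> W" and X: "smooth_field A W X"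
    and "\<And>i. i \<in> I \<Longrightarrow> smooth_fun A W (f i)" "\<And>i. i \<in> I \<Longrightarrow> smooth_field A W (Y i)"
  shows "nb X (\<lambda>q. \<Sum>i\<in>I. f i q *\<^sub>R Y i q) p = (\<Sum>i\<in>I. dir_deriv A X (f i) p *\<^sub>R Y i p + f i p *\<^sub>R nb X (Y i) p)"
  using assms(4,5)
proof (induction I rule: infinite_finite_induct)
  case (insert i I)
  have "smooth_field A W (\<lambda>q. f i q *\<^sub>R Y i q)" "smooth_field A W (\<lambda>q. \<Sum>i\<in>I. f i q *\<^sub>R Y i q)"
    using insert by (auto intro!: smooth_field_sum smooth_field_scaleR W)
  then show ?case using insert conn_add_right[OF W(1) X _ W(2)] conn_scaleR_right[OF W(1) X _ W(2)] by simp
qed (simp_all add: conn_zero_right[OF W X])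

text \<open>In its second argument a connection is not function-linear, so the cut-off argument
  meets a Leibniz term; that term carries the factor \<open>?D p\<close>, which is 0.\<close>

lemma conn_local_right:
  assumes W: "open W" "p \<in> W" and X: "smooth_field A W X" and Y: "smooth_field A W Y" and Z: "smooth_field A W Z"
    and eq: "\<And>q. q \<in> W \<Longrightarrow> Y q = Z q"
  shows "nb X Y p = nb X Z p"
proof -
  let ?f = "\<lambda>q. if q \<in> W then 0 else 1::real" and ?D = "\<lambda>q. Y q - Z q"
  have D: "smooth_field A W ?D" by (rule smooth_field_diff[OF W(1) Y Z])
  have "?D = (\<lambda>q. ?f q *\<^sub>R ?D q)" using eq by auto
  moreover have "nb X (\<lambda>q. ?f q *\<^sub>R ?D q) p = dir_deriv A X ?f p *\<^sub>R ?D p + ?f p *\<^sub>R nb X ?D p"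
    by (rule conn_scaleR_right[OF W(1) X D W(2) smooth_fun_cutoff[OF W(1)]])
  ultimately have "nb X ?D p = 0" using W(2) eq by simp
  then show ?thesis using conn_add_right[OF W(1) X Z W(2) D] by simp
qed

end

locale metric_atlas = atlas A for A :: "('a::{t2_space,second_countable_topology}, 'n::finite) chart set" +
  fixes g :: "('a, 'n) metric"
  assumes metric: "pseudo_riemannian_metric A g"
begin

lemma bilinear_g: "bilinear (g p)" and g_sym: "g p v w = g p w v"
  using metric unfolding pseudo_riemannian_metric_def by blast+

lemma g_nondegenerate: "(\<And>w. g p v w = 0) \<Longrightarrow> v = 0"
  using metric unfolding pseudo_riemannian_metric_def by blast

lemmas g_simps = bilinear_ladd[OF bilinear_g] bilinear_radd[OF bilinear_g] bilinear_lmul[OF bilinear_g]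
  bilinear_rmul[OF bilinear_g] bilinear_lneg[OF bilinear_g] bilinear_rneg[OF bilinear_g]
  bilinear_lzero[OF bilinear_g] bilinear_rzero[OF bilinear_g] bilinear_lsub[OF bilinear_g] bilinear_rsub[OF bilinear_g]
  bilinear_sum_left[OF bilinear_g] bilinear_sum_right[OF bilinear_g]

text \<open>The base point enters through a map \<pi>: the identity for fields on a chart, the
  second projection for families depending on time and position.\<close>

lemma smooth_on_g_coord:
  fixes \<pi> :: "'z::real_normed_vector \<Rightarrow> real ^ 'n"
  assumes c: "c \<in> A" and S: "open S" and \<pi>: "smooth_on S \<pi>" "\<pi> ` S \<subseteq> snd c ` fst c"
    and u: "smooth_on S u" and w: "smooth_on S w"
  shows "smooth_on S (\<lambda>z. g (chart_inv c (\<pi> z)) (of_coord A c (chart_inv c (\<pi> z)) (u z)) (of_coord A c (chart_inv c (\<pi> z)) (w z)))"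
proof -
  let ?G = "\<lambda>i j x. let p = chart_inv c x in g p (of_coord A c p (axis i 1)) (of_coord A c p (axis j 1))"
  have G: "smooth_on (snd c ` fst c) (?G i j)" for i j
    using metric c unfolding pseudo_riemannian_metric_def by blast
  have G': "smooth_on S (\<lambda>z. ?G i j (\<pi> z))" for i j
    by (rule smooth_on_compose[OF S chart_image_open[OF c] \<pi>(2,1) G])
  show ?thesis
  proof (rule smooth_on_cong[OF S])
    show "smooth_on S (\<lambda>z. \<Sum>i\<in>UNIV. \<Sum>j\<in>UNIV. (u z $ i * w z $ j) *\<^sub>R ?G i j (\<pi> z))"
      by (intro smooth_on_sum smooth_on_scaleR smooth_on_mult smooth_on_nth S u w G')
    fix z assume "z \<in> S"
    then have "chart_inv c (\<pi> z) \<in> fst c" using \<pi>(2) chart_inv_in[OF c] by blast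
    from bilinear_axis_expansion[OF bilinear_compose_linear[OF bilinear_g linear_of_coord[OF c this]], of _ "u z" "w z"]
    show "(\<Sum>i\<in>UNIV. \<Sum>j\<in>UNIV. (u z $ i * w z $ j) *\<^sub>R ?G i j (\<pi> z)) =
      g (chart_inv c (\<pi> z)) (of_coord A c (chart_inv c (\<pi> z)) (u z)) (of_coord A c (chart_inv c (\<pi> z)) (w z))"
      by (simp add: Let_def)
  qed
qed

lemma smooth_fun_g:
  assumes W: "open W" and X: "smooth_field A W X" and Y: "smooth_field A W Y"
  shows "smooth_fun A W (\<lambda>q. g q (X q) (Y q))"
  unfolding smooth_fun_def o_def
proof
  fix c assume c: "c \<in> A"
  have o: "open (snd c ` (fst c \<inter> W))" by (rule open_chart_image[OF c W])
  have "smooth_on (snd c ` (fst c \<inter> W)) (\<lambda>x. x)" by (rule smooth_on_linear[OF o bounded_linear_ident])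
  from smooth_on_g_coord[OF c o this _ smooth_fieldD[OF X c] smooth_fieldD[OF Y c]]
  have "smooth_on (snd c ` (fst c \<inter> W)) (\<lambda>z. g (chart_inv c z) (of_coord A c (chart_inv c z) (field_coord A c X z))
     (of_coord A c (chart_inv c z) (field_coord A c Y z)))" by blast
  then show "smooth_on (snd c ` (fst c \<inter> W)) (\<lambda>x. g (chart_inv c x) (X (chart_inv c x)) (Y (chart_inv c x)))"
    by (rule smooth_on_cong[OF o, rotated]) (auto simp: field_coord_def chart_inv_left[OF c] of_to_coord[OF c])
qed

end

context atlas
begin

text \<open>As for the metric, \<pi> lets one statement serve both fields and time-dependent
  families; here the tensor may itself depend on the parameter \<open>z\<close>.\<close>

lemma smooth_on_tensor_coord:
  fixes \<pi> :: "'z::real_normed_vector \<Rightarrow> real ^ 'n" and F :: "'z \<Rightarrow> real ^ 'n \<Rightarrow> real ^ 'n \<Rightarrow> real ^ 'n"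
  assumes c: "c \<in> A" and S: "open S" and \<pi>: "\<pi> ` S \<subseteq> snd c ` fst c"
    and u: "smooth_on S u" and w: "smooth_on S w" and F: "\<And>z. z \<in> S \<Longrightarrow> bilinear (F z)"
    and sF: "\<And>v w. smooth_on S (\<lambda>z. to_coord A c (chart_inv c (\<pi> z))
        (F z (of_coord A c (chart_inv c (\<pi> z)) v) (of_coord A c (chart_inv c (\<pi> z)) w)))"
  shows "smooth_on S (\<lambda>z. to_coord A c (chart_inv c (\<pi> z))
        (F z (of_coord A c (chart_inv c (\<pi> z)) (u z)) (of_coord A c (chart_inv c (\<pi> z)) (w z))))"
proof (rule smooth_on_cong[OF S])
  let ?F = "\<lambda>z v w. to_coord A c (chart_inv c (\<pi> z))
        (F z (of_coord A c (chart_inv c (\<pi> z)) v) (of_coord A c (chart_inv c (\<pi> z)) w))"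
  show "smooth_on S (\<lambda>z. \<Sum>i\<in>UNIV. \<Sum>j\<in>UNIV. (u z $ i * w z $ j) *\<^sub>R ?F z (axis i 1) (axis j 1))"
    by (intro smooth_on_sum smooth_on_scaleR smooth_on_mult smooth_on_nth S u w sF)
  fix z assume z: "z \<in> S"
  then have p: "chart_inv c (\<pi> z) \<in> fst c" using \<pi> chart_inv_in[OF c] by blast
  have "bilinear (?F z)"
    using bilinear_compose_linear[OF F[OF z] linear_of_coord[OF c p]] linear_compose[OF _ linear_to_coord[OF c p], unfolded o_def]
    unfolding bilinear_def by blast
  from bilinear_axis_expansion[OF this, of "u z" "w z"]
  show "(\<Sum>i\<in>UNIV. \<Sum>j\<in>UNIV. (u z $ i * w z $ j) *\<^sub>R ?F z (axis i 1) (axis j 1)) = ?F z (u z) (w z)" by simp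
qed

lemma smooth_field_tensor:
  assumes T: "smooth_tensor12 A T" and W: "open W" and X: "smooth_field A W X" and Y: "smooth_field A W Y"
  shows "smooth_field A W (\<lambda>q. T q (X q) (Y q))"
  unfolding smooth_field_def field_coord_def
proof
  fix c assume c: "c \<in> A"
  have o: "open (snd c ` (fst c \<inter> W))" by (rule open_chart_image[OF c W])
  have sT: "smooth_on (snd c ` (fst c \<inter> W)) (\<lambda>z. to_coord A c (chart_inv c z)
      (T (chart_inv c z) (of_coord A c (chart_inv c z) v) (of_coord A c (chart_inv c z) w)))" for v w
  proof -
    have "smooth_on (snd c ` fst c) (\<lambda>z. to_coord A c (chart_inv c z)
      (T (chart_inv c z) (of_coord A c (chart_inv c z) v) (of_coord A c (chart_inv c z) w)))"
      using T c unfolding smooth_tensor12_def Let_def by blast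
    then show ?thesis by (rule smooth_on_subset) auto
  qed
  have "smooth_on (snd c ` (fst c \<inter> W)) (\<lambda>z. to_coord A c (chart_inv c z)
      (T (chart_inv c z) (of_coord A c (chart_inv c z) (field_coord A c X z)) (of_coord A c (chart_inv c z) (field_coord A c Y z))))"
    by (rule smooth_on_tensor_coord[where \<pi>="\<lambda>z. z" and F="\<lambda>z. T (chart_inv c z)", OF c o _ smooth_fieldD[OF X c] smooth_fieldD[OF Y c] _ sT])
       (use T in \<open>auto simp: smooth_tensor12_def\<close>)
  then show "smooth_on (snd c ` (fst c \<inter> W)) (\<lambda>x. to_coord A c (chart_inv c x) (T (chart_inv c x) (X (chart_inv c x)) (Y (chart_inv c x))))"
    by (rule smooth_on_cong[OF o, rotated]) (auto simp: field_coord_def chart_inv_left[OF c] of_to_coord[OF c])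
qed

lemma nabla_bar_connection:
  assumes nabla: "linear_connection A nabla" and T: "smooth_tensor12 A T"
  shows "linear_connection A (nabla_bar nabla T)"
proof -
  interpret atlas_connection A nabla by unfold_locales (rule nabla)
  have b: "bilinear (T p)" for p using T by (simp add: smooth_tensor12_def)
  have "smooth_field A W (nabla_bar nabla T X Y)" if "open W" "smooth_field A W X" "smooth_field A W Y" for W X Y
    using smooth_field_add[OF that(1) smooth_field_conn[OF that] smooth_field_tensor[OF T that]]
    by (simp add: nabla_bar_def[abs_def])
  then show ?thesis
    unfolding linear_connection_def
    by (auto simp: nabla_bar_def conn_add_left conn_scaleR_left conn_add_right conn_scaleR_right
        bilinear_ladd[OF b] bilinear_radd[OF b] bilinear_lmul[OF b] bilinear_rmul[OF b] scaleR_add_right)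
qed

end

context metric_atlas
begin

section \<open>Orthonormal frames: expansions and traces\<close>

text \<open>Indices range over the coordinate type, so there are exactly as many vectors as the
  dimension, and sums over \<open>UNIV\<close> are full traces. The signs \<epsilon> are constant on
  \<open>W\<close> and equal to their own inverses.\<close>

definition pframe :: "'a set \<Rightarrow> ('n \<Rightarrow> ('a, 'n) vfield) \<Rightarrow> ('n \<Rightarrow> real) \<Rightarrow> bool" where
  "pframe W e \<epsilon> \<longleftrightarrow> open W \<and> (\<forall>i. smooth_field A W (e i)) \<and> (\<forall>i. \<epsilon> i * \<epsilon> i = 1) \<and>
     (\<forall>q\<in>W. \<forall>i j. g q (e i q) (e j q) = (if i = j then \<epsilon> i else 0))"

lemma pframe_subset: "pframe W e \<epsilon> \<Longrightarrow> open W' \<Longrightarrow> W' \<subseteq> W \<Longrightarrow> pframe W' e \<epsilon>"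
  unfolding pframe_def using smooth_field_subset by blast

text \<open>Each coefficient carries the factor \<open>g p (e i) (e i)\<close>, which is its own
  inverse because it is 1 or -1.\<close>

lemma orthonormal_span_expansion:
  assumes I: "finite I" and norm: "\<And>i. i \<in> I \<Longrightarrow> g p (e i) (e i) * g p (e i) (e i) = 1"
    and orth: "\<And>i j. i \<in> I \<Longrightarrow> j \<in> I \<Longrightarrow> i \<noteq> j \<Longrightarrow> g p (e i) (e j) = 0"
    and v: "v \<in> span (e ` I)"
  shows "v = (\<Sum>i\<in>I. (g p (e i) (e i) * g p v (e i)) *\<^sub>R e i)"
  using v
proof (induction rule: span_induct_alt)
  case base then show ?case by (simp add: g_simps)
next
  case (step c x y)
  then obtain j where j: "j \<in> I" "x = e j" by auto
  have "(\<Sum>i\<in>I. (g p (e i) (e i) * g p x (e i)) *\<^sub>R e i) = (\<Sum>i\<in>I. if i = j then e j else 0)"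
    by (rule sum.cong) (auto simp: j orth norm)
  also have "\<dots> = x" using I j by simp
  finally show ?case
    using step(2) by (simp add: g_simps distrib_left scaleR_add_left sum.distrib mult.left_commute[of _ c]
        scaleR_sum_right[symmetric] flip: scaleR_scaleR)
qed

lemma orthonormal_independent:
  assumes I: "finite I" and norm: "\<And>i. i \<in> I \<Longrightarrow> g p (e i) (e i) \<noteq> 0"
    and orth: "\<And>i j. i \<in> I \<Longrightarrow> j \<in> I \<Longrightarrow> i \<noteq> j \<Longrightarrow> g p (e i) (e j) = 0"
  shows "inj_on e I" "independent (e ` I)"
proof -
  show inj: "inj_on e I" using norm orth unfolding inj_on_def by metis
  show "independent (e ` I)"
  proof (rule independent_if_scalars_zero)
    fix f x assume s: "(\<Sum>x\<in>e ` I. f x *\<^sub>R x) = 0" and x: "x \<in> e ` I"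
    then obtain j where j: "j \<in> I" "x = e j" by auto
    have "0 = g p (\<Sum>i\<in>I. f (e i) *\<^sub>R e i) (e j)" using s by (simp add: sum.reindex[OF inj] g_simps)
    also have "\<dots> = (\<Sum>i\<in>I. if i = j then f (e j) * g p (e j) (e j) else 0)"
      unfolding g_simps by (rule sum.cong) (auto simp: orth j)
    also have "\<dots> = f (e j) * g p (e j) (e j)" using I j by simp
    finally show "f x = 0" using norm j by simp
  qed (use I in simp)
qed

text \<open>Expanding \<open>f j\<close> in the frame \<open>e\<close> in the first argument, and
  \<open>e i\<close> in the frame \<open>f\<close> in the second, turns both sides into the same
  double sum of values \<open>Q (e i) (f j)\<close>.\<close>

lemma orthonormal_trace_unique:
  fixes Q :: "real ^ 'n \<Rightarrow> real ^ 'n \<Rightarrow> 'b::real_vector"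
  assumes Q: "bilinear Q" and I: "finite I" "finite J"
    and e: "\<And>i. i \<in> I \<Longrightarrow> g p (e i) (e i) * g p (e i) (e i) = 1"
      "\<And>i j. i \<in> I \<Longrightarrow> j \<in> I \<Longrightarrow> i \<noteq> j \<Longrightarrow> g p (e i) (e j) = 0"
    and f: "\<And>i. i \<in> J \<Longrightarrow> g p (f i) (f i) * g p (f i) (f i) = 1"
      "\<And>i j. i \<in> J \<Longrightarrow> j \<in> J \<Longrightarrow> i \<noteq> j \<Longrightarrow> g p (f i) (f j) = 0"
    and span: "span (e ` I) = span (f ` J)"
  shows "(\<Sum>i\<in>I. g p (e i) (e i) *\<^sub>R Q (e i) (e i)) = (\<Sum>j\<in>J. g p (f j) (f j) *\<^sub>R Q (f j) (f j))"
proof -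
  have fj: "f j = (\<Sum>i\<in>I. (g p (e i) (e i) * g p (f j) (e i)) *\<^sub>R e i)" if "j \<in> J" for j
    by (rule orthonormal_span_expansion[OF I(1) e]) (simp_all add: span span_base that)
  have ei: "e i = (\<Sum>j\<in>J. (g p (f j) (f j) * g p (e i) (f j)) *\<^sub>R f j)" if "i \<in> I" for i
    by (rule orthonormal_span_expansion[OF I(2) f]) (simp_all flip: span add: span_base that)
  have "(\<Sum>j\<in>J. g p (f j) (f j) *\<^sub>R Q (f j) (f j))
      = (\<Sum>j\<in>J. \<Sum>i\<in>I. (g p (f j) (f j) * g p (e i) (e i) * g p (f j) (e i)) *\<^sub>R Q (e i) (f j))"
  proof (rule sum.cong[OF refl])
    fix j assume j: "j \<in> J"
    have "Q (f j) (f j) = (\<Sum>i\<in>I. (g p (e i) (e i) * g p (f j) (e i)) *\<^sub>R Q (e i) (f j))"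
      by (subst (1) fj[OF j]) (simp add: bilinear_sum_left[OF Q] bilinear_lmul[OF Q])
    then show "g p (f j) (f j) *\<^sub>R Q (f j) (f j) = (\<Sum>i\<in>I. (g p (f j) (f j) * g p (e i) (e i) * g p (f j) (e i)) *\<^sub>R Q (e i) (f j))"
      by (simp add: scaleR_sum_right mult.assoc)
  qed
  also have "\<dots> = (\<Sum>i\<in>I. \<Sum>j\<in>J. (g p (f j) (f j) * g p (e i) (e i) * g p (f j) (e i)) *\<^sub>R Q (e i) (f j))"
    by (rule sum.swap)
  also have "\<dots> = (\<Sum>i\<in>I. g p (e i) (e i) *\<^sub>R Q (e i) (e i))"
  proof (rule sum.cong[OF refl])
    fix i assume i: "i \<in> I"
    have "Q (e i) (e i) = (\<Sum>j\<in>J. (g p (f j) (f j) * g p (e i) (f j)) *\<^sub>R Q (e i) (f j))"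
      by (subst (2) ei[OF i]) (simp add: bilinear_sum_right[OF Q] bilinear_rmul[OF Q])
    then show "(\<Sum>j\<in>J. (g p (f j) (f j) * g p (e i) (e i) * g p (f j) (e i)) *\<^sub>R Q (e i) (f j)) = g p (e i) (e i) *\<^sub>R Q (e i) (e i)"
      by (simp add: scaleR_sum_right mult_ac g_sym[of p "f _" "e i"])
  qed
  finally show ?thesis by simp
qed

text \<open>Orthonormal vectors are independent, and their number is the dimension, so they
  span.\<close>

lemma pframe_expansion:
  assumes "pframe W e \<epsilon>" "p \<in> W"
  shows "v = (\<Sum>i\<in>UNIV. (\<epsilon> i * g p v (e i p)) *\<^sub>R e i p)"
proof -
  have o: "g p (e i p) (e j p) = (if i = j then \<epsilon> i else 0)" and n: "\<epsilon> i * \<epsilon> i = 1" for i j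
    using assms unfolding pframe_def by blast+
  have nz: "\<epsilon> i \<noteq> 0" for i using n[of i] by auto
  have "inj (\<lambda>i. e i p)" "independent (range (\<lambda>i. e i p))"
    by (rule orthonormal_independent[of UNIV p "\<lambda>i. e i p"]; simp add: o nz)+
  then have "UNIV \<subseteq> span (range (\<lambda>i. e i p))"
    by (intro card_ge_dim_independent) (auto simp: card_image)
  then have "v \<in> span (range (\<lambda>i. e i p))" by blast
  from orthonormal_span_expansion[of UNIV p "\<lambda>i. e i p", OF _ _ _ this] show ?thesis by (simp add: o n)
qed

text \<open>The field agrees on \<open>W\<close> with its frame expansion; locality and
  function-linearity then carry the expansion through \<Phi>.\<close>

lemma tensorial_frame_expansion:
  assumes \<Phi>: "tensorial A W p \<Phi>" and e: "pframe W e \<epsilon>" and p: "p \<in> W" and X: "smooth_field A W X"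
  shows "\<Phi> X = (\<Sum>i\<in>UNIV. (\<epsilon> i * g p (X p) (e i p)) *\<^sub>R \<Phi> (e i))"
proof -
  have W: "open W" and se: "smooth_field A W (e i)" for i using e by (auto simp: pframe_def)
  let ?f = "\<lambda>i q. \<epsilon> i * g q (X q) (e i q)"
  have f: "smooth_fun A W (?f i)" for i
    by (intro smooth_fun_mult smooth_fun_const smooth_fun_g W X se)
  have "\<Phi> X = \<Phi> (\<lambda>q. \<Sum>i\<in>UNIV. ?f i q *\<^sub>R e i q)"
    by (rule tensorial_local[OF \<Phi> W p X])
       (use pframe_expansion[OF e] in \<open>auto intro!: smooth_field_sum smooth_field_scaleR W f se\<close>)
  also have "\<dots> = (\<Sum>i\<in>UNIV. ?f i p *\<^sub>R \<Phi> (e i))"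
    by (rule tensorial_sum[OF \<Phi> W p]) (auto intro: f se)
  finally show ?thesis .
qed

end

section \<open>Curvature in orthonormal frames\<close>

context metric_atlas
begin

text \<open>Connection coefficients in a frame with the last index lowered by the metric; for the
  Levi-Civita connection this makes metric compatibility a skew symmetry in the last two
  indices.\<close>

definition christ :: "('a, 'n) connection \<Rightarrow> ('n \<Rightarrow> ('a, 'n) vfield) \<Rightarrow> 'n \<Rightarrow> 'n \<Rightarrow> 'n \<Rightarrow> 'a \<Rightarrow> real" where
  "christ nb e a b c q = g q (nb (e a) (e b) q) (e c q)"

definition tcomp :: "('a, 'n) tensor12 \<Rightarrow> ('n \<Rightarrow> ('a, 'n) vfield) \<Rightarrow> 'n \<Rightarrow> 'n \<Rightarrow> 'n \<Rightarrow> 'a \<Rightarrow> real" where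
  "tcomp T e a b c q = g q (T q (e a q) (e b q)) (e c q)"

lemma christ_nabla_bar: "christ (nabla_bar nabla T) e a b c q = christ nabla e a b c q + tcomp T e a b c q"
  by (simp add: christ_def tcomp_def nabla_bar_def g_simps)

lemma smooth_fun_tcomp:
  assumes "pframe W e \<epsilon>" "smooth_tensor12 A T" shows "smooth_fun A W (tcomp T e a b c)"
proof -
  have W: "open W" and se: "smooth_field A W (e i)" for i using assms(1) by (auto simp: pframe_def)
  show ?thesis
    unfolding tcomp_def[abs_def] by (rule smooth_fun_g[OF W smooth_field_tensor[OF assms(2) W se se] se])
qed

text \<open>\<open>nabla_bar\<close> is in general not compatible with the metric, so the formula
  comes from expanding \<open>Z\<close> in the frame and applying the Leibniz rule, instead of
  differentiating the inner product.\<close>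

lemma conn_frame_component:
  assumes nb: "linear_connection A nb" and e: "pframe W e \<epsilon>" and p: "p \<in> W" and Z: "smooth_field A W Z"
  shows "g p (nb (e b) Z p) (e d p) =
    dir_deriv A (e b) (\<lambda>q. g q (Z q) (e d q)) p + (\<Sum>c\<in>UNIV. \<epsilon> c * g p (Z p) (e c p) * christ nb e b c d p)"
proof -
  interpret atlas_connection A nb by unfold_locales (rule nb)
  have W: "open W" and se: "smooth_field A W (e i)" and n: "\<epsilon> i * \<epsilon> i = 1"
    and o: "g p (e i p) (e j p) = (if i = j then \<epsilon> i else 0)" for i j using e p by (auto simp: pframe_def)
  let ?f = "\<lambda>i q. \<epsilon> i * g q (Z q) (e i q)"
  have h: "smooth_fun A W (\<lambda>q. g q (Z q) (e i q))" for i by (rule smooth_fun_g[OF W Z se])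
  have f: "smooth_fun A W (?f i)" for i
    by (intro smooth_fun_mult smooth_fun_const h W)
  have "nb (e b) Z p = nb (e b) (\<lambda>q. \<Sum>i\<in>UNIV. ?f i q *\<^sub>R e i q) p"
    by (rule conn_local_right[OF W p se Z])
       (use pframe_expansion[OF e] in \<open>auto intro!: smooth_field_sum smooth_field_scaleR W f se\<close>)
  also have "\<dots> = (\<Sum>i\<in>UNIV. dir_deriv A (e b) (?f i) p *\<^sub>R e i p + ?f i p *\<^sub>R nb (e b) (e i) p)"
    by (rule conn_sum_right[OF W p se]) (auto intro: f se)
  finally have "g p (nb (e b) Z p) (e d p) = (\<Sum>i\<in>UNIV. dir_deriv A (e b) (?f i) p * (if i = d then \<epsilon> i else 0))
      + (\<Sum>i\<in>UNIV. ?f i p * christ nb e b i d p)"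
    by (simp add: g_simps sum.distrib christ_def o)
  also have "(\<Sum>i\<in>UNIV. dir_deriv A (e b) (?f i) p * (if i = d then \<epsilon> i else 0)) = dir_deriv A (e b) (?f d) p * \<epsilon> d"
    by (simp add: if_distrib cong: if_cong)
  also have "\<dots> = \<epsilon> d * \<epsilon> d * dir_deriv A (e b) (\<lambda>q. g q (Z q) (e d q)) p"
    unfolding dir_deriv_cmult[OF h p] by (simp only: mult_ac)
  also have "\<dots> = dir_deriv A (e b) (\<lambda>q. g q (Z q) (e d q)) p" by (simp add: n)
  finally show ?thesis .
qed

end

locale levi_civita_atlas = metric_atlas A g for A :: "('a::{t2_space,second_countable_topology}, 'n::finite) chart set" and g +
  fixes nabla :: "('a, 'n) connection"
  assumes levi_civita: "levi_civita A g nabla"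
begin

lemma nabla_linear: "linear_connection A nabla" using levi_civita by (simp add: levi_civita_def)

sublocale atlas_connection A nabla by unfold_locales (rule nabla_linear)

lemma
  assumes "open W" "smooth_field A W X" "smooth_field A W Y" "p \<in> W"
  shows nabla_torsion_free: "lie_bracket A X Y p = nabla X Y p - nabla Y X p"
    and nabla_metric: "smooth_field A W Z \<Longrightarrow>
      dir_deriv A X (\<lambda>q. g q (Y q) (Z q)) p = g p (nabla X Y p) (Z p) + g p (Y p) (nabla X Z p)"
proof -
  have *: "\<And>Z. smooth_field A W Z \<Longrightarrow> nabla X Y p - nabla Y X p = lie_bracket A X Y p \<and>
    dir_deriv A X (\<lambda>q. g q (Y q) (Z q)) p = g p (nabla X Y p) (Z p) + g p (Y p) (nabla X Z p)"
    using levi_civita assms unfolding levi_civita_def by blast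
  show "lie_bracket A X Y p = nabla X Y p - nabla Y X p" using *[OF smooth_field_zero[OF assms(1)]] by simp
  show "dir_deriv A X (\<lambda>q. g q (Y q) (Z q)) p = g p (nabla X Y p) (Z p) + g p (Y p) (nabla X Z p)"
    if "smooth_field A W Z" using *[OF that] by blast
qed

lemma smooth_field_lie_bracket:
  assumes "open W" "smooth_field A W X" "smooth_field A W Y" shows "smooth_field A W (lie_bracket A X Y)"
  by (rule smooth_field_cong[OF assms(1) nabla_torsion_free[OF assms, symmetric]])
     (auto intro!: smooth_field_diff smooth_field_conn assms)

lemma lie_bracket_skew: "lie_bracket A X Y p = - lie_bracket A Y X p"
  by (simp add: lie_bracket_def Let_def)

text \<open>The functions \<open>g q (e b q) (e c q)\<close> are constant on \<open>W\<close>, so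
  the two terms of metric compatibility add up to zero.\<close>

lemma christ_skew:
  assumes e: "pframe W e \<epsilon>" and p: "p \<in> W"
  shows "christ nabla e a b c p = - christ nabla e a c b p"
proof -
  have W: "open W" and se: "smooth_field A W (e i)"
    and o: "q \<in> W \<Longrightarrow> g q (e i q) (e j q) = (if i = j then \<epsilon> i else 0)" for i j q using e by (auto simp: pframe_def)
  have "dir_deriv A (e a) (\<lambda>q. g q (e b q) (e c q)) p = dir_deriv A (e a) (\<lambda>q. if b = c then \<epsilon> b else 0) p"
    by (rule dir_deriv_cong[OF W p]) (auto simp: o intro: smooth_fun_g W se)
  then show ?thesis
    using nabla_metric[OF W se se p se, of a b c] by (simp add: dir_deriv_const christ_def g_sym[of p "e b p"])
qed

lemma smooth_fun_christ:
  assumes "pframe W e \<epsilon>" shows "smooth_fun A W (christ nabla e a b c)"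
proof -
  have W: "open W" and se: "smooth_field A W (e i)" for i using assms by (auto simp: pframe_def)
  show ?thesis unfolding christ_def[abs_def] by (rule smooth_fun_g[OF W smooth_field_conn[OF W se se] se])
qed

context
  fixes T
  assumes T: "smooth_tensor12 A T"
begin

abbreviation "nb \<equiv> nabla_bar nabla T"

interpretation bar: atlas_connection A nb
  by unfold_locales (rule nabla_bar_connection[OF nabla_linear T])

section \<open>Tensoriality of the curvature\<close>

lemma curv_bar_skew:
  assumes "open W" "p \<in> W" "smooth_field A W X" "smooth_field A W Y" "smooth_field A W Z"
  shows "curv_bar A nabla T X Y Z p = - curv_bar A nabla T Y X Z p"
proof -
  have "nb (lie_bracket A X Y) Z p = nb (\<lambda>q. (-1) *\<^sub>R lie_bracket A Y X q) Z p"
    by (rule tensorial_local[OF bar.tensorial_conn[OF assms(1,5,2)] assms(1,2)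
          smooth_field_lie_bracket[OF assms(1,3,4)]
          smooth_field_scaleR[OF assms(1) smooth_fun_const smooth_field_lie_bracket[OF assms(1,4,3)]]])
       (simp add: lie_bracket_skew[of X])
  also have "\<dots> = (-1) *\<^sub>R nb (lie_bracket A Y X) Z p"
    by (rule bar.conn_scaleR_left[OF assms(1) smooth_field_lie_bracket[OF assms(1,4,3)] assms(5,2)]) (rule smooth_fun_const)
  finally show ?thesis unfolding curv_bar_def by simp
qed

text \<open>For homogeneity, the bracket of \<open>f X\<close> and \<open>Y\<close> contains
  \<open>- (Y f) X\<close>; the connection along this extra field cancels the derivative of
  \<open>f\<close> that arises when \<open>f * nb X Z\<close> is differentiated along
  \<open>Y\<close>.\<close>

lemma tensorial_curv_bar_1:
  assumes W: "open W" "p \<in> W" and Y: "smooth_field A W Y" and Z: "smooth_field A W Z"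
  shows "tensorial A W p (\<lambda>X. curv_bar A nabla T X Y Z p)"
  unfolding tensorial_def
proof (intro conjI allI impI)
  fix X X' assume X: "smooth_field A W X" and X': "smooth_field A W X'"
  have a: "nb Y (nb (\<lambda>q. X q + X' q) Z) p = nb Y (\<lambda>q. nb X Z q + nb X' Z q) p"
    by (rule bar.conn_local_right[OF W Y])
       (auto intro!: bar.smooth_field_conn smooth_field_add bar.conn_add_left W X X' Z)
  have b: "nb (lie_bracket A (\<lambda>q. X q + X' q) Y) Z p = nb (\<lambda>q. lie_bracket A X Y q + lie_bracket A X' Y q) Z p"
  proof (rule tensorial_local[OF bar.tensorial_conn[OF W(1) Z W(2)] W])
    fix q assume q: "q \<in> W"
    note XX = smooth_field_add[OF W(1) X X']
    show "lie_bracket A (\<lambda>q. X q + X' q) Y q = lie_bracket A X Y q + lie_bracket A X' Y q"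
      unfolding nabla_torsion_free[OF W(1) XX Y q] nabla_torsion_free[OF W(1) X Y q] nabla_torsion_free[OF W(1) X' Y q]
        conn_add_left[OF W(1) X Y q X'] conn_add_right[OF W(1) Y X q X'] by simp
  qed (auto intro!: smooth_field_lie_bracket smooth_field_add W X X' Y)
  show "curv_bar A nabla T (\<lambda>q. X q + X' q) Y Z p = curv_bar A nabla T X Y Z p + curv_bar A nabla T X' Y Z p"
    unfolding curv_bar_def a b
    using bar.conn_add_right[OF W(1) Y bar.smooth_field_conn[OF W(1) X Z] W(2) bar.smooth_field_conn[OF W(1) X' Z]]
      bar.conn_add_left[OF W(1) X bar.smooth_field_conn[OF W(1) Y Z] W(2) X']
      bar.conn_add_left[OF W(1) smooth_field_lie_bracket[OF W(1) X Y] Z W(2) smooth_field_lie_bracket[OF W(1) X' Y]]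
    by simp
next
  fix X f assume X: "smooth_field A W X" and f: "smooth_fun A W f"
  have a: "nb Y (nb (\<lambda>q. f q *\<^sub>R X q) Z) p = nb Y (\<lambda>q. f q *\<^sub>R nb X Z q) p"
    by (rule bar.conn_local_right[OF W Y])
       (auto intro!: bar.smooth_field_conn smooth_field_scaleR bar.conn_scaleR_left W X f Z)
  have m: "smooth_fun A W (\<lambda>q. (-1) * dir_deriv A Y f q)"
    by (intro smooth_fun_mult smooth_fun_const smooth_fun_dir_deriv W f Y)
  have b: "nb (lie_bracket A (\<lambda>q. f q *\<^sub>R X q) Y) Z p = nb (\<lambda>q. f q *\<^sub>R lie_bracket A X Y q + ((-1) * dir_deriv A Y f q) *\<^sub>R X q) Z p"
  proof (rule tensorial_local[OF bar.tensorial_conn[OF W(1) Z W(2)] W])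
    note fX = smooth_field_scaleR[OF W(1) f X]
    show "smooth_field A W (lie_bracket A (\<lambda>q. f q *\<^sub>R X q) Y)" by (rule smooth_field_lie_bracket[OF W(1) fX Y])
    show "smooth_field A W (\<lambda>q. f q *\<^sub>R lie_bracket A X Y q + ((-1) * dir_deriv A Y f q) *\<^sub>R X q)"
      by (rule smooth_field_add[OF W(1) smooth_field_scaleR[OF W(1) f smooth_field_lie_bracket[OF W(1) X Y]]
            smooth_field_scaleR[OF W(1) m X]])
    fix q assume q: "q \<in> W"
    show "lie_bracket A (\<lambda>q. f q *\<^sub>R X q) Y q = f q *\<^sub>R lie_bracket A X Y q + ((-1) * dir_deriv A Y f q) *\<^sub>R X q"
      unfolding nabla_torsion_free[OF W(1) fX Y q] nabla_torsion_free[OF W(1) X Y q]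
        conn_scaleR_left[OF W(1) X Y q f] conn_scaleR_right[OF W(1) Y X q f] by (simp add: scaleR_diff_right)
  qed
  show "curv_bar A nabla T (\<lambda>q. f q *\<^sub>R X q) Y Z p = f p *\<^sub>R curv_bar A nabla T X Y Z p"
    unfolding curv_bar_def a b
    using bar.conn_scaleR_right[OF W(1) Y bar.smooth_field_conn[OF W(1) X Z] W(2) f]
      bar.conn_scaleR_left[OF W(1) X bar.smooth_field_conn[OF W(1) Y Z] W(2) f]
      bar.conn_add_left[OF W(1) smooth_field_scaleR[OF W(1) f smooth_field_lie_bracket[OF W(1) X Y]] Z W(2)
        smooth_field_scaleR[OF W(1) m X]]
      bar.conn_scaleR_left[OF W(1) smooth_field_lie_bracket[OF W(1) X Y] Z W(2) f]
      bar.conn_scaleR_left[OF W(1) X Z W(2) m]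
    by (simp add: algebra_simps)
qed

lemma tensorial_curv_bar_2:
  assumes W: "open W" "p \<in> W" and X: "smooth_field A W X" and Z: "smooth_field A W Z"
  shows "tensorial A W p (\<lambda>Y. curv_bar A nabla T X Y Z p)"
proof -
  have "curv_bar A nabla T X Y Z p = - curv_bar A nabla T Y X Z p" if "smooth_field A W Y" for Y
    by (rule curv_bar_skew[OF W X that Z])
  then show ?thesis
    using tensorial_curv_bar_1[OF W X Z] smooth_field_add[OF W(1)] smooth_field_scaleR[OF W(1)]
    unfolding tensorial_def by simp
qed

text \<open>The second derivatives of \<open>f\<close> produced by the two iterated covariant
  derivatives form a commutator, which cancels the derivative of \<open>f\<close> along the
  bracket.\<close>

lemma tensorial_curv_bar_3:
  assumes W: "open W" "p \<in> W" and X: "smooth_field A W X" and Y: "smooth_field A W Y"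
  shows "tensorial A W p (\<lambda>Z. curv_bar A nabla T X Y Z p)"
  unfolding tensorial_def
proof (intro conjI allI impI)
  fix Z Z' assume Z: "smooth_field A W Z" and Z': "smooth_field A W Z'"
  have a: "nb U (nb V (\<lambda>q. Z q + Z' q)) p = nb U (\<lambda>q. nb V Z q + nb V Z' q) p"
    if U: "smooth_field A W U" and V: "smooth_field A W V" for U V
    by (rule bar.conn_local_right[OF W U])
       (auto intro!: bar.smooth_field_conn smooth_field_add bar.conn_add_right W V Z Z')
  show "curv_bar A nabla T X Y (\<lambda>q. Z q + Z' q) p = curv_bar A nabla T X Y Z p + curv_bar A nabla T X Y Z' p"
    unfolding curv_bar_def a[OF X Y] a[OF Y X]
    using bar.conn_add_right[OF W(1) Y bar.smooth_field_conn[OF W(1) X Z] W(2) bar.smooth_field_conn[OF W(1) X Z']]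
      bar.conn_add_right[OF W(1) X bar.smooth_field_conn[OF W(1) Y Z] W(2) bar.smooth_field_conn[OF W(1) Y Z']]
      bar.conn_add_right[OF W(1) smooth_field_lie_bracket[OF W(1) X Y] Z W(2) Z']
    by simp
next
  fix Z f assume Z: "smooth_field A W Z" and f: "smooth_fun A W f"
  have a: "nb U (nb V (\<lambda>q. f q *\<^sub>R Z q)) p = dir_deriv A U (dir_deriv A V f) p *\<^sub>R Z p + dir_deriv A V f p *\<^sub>R nb U Z p
     + (dir_deriv A U f p *\<^sub>R nb V Z p + f p *\<^sub>R nb U (nb V Z) p)"
    if U: "smooth_field A W U" and V: "smooth_field A W V" for U V
  proof -
    note df = smooth_fun_dir_deriv[OF W(1) f V] and VZ = bar.smooth_field_conn[OF W(1) V Z]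
    have "nb U (nb V (\<lambda>q. f q *\<^sub>R Z q)) p = nb U (\<lambda>q. dir_deriv A V f q *\<^sub>R Z q + f q *\<^sub>R nb V Z q) p"
      by (rule bar.conn_local_right[OF W U])
         (auto intro!: bar.smooth_field_conn smooth_field_add smooth_field_scaleR bar.conn_scaleR_right W V Z f df)
    then show ?thesis
      using bar.conn_add_right[OF W(1) U smooth_field_scaleR[OF W(1) df Z] W(2) smooth_field_scaleR[OF W(1) f VZ]]
        bar.conn_scaleR_right[OF W(1) U Z W(2) df] bar.conn_scaleR_right[OF W(1) U VZ W(2) f] by simp
  qed
  show "curv_bar A nabla T X Y (\<lambda>q. f q *\<^sub>R Z q) p = f p *\<^sub>R curv_bar A nabla T X Y Z p"
    unfolding curv_bar_def a[OF X Y] a[OF Y X]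
      bar.conn_scaleR_right[OF W(1) smooth_field_lie_bracket[OF W(1) X Y] Z W(2) f]
      lie_bracket_commutator[OF W X Y f]
    by (simp add: algebra_simps)
qed

text \<open>A single trilinear \<open>R\<close> on vectors at \<open>p\<close> serves all fields on
  all neighbourhoods of \<open>p\<close>; through it the sums over two different local frames become
  comparable.\<close>

lemma curv_bar_pointwise:
  assumes e: "pframe W e \<epsilon>" and p: "p \<in> W"
  shows "\<exists>R. (\<forall>v w. linear (\<lambda>u. R u v w)) \<and> (\<forall>u w. linear (\<lambda>v. R u v w)) \<and> (\<forall>u v. linear (\<lambda>w. R u v w)) \<and>
    (\<forall>V X Y Z. open V \<longrightarrow> p \<in> V \<longrightarrow> smooth_field A V X \<longrightarrow> smooth_field A V Y \<longrightarrow> smooth_field A V Z \<longrightarrow>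
       curv_bar A nabla T X Y Z p = R (X p) (Y p) (Z p))"
proof -
  define cf where "cf = (\<lambda>i v. \<epsilon> i * g p v (e i p))"
  define R where "R = (\<lambda>u v w. \<Sum>i\<in>UNIV. cf i u *\<^sub>R (\<Sum>j\<in>UNIV. cf j v *\<^sub>R (\<Sum>k\<in>UNIV. cf k w *\<^sub>R curv_bar A nabla T (e i) (e j) (e k) p)))"
  have cf: "cf i (u + v) = cf i u + cf i v" "cf i (c *\<^sub>R u) = c * cf i u" for i u v c
    by (simp_all add: cf_def g_simps algebra_simps)
  show ?thesis
  proof (intro exI[of _ R] conjI allI impI)
    show "linear (\<lambda>u. R u v w)" for v w
      by (rule linearI) (simp_all add: R_def cf scaleR_add_left sum.distrib scaleR_sum_right[symmetric] flip: scaleR_scaleR)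
    show "linear (\<lambda>v. R u v w)" for u w
      by (rule linearI) (simp_all add: R_def cf scaleR_add_left sum.distrib scaleR_add_right scaleR_sum_right algebra_simps)
    show "linear (\<lambda>w. R u v w)" for u v
      by (rule linearI) (simp_all add: R_def cf scaleR_add_left sum.distrib scaleR_add_right scaleR_sum_right algebra_simps)
    fix V X Y Z assume V: "open V" "p \<in> V" and X: "smooth_field A V X" and Y: "smooth_field A V Y" and Z: "smooth_field A V Z"
    let ?V = "V \<inter> W"
    have V': "open ?V" "p \<in> ?V" using e V p by (auto simp: pframe_def)
    have e': "pframe ?V e \<epsilon>" by (rule pframe_subset[OF e V'(1)]) simp
    have X': "smooth_field A ?V X" and Y': "smooth_field A ?V Y" and Z': "smooth_field A ?V Z"
      using X Y Z smooth_field_subset by blast+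
    have se: "smooth_field A ?V (e i)" for i using e' by (auto simp: pframe_def)
    have 1: "curv_bar A nabla T X Y Z p = (\<Sum>i\<in>UNIV. cf i (X p) *\<^sub>R curv_bar A nabla T (e i) Y Z p)"
      unfolding cf_def by (rule tensorial_frame_expansion[OF tensorial_curv_bar_1[OF V' Y' Z'] e' V'(2) X'])
    have 2: "curv_bar A nabla T (e i) Y Z p = (\<Sum>j\<in>UNIV. cf j (Y p) *\<^sub>R curv_bar A nabla T (e i) (e j) Z p)" for i
      unfolding cf_def by (rule tensorial_frame_expansion[OF tensorial_curv_bar_2[OF V' se Z'] e' V'(2) Y'])
    have 3: "curv_bar A nabla T (e i) (e j) Z p = (\<Sum>k\<in>UNIV. cf k (Z p) *\<^sub>R curv_bar A nabla T (e i) (e j) (e k) p)" for i j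
      unfolding cf_def by (rule tensorial_frame_expansion[OF tensorial_curv_bar_3[OF V' se se] e' V'(2) Z'])
    show "curv_bar A nabla T X Y Z p = R (X p) (Y p) (Z p)"
      unfolding 1 R_def by (subst 2, subst 3) simp
  qed
qed

text \<open>The bracket is expressed through the torsion-free \<open>nabla\<close>, so its
  components come from \<open>christ nabla\<close> and not from \<open>christ nb\<close>. The last
  product thus mixes the two connections, and its first factor stays fixed when the contorsion
  varies.\<close>

lemma curv_bar_component:
  assumes e: "pframe W e \<epsilon>" and p: "p \<in> W"
  shows "g p (curv_bar A nabla T (e a) (e b) (e a) p) (e b p) =
      dir_deriv A (e b) (christ nb e a a b) p - dir_deriv A (e a) (christ nb e b a b) p
    + (\<Sum>c\<in>UNIV. \<epsilon> c * (christ nb e a a c p * christ nb e b c b p - christ nb e b a c p * christ nb e a c b p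
        + (christ nabla e a b c p - christ nabla e b a c p) * christ nb e c a b p))"
proof -
  have W: "open W" and se: "smooth_field A W (e i)" for i using e p by (auto simp: pframe_def)
  note nbl = nabla_bar_connection[OF nabla_linear T]
  note s = bar.smooth_field_conn[OF W se se]
  have 1: "g p (nb (e b) (nb (e a) (e a)) p) (e b p) = dir_deriv A (e b) (christ nb e a a b) p
      + (\<Sum>c\<in>UNIV. \<epsilon> c * christ nb e a a c p * christ nb e b c b p)"
    using conn_frame_component[OF nbl e p s, of b a a b] by (simp add: christ_def[abs_def])
  have 2: "g p (nb (e a) (nb (e b) (e a)) p) (e b p) = dir_deriv A (e a) (christ nb e b a b) p
      + (\<Sum>c\<in>UNIV. \<epsilon> c * christ nb e b a c p * christ nb e a c b p)"
    using conn_frame_component[OF nbl e p s, of a b a b] by (simp add: christ_def[abs_def])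
  have "nb (lie_bracket A (e a) (e b)) (e a) p =
     (\<Sum>c\<in>UNIV. (\<epsilon> c * g p (lie_bracket A (e a) (e b) p) (e c p)) *\<^sub>R nb (e c) (e a) p)"
    by (rule tensorial_frame_expansion[OF bar.tensorial_conn[OF W se p] e p smooth_field_lie_bracket[OF W se se]])
  also have "\<dots> = (\<Sum>c\<in>UNIV. (\<epsilon> c * (christ nabla e a b c p - christ nabla e b a c p)) *\<^sub>R nb (e c) (e a) p)"
    unfolding nabla_torsion_free[OF W se se p] christ_def g_simps by simp
  finally have 3: "g p (nb (lie_bracket A (e a) (e b)) (e a) p) (e b p) =
     (\<Sum>c\<in>UNIV. \<epsilon> c * (christ nabla e a b c p - christ nabla e b a c p) * christ nb e c a b p)"
    by (simp add: g_simps christ_def[of nb])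
  show ?thesis
    unfolding curv_bar_def g_simps 1 2 3
    by (simp add: sum.distrib sum_subtractf algebra_simps)
qed

end

end

section \<open>Adapted frames and the mixed scalar curvature\<close>

lemma span_image_finite_coeffs:
  assumes "finite I" "v \<in> span (h ` I)" shows "\<exists>c. v = (\<Sum>i\<in>I. c i *\<^sub>R h i)"
  using assms(2)
proof (induction rule: span_induct_alt)
  case base then show ?case by (intro exI[of _ "\<lambda>_. 0"]) simp
next
  case (step a x y)
  then obtain j c where j: "j \<in> I" "x = h j" "y = (\<Sum>i\<in>I. c i *\<^sub>R h i)" by auto
  have "(\<Sum>i\<in>I. (if i = j then a else 0) *\<^sub>R h i) = (\<Sum>i\<in>I. if i = j then a *\<^sub>R h j else 0)"
    by (rule sum.cong) auto
  then have "a *\<^sub>R x + y = (\<Sum>i\<in>I. ((if i = j then a else 0) + c i) *\<^sub>R h i)"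
    using j assms(1) by (simp add: scaleR_add_left sum.distrib)
  then show ?case by (rule exI[of _ "\<lambda>i. (if i = j then a else 0) + c i"])
qed

context atlas
begin

lemma open_smooth_fun_positive:
  assumes "open W" "finite I" "\<And>i. i \<in> I \<Longrightarrow> smooth_fun A W (f i)"
  shows "open {q \<in> W. \<forall>i\<in>I. f i q > 0}"
  using assms(2,3)
proof (induction I)
  case (insert i I)
  have o: "open (W \<inter> f i -` {0<..})"
    by (rule continuous_open_preimage[OF continuous_on_smooth_fun[OF assms(1)] assms(1) open_greaterThan])
       (use insert in auto)
  have IH: "open {q \<in> W. \<forall>j\<in>I. f j q > 0}" using insert by blast
  have eq: "{q \<in> W. \<forall>j\<in>insert i I. f j q > 0} = (W \<inter> f i -` {0<..}) \<inter> {q \<in> W. \<forall>j\<in>I. f j q > 0}" by auto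
  show ?case unfolding eq by (rule open_Int[OF o IH])
qed (use assms in simp)

end

context metric_atlas
begin

section \<open>Gram-Schmidt for an indefinite metric\<close>

text \<open>If every vector of \<open>V\<close> orthogonal to all \<open>f a\<close> were null,
  polarisation would make this complement totally isotropic. Being orthogonal to the
  \<open>f a\<close> as well, it would be orthogonal to all of \<open>V\<close> and hence zero; then
  the \<open>f a\<close> would span \<open>V\<close>, against \<open>m < dim V\<close>.\<close>

lemma orthonormal_section_exists:
  assumes V: "subspace V" and nd: "\<And>v. v \<in> V \<Longrightarrow> (\<And>w. w \<in> V \<Longrightarrow> g p v w = 0) \<Longrightarrow> v = 0"
    and f: "\<And>a. a \<in> {1..m} \<Longrightarrow> f a \<in> V" "\<And>a. a \<in> {1..m} \<Longrightarrow> g p (f a) (f a) * g p (f a) (f a) = 1"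
      "\<And>a b. a \<in> {1..m} \<Longrightarrow> b \<in> {1..m} \<Longrightarrow> a \<noteq> b \<Longrightarrow> g p (f a) (f b) = 0"
    and m: "m < dim V"
  obtains v where "v \<in> V" "\<And>a. a \<in> {1..m} \<Longrightarrow> g p v (f a) = 0" "g p v v \<noteq> 0"
proof (rule ccontr)
  assume no: "\<not> thesis"
  define V' where "V' = {v \<in> V. \<forall>a\<in>{1..m}. g p v (f a) = 0}"
  have null: "g p v v = 0" if "v \<in> V'" for v using no that V'_def that[unfolded V'_def] \<open>\<And>v. \<lbrakk>v \<in> V; \<And>a. a \<in> {1..m} \<Longrightarrow> g p v (f a) = 0; g p v v \<noteq> 0\<rbrakk> \<Longrightarrow> thesis\<close> by blast
  have add: "v + w \<in> V'" if "v \<in> V'" "w \<in> V'" for v w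
    using that V by (auto simp: V'_def g_simps subspace_add)
  have orth: "g p v w = 0" if "v \<in> V'" "w \<in> V'" for v w
    using null[OF add[OF that]] null[OF that(1)] null[OF that(2)] g_sym[of p v w] by (simp add: g_simps)
  let ?P = "\<lambda>w. \<Sum>a\<in>{1..m}. (g p (f a) (f a) * g p w (f a)) *\<^sub>R f a"
  have proj: "w - ?P w \<in> V'" if "w \<in> V" for w
  proof -
    have "g p (?P w) (f b) = g p w (f b)" if b: "b \<in> {1..m}" for b
    proof -
      have "g p (?P w) (f b) = (\<Sum>a\<in>{1..m}. if a = b then g p (f b) (f b) * g p (f b) (f b) * g p w (f b) else 0)"
        unfolding g_simps by (rule sum.cong) (use b in \<open>auto simp: f(3)\<close>)
      also have "\<dots> = g p w (f b)" using b f(2)[OF b] by simp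
      finally show ?thesis .
    qed
    moreover have "w - ?P w \<in> V" using V that f(1) by (auto intro!: subspace_diff subspace_sum subspace_scale)
    ultimately show ?thesis by (simp add: V'_def g_simps(9))
  qed
  have zero: "v = 0" if v: "v \<in> V'" for v
  proof (rule nd)
    show "v \<in> V" using v by (simp add: V'_def)
    fix w assume w: "w \<in> V"
    have "g p v w = g p v (w - ?P w) + g p v (?P w)" by (simp add: g_simps(10))
    also have "g p v (?P w) = 0" using v by (simp add: g_simps V'_def)
    finally show "g p v w = 0" using orth[OF v proj[OF w]] by simp
  qed
  have "V \<subseteq> span (f ` {1..m})"
  proof
    fix w assume "w \<in> V"
    then have "w = ?P w" using zero[OF proj] by simp
    then show "w \<in> span (f ` {1..m})" by (metis (no_types, lifting) span_base span_scale span_sum imageI)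
  qed
  then have "dim V \<le> card (f ` {1..m})" by (intro dim_le_card) auto
  also have "\<dots> \<le> m" using card_image_le[of "{1..m}" f] by simp
  finally show False using m by simp
qed

text \<open>One step extends a non-null vector at \<open>p\<close> to a smooth section, removes its
  components along the sections already found, and divides by the root of the absolute square on a
  neighbourhood where that square does not vanish.\<close>

lemma local_orthonormal_frame_exists:
  assumes D: "distribution A V r"
    and nd: "\<And>p v. v \<in> V p \<Longrightarrow> (\<And>w. w \<in> V p \<Longrightarrow> g p v w = 0) \<Longrightarrow> v = 0"
  shows "\<exists>W e. p \<in> W \<and> local_orthonormal_frame A g V r W e"
proof -
  have sub: "subspace (V q)" "dim (V q) = r" for q using D by (auto simp: distribution_def)
  obtain W0 e0 where W0: "open W0" "p \<in> W0" and e0: "\<And>a. a \<in> {1..r} \<Longrightarrow> smooth_field A W0 (e0 a)"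
    and s0: "\<And>q. q \<in> W0 \<Longrightarrow> span ((\<lambda>a. e0 a q) ` {1..r}) = V q"
    using D unfolding distribution_def by metis
  define on where "on = (\<lambda>(m::nat) W f. open W \<and> p \<in> W \<and> (\<forall>a\<in>{1..m}. smooth_field A W (f a)) \<and>
      (\<forall>q\<in>W. (\<forall>a\<in>{1..m}. f a q \<in> V q \<and> \<bar>g q (f a q) (f a q)\<bar> = 1) \<and>
        (\<forall>a\<in>{1..m}. \<forall>b\<in>{1..m}. a \<noteq> b \<longrightarrow> g q (f a q) (f b q) = 0)))"
  have onD: "open W" "p \<in> W" "\<And>a. a \<in> {1..m} \<Longrightarrow> smooth_field A W (f a)"
    "\<And>q a. q \<in> W \<Longrightarrow> a \<in> {1..m} \<Longrightarrow> f a q \<in> V q"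
    "\<And>q a. q \<in> W \<Longrightarrow> a \<in> {1..m} \<Longrightarrow> \<bar>g q (f a q) (f a q)\<bar> = 1"
    "\<And>q a b. q \<in> W \<Longrightarrow> a \<in> {1..m} \<Longrightarrow> b \<in> {1..m} \<Longrightarrow> a \<noteq> b \<Longrightarrow> g q (f a q) (f b q) = 0"
    if "on m W f" for m W f using that unfolding on_def by blast+
  have "\<exists>W f. on m W f" if "m \<le> r" for m
    using that
  proof (induction m)
    case 0 show ?case using W0 by (intro exI[of _ W0]) (auto simp: on_def)
  next
    case (Suc m)
    then obtain W f where *: "on m W f" using Suc_leD by blast
    note W = onD(1,2)[OF *] and sf = onD(3)[OF *] and fV = onD(4)[OF *] and f1 = onD(5)[OF *] and fo = onD(6)[OF *]
    have f2: "g q (f a q) (f a q) * g q (f a q) (f a q) = 1" if "q \<in> W" "a \<in> {1..m}" for q a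
      using f1[OF that] by (metis abs_mult_self_eq mult_1)
    obtain v where v: "v \<in> V p" "\<And>a. a \<in> {1..m} \<Longrightarrow> g p v (f a p) = 0" "g p v v \<noteq> 0"
    proof (rule orthonormal_section_exists[of "V p" p m "\<lambda>a. f a p"])
      show "m < dim (V p)" using Suc sub by simp
    qed (use sub nd fV f2 fo W in \<open>auto\<close>)
    obtain c where c: "v = (\<Sum>a\<in>{1..r}. c a *\<^sub>R e0 a p)"
      using span_image_finite_coeffs[of "{1..r}" v "\<lambda>a. e0 a p"] v(1) s0[OF W0(2)] by auto
    let ?W = "W \<inter> W0"
    have W': "open ?W" "p \<in> ?W" using W W0 by auto
    \<comment> \<open>The extension has constant coefficients in the local spanning sections, so it
      is smooth and stays in the distribution.\<close>
    define X where "X = (\<lambda>q. \<Sum>a\<in>{1..r}. c a *\<^sub>R e0 a q)"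
    define u where "u = (\<lambda>q. X q - (\<Sum>a\<in>{1..m}. (g q (f a q) (f a q) * g q (X q) (f a q)) *\<^sub>R f a q))"
    have sf': "smooth_field A ?W (f a)" if "a \<in> {1..m}" for a using smooth_field_subset[OF sf[OF that]] by simp
    have sX: "smooth_field A ?W X"
      unfolding X_def by (intro smooth_field_sum smooth_field_scaleR smooth_fun_const W' smooth_field_subset[OF e0]) auto
    have su: "smooth_field A ?W u"
      unfolding u_def by (intro smooth_field_diff smooth_field_sum smooth_field_scaleR smooth_fun_mult smooth_fun_g sX sf' W')
    have XV: "X q \<in> V q" if "q \<in> ?W" for q
    proof -
      have "X q \<in> span ((\<lambda>a. e0 a q) ` {1..r})"
        unfolding X_def by (intro span_sum span_scale span_base imageI)
      then show ?thesis using s0[of q] that by simp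
    qed
    have uV: "u q \<in> V q" if "q \<in> ?W" for q
      unfolding u_def using that by (auto intro!: subspace_diff subspace_sum subspace_scale sub XV fV)
    have uo: "g q (u q) (f b q) = 0" if q: "q \<in> ?W" and b: "b \<in> {1..m}" for q b
    proof -
      have "g q (\<Sum>a\<in>{1..m}. (g q (f a q) (f a q) * g q (X q) (f a q)) *\<^sub>R f a q) (f b q)
        = (\<Sum>a\<in>{1..m}. if a = b then g q (f b q) (f b q) * g q (f b q) (f b q) * g q (X q) (f b q) else 0)"
        unfolding g_simps by (rule sum.cong) (use q b fo in \<open>auto\<close>)
      also have "\<dots> = g q (X q) (f b q)" using b f2[of q b] q by simp
      finally show ?thesis unfolding u_def g_simps(9) by simp
    qed
    have up: "u p = v" using v(2) c by (simp add: u_def X_def)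
    \<comment> \<open>The sign of the square of \<open>v\<close>; multiplying by it makes the
      quantity under the root positive near \<open>p\<close>.\<close>
    define s where "s = sgn (g p v v)"
    have s: "s * s = 1" "\<bar>s\<bar> = 1" using v(3) by (simp_all add: s_def sgn_if)
    let ?h = "\<lambda>q. s * g q (u q) (u q)"
    have h: "smooth_fun A ?W ?h" by (intro smooth_fun_mult smooth_fun_const smooth_fun_g su W')
    define N where "N = {q \<in> ?W. \<forall>i\<in>{()}. ?h q > 0}"
    have N: "open N" unfolding N_def by (rule open_smooth_fun_positive[OF W'(1)]) (use h in auto)
    have pN: "p \<in> N" using W' v(3) by (simp add: N_def up s_def sgn_if)
    have hN: "?h q > 0" if "q \<in> N" for q using that by (simp add: N_def)
    have hs: "sqrt (?h q) \<noteq> 0" if "q \<in> N" for q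
      using hN[OF that] real_sqrt_eq_0_iff by (metis less_irrefl)
    have NW: "N \<subseteq> ?W" by (auto simp: N_def)
    define w where "w = (\<lambda>q. inverse (sqrt (?h q)) *\<^sub>R u q)"
    have sw: "smooth_field A N w"
      unfolding w_def
      by (intro smooth_field_scaleR smooth_fun_inverse smooth_fun_sqrt N smooth_fun_subset[OF h] smooth_field_subset[OF su] NW hN hs)
    have w1: "\<bar>g q (w q) (w q)\<bar> = 1" if "q \<in> N" for q
    proof -
      have "g q (w q) (w q) = inverse (sqrt (?h q)) * inverse (sqrt (?h q)) * g q (u q) (u q)"
        by (simp add: w_def g_simps)
      also have "\<dots> = inverse (?h q) * g q (u q) (u q)"
        using hN[OF that] by (simp add: inverse_mult_distrib[symmetric] del: inverse_mult_distrib)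
      also have "\<dots> = s"
      proof -
        have "s = 1 \<or> s = -1" using s(2) by linarith
        then show ?thesis using hN[OF that] by (elim disjE) simp_all
      qed
      finally show ?thesis using s by simp
    qed
    have wo: "g q (w q) (f b q) = 0" "g q (f b q) (w q) = 0" if "q \<in> N" "b \<in> {1..m}" for q b
      using uo[of q b] NW that g_sym[of q "f b q"] by (auto simp: w_def g_simps)
    have wV: "w q \<in> V q" if "q \<in> N" for q using uV[of q] that NW by (auto simp: w_def intro!: subspace_scale sub)
    let ?f = "f(Suc m := w)"
    have atm: "{1..Suc m} = insert (Suc m) {1..m}" by auto
    have "on (Suc m) N ?f"
      unfolding on_def
    proof (intro conjI N pN ballI impI)
      show "smooth_field A N (?f a)" if "a \<in> {1..Suc m}" for a
        using that sw smooth_field_subset[OF sf, of a N] NW by (auto simp: atm)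
      fix q assume q: "q \<in> N"
      then have qW: "q \<in> W" using NW by auto
      show "?f a q \<in> V q" "\<bar>g q (?f a q) (?f a q)\<bar> = 1" if "a \<in> {1..Suc m}" for a
        using that wV[OF q] w1[OF q] fV[OF qW] f1[OF qW] by (auto simp: atm)
      show "g q (?f a q) (?f b q) = 0" if "a \<in> {1..Suc m}" "b \<in> {1..Suc m}" "a \<noteq> b" for a b
        using that wo[OF q] fo[OF qW] unfolding atm by auto
    qed
    then show ?case by blast
  qed
  from this[of r] obtain W f where *: "on r W f" by blast
  note W = onD(1,2)[OF *] and sf = onD(3)[OF *] and fV = onD(4)[OF *] and f1 = onD(5)[OF *] and fo = onD(6)[OF *]
  have "span ((\<lambda>a. f a q) ` {1..r}) = V q" if q: "q \<in> W" for q
  proof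
    show "span ((\<lambda>a. f a q) ` {1..r}) \<subseteq> V q" 
      by (rule span_minimal[OF _ sub(1)]) (use fV[OF q] in auto)
    have "inj_on (\<lambda>a. f a q) {1..r}" "independent ((\<lambda>a. f a q) ` {1..r})"
      by (rule orthonormal_independent[of _ q]; use f1[OF q] fo[OF q] in force)+
    then show "V q \<subseteq> span ((\<lambda>a. f a q) ` {1..r})"
      using fV[OF q] sub by (intro card_ge_dim_independent) (auto simp: card_image)
  qed
  then have "local_orthonormal_frame A g V r W f"
    using W sf f1 fo by (simp add: local_orthonormal_frame_def)
  then show ?thesis using W by blast
qed

section \<open>Projections, traces and adjoints in a frame\<close>

lemma orthoproj_frame:
  assumes e: "pframe W e \<epsilon>" and p: "p \<in> W" and V: "V p = span ((\<lambda>i. e i p) ` J)"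
  shows "orthoproj g V p v = (\<Sum>i\<in>J. (\<epsilon> i * g p v (e i p)) *\<^sub>R e i p)"
proof -
  have o: "g p (e i p) (e j p) = (if i = j then \<epsilon> i else 0)" and n: "\<epsilon> i * \<epsilon> i = 1" for i j
    using e p unfolding pframe_def by blast+
  let ?P = "\<Sum>i\<in>J. (\<epsilon> i * g p v (e i p)) *\<^sub>R e i p"
  have comp: "g p ?P (e j p) = g p v (e j p)" if "j \<in> J" for j
  proof -
    have "g p ?P (e j p) = (\<Sum>i\<in>J. if i = j then \<epsilon> j * \<epsilon> j * g p v (e j p) else 0)"
      unfolding g_simps by (rule sum.cong) (auto simp: o)
    then show ?thesis using that by (simp add: n)
  qed
  show ?thesis
    unfolding orthoproj_def
  proof (rule the_equality)
    have "g p (v - ?P) w = 0" if "w \<in> span ((\<lambda>i. e i p) ` J)" for w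
      using that by (induction rule: span_induct_alt) (auto simp: g_simps(1-8,10) bilinear_lsub[OF bilinear_g] comp)
    then show "?P \<in> V p \<and> (\<forall>w\<in>V p. g p (v - ?P) w = 0)"
      unfolding V by (intro conjI ballI span_sum span_scale span_base imageI)
    fix u assume u: "u \<in> V p \<and> (\<forall>w\<in>V p. g p (v - u) w = 0)"
    have "u = (\<Sum>i\<in>J. (g p (e i p) (e i p) * g p u (e i p)) *\<^sub>R e i p)"
      by (rule orthonormal_span_expansion) (use u V in \<open>auto simp: o n\<close>)
    also have "\<dots> = ?P"
    proof (rule sum.cong[OF refl])
      fix i assume "i \<in> J"
      then have "g p (v - u) (e i p) = 0" using u V by (auto intro: span_base)
      then show "(g p (e i p) (e i p) * g p u (e i p)) *\<^sub>R e i p = (\<epsilon> i * g p v (e i p)) *\<^sub>R e i p"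
        by (simp add: o bilinear_lsub[OF bilinear_g])
    qed
    finally show "u = ?P" .
  qed
qed

text \<open>\<open>B\<close> acts on fields and need not be function-linear on arbitrary ones. What
  counts is that on sections of \<open>V\<close>, and on the diagonal, it agrees with a bilinear map
  \<open>Q\<close> on vectors, so that the sums in different frames coincide.\<close>

lemma frame_trace_eq:
  fixes V :: "'a \<Rightarrow> (real ^ 'n) set" and J :: "'n set"
  assumes e: "pframe W e \<epsilon>" and p: "p \<in> W" and V: "\<And>q. q \<in> W \<Longrightarrow> V q = span ((\<lambda>i. e i q) ` J)"
    and Q: "bilinear Q"
    and B: "\<And>W' X. open W' \<Longrightarrow> p \<in> W' \<Longrightarrow> smooth_field A W' X \<Longrightarrow> (\<And>q. q \<in> W' \<Longrightarrow> X q \<in> V q) \<Longrightarrow> B X X p = Q (X p) (X p)"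
  shows "frame_trace A g V B p = (\<Sum>i\<in>J. \<epsilon> i *\<^sub>R Q (e i p) (e i p))"
proof -
  have W: "open W" and se: "smooth_field A W (e i)" for i using e by (auto simp: pframe_def)
  have o: "g q (e i q) (e j q) = (if i = j then \<epsilon> i else 0)" and n: "\<epsilon> i * \<epsilon> i = 1" if "q \<in> W" for i j q
    using e that unfolding pframe_def by blast+
  have nz: "\<epsilon> i \<noteq> 0" for i using n[OF p, of i] by auto
  have abs1: "\<bar>\<epsilon> i\<bar> = 1" for i using n[OF p, of i] by (simp add: square_eq_1_iff) auto
  have ind: "inj_on (\<lambda>i. e i p) J" "independent ((\<lambda>i. e i p) ` J)"
    by (rule orthonormal_independent[of _ p]; simp add: o[OF p] nz)+
  then have dim: "dim (V p) = card J"
    by (simp add: V[OF p] dim_span dim_eq_card_independent card_image)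
  \<comment> \<open>The definition numbers the frame vectors from 1, whereas \<open>J\<close> is a
    set of coordinate indices.\<close>
  obtain h where h: "bij_betw h {1..card J} J" using ex_bij_betw_nat_finite_1[of J] by auto
  have hJ: "h ` {1..card J} = J" and hi: "inj_on h {1..card J}" using h by (auto simp: bij_betw_def)
  have fr: "local_orthonormal_frame A g V (dim (V p)) W (\<lambda>a. e (h a))"
  proof -
    have "(\<lambda>a. e (h a) q) ` {1..card J} = (\<lambda>i. e i q) ` J" for q
      using image_image[of "\<lambda>i. e i q" h "{1..card J}"] by (simp only: hJ)
    moreover have "h a \<noteq> h b" if "a \<in> {1..card J}" "b \<in> {1..card J}" "a \<noteq> b" for a b
      using hi that by (metis inj_onD)
    ultimately show ?thesis
      unfolding local_orthonormal_frame_def dim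
      by (intro conjI ballI impI W se) (simp_all add: V o abs1)
  qed
  have val: "(\<Sum>a\<in>{1..dim (V p)}. g p (f a p) (f a p) *\<^sub>R B (f a) (f a) p) = (\<Sum>i\<in>J. \<epsilon> i *\<^sub>R Q (e i p) (e i p))"
    if W': "p \<in> W'" and f: "local_orthonormal_frame A g V (dim (V p)) W' f" for W' f
  proof -
    have f1: "\<bar>g p (f a p) (f a p)\<bar> = 1" if "a \<in> {1..dim (V p)}" for a
      using f W' that unfolding local_orthonormal_frame_def by blast
    have "(\<Sum>a\<in>{1..dim (V p)}. g p (f a p) (f a p) *\<^sub>R Q (f a p) (f a p))
        = (\<Sum>i\<in>J. g p (e i p) (e i p) *\<^sub>R Q (e i p) (e i p))"
    proof (rule orthonormal_trace_unique[OF Q])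
      show "g p (f a p) (f a p) * g p (f a p) (f a p) = 1" if "a \<in> {1..dim (V p)}" for a
        using f1[OF that] by (metis abs_mult_self_eq mult_1)
      show "g p (f a p) (f b p) = 0" if "a \<in> {1..dim (V p)}" "b \<in> {1..dim (V p)}" "a \<noteq> b" for a b
        using f W' that unfolding local_orthonormal_frame_def by blast
      show "span ((\<lambda>a. f a p) ` {1..dim (V p)}) = span ((\<lambda>i. e i p) ` J)"
        using f W' V[OF p] unfolding local_orthonormal_frame_def by simp
    qed (simp_all add: o[OF p] n[OF p])
    moreover have "B (f a) (f a) p = Q (f a p) (f a p)" if "a \<in> {1..dim (V p)}" for a
    proof (rule B)
      show "open W'" "smooth_field A W' (f a)" using f that unfolding local_orthonormal_frame_def by blast+
      show "f a q \<in> V q" if "q \<in> W'" for q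
        using f that \<open>a \<in> _\<close> unfolding local_orthonormal_frame_def by (metis imageI span_base)
    qed (rule W')
    ultimately show ?thesis by (simp add: o[OF p])
  qed
  show ?thesis
    unfolding frame_trace_def
  proof (rule the_equality)
    show "\<forall>W' f. p \<in> W' \<and> local_orthonormal_frame A g V (dim (V p)) W' f \<longrightarrow>
       (\<Sum>i\<in>J. \<epsilon> i *\<^sub>R Q (e i p) (e i p)) = (\<Sum>a\<in>{1..dim (V p)}. g p (f a p) (f a p) *\<^sub>R B (f a) (f a) p)"
      using val by auto
    fix v assume "\<forall>W' f. p \<in> W' \<and> local_orthonormal_frame A g V (dim (V p)) W' f \<longrightarrow>
       v = (\<Sum>a\<in>{1..dim (V p)}. g p (f a p) (f a p) *\<^sub>R B (f a) (f a) p)"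
    then show "v = (\<Sum>i\<in>J. \<epsilon> i *\<^sub>R Q (e i p) (e i p))" using val[OF p fr] p fr by auto
  qed
qed

lemma tensor_adj_eq:
  assumes e: "pframe W e \<epsilon>" and p: "p \<in> W" and T: "bilinear (T p)"
  shows "g p (tensor_adj g T p x y) z = g p (T p x z) y"
proof -
  let ?u = "\<Sum>i\<in>UNIV. (\<epsilon> i * g p (T p x (e i p)) y) *\<^sub>R e i p"
  have u: "g p ?u z = g p (T p x z) y" for z
    by (subst (2) pframe_expansion[OF e p, of z])
       (simp add: g_simps bilinear_sum_right[OF T] bilinear_rmul[OF T] g_sym[of p "e _ p" z] mult_ac)
  have "tensor_adj g T p x y = ?u"
    unfolding tensor_adj_def
  proof (rule the_equality)
    fix w assume w: "\<forall>z. g p w z = g p (T p x z) y"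
    have "w - ?u = 0" by (rule g_nondegenerate[of p]) (use w u in \<open>simp add: bilinear_lsub[OF bilinear_g]\<close>)
    then show "w = ?u" by simp
  qed (use u in simp)
  then show ?thesis using u by simp
qed

end

context levi_civita_atlas
begin

text \<open>For a section \<open>X\<close> of \<open>V\<close> and a frame vector \<open>e z\<close>
  orthogonal to \<open>V\<close>, differentiating g(X, e z) = 0 along \<open>X\<close> moves the
  derivative from \<open>X\<close> to \<open>e z\<close>. The result involves \<open>X\<close> only
  through its value at the point, and this is \<open>Q\<close>. Taking for \<open>J\<close> the
  indices of one distribution, or their complement, yields both kinds of mean curvature.\<close>

lemma sff_trace:
  assumes e: "pframe W e \<epsilon>" and p: "p \<in> W" and V: "\<And>q. q \<in> W \<Longrightarrow> V q = span ((\<lambda>i. e i q) ` J)"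
    and V': "\<And>q. q \<in> W \<Longrightarrow> V' q = span ((\<lambda>i. e i q) ` (- J))"
  shows "frame_trace A g V (\<lambda>X Y p. (1/2) *\<^sub>R orthoproj g V' p (nabla X Y p + nabla Y X p)) p
    = (\<Sum>i\<in>J. \<epsilon> i *\<^sub>R (\<Sum>z\<in>-J. (\<epsilon> z * christ nabla e i i z p) *\<^sub>R e z p))"
proof -
  have W: "open W" and se: "smooth_field A W (e i)" for i using e by (auto simp: pframe_def)
  have o: "g q (e i q) (e j q) = (if i = j then \<epsilon> i else 0)" and n: "\<epsilon> i * \<epsilon> i = 1" if "q \<in> W" for i j q
    using e that unfolding pframe_def by blast+
  define N where "N = (\<lambda>u z. \<Sum>i\<in>UNIV. (\<epsilon> i * g p u (e i p)) *\<^sub>R nabla (e i) (e z) p)"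
  define Q where "Q = (\<lambda>u w. \<Sum>z\<in>-J. (\<epsilon> z * - g p w (N u z)) *\<^sub>R e z p)"
  have N: "N (u + v) z = N u z + N v z" "N (c *\<^sub>R u) z = c *\<^sub>R N u z" for u v c z
    by (simp_all add: N_def g_simps algebra_simps sum.distrib scaleR_sum_right)
  have Q: "bilinear Q"
    unfolding bilinear_def by (auto intro!: linearI simp: Q_def N g_simps algebra_simps sum.distrib sum_negf sum_subtractf scaleR_sum_right)
  have Ne: "N (e i p) z = nabla (e i) (e z) p" for i z
    by (simp add: N_def o[OF p] n[OF p] if_distrib if_distribR cong: if_cong)
  have "frame_trace A g V (\<lambda>X Y p. (1/2) *\<^sub>R orthoproj g V' p (nabla X Y p + nabla Y X p)) p
    = (\<Sum>i\<in>J. \<epsilon> i *\<^sub>R Q (e i p) (e i p))"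
  proof (rule frame_trace_eq[OF e p V Q])
    fix W' X assume W': "open W'" "p \<in> W'" and X: "smooth_field A W' X" and XV: "\<And>q. q \<in> W' \<Longrightarrow> X q \<in> V q"
    let ?W = "W \<inter> W'"
    have o': "open ?W" "p \<in> ?W" using W W' p by auto
    have X': "smooth_field A ?W X" and e': "smooth_field A ?W (e i)" for i
      using X se smooth_field_subset by blast+
    have pf: "pframe ?W e \<epsilon>" using pframe_subset[OF e o'(1)] by simp
    have "g p (nabla X X p) (e z p) = - g p (X p) (N (X p) z)" if z: "z \<in> - J" for z
    proof -
      have X0: "g q (X q) (e z q) = 0" if q: "q \<in> ?W" for q
      proof -
        have "X q \<in> span ((\<lambda>i. e i q) ` J)" using XV[of q] V[of q] q by auto
        then show ?thesis
          by (induction rule: span_induct_alt) (use z q in \<open>auto simp: g_simps o split: if_splits\<close>)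
      qed
      have "dir_deriv A X (\<lambda>q. g q (X q) (e z q)) p = dir_deriv A X (\<lambda>q. 0) p"
        by (rule dir_deriv_cong[OF o']) (auto simp: X0 intro: smooth_fun_g o' X' e')
      moreover have "nabla X (e z) p = N (X p) z"
        unfolding N_def by (rule tensorial_frame_expansion[OF tensorial_conn[OF o'(1) e' o'(2)] pf o'(2) X'])
      ultimately show ?thesis using nabla_metric[OF o'(1) X' X' o'(2) e', of z] by (simp add: dir_deriv_const)
    qed
    then show "(1/2) *\<^sub>R orthoproj g V' p (nabla X X p + nabla X X p) = Q (X p) (X p)"
      unfolding orthoproj_frame[where V=V', OF e p V'[OF p]] Q_def g_simps scaleR_sum_right
      by (intro sum.cong refl) simp
  qed
  also have "\<dots> = (\<Sum>i\<in>J. \<epsilon> i *\<^sub>R (\<Sum>z\<in>-J. (\<epsilon> z * christ nabla e i i z p) *\<^sub>R e z p))"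
  proof -
    have "- g p (e i p) (nabla (e i) (e z) p) = christ nabla e i i z p" for i z
      unfolding christ_skew[OF e p, of i i z] by (simp add: christ_def g_sym)
    then show ?thesis unfolding Q_def Ne by simp
  qed
  finally show ?thesis .
qed

end

section \<open>Adapted frames of an almost multi-product structure\<close>

locale multi_product = levi_civita_atlas A g nabla
  for A :: "('a::{t2_space,second_countable_topology}, 'n::finite) chart set" and g and nabla :: "('a, 'n) connection" +
  fixes k :: nat and n :: "nat \<Rightarrow> nat" and D :: "nat \<Rightarrow> 'a \<Rightarrow> (real ^ 'n) set"
  assumes product: "almost_multi_product A k n D" and adapted: "adapted_metric A k D g"
begin

definition fe :: "(nat \<Rightarrow> nat \<Rightarrow> ('a, 'n) vfield) \<Rightarrow> ('n \<Rightarrow> nat \<times> nat) \<Rightarrow> 'n \<Rightarrow> ('a, 'n) vfield" where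
  "fe E \<beta> i = E (fst (\<beta> i)) (snd (\<beta> i))"

text \<open>An adapted frame re-indexed by the coordinate type \<open>'n\<close>, on an open set where the signs
  \<open>\<epsilon>\<close> of its vectors are constant.\<close>

definition lframe where
  "lframe W E \<beta> \<epsilon> \<longleftrightarrow> adapted_frame A k n D g W E \<and>
     bij_betw \<beta> UNIV (SIGMA \<mu>:{1..k}. {1..n \<mu>}) \<and> pframe W (fe E \<beta>) \<epsilon>"

lemma distribution_D: "\<mu> \<in> {1..k} \<Longrightarrow> distribution A (D \<mu>) (n \<mu>)"
  using product unfolding almost_multi_product_def by blast

lemma D_nondegenerate: "\<mu> \<in> {1..k} \<Longrightarrow> v \<in> D \<mu> p \<Longrightarrow> (\<And>w. w \<in> D \<mu> p \<Longrightarrow> g p v w = 0) \<Longrightarrow> v = 0"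
  and D_orthogonal: "\<mu> \<in> {1..k} \<Longrightarrow> \<nu> \<in> {1..k} \<Longrightarrow> \<mu> \<noteq> \<nu> \<Longrightarrow> v \<in> D \<mu> p \<Longrightarrow> w \<in> D \<nu> p \<Longrightarrow> g p v w = 0"
  using adapted unfolding adapted_metric_def by blast+

lemma span_D: "v \<in> span (\<Union>\<mu>\<in>{1..k}. D \<mu> p)"
proof -
  obtain u where u: "u \<in> (\<Pi>\<^sub>E \<mu>\<in>{1..k}. D \<mu> p)" "v = (\<Sum>\<mu>\<in>{1..k}. u \<mu>)"
    using product unfolding almost_multi_product_def by blast
  show ?thesis unfolding u(2) by (intro span_sum span_base) (use u(1) in blast)
qed

lemma adapted_frameD:
  assumes "adapted_frame A k n D g W E" "\<mu> \<in> {1..k}"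
  shows "open W" "a \<in> {1..n \<mu>} \<Longrightarrow> smooth_field A W (E \<mu> a)"
    "q \<in> W \<Longrightarrow> span ((\<lambda>a. E \<mu> a q) ` {1..n \<mu>}) = D \<mu> q"
    "q \<in> W \<Longrightarrow> a \<in> {1..n \<mu>} \<Longrightarrow> \<bar>g q (E \<mu> a q) (E \<mu> a q)\<bar> = 1"
    "q \<in> W \<Longrightarrow> a \<in> {1..n \<mu>} \<Longrightarrow> b \<in> {1..n \<mu>} \<Longrightarrow> a \<noteq> b \<Longrightarrow> g q (E \<mu> a q) (E \<mu> b q) = 0"
  using assms unfolding adapted_frame_def local_orthonormal_frame_def by blast+

lemma adapted_frame_subset:
  assumes E: "adapted_frame A k n D g W E" and W': "open W'" "W' \<subseteq> W"
  shows "adapted_frame A k n D g W' E"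
  unfolding adapted_frame_def local_orthonormal_frame_def
proof (intro ballI conjI impI W'(1))
  fix \<mu> assume \<mu>: "\<mu> \<in> {1..k}"
  show "smooth_field A W' (E \<mu> a)" if "a \<in> {1..n \<mu>}" for a
    by (rule smooth_field_subset[OF adapted_frameD(2)[OF E \<mu> that] W'(2)])
  fix q assume "q \<in> W'"
  then have q: "q \<in> W" using W'(2) by blast
  show "span ((\<lambda>a. E \<mu> a q) ` {1..n \<mu>}) = D \<mu> q" by (rule adapted_frameD(3)[OF E \<mu> q])
  show "\<bar>g q (E \<mu> a q) (E \<mu> a q)\<bar> = 1" if "a \<in> {1..n \<mu>}" for a by (rule adapted_frameD(4)[OF E \<mu> q that])
  show "g q (E \<mu> a q) (E \<mu> b q) = 0" if "a \<in> {1..n \<mu>}" "b \<in> {1..n \<mu>}" "a \<noteq> b" for a b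
    by (rule adapted_frameD(5)[OF E \<mu> q that])
qed

lemma adapted_frame_orthogonal:
  assumes E: "adapted_frame A k n D g W E" and q: "q \<in> W"
    and x: "x \<in> (SIGMA \<mu>:{1..k}. {1..n \<mu>})" and y: "y \<in> (SIGMA \<mu>:{1..k}. {1..n \<mu>})" and "x \<noteq> y"
  shows "g q (E (fst x) (snd x) q) (E (fst y) (snd y) q) = 0"
proof -
  have inD: "E (fst x) (snd x) q \<in> D (fst x) q" if "x \<in> (SIGMA \<mu>:{1..k}. {1..n \<mu>})" for x
  proof -
    have "fst x \<in> {1..k}" "snd x \<in> {1..n (fst x)}" using that by auto
    then show ?thesis unfolding adapted_frameD(3)[OF E \<open>fst x \<in> {1..k}\<close> q, symmetric] by (intro span_base imageI)
  qed
  show ?thesis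
  proof (cases "fst x = fst y")
    case True
    have "fst x \<in> {1..k}" "snd x \<in> {1..n (fst x)}" "snd y \<in> {1..n (fst x)}" "snd x \<noteq> snd y"
      using x y \<open>x \<noteq> y\<close> True by (auto simp: prod_eq_iff)
    from adapted_frameD(5)[OF E this(1) q this(2-4)] show ?thesis using True by simp
  next
    case False
    have "fst x \<in> {1..k}" "fst y \<in> {1..k}" using x y by auto
    then show ?thesis using D_orthogonal False inD[OF x] inD[OF y] by blast
  qed
qed

text \<open>The adapted frame vectors are independent and span the tangent space, so their index set
  is in bijection with the coordinate type. Near \<open>p\<close> their squares keep their signs,
  which makes \<epsilon> constant on a smaller domain.\<close>

lemma adapted_frame_lframe:
  assumes E: "adapted_frame A k n D g W E" and p: "p \<in> W" and k: "k \<ge> 1"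
  obtains W' \<beta> \<epsilon> where "p \<in> W'" "W' \<subseteq> W" "lframe W' E \<beta> \<epsilon>"
proof -
  let ?I = "SIGMA \<mu>:{1..k}. {1..n \<mu>}"
  have W: "open W" using adapted_frameD(1)[OF E] k by auto
  define v where "v = (\<lambda>q x. E (fst x) (snd x) q)"
  have I: "finite ?I" by auto
  have v1: "\<bar>g q (v q x) (v q x)\<bar> = 1" if "q \<in> W" "x \<in> ?I" for q x
    using adapted_frameD(4)[OF E _ that(1), of "fst x" "snd x"] that(2) by (auto simp: v_def)
  have vo: "g q (v q x) (v q y) = 0" if "q \<in> W" "x \<in> ?I" "y \<in> ?I" "x \<noteq> y" for q x y
    unfolding v_def by (rule adapted_frame_orthogonal[OF E that])
  have inj: "inj_on (v p) ?I" and ind: "independent (v p ` ?I)"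
  proof -
    have nz: "g p (v p x) (v p x) \<noteq> 0" if "x \<in> ?I" for x using v1[OF p that] by auto
    show "inj_on (v p) ?I" "independent (v p ` ?I)" by (rule orthonormal_independent[OF I nz vo[OF p]]; assumption)+
  qed
  have spn: "span (v p ` ?I) = UNIV"
  proof -
    have Dsub: "D \<mu> p \<subseteq> span (v p ` ?I)" if \<mu>: "\<mu> \<in> {1..k}" for \<mu>
    proof -
      have "span ((\<lambda>a. E \<mu> a p) ` {1..n \<mu>}) \<subseteq> span (v p ` ?I)"
        using \<mu> by (intro span_mono) (force simp: v_def)
      then show ?thesis using adapted_frameD(3)[OF E \<mu> p] by simp
    qed
    have "span (\<Union>\<mu>\<in>{1..k}. D \<mu> p) \<subseteq> span (v p ` ?I)"
      by (rule span_minimal[OF UN_least[OF Dsub] subspace_span])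
    then show ?thesis using span_D by blast
  qed
  have "card ?I = card (v p ` ?I)" by (rule card_image[OF inj, symmetric])
  also have "\<dots> = dim (span (v p ` ?I))" unfolding dim_span by (rule dim_eq_card_independent[OF ind, symmetric])
  also have "\<dots> = dim (UNIV :: (real ^ 'n) set)" unfolding spn ..
  finally have "card ?I = dim (UNIV :: (real ^ 'n) set)" .
  then have "card (UNIV :: 'n set) = card ?I" by simp
  then obtain \<beta> where \<beta>: "bij_betw \<beta> (UNIV :: 'n set) ?I"
    using finite_same_card_bij[OF finite I] by blast
  have \<beta>I: "\<beta> i \<in> ?I" for i using \<beta> by (auto simp: bij_betw_def)
  have \<beta>inj: "\<beta> i = \<beta> j \<longleftrightarrow> i = j" for i j using \<beta> by (auto simp: bij_betw_def inj_on_def)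
  have se: "smooth_field A W (fe E \<beta> i)" for i
    unfolding fe_def using adapted_frameD(2)[OF E, of "fst (\<beta> i)" "snd (\<beta> i)"] \<beta>I[of i] by auto
  have fv: "fe E \<beta> i q = v q (\<beta> i)" for i q by (simp add: fe_def v_def)
  define \<epsilon> where "\<epsilon> = (\<lambda>i. g p (fe E \<beta> i p) (fe E \<beta> i p))"
  have \<epsilon>: "\<bar>\<epsilon> i\<bar> = 1" for i unfolding \<epsilon>_def fv by (rule v1[OF p \<beta>I])
  define W' where "W' = {q \<in> W. \<forall>i\<in>UNIV. \<epsilon> i * g q (fe E \<beta> i q) (fe E \<beta> i q) > 0}"
  have W'o: "open W'"
    unfolding W'_def by (rule open_smooth_fun_positive[OF W]) (auto intro!: smooth_fun_mult smooth_fun_const smooth_fun_g se W)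
  have sq: "\<epsilon> i * \<epsilon> i = 1" for i using \<epsilon>[of i] by (metis abs_mult_self_eq mult_1)
  have \<epsilon>_eq: "g p (fe E \<beta> i p) (fe E \<beta> i p) = \<epsilon> i" for i by (simp add: \<epsilon>_def)
  have pW': "p \<in> W'" using p by (simp add: W'_def \<epsilon>_eq sq)
  have W'W: "W' \<subseteq> W" by (auto simp: W'_def)
  have norm: "g q (fe E \<beta> i q) (fe E \<beta> i q) = \<epsilon> i" if q: "q \<in> W'" for q i
  proof -
    have "\<bar>g q (fe E \<beta> i q) (fe E \<beta> i q)\<bar> = 1" unfolding fv by (rule v1[OF _ \<beta>I]) (use q W'W in auto)
    moreover have "\<epsilon> i * g q (fe E \<beta> i q) (fe E \<beta> i q) > 0" using q by (simp add: W'_def)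
    ultimately show ?thesis using \<epsilon>[of i] by (auto simp: abs_if split: if_splits)
  qed
  have "pframe W' (fe E \<beta>) \<epsilon>"
    unfolding pframe_def
  proof (intro conjI allI ballI W'o sq)
    show "smooth_field A W' (fe E \<beta> i)" for i by (rule smooth_field_subset[OF se W'W])
    show "g q (fe E \<beta> i q) (fe E \<beta> j q) = (if i = j then \<epsilon> i else 0)" if "q \<in> W'" for q i j
      using norm[OF that] vo[of q "\<beta> i" "\<beta> j"] \<beta>I \<beta>inj W'W that by (auto simp: fv)
  qed
  then have "lframe W' E \<beta> \<epsilon>"
    using adapted_frame_subset[OF E W'o W'W] \<beta> by (simp add: lframe_def)
  then show thesis using that pW' W'W by blast
qed

lemma adapted_frame_exists:
  obtains W E where "p \<in> W" "open W" "adapted_frame A k n D g W E"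
proof -
  have "\<exists>W e. p \<in> W \<and> local_orthonormal_frame A g (D \<mu>) (n \<mu>) W e" if "\<mu> \<in> {1..k}" for \<mu>
    by (rule local_orthonormal_frame_exists[OF distribution_D[OF that]]) (use D_nondegenerate[OF that] in blast)
  then obtain W E where WE: "\<And>\<mu>. \<mu> \<in> {1..k} \<Longrightarrow> p \<in> W \<mu>"
      "\<And>\<mu>. \<mu> \<in> {1..k} \<Longrightarrow> local_orthonormal_frame A g (D \<mu>) (n \<mu>) (W \<mu>) (E \<mu>)" by metis
  let ?W = "\<Inter>\<mu>\<in>{1..k}. W \<mu>"
  have o: "open ?W" using WE(2) by (intro open_INT) (auto simp: local_orthonormal_frame_def)
  have "local_orthonormal_frame A g (D \<mu>) (n \<mu>) ?W (E \<mu>)" if \<mu>: "\<mu> \<in> {1..k}" for \<mu>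
    unfolding local_orthonormal_frame_def
  proof (intro conjI ballI impI o)
    have sub: "?W \<subseteq> W \<mu>" using \<mu> by blast
    show "smooth_field A ?W (E \<mu> a)" if "a \<in> {1..n \<mu>}" for a
      by (rule smooth_field_subset[OF _ sub]) (use WE(2)[OF \<mu>] that in \<open>auto simp: local_orthonormal_frame_def\<close>)
  qed (use WE(2)[OF \<mu>] \<mu> in \<open>(auto simp: local_orthonormal_frame_def)+\<close>)
  then have "adapted_frame A k n D g ?W E" by (simp add: adapted_frame_def)
  then show thesis using that[of ?W E] WE(1) o by blast
qed

lemma lframe_subset:
  "lframe W E \<beta> \<epsilon> \<Longrightarrow> open W' \<Longrightarrow> W' \<subseteq> W \<Longrightarrow> lframe W' E \<beta> \<epsilon>"
  unfolding lframe_def using adapted_frame_subset pframe_subset by blast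

lemma lframe_pframe: "lframe W E \<beta> \<epsilon> \<Longrightarrow> pframe W (fe E \<beta>) \<epsilon>" by (simp add: lframe_def)

lemma lframe_index: "lframe W E \<beta> \<epsilon> \<Longrightarrow> fst (\<beta> i) \<in> {1..k} \<and> snd (\<beta> i) \<in> {1..n (fst (\<beta> i))}"
  unfolding lframe_def bij_betw_def by (metis SigmaE fst_conv snd_conv rangeI)

lemma lframe_index_surj:
  assumes "lframe W E \<beta> \<epsilon>" "\<mu> \<in> {1..k}" "a \<in> {1..n \<mu>}" obtains i where "\<beta> i = (\<mu>, a)"
proof -
  have "(\<mu>, a) \<in> range \<beta>" using assms unfolding lframe_def bij_betw_def by blast
  then show thesis using that by force
qed

lemma lframe_span:
  assumes E: "lframe W E \<beta> \<epsilon>" and q: "q \<in> W" and \<mu>: "\<mu> \<in> {1..k}"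
  shows "D \<mu> q = span ((\<lambda>i. fe E \<beta> i q) ` {i. fst (\<beta> i) = \<mu>})"
proof -
  have "(\<lambda>a. E \<mu> a q) ` {1..n \<mu>} = (\<lambda>i. fe E \<beta> i q) ` {i. fst (\<beta> i) = \<mu>}"
  proof (intro set_eqI iffI)
    fix v assume "v \<in> (\<lambda>a. E \<mu> a q) ` {1..n \<mu>}"
    then obtain a where a: "a \<in> {1..n \<mu>}" "v = E \<mu> a q" by auto
    obtain i where "\<beta> i = (\<mu>, a)" using lframe_index_surj[OF E \<mu> a(1)] .
    then show "v \<in> (\<lambda>i. fe E \<beta> i q) ` {i. fst (\<beta> i) = \<mu>}" 
      using a by (intro image_eqI[of _ _ i]) (simp_all add: fe_def)
  next
    fix v assume "v \<in> (\<lambda>i. fe E \<beta> i q) ` {i. fst (\<beta> i) = \<mu>}"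
    then show "v \<in> (\<lambda>a. E \<mu> a q) ` {1..n \<mu>}" using lframe_index[OF E] by (auto simp: fe_def)
  qed
  then show ?thesis using adapted_frameD(3)[of W E \<mu> q] E q \<mu> by (simp add: lframe_def)
qed

lemma lframe_perp:
  assumes E: "lframe W E \<beta> \<epsilon>" and q: "q \<in> W" and \<mu>: "\<mu> \<in> {1..k}"
  shows "perp k D \<mu> q = span ((\<lambda>i. fe E \<beta> i q) ` (- {i. fst (\<beta> i) = \<mu>}))"
  unfolding perp_def
proof
  let ?S = "\<lambda>J. span ((\<lambda>i. fe E \<beta> i q) ` J)"
  show "span (\<Union>\<nu>\<in>{1..k} - {\<mu>}. D \<nu> q) \<subseteq> ?S (- {i. fst (\<beta> i) = \<mu>})"
  proof (rule span_minimal)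
    show "(\<Union>\<nu>\<in>{1..k} - {\<mu>}. D \<nu> q) \<subseteq> ?S (- {i. fst (\<beta> i) = \<mu>})"
    proof (rule UN_least)
      fix \<nu> assume \<nu>: "\<nu> \<in> {1..k} - {\<mu>}"
      have "?S {i. fst (\<beta> i) = \<nu>} \<subseteq> ?S (- {i. fst (\<beta> i) = \<mu>})" by (intro span_mono image_mono) (use \<nu> in auto)
      then show "D \<nu> q \<subseteq> ?S (- {i. fst (\<beta> i) = \<mu>})" using lframe_span[OF E q] \<nu> by simp
    qed
  qed simp
  show "?S (- {i. fst (\<beta> i) = \<mu>}) \<subseteq> span (\<Union>\<nu>\<in>{1..k} - {\<mu>}. D \<nu> q)"
  proof (rule span_mono, rule image_subsetI)
    fix i assume i: "i \<in> - {i. fst (\<beta> i) = \<mu>}"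
    have "fst (\<beta> i) \<in> {1..k}" using lframe_index[OF E] by blast
    moreover have "fe E \<beta> i q \<in> D (fst (\<beta> i)) q"
      unfolding lframe_span[OF E q \<open>fst (\<beta> i) \<in> {1..k}\<close>] by (rule span_base) auto
    ultimately show "fe E \<beta> i q \<in> (\<Union>\<nu>\<in>{1..k} - {\<mu>}. D \<nu> q)" using i by blast
  qed
qed

end

section \<open>Frame independence of the mixed scalar curvature\<close>

lemma sum_ordered_pairs:
  fixes P :: "nat \<Rightarrow> nat \<Rightarrow> real"
  shows "(\<Sum>\<mu>\<in>{1..k}. \<Sum>\<nu>\<in>{1..<\<mu>}. P \<nu> \<mu> + P \<mu> \<nu>) = (\<Sum>\<nu>\<in>{1..k}. \<Sum>\<mu>\<in>{1..k}. if \<nu> = \<mu> then 0 else P \<nu> \<mu>)"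
proof (induction k)
  case (Suc k)
  have i: "{1..<Suc k} = {1..k}" by auto
  have a: "(\<Sum>\<mu>\<in>{1..k}. if Suc k = \<mu> then 0 else P (Suc k) \<mu>) = (\<Sum>\<mu>\<in>{1..k}. P (Suc k) \<mu>)"
    by (rule sum.cong) auto
  have b: "(\<Sum>\<nu>\<in>{1..k}. if \<nu> = Suc k then 0 else P \<nu> (Suc k)) = (\<Sum>\<nu>\<in>{1..k}. P \<nu> (Suc k))"
    by (rule sum.cong) auto
  have "(\<Sum>\<nu>\<in>{1..Suc k}. \<Sum>\<mu>\<in>{1..Suc k}. if \<nu> = \<mu> then 0 else P \<nu> \<mu>)
     = (\<Sum>\<nu>\<in>{1..k}. (\<Sum>\<mu>\<in>{1..k}. if \<nu> = \<mu> then 0 else P \<nu> \<mu>) + (if \<nu> = Suc k then 0 else P \<nu> (Suc k)))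
      + (\<Sum>\<mu>\<in>{1..k}. if Suc k = \<mu> then 0 else P (Suc k) \<mu>)"
    by simp
  also have "\<dots> = (\<Sum>\<nu>\<in>{1..k}. \<Sum>\<mu>\<in>{1..k}. if \<nu> = \<mu> then 0 else P \<nu> \<mu>) + (\<Sum>\<nu>\<in>{1..k}. P \<nu> (Suc k) + P (Suc k) \<nu>)"
    unfolding a sum.distrib b by simp
  finally show ?case using Suc.IH i by simp
qed simp

context multi_product
begin

text \<open>\<open>h\<close> is quadratic in each argument, and the frames are exchanged in one
  argument at a time. \<open>Q1\<close> and \<open>Q2\<close> are bilinear maps with the required
  diagonal, which is all that a trace sees.\<close>

lemma trace_pair_unique:
  fixes R :: "real ^ 'n \<Rightarrow> real ^ 'n \<Rightarrow> real ^ 'n \<Rightarrow> real ^ 'n"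
  assumes R: "\<And>v w. linear (\<lambda>u. R u v w)" "\<And>u w. linear (\<lambda>v. R u v w)" "\<And>u v. linear (\<lambda>w. R u v w)"
    and p: "p \<in> W" "p \<in> W'" and \<mu>: "\<mu> \<in> {1..k}" and \<nu>: "\<nu> \<in> {1..k}"
    and E: "adapted_frame A k n D g W E" and F: "adapted_frame A k n D g W' F"
  defines "h \<equiv> \<lambda>u v. g p (R u v u) v + g p (R v u v) u"
  shows "(\<Sum>a\<in>{1..n \<nu>}. \<Sum>b\<in>{1..n \<mu>}. g p (E \<nu> a p) (E \<nu> a p) * g p (E \<mu> b p) (E \<mu> b p) * h (E \<nu> a p) (E \<mu> b p))
       = (\<Sum>a\<in>{1..n \<nu>}. \<Sum>b\<in>{1..n \<mu>}. g p (F \<nu> a p) (F \<nu> a p) * g p (F \<mu> b p) (F \<mu> b p) * h (F \<nu> a p) (F \<mu> b p))"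
proof -
  note R' = R(1)[THEN linear_add] R(2)[THEN linear_add] R(3)[THEN linear_add]
    R(1)[THEN linear_scale] R(2)[THEN linear_scale] R(3)[THEN linear_scale]
  have tr: "(\<Sum>a\<in>{1..n \<rho>}. g p (E \<rho> a p) (E \<rho> a p) * Q (E \<rho> a p) (E \<rho> a p))
      = (\<Sum>a\<in>{1..n \<rho>}. g p (F \<rho> a p) (F \<rho> a p) * Q (F \<rho> a p) (F \<rho> a p))"
    if Q: "bilinear Q" and \<rho>: "\<rho> \<in> {1..k}" for \<rho> and Q :: "real ^ 'n \<Rightarrow> real ^ 'n \<Rightarrow> real"
  proof -
    have sq: "g p (G \<rho> a p) (G \<rho> a p) * g p (G \<rho> a p) (G \<rho> a p) = 1"
      if "adapted_frame A k n D g U G" "p \<in> U" "a \<in> {1..n \<rho>}" for G U a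
      using adapted_frameD(4)[OF that(1) \<rho> that(2,3)] by (metis abs_mult_self_eq mult_1)
    show ?thesis
      using orthonormal_trace_unique[OF Q, of "{1..n \<rho>}" "{1..n \<rho>}" p "\<lambda>a. E \<rho> a p" "\<lambda>a. F \<rho> a p"]
        sq[OF E p(1)] sq[OF F p(2)] adapted_frameD(5)[OF E \<rho> p(1)] adapted_frameD(5)[OF F \<rho> p(2)]
        adapted_frameD(3)[OF E \<rho> p(1)] adapted_frameD(3)[OF F \<rho> p(2)] by simp
  qed
  have Q1: "bilinear (\<lambda>u u'. g p (R u v u') v + g p (R v u v) u')" for v
    unfolding bilinear_def by (auto intro!: linearI simp: R' g_simps algebra_simps)
  have Q2: "bilinear (\<lambda>v v'. g p (R u v u) v' + g p (R v u v') u)" for u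
    unfolding bilinear_def by (auto intro!: linearI simp: R' g_simps algebra_simps)
  have "(\<Sum>a\<in>{1..n \<nu>}. \<Sum>b\<in>{1..n \<mu>}. g p (E \<nu> a p) (E \<nu> a p) * g p (E \<mu> b p) (E \<mu> b p) * h (E \<nu> a p) (E \<mu> b p))
      = (\<Sum>a\<in>{1..n \<nu>}. g p (E \<nu> a p) (E \<nu> a p) * (\<Sum>b\<in>{1..n \<mu>}. g p (E \<mu> b p) (E \<mu> b p) * h (E \<nu> a p) (E \<mu> b p)))"
    by (simp add: sum_distrib_left mult.assoc)
  also have "\<dots> = (\<Sum>a\<in>{1..n \<nu>}. g p (E \<nu> a p) (E \<nu> a p) * (\<Sum>b\<in>{1..n \<mu>}. g p (F \<mu> b p) (F \<mu> b p) * h (E \<nu> a p) (F \<mu> b p)))"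
    unfolding h_def tr[OF Q2 \<mu>] ..
  also have "\<dots> = (\<Sum>b\<in>{1..n \<mu>}. g p (F \<mu> b p) (F \<mu> b p) * (\<Sum>a\<in>{1..n \<nu>}. g p (E \<nu> a p) (E \<nu> a p) * h (E \<nu> a p) (F \<mu> b p)))"
    unfolding sum_distrib_left by (subst sum.swap) (simp only: mult.left_commute)
  also have "\<dots> = (\<Sum>b\<in>{1..n \<mu>}. g p (F \<mu> b p) (F \<mu> b p) * (\<Sum>a\<in>{1..n \<nu>}. g p (F \<nu> a p) (F \<nu> a p) * h (F \<nu> a p) (F \<mu> b p)))"
    unfolding h_def tr[OF Q1 \<nu>] ..
  also have "\<dots> = (\<Sum>a\<in>{1..n \<nu>}. \<Sum>b\<in>{1..n \<mu>}. g p (F \<nu> a p) (F \<nu> a p) * g p (F \<mu> b p) (F \<mu> b p) * h (F \<nu> a p) (F \<mu> b p))"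
    unfolding sum_distrib_left by (subst sum.swap) (simp only: mult.left_commute mult.assoc)
  finally show ?thesis .
qed

text \<open>The two curvature terms of the definition belong to the ordered pairs (\<nu>, \<mu>) and
  (\<mu>, \<nu>). Gathering them turns the sum over \<nu> < \<mu> into a sum over all ordered pairs
  of frame indices from different distributions, and the factor 1/2 remains.\<close>

lemma mixed_scalar_curv_frame:
  assumes T: "smooth_tensor12 A T" and E: "lframe W E \<beta> \<epsilon>" and p: "p \<in> W"
  shows "mixed_scalar_curv A k n D g nabla T p = (1/2) * (\<Sum>i\<in>UNIV. \<Sum>j\<in>UNIV. if fst (\<beta> i) = fst (\<beta> j) then 0 else
     \<epsilon> i * \<epsilon> j * g p (curv_bar A nabla T (fe E \<beta> i) (fe E \<beta> j) (fe E \<beta> i) p) (fe E \<beta> j p))"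
proof -
  have aE: "adapted_frame A k n D g W E" using E by (simp add: lframe_def)
  have nE: "g p (fe E \<beta> i p) (fe E \<beta> i p) = \<epsilon> i" for i
    using lframe_pframe[OF E] p by (simp add: pframe_def)
  define K where "K = (\<lambda>E (\<nu>::nat) (a::nat) (\<mu>::nat) (b::nat). g p (E \<nu> a p) (E \<nu> a p) * g p (E \<mu> b p) (E \<mu> b p) *
       g p (curv_bar A nabla T (E \<nu> a) (E \<mu> b) (E \<nu> a) p) (E \<mu> b p))"
  define S where "S E = (1/2) * (\<Sum>\<mu>\<in>{1..k}. \<Sum>\<nu>\<in>{1..<\<mu>}. \<Sum>a\<in>{1..n \<nu>}. \<Sum>b\<in>{1..n \<mu>}.
              g p (E \<nu> a p) (E \<nu> a p) * g p (E \<mu> b p) (E \<mu> b p) *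
              (g p (curv_bar A nabla T (E \<nu> a) (E \<mu> b) (E \<nu> a) p) (E \<mu> b p)
             + g p (curv_bar A nabla T (E \<mu> b) (E \<nu> a) (E \<mu> b) p) (E \<nu> a p)))" for E
  obtain R where R0: "\<forall>v w. linear (\<lambda>u. R u v w)" "\<forall>u w. linear (\<lambda>v. R u v w)" "\<forall>u v. linear (\<lambda>w. R u v w)"
      "\<forall>V X Y Z. open V \<longrightarrow> p \<in> V \<longrightarrow> smooth_field A V X \<longrightarrow> smooth_field A V Y \<longrightarrow> smooth_field A V Z \<longrightarrow>
       curv_bar A nabla T X Y Z p = R (X p) (Y p) (Z p)"
    using curv_bar_pointwise[OF T lframe_pframe[OF E] p] by (elim exE conjE)
  note R = R0(1-3)[rule_format] and Rc = R0(4)[rule_format]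
  have SR: "S F = (1/2) * (\<Sum>\<mu>\<in>{1..k}. \<Sum>\<nu>\<in>{1..<\<mu>}. \<Sum>a\<in>{1..n \<nu>}. \<Sum>b\<in>{1..n \<mu>}.
              g p (F \<nu> a p) (F \<nu> a p) * g p (F \<mu> b p) (F \<mu> b p) *
              (g p (R (F \<nu> a p) (F \<mu> b p) (F \<nu> a p)) (F \<mu> b p)
             + g p (R (F \<mu> b p) (F \<nu> a p) (F \<mu> b p)) (F \<nu> a p)))"
    if F: "adapted_frame A k n D g V F" and pV: "p \<in> V" for V F
    unfolding S_def
  proof (intro arg_cong[where f="\<lambda>x. (1/2) * x"] sum.cong refl)
    fix \<mu> \<nu> a b assume h: "\<mu> \<in> {1..k}" "\<nu> \<in> {1..<\<mu>}" "a \<in> {1..n \<nu>}" "b \<in> {1..n \<mu>}"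
    then have \<nu>: "\<nu> \<in> {1..k}" by auto
    note s = adapted_frameD(2)[OF F \<nu> h(3)] adapted_frameD(2)[OF F h(1,4)] and o = adapted_frameD(1)[OF F \<nu>]
    show "g p (F \<nu> a p) (F \<nu> a p) * g p (F \<mu> b p) (F \<mu> b p) *
              (g p (curv_bar A nabla T (F \<nu> a) (F \<mu> b) (F \<nu> a) p) (F \<mu> b p)
             + g p (curv_bar A nabla T (F \<mu> b) (F \<nu> a) (F \<mu> b) p) (F \<nu> a p))
      = g p (F \<nu> a p) (F \<nu> a p) * g p (F \<mu> b p) (F \<mu> b p) *
              (g p (R (F \<nu> a p) (F \<mu> b p) (F \<nu> a p)) (F \<mu> b p)
             + g p (R (F \<mu> b p) (F \<nu> a p) (F \<mu> b p)) (F \<nu> a p))"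
      unfolding Rc[OF o pV s(1) s(2) s(1)] Rc[OF o pV s(2) s(1) s(2)] ..
  qed
  have uniq: "S F = S E" if F: "adapted_frame A k n D g V F" and pV: "p \<in> V" for V F
    unfolding SR[OF F pV] SR[OF aE p]
  proof (rule arg_cong[where f="\<lambda>x. (1/2) * x"], rule sum.cong[OF refl], rule sum.cong[OF refl])
    fix \<mu> \<nu> assume h: "\<mu> \<in> {1..k}" "\<nu> \<in> {1..<\<mu>}"
    then have \<nu>: "\<nu> \<in> {1..k}" by auto
    show "(\<Sum>a\<in>{1..n \<nu>}. \<Sum>b\<in>{1..n \<mu>}. g p (F \<nu> a p) (F \<nu> a p) * g p (F \<mu> b p) (F \<mu> b p) *
              (g p (R (F \<nu> a p) (F \<mu> b p) (F \<nu> a p)) (F \<mu> b p)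
             + g p (R (F \<mu> b p) (F \<nu> a p) (F \<mu> b p)) (F \<nu> a p)))
      = (\<Sum>a\<in>{1..n \<nu>}. \<Sum>b\<in>{1..n \<mu>}. g p (E \<nu> a p) (E \<nu> a p) * g p (E \<mu> b p) (E \<mu> b p) *
              (g p (R (E \<nu> a p) (E \<mu> b p) (E \<nu> a p)) (E \<mu> b p)
             + g p (R (E \<mu> b p) (E \<nu> a p) (E \<mu> b p)) (E \<nu> a p)))"
      by (rule trace_pair_unique[OF R pV p h(1) \<nu> F aE])
  qed
  have "mixed_scalar_curv A k n D g nabla T p = S E"
    unfolding mixed_scalar_curv_def S_def[symmetric]
  proof (rule the_equality)
    show "\<forall>V F. p \<in> V \<and> adapted_frame A k n D g V F \<longrightarrow> S E = S F" by (metis uniq)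
    fix s assume "\<forall>V F. p \<in> V \<and> adapted_frame A k n D g V F \<longrightarrow> s = S F"
    then show "s = S E" using aE p by blast
  qed
  also have "S E = (1/2) * (\<Sum>\<mu>\<in>{1..k}. \<Sum>\<nu>\<in>{1..<\<mu>}.
      (\<Sum>a\<in>{1..n \<nu>}. \<Sum>b\<in>{1..n \<mu>}. K E \<nu> a \<mu> b) + (\<Sum>b\<in>{1..n \<mu>}. \<Sum>a\<in>{1..n \<nu>}. K E \<mu> b \<nu> a))"
    unfolding S_def
  proof (rule arg_cong[where f="\<lambda>x. (1/2) * x"], rule sum.cong[OF refl], rule sum.cong[OF refl])
    fix \<mu> \<nu>
    have swap: "(\<Sum>b\<in>{1..n \<mu>}. \<Sum>a\<in>{1..n \<nu>}. K E \<mu> b \<nu> a) = (\<Sum>a\<in>{1..n \<nu>}. \<Sum>b\<in>{1..n \<mu>}. K E \<mu> b \<nu> a)" by (rule sum.swap)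
    show "(\<Sum>a\<in>{1..n \<nu>}. \<Sum>b\<in>{1..n \<mu>}. g p (E \<nu> a p) (E \<nu> a p) * g p (E \<mu> b p) (E \<mu> b p) *
              (g p (curv_bar A nabla T (E \<nu> a) (E \<mu> b) (E \<nu> a) p) (E \<mu> b p)
             + g p (curv_bar A nabla T (E \<mu> b) (E \<nu> a) (E \<mu> b) p) (E \<nu> a p)))
      = (\<Sum>a\<in>{1..n \<nu>}. \<Sum>b\<in>{1..n \<mu>}. K E \<nu> a \<mu> b) + (\<Sum>b\<in>{1..n \<mu>}. \<Sum>a\<in>{1..n \<nu>}. K E \<mu> b \<nu> a)"
      unfolding swap unfolding K_def sum.distrib[symmetric]
      by (intro sum.cong refl) (simp add: algebra_simps)
  qed
  also have "\<dots> = (1/2) * (\<Sum>\<nu>\<in>{1..k}. \<Sum>\<mu>\<in>{1..k}. if \<nu> = \<mu> then 0 else (\<Sum>a\<in>{1..n \<nu>}. \<Sum>b\<in>{1..n \<mu>}. K E \<nu> a \<mu> b))"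
    unfolding sum_ordered_pairs[of "\<lambda>\<nu> \<mu>. \<Sum>a\<in>{1..n \<nu>}. \<Sum>b\<in>{1..n \<mu>}. K E \<nu> a \<mu> b", symmetric] ..
  also have "(\<Sum>\<nu>\<in>{1..k}. \<Sum>\<mu>\<in>{1..k}. if \<nu> = \<mu> then 0 else (\<Sum>a\<in>{1..n \<nu>}. \<Sum>b\<in>{1..n \<mu>}. K E \<nu> a \<mu> b))
     = (\<Sum>\<nu>\<in>{1..k}. \<Sum>a\<in>{1..n \<nu>}. \<Sum>\<mu>\<in>{1..k}. \<Sum>b\<in>{1..n \<mu>}. if \<nu> = \<mu> then 0 else K E \<nu> a \<mu> b)"
  proof (rule sum.cong[OF refl])
    fix \<nu>
    have "(\<Sum>a\<in>{1..n \<nu>}. \<Sum>\<mu>\<in>{1..k}. \<Sum>b\<in>{1..n \<mu>}. if \<nu> = \<mu> then 0 else K E \<nu> a \<mu> b)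
        = (\<Sum>\<mu>\<in>{1..k}. \<Sum>a\<in>{1..n \<nu>}. \<Sum>b\<in>{1..n \<mu>}. if \<nu> = \<mu> then 0 else K E \<nu> a \<mu> b)" by (rule sum.swap)
    also have "\<dots> = (\<Sum>\<mu>\<in>{1..k}. if \<nu> = \<mu> then 0 else (\<Sum>a\<in>{1..n \<nu>}. \<Sum>b\<in>{1..n \<mu>}. K E \<nu> a \<mu> b))"
      by (rule sum.cong) auto
    finally show "(\<Sum>\<mu>\<in>{1..k}. if \<nu> = \<mu> then 0 else (\<Sum>a\<in>{1..n \<nu>}. \<Sum>b\<in>{1..n \<mu>}. K E \<nu> a \<mu> b))
        = (\<Sum>a\<in>{1..n \<nu>}. \<Sum>\<mu>\<in>{1..k}. \<Sum>b\<in>{1..n \<mu>}. if \<nu> = \<mu> then 0 else K E \<nu> a \<mu> b)" by simp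
  qed
  also have "\<dots> = (\<Sum>x\<in>(SIGMA \<mu>:{1..k}. {1..n \<mu>}). \<Sum>y\<in>(SIGMA \<mu>:{1..k}. {1..n \<mu>}).
      if fst x = fst y then 0 else K E (fst x) (snd x) (fst y) (snd y))"
  proof -
    have sig: "(\<Sum>x\<in>(SIGMA \<mu>:{1..k}. {1..n \<mu>}). f x) = (\<Sum>\<mu>\<in>{1..k}. \<Sum>a\<in>{1..n \<mu>}. f (\<mu>, a))" for f :: "nat \<times> nat \<Rightarrow> real"
      by (simp add: sum.Sigma)
    show ?thesis unfolding sig fst_conv snd_conv ..
  qed
  also have "\<dots> = (\<Sum>i\<in>UNIV. \<Sum>j\<in>UNIV. if fst (\<beta> i) = fst (\<beta> j) then 0 else
       K E (fst (\<beta> i)) (snd (\<beta> i)) (fst (\<beta> j)) (snd (\<beta> j)))"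
  proof -
    have \<beta>: "bij_betw \<beta> UNIV (SIGMA \<mu>:{1..k}. {1..n \<mu>})" using E by (simp add: lframe_def)
    have re: "(\<Sum>x\<in>(SIGMA \<mu>:{1..k}. {1..n \<mu>}). f x) = (\<Sum>i\<in>UNIV. f (\<beta> i))" for f :: "nat \<times> nat \<Rightarrow> real"
      by (rule sum.reindex_bij_betw[OF \<beta>, symmetric])
    show ?thesis unfolding re ..
  qed
  finally show ?thesis unfolding K_def fe_def[symmetric] nE .
qed

end

section \<open>The Euler-Lagrange coefficients\<close>

text \<open>The coefficient of the component \<open>B\<^bsub>xyz\<^esub>\<close> in the first variation of the mixed scalar curvature,
  up to a divergence, in terms of the Christoffel symbols \<open>\<Gamma>\<close> of the Levi-Civita connection and \<open>G\<close> of
  the connection with contorsion. The map \<open>d\<close> sends a frame index to the number of its distribution.\<close>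

definition el_coeff :: "('n::finite \<Rightarrow> real) \<Rightarrow> ('n \<Rightarrow> nat) \<Rightarrow> ('n \<Rightarrow> 'n \<Rightarrow> 'n \<Rightarrow> real) \<Rightarrow> ('n \<Rightarrow> 'n \<Rightarrow> 'n \<Rightarrow> real) \<Rightarrow>
    'n \<Rightarrow> 'n \<Rightarrow> 'n \<Rightarrow> real" where
  "el_coeff \<epsilon> d G \<Gamma> x y z =
     (if x = y then \<epsilon> x * ((\<Sum>b\<in>UNIV. if d b = d x then 0 else \<epsilon> b * G b z b) + (if d x = d z then 0 else \<Sum>i\<in>UNIV. \<epsilon> i * \<Gamma> i i z)) else 0)
   + (if x = z then \<epsilon> x * ((\<Sum>a\<in>UNIV. if d a = d x then 0 else \<epsilon> a * G a a y) - (if d x = d y then 0 else \<Sum>i\<in>UNIV. \<epsilon> i * \<Gamma> i i y)) else 0)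
   - (if d x = d y then 0 else G y z x) - (if d x = d z then 0 else G z x y) + (if d y = d z then 0 else \<Gamma> y z x - \<Gamma> z y x)"

text \<open>The left side is the zeroth-order part of twice the first variation, plus the terms that
  complete its derivatives to divergences. The identity renames summation indices in the seven parts
  of \<open>el_coeff\<close>; \<open>K\<close> eliminates a repeated index, and squares of signs
  cancel.\<close>

lemma first_variation_algebra:
  fixes \<epsilon> :: "'n::finite \<Rightarrow> real" and d :: "'n \<Rightarrow> nat" and B G \<Gamma> :: "'n \<Rightarrow> 'n \<Rightarrow> 'n \<Rightarrow> real"
  assumes \<epsilon>: "\<And>i. \<epsilon> i * \<epsilon> i = 1"
  shows "(\<Sum>a\<in>UNIV. \<Sum>b\<in>UNIV. if d a = d b then 0 else \<epsilon> a * \<epsilon> b * (\<Sum>c\<in>UNIV. \<epsilon> c *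
            (B a a c * G b c b + G a a c * B b c b - B b a c * G a c b - G b a c * B a c b + (\<Gamma> a b c - \<Gamma> b a c) * B c a b)))
       + (\<Sum>j\<in>UNIV. \<epsilon> j * ((\<Sum>a\<in>UNIV. if d a = d j then 0 else \<epsilon> a * (B a a j - B a j a)) * (\<Sum>i\<in>UNIV. \<epsilon> i * \<Gamma> i i j)))
     = (\<Sum>x\<in>UNIV. \<Sum>y\<in>UNIV. \<Sum>z\<in>UNIV. \<epsilon> x * \<epsilon> y * \<epsilon> z * el_coeff \<epsilon> d G \<Gamma> x y z * B x y z)"
proof -
  define \<delta> where "\<delta> = (\<lambda>a b. if d a = d b then 0 else 1::real)"
  define K where "K = (\<lambda>x y::'n. if x = y then 1 else 0::real)"
  define w where "w = (\<lambda>a b c. \<epsilon> a * \<epsilon> b * \<epsilon> c)"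
  define S where "S j = (\<Sum>i\<in>UNIV. \<epsilon> i * \<Gamma> i i j)" for j
  have \<delta>s: "\<delta> a b = \<delta> b a" for a b by (simp add: \<delta>_def)
  have if\<delta>: "(if d a = d b then 0 else r) = \<delta> a b * r" for a b r by (simp add: \<delta>_def)
  have ifK: "(if x = y then r else 0) = K x y * r" for x y r by (simp add: K_def)
  have Kr: "(\<Sum>y\<in>UNIV. K x y * f y) = f x" for x f
    by (simp add: K_def if_distribR if_distrib cong: if_cong)
  have e3: "\<epsilon> x * (\<epsilon> x * r) = r" for x r using \<epsilon>[of x] by (simp add: mult.assoc[symmetric])
  have L: "(\<Sum>a\<in>UNIV. \<Sum>b\<in>UNIV. if d a = d b then 0 else \<epsilon> a * \<epsilon> b * (\<Sum>c\<in>UNIV. \<epsilon> c *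
            (B a a c * G b c b + G a a c * B b c b - B b a c * G a c b - G b a c * B a c b + (\<Gamma> a b c - \<Gamma> b a c) * B c a b)))
     = (\<Sum>a\<in>UNIV. \<Sum>b\<in>UNIV. \<Sum>c\<in>UNIV. \<delta> a b * w a b c * (B a a c * G b c b))
     + (\<Sum>a\<in>UNIV. \<Sum>b\<in>UNIV. \<Sum>c\<in>UNIV. \<delta> a b * w a b c * (G a a c * B b c b))
     - (\<Sum>a\<in>UNIV. \<Sum>b\<in>UNIV. \<Sum>c\<in>UNIV. \<delta> a b * w a b c * (B b a c * G a c b))
     - (\<Sum>a\<in>UNIV. \<Sum>b\<in>UNIV. \<Sum>c\<in>UNIV. \<delta> a b * w a b c * (G b a c * B a c b))
     + (\<Sum>a\<in>UNIV. \<Sum>b\<in>UNIV. \<Sum>c\<in>UNIV. \<delta> a b * w a b c * ((\<Gamma> a b c - \<Gamma> b a c) * B c a b))"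
    unfolding if\<delta> sum_distrib_left sum.distrib[symmetric] sum_subtractf[symmetric]
    by (intro sum.cong refl) (simp add: w_def algebra_simps)
  have R: "(\<Sum>x\<in>UNIV. \<Sum>y\<in>UNIV. \<Sum>z\<in>UNIV. \<epsilon> x * \<epsilon> y * \<epsilon> z * el_coeff \<epsilon> d G \<Gamma> x y z * B x y z)
     = (\<Sum>x\<in>UNIV. \<Sum>y\<in>UNIV. \<Sum>z\<in>UNIV. K x y * (w x y z * \<epsilon> x * (\<Sum>b\<in>UNIV. \<delta> b x * (\<epsilon> b * G b z b)) * B x y z))
     + (\<Sum>x\<in>UNIV. \<Sum>y\<in>UNIV. \<Sum>z\<in>UNIV. K x y * (w x y z * \<epsilon> x * \<delta> x z * S z * B x y z))
     + (\<Sum>x\<in>UNIV. \<Sum>y\<in>UNIV. \<Sum>z\<in>UNIV. K x z * (w x y z * \<epsilon> x * (\<Sum>a\<in>UNIV. \<delta> a x * (\<epsilon> a * G a a y)) * B x y z))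
     - (\<Sum>x\<in>UNIV. \<Sum>y\<in>UNIV. \<Sum>z\<in>UNIV. K x z * (w x y z * \<epsilon> x * \<delta> x y * S y * B x y z))
     - (\<Sum>x\<in>UNIV. \<Sum>y\<in>UNIV. \<Sum>z\<in>UNIV. \<delta> x y * w x y z * (G y z x * B x y z))
     - (\<Sum>x\<in>UNIV. \<Sum>y\<in>UNIV. \<Sum>z\<in>UNIV. \<delta> x z * w x y z * (G z x y * B x y z))
     + (\<Sum>x\<in>UNIV. \<Sum>y\<in>UNIV. \<Sum>z\<in>UNIV. \<delta> y z * w x y z * ((\<Gamma> y z x - \<Gamma> z y x) * B x y z))"
    unfolding el_coeff_def if\<delta> ifK S_def[symmetric] sum.distrib[symmetric] sum_subtractf[symmetric]
    by (intro sum.cong refl) (simp add: w_def algebra_simps)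
  have M: "(\<Sum>j\<in>UNIV. \<epsilon> j * ((\<Sum>a\<in>UNIV. if d a = d j then 0 else \<epsilon> a * (B a a j - B a j a)) * (\<Sum>i\<in>UNIV. \<epsilon> i * \<Gamma> i i j)))
     = (\<Sum>j\<in>UNIV. \<Sum>a\<in>UNIV. \<epsilon> j * \<delta> a j * \<epsilon> a * S j * B a a j) - (\<Sum>j\<in>UNIV. \<Sum>a\<in>UNIV. \<epsilon> j * \<delta> a j * \<epsilon> a * S j * B a j a)"
    unfolding if\<delta> S_def[symmetric] sum_subtractf[symmetric] sum_distrib_right sum_distrib_left
    by (intro sum.cong refl) (simp add: algebra_simps)
  have zy: "(\<Sum>y\<in>UNIV. \<Sum>z\<in>UNIV. K x y * f y z) = (\<Sum>z\<in>UNIV. f x z)" for x and f :: "'n \<Rightarrow> 'n \<Rightarrow> real"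
    unfolding sum_distrib_left[symmetric] by (rule Kr)
  have T1: "(\<Sum>x\<in>UNIV. \<Sum>y\<in>UNIV. \<Sum>z\<in>UNIV. K x y * (w x y z * \<epsilon> x * (\<Sum>b\<in>UNIV. \<delta> b x * (\<epsilon> b * G b z b)) * B x y z))
     = (\<Sum>a\<in>UNIV. \<Sum>b\<in>UNIV. \<Sum>c\<in>UNIV. \<delta> a b * w a b c * (B a a c * G b c b))"
    unfolding zy
  proof (rule sum.cong[OF refl])
    fix a
    have "(\<Sum>z\<in>UNIV. w a a z * \<epsilon> a * (\<Sum>b\<in>UNIV. \<delta> b a * (\<epsilon> b * G b z b)) * B a a z)
       = (\<Sum>z\<in>UNIV. \<Sum>b\<in>UNIV. \<delta> a b * w a b z * (B a a z * G b z b))"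
      unfolding sum_distrib_right sum_distrib_left by (intro sum.cong refl) (simp add: w_def \<delta>s[of a] e3 mult_ac)
    also have "\<dots> = (\<Sum>b\<in>UNIV. \<Sum>z\<in>UNIV. \<delta> a b * w a b z * (B a a z * G b z b))" by (rule sum.swap)
    finally show "(\<Sum>z\<in>UNIV. w a a z * \<epsilon> a * (\<Sum>b\<in>UNIV. \<delta> b a * (\<epsilon> b * G b z b)) * B a a z)
       = (\<Sum>b\<in>UNIV. \<Sum>z\<in>UNIV. \<delta> a b * w a b z * (B a a z * G b z b))" .
  qed
  have T2: "(\<Sum>x\<in>UNIV. \<Sum>y\<in>UNIV. \<Sum>z\<in>UNIV. K x z * (w x y z * \<epsilon> x * (\<Sum>a\<in>UNIV. \<delta> a x * (\<epsilon> a * G a a y)) * B x y z))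
     = (\<Sum>a\<in>UNIV. \<Sum>b\<in>UNIV. \<Sum>c\<in>UNIV. \<delta> a b * w a b c * (G a a c * B b c b))"
  proof -
    have "(\<Sum>y\<in>UNIV. w x y x * \<epsilon> x * (\<Sum>a\<in>UNIV. \<delta> a x * (\<epsilon> a * G a a y)) * B x y x)
       = (\<Sum>a\<in>UNIV. \<Sum>y\<in>UNIV. \<delta> a x * w a x y * (G a a y * B x y x))" for x
      unfolding sum_distrib_right sum_distrib_left by (subst sum.swap, intro sum.cong refl) (simp add: w_def e3 mult_ac)
    then have "(\<Sum>x\<in>UNIV. \<Sum>y\<in>UNIV. w x y x * \<epsilon> x * (\<Sum>a\<in>UNIV. \<delta> a x * (\<epsilon> a * G a a y)) * B x y x)
       = (\<Sum>x\<in>UNIV. \<Sum>a\<in>UNIV. \<Sum>y\<in>UNIV. \<delta> a x * w a x y * (G a a y * B x y x))" by simp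
    also have "\<dots> = (\<Sum>a\<in>UNIV. \<Sum>x\<in>UNIV. \<Sum>y\<in>UNIV. \<delta> a x * w a x y * (G a a y * B x y x))" by (rule sum.swap)
    finally show ?thesis unfolding Kr .
  qed
  have T3: "(\<Sum>x\<in>UNIV. \<Sum>y\<in>UNIV. \<Sum>z\<in>UNIV. \<delta> x y * w x y z * (G y z x * B x y z))
     = (\<Sum>a\<in>UNIV. \<Sum>b\<in>UNIV. \<Sum>c\<in>UNIV. \<delta> a b * w a b c * (B b a c * G a c b))"
    by (subst sum.swap, intro sum.cong refl) (simp add: w_def \<delta>s mult_ac)
  have T4: "(\<Sum>x\<in>UNIV. \<Sum>y\<in>UNIV. \<Sum>z\<in>UNIV. \<delta> x z * w x y z * (G z x y * B x y z))
     = (\<Sum>a\<in>UNIV. \<Sum>b\<in>UNIV. \<Sum>c\<in>UNIV. \<delta> a b * w a b c * (G b a c * B a c b))"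
    by (rule sum.cong[OF refl], subst sum.swap, intro sum.cong refl) (simp add: w_def mult_ac)
  have T5: "(\<Sum>x\<in>UNIV. \<Sum>y\<in>UNIV. \<Sum>z\<in>UNIV. \<delta> y z * w x y z * ((\<Gamma> y z x - \<Gamma> z y x) * B x y z))
     = (\<Sum>a\<in>UNIV. \<Sum>b\<in>UNIV. \<Sum>c\<in>UNIV. \<delta> a b * w a b c * ((\<Gamma> a b c - \<Gamma> b a c) * B c a b))"
  proof -
    have "(\<Sum>x\<in>UNIV. \<Sum>y\<in>UNIV. \<Sum>z\<in>UNIV. \<delta> y z * w x y z * ((\<Gamma> y z x - \<Gamma> z y x) * B x y z))
      = (\<Sum>y\<in>UNIV. \<Sum>x\<in>UNIV. \<Sum>z\<in>UNIV. \<delta> y z * w x y z * ((\<Gamma> y z x - \<Gamma> z y x) * B x y z))" by (rule sum.swap)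
    also have "\<dots> = (\<Sum>y\<in>UNIV. \<Sum>z\<in>UNIV. \<Sum>x\<in>UNIV. \<delta> y z * w x y z * ((\<Gamma> y z x - \<Gamma> z y x) * B x y z))"
      by (rule sum.cong[OF refl], rule sum.swap)
    finally show ?thesis by (simp add: w_def mult_ac)
  qed
  have T6: "(\<Sum>x\<in>UNIV. \<Sum>y\<in>UNIV. \<Sum>z\<in>UNIV. K x y * (w x y z * \<epsilon> x * \<delta> x z * S z * B x y z))
     = (\<Sum>j\<in>UNIV. \<Sum>a\<in>UNIV. \<epsilon> j * \<delta> a j * \<epsilon> a * S j * B a a j)"
    unfolding zy by (subst sum.swap, intro sum.cong refl) (simp add: w_def e3 mult_ac)
  have T7: "(\<Sum>x\<in>UNIV. \<Sum>y\<in>UNIV. \<Sum>z\<in>UNIV. K x z * (w x y z * \<epsilon> x * \<delta> x y * S y * B x y z))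
     = (\<Sum>j\<in>UNIV. \<Sum>a\<in>UNIV. \<epsilon> j * \<delta> a j * \<epsilon> a * S j * B a j a)"
    unfolding Kr by (subst sum.swap, intro sum.cong refl) (simp add: w_def e3 mult_ac)
  show ?thesis unfolding L R M T1 T2 T3 T4 T5 T6 T7 by simp
qed

context multi_product
begin

section \<open>The five equations as components of the Euler-Lagrange expression\<close>

definition critical_equations where
  "critical_equations T E p \<longleftrightarrow> (\<forall>\<mu>\<in>{1..k}.
      (\<forall>a\<in>{1..n \<mu>}. \<forall>b\<in>{1..n \<mu>}. \<forall>c\<in>{1..n \<mu>}.
          g p (trace_perp A k D g \<mu> (tensor_adj g T) p - mean_curv_perp A k D g nabla \<mu> p) (E \<mu> c p) * g p (E \<mu> a p) (E \<mu> b p)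
        + g p (trace_perp A k D g \<mu> T p + mean_curv_perp A k D g nabla \<mu> p) (E \<mu> b p) * g p (E \<mu> a p) (E \<mu> c p) = 0) \<and>
      (\<forall>\<rho>\<in>{1..k} - {\<mu>}. \<forall>a\<in>{1..n \<mu>}. \<forall>b\<in>{1..n \<mu>}. \<forall>i\<in>{1..n \<rho>}.
          g p (trace_perp A k D g \<mu> (tensor_adj g T) p + mean_curv A k D g nabla \<mu> p) (E \<rho> i p) * g p (E \<mu> a p) (E \<mu> b p)
        - g p (sff k D g nabla \<mu> (E \<mu> a) (E \<mu> b) p - integrability k D g nabla \<mu> (E \<mu> a) (E \<mu> b) p) (E \<rho> i p)
        - g p (T p (E \<rho> i p) (E \<mu> a p)) (E \<mu> b p) = 0) \<and>
      (\<forall>\<rho>\<in>{1..k} - {\<mu>}. \<forall>a\<in>{1..n \<mu>}. \<forall>b\<in>{1..n \<mu>}. \<forall>i\<in>{1..n \<rho>}.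
          g p (trace_perp A k D g \<mu> T p - mean_curv A k D g nabla \<mu> p) (E \<rho> i p) * g p (E \<mu> a p) (E \<mu> b p)
        + g p (sff k D g nabla \<mu> (E \<mu> b) (E \<mu> a) p + integrability k D g nabla \<mu> (E \<mu> b) (E \<mu> a) p) (E \<rho> i p)
        - g p (T p (E \<rho> i p) (E \<mu> b p)) (E \<mu> a p) = 0) \<and>
      (\<forall>\<rho>\<in>{1..k} - {\<mu>}. \<forall>a\<in>{1..n \<mu>}. \<forall>b\<in>{1..n \<mu>}. \<forall>i\<in>{1..n \<rho>}.
          g p (2 *\<^sub>R integrability k D g nabla \<mu> (E \<mu> a) (E \<mu> b) p) (E \<rho> i p)
        + g p (T p (E \<mu> a p) (E \<mu> b p) + tensor_adj g T p (E \<mu> b p) (E \<mu> a p)) (E \<rho> i p) = 0) \<and>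
      (\<forall>\<rho>\<in>{1..k} - {\<mu>}. \<forall>\<xi>\<in>{1..k} - {\<mu>, \<rho>}.
        \<forall>a\<in>{1..n \<mu>}. \<forall>j\<in>{1..n \<rho>}. \<forall>l\<in>{1..n \<xi>}.
          g p (2 *\<^sub>R integrability_perp D g nabla \<mu> (E \<rho> j) (E \<xi> l) p) (E \<mu> a p)
        + g p (sff_perp D g nabla \<xi> (E \<rho> j) (E \<mu> a) p + integrability_perp D g nabla \<xi> (E \<rho> j) (E \<mu> a) p) (E \<xi> l p)
        + 2 * g p (T p (E \<xi> l p) (E \<mu> a p)) (E \<rho> j p)
        - g p (sff_perp D g nabla \<rho> (E \<xi> l) (E \<mu> a) p + integrability_perp D g nabla \<rho> (E \<xi> l) (E \<mu> a) p) (E \<rho> j p)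
        + 2 * g p (T p (E \<rho> j p) (E \<xi> l p)) (E \<mu> a p) = 0))"

context
  fixes T W E \<beta> \<epsilon> p
  assumes T: "smooth_tensor12 A T" and E: "lframe W E \<beta> \<epsilon>" and p: "p \<in> W"
begin

abbreviation (input) "frm \<equiv> fe E \<beta>"
abbreviation (input) "dst i \<equiv> fst (\<beta> i)"
abbreviation (input) "chr x y z \<equiv> christ nabla frm x y z p"
abbreviation (input) "tau x y z \<equiv> tcomp T frm x y z p"

lemma frame_orthonormal: "g p (frm i p) (frm j p) = (if i = j then \<epsilon> i else 0)" and frame_sign: "\<epsilon> i * \<epsilon> i = 1"
  using lframe_pframe[OF E] p unfolding pframe_def by blast+

lemma bilinear_T: "bilinear (T q)" using T by (simp add: smooth_tensor12_def)

lemma bilinear_tensor_adj: "bilinear (tensor_adj g T p)"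
proof -
  note adj = tensor_adj_eq[where T=T, OF lframe_pframe[OF E] p bilinear_T]
  have eqI: "u = v" if "\<And>z. g p u z = g p v z" for u v
    using g_nondegenerate[of p "u - v"] that by (simp add: g_simps(9))
  show ?thesis
    unfolding bilinear_def
    by (auto intro!: linearI eqI simp: adj g_simps bilinear_ladd[OF bilinear_T] bilinear_radd[OF bilinear_T]
        bilinear_lmul[OF bilinear_T] bilinear_rmul[OF bilinear_T])
qed

lemma orthoproj_component:
  assumes V: "V p = span ((\<lambda>i. frm i p) ` J)" and z: "z \<in> J"
  shows "g p (orthoproj g V p v) (frm z p) = g p v (frm z p)"
proof -
  have "g p (orthoproj g V p v) (frm z p) = (\<Sum>i\<in>J. if i = z then \<epsilon> z * \<epsilon> z * g p v (frm z p) else 0)"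
    unfolding orthoproj_frame[where V=V, OF lframe_pframe[OF E] p V] g_simps
    by (rule sum.cong) (auto simp: frame_orthonormal)
  then show ?thesis using z by (simp add: frame_sign)
qed

lemma sff_component:
  assumes "dst z \<noteq> \<mu>" "\<mu> \<in> {1..k}"
  shows "g p (sff k D g nabla \<mu> X Y p) (frm z p) = (g p (nabla X Y p) (frm z p) + g p (nabla Y X p) (frm z p)) / 2"
    and "g p (integrability k D g nabla \<mu> X Y p) (frm z p) = (g p (nabla X Y p) (frm z p) - g p (nabla Y X p) (frm z p)) / 2"
proof -
  have z: "z \<in> - {i. dst i = \<mu>}" using assms by simp
  note o = orthoproj_component[where V="perp k D \<mu>", OF lframe_perp[OF E p assms(2)] z]
  show "g p (sff k D g nabla \<mu> X Y p) (frm z p) = (g p (nabla X Y p) (frm z p) + g p (nabla Y X p) (frm z p)) / 2"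
    "g p (integrability k D g nabla \<mu> X Y p) (frm z p) = (g p (nabla X Y p) (frm z p) - g p (nabla Y X p) (frm z p)) / 2"
    unfolding sff_def integrability_def g_simps o by simp_all
qed

lemma sff_perp_component:
  assumes "dst z \<in> {1..k}"
  shows "g p (sff_perp D g nabla (dst z) X Y p) (frm z p) = (g p (nabla X Y p) (frm z p) + g p (nabla Y X p) (frm z p)) / 2"
    and "g p (integrability_perp D g nabla (dst z) X Y p) (frm z p) = (g p (nabla X Y p) (frm z p) - g p (nabla Y X p) (frm z p)) / 2"
proof -
  have z: "z \<in> {i. dst i = dst z}" by simp
  note o = orthoproj_component[where V="D (dst z)", OF lframe_span[OF E p assms] z]
  show "g p (sff_perp D g nabla (dst z) X Y p) (frm z p) = (g p (nabla X Y p) (frm z p) + g p (nabla Y X p) (frm z p)) / 2"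
    "g p (integrability_perp D g nabla (dst z) X Y p) (frm z p) = (g p (nabla X Y p) (frm z p) - g p (nabla Y X p) (frm z p)) / 2"
    unfolding sff_perp_def integrability_perp_def g_simps o by simp_all
qed

lemma trace_component:
  assumes "z \<in> J'"
  shows "g p (\<Sum>i\<in>J. \<epsilon> i *\<^sub>R (\<Sum>z\<in>J'. (\<epsilon> z * chr i i z) *\<^sub>R frm z p)) (frm z p) = (\<Sum>i\<in>J. \<epsilon> i * chr i i z)"
proof -
  have "g p (\<Sum>z\<in>J'. (\<epsilon> z * chr i i z) *\<^sub>R frm z p) (frm z p) = chr i i z" for i
  proof -
    have "g p (\<Sum>z\<in>J'. (\<epsilon> z * chr i i z) *\<^sub>R frm z p) (frm z p) = (\<Sum>y\<in>J'. if y = z then \<epsilon> z * \<epsilon> z * chr i i z else 0)"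
      unfolding g_simps by (rule sum.cong) (auto simp: frame_orthonormal)
    then show ?thesis using assms by (simp add: frame_sign)
  qed
  then show ?thesis unfolding g_simps(11) g_simps(3) by simp
qed

lemma mean_curv_component:
  assumes "dst z \<noteq> \<mu>" "\<mu> \<in> {1..k}"
  shows "g p (mean_curv A k D g nabla \<mu> p) (frm z p) = (\<Sum>i | dst i = \<mu>. \<epsilon> i * chr i i z)"
proof -
  have "mean_curv A k D g nabla \<mu> p = (\<Sum>i\<in>{i. dst i = \<mu>}. \<epsilon> i *\<^sub>R (\<Sum>z\<in>-{i. dst i = \<mu>}. (\<epsilon> z * chr i i z) *\<^sub>R frm z p))"
    unfolding mean_curv_def sff_def[abs_def]
    by (rule sff_trace[OF lframe_pframe[OF E] p lframe_span[OF E _ assms(2)] lframe_perp[OF E _ assms(2)]])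
  then show ?thesis using trace_component[of z "-{i. dst i = \<mu>}"] assms by simp
qed

lemma mean_curv_perp_component:
  assumes "dst z \<in> {1..k}"
  shows "g p (mean_curv_perp A k D g nabla (dst z) p) (frm z p) = (\<Sum>i | dst i \<noteq> dst z. \<epsilon> i * chr i i z)"
proof -
  have span: "D (dst z) q = span ((\<lambda>i. frm i q) ` (- (- {i. dst i = dst z})))" if "q \<in> W" for q
    using lframe_span[OF E that assms] by simp
  have "mean_curv_perp A k D g nabla (dst z) p
     = (\<Sum>i\<in>-{i. dst i = dst z}. \<epsilon> i *\<^sub>R (\<Sum>y\<in>-(-{i. dst i = dst z}). (\<epsilon> y * chr i i y) *\<^sub>R frm y p))"
    unfolding mean_curv_perp_def sff_perp_def[abs_def]
    by (rule sff_trace[OF lframe_pframe[OF E] p lframe_perp[OF E _ assms] span])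
  then show ?thesis using trace_component[of z "-(-{i. dst i = dst z})" "-{i. dst i = dst z}"] by (simp add: Collect_neg_eq)
qed

lemma trace_perp_component:
  assumes "\<mu> \<in> {1..k}"
  shows "g p (trace_perp A k D g \<mu> T p) (frm z p) = (\<Sum>i | dst i \<noteq> \<mu>. \<epsilon> i * tau i i z)"
    and "g p (trace_perp A k D g \<mu> (tensor_adj g T) p) (frm z p) = (\<Sum>i | dst i \<noteq> \<mu>. \<epsilon> i * tau i z i)"
proof -
  note tr = frame_trace_eq[OF lframe_pframe[OF E] p lframe_perp[OF E _ assms]]
  have "trace_perp A k D g \<mu> T p = (\<Sum>i\<in>-{i. dst i = \<mu>}. \<epsilon> i *\<^sub>R T p (frm i p) (frm i p))"
    unfolding trace_perp_def by (rule tr[OF _ bilinear_T]) auto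
  then show "g p (trace_perp A k D g \<mu> T p) (frm z p) = (\<Sum>i | dst i \<noteq> \<mu>. \<epsilon> i * tau i i z)"
    by (simp add: g_simps tcomp_def Collect_neg_eq)
  have "trace_perp A k D g \<mu> (tensor_adj g T) p = (\<Sum>i\<in>-{i. dst i = \<mu>}. \<epsilon> i *\<^sub>R tensor_adj g T p (frm i p) (frm i p))"
    unfolding trace_perp_def by (rule tr[OF _ bilinear_tensor_adj]) auto
  then show "g p (trace_perp A k D g \<mu> (tensor_adj g T) p) (frm z p) = (\<Sum>i | dst i \<noteq> \<mu>. \<epsilon> i * tau i z i)"
    by (simp add: g_simps tcomp_def Collect_neg_eq tensor_adj_eq[where T=T, OF lframe_pframe[OF E] p bilinear_T])
qed

abbreviation (input) "chr_bar x y z \<equiv> christ (nabla_bar nabla T) frm x y z p"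
abbreviation (input) "el \<equiv> el_coeff \<epsilon> (\<lambda>i. dst i) (\<lambda>x y z. chr_bar x y z) (\<lambda>x y z. chr x y z)"

lemma sum_if_distribution:
  fixes f :: "'n \<Rightarrow> real"
  shows "(\<Sum>b\<in>UNIV. if dst b = \<mu> then 0 else f b) = (\<Sum>b | dst b \<noteq> \<mu>. f b)"
  by (rule sum.mono_neutral_cong_right) auto

lemma sum_split_distribution:
  fixes f :: "'n \<Rightarrow> real"
  shows "(\<Sum>b\<in>UNIV. f b) = (\<Sum>b | dst b = \<mu>. f b) + (\<Sum>b | dst b \<noteq> \<mu>. f b)"
proof -
  have "(\<Sum>b\<in>UNIV. f b) = (\<Sum>b\<in>{b. dst b = \<mu>} \<union> {b. dst b \<noteq> \<mu>}. f b)" by (rule sum.cong) auto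
  then show ?thesis by (subst (asm) sum.union_disjoint) auto
qed

lemmas G_split = christ_nabla_bar[of nabla T "fe E \<beta>" _ _ _ p]
lemmas \<Gamma>_skew = christ_skew[OF lframe_pframe[OF E] p]

text \<open>Skewness turns \<open>\<Gamma> b z b\<close> into \<open>- \<Gamma> b b z\<close>, so
  this trace of \<open>G\<close> is a trace of the adjoint contorsion minus a trace of second
  fundamental form type.\<close>

lemma sum_G_last: "(\<Sum>b\<in>UNIV. if dst b = \<mu> then 0 else \<epsilon> b * chr_bar b z b) =
    (\<Sum>b | dst b \<noteq> \<mu>. \<epsilon> b * tau b z b) - (\<Sum>b | dst b \<noteq> \<mu>. \<epsilon> b * chr b b z)"
proof -
  have "\<epsilon> b * chr_bar b z b = \<epsilon> b * tau b z b - \<epsilon> b * chr b b z" for b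
    using \<Gamma>_skew[of b z b] by (simp add: G_split right_diff_distrib)
  then show ?thesis unfolding sum_if_distribution by (simp add: sum_subtractf)
qed

lemma sum_G_middle: "(\<Sum>a\<in>UNIV. if dst a = \<mu> then 0 else \<epsilon> a * chr_bar a a y) =
    (\<Sum>b | dst b \<noteq> \<mu>. \<epsilon> b * tau b b y) + (\<Sum>b | dst b \<noteq> \<mu>. \<epsilon> b * chr b b y)"
  unfolding sum_if_distribution by (simp add: G_split distrib_left sum.distrib)

text \<open>With all three indices in one distribution only the two diagonal terms of
  \<open>el_coeff\<close> survive, and in them only the traces of \<open>G\<close> over the
  complement.\<close>

lemma EL_same:
  assumes "dst y = dst x" "dst z = dst x"
  shows "g p (trace_perp A k D g (dst x) (tensor_adj g T) p - mean_curv_perp A k D g nabla (dst x) p) (frm z p) * g p (frm x p) (frm y p)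
      + g p (trace_perp A k D g (dst x) T p + mean_curv_perp A k D g nabla (dst x) p) (frm y p) * g p (frm x p) (frm z p) = el x y z"
proof -
  have dk: "dst x \<in> {1..k}" "dst y \<in> {1..k}" "dst z \<in> {1..k}" using lframe_index[OF E] by blast+
  obtain m where ms: "dst x = m" "dst y = m" "dst z = m" using assms by metis
  show ?thesis
    unfolding el_coeff_def sum_G_last sum_G_middle g_simps(1,9) trace_perp_component[OF dk(1)] frame_orthonormal
      mean_curv_perp_component[OF dk(2), unfolded assms] mean_curv_perp_component[OF dk(3), unfolded assms]
    by (simp add: ms)
qed

text \<open>The full sum of \<open>\<Gamma> i i z\<close>, which stems from the divergence, minus
  the part outside the distribution of \<open>x\<close>, which stems from the trace of
  \<open>G\<close>, leaves the mean curvature.\<close>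

lemma EL_last:
  assumes "dst y = dst x" "dst z \<noteq> dst x"
  shows "g p (trace_perp A k D g (dst x) (tensor_adj g T) p + mean_curv A k D g nabla (dst x) p) (frm z p) * g p (frm x p) (frm y p)
        - g p (sff k D g nabla (dst x) (frm x) (frm y) p - integrability k D g nabla (dst x) (frm x) (frm y) p) (frm z p)
        - g p (T p (frm z p) (frm x p)) (frm y p) = el x y z"
proof -
  have dk: "dst x \<in> {1..k}" using lframe_index[OF E] by blast
  have "x \<noteq> z" using assms by auto
  obtain m r where ms: "dst x = m" "dst y = m" "dst z = r" "m \<noteq> r" "r \<noteq> m" using assms by metis
  show ?thesis
    unfolding el_coeff_def sum_G_last sum_G_middle sum_split_distribution[of "\<lambda>i. \<epsilon> i * chr i i z" "dst x"] g_simps(1,9)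
      trace_perp_component[OF dk] frame_orthonormal mean_curv_component[OF assms(2) dk] sff_component[OF assms(2) dk]
      christ_def[of nabla frm x y z p, symmetric] christ_def[of nabla frm y x z p, symmetric] tcomp_def[of T frm z x y p, symmetric]
    using \<Gamma>_skew[of z x y] \<Gamma>_skew[of y x z] \<open>x \<noteq> z\<close> by (simp add: ms G_split field_simps)
qed

text \<open>Here the trace of \<open>G\<close> contributes the outer part of the sum of
  \<open>\<Gamma> i i y\<close> with a plus sign, and subtracting the full sum leaves minus the mean
  curvature.\<close>

lemma EL_middle:
  assumes "dst z = dst x" "dst y \<noteq> dst x"
  shows "g p (trace_perp A k D g (dst x) T p - mean_curv A k D g nabla (dst x) p) (frm y p) * g p (frm x p) (frm z p)
        + g p (sff k D g nabla (dst x) (frm z) (frm x) p + integrability k D g nabla (dst x) (frm z) (frm x) p) (frm y p)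
        - g p (T p (frm y p) (frm z p)) (frm x p) = el x y z"
proof -
  have dk: "dst x \<in> {1..k}" using lframe_index[OF E] by blast
  have "x \<noteq> y" using assms by auto
  obtain m r where ms: "dst x = m" "dst z = m" "dst y = r" "m \<noteq> r" "r \<noteq> m" using assms by metis
  show ?thesis
    unfolding el_coeff_def sum_G_last sum_G_middle sum_split_distribution[of "\<lambda>i. \<epsilon> i * chr i i y" "dst x"] g_simps(1,9)
      trace_perp_component[OF dk] frame_orthonormal mean_curv_component[OF assms(2) dk] sff_component[OF assms(2) dk]
      christ_def[of nabla frm x z y p, symmetric] christ_def[of nabla frm z x y p, symmetric] tcomp_def[of T frm y z x p, symmetric]
    using \<Gamma>_skew[of z x y] \<Gamma>_skew[of y z x] \<open>x \<noteq> y\<close> by (simp add: ms G_split field_simps)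
qed

text \<open>Both diagonal terms and the bracket term vanish, since \<open>y\<close> and
  \<open>z\<close> share a distribution that does not contain \<open>x\<close>. By skewness what is
  left of \<open>\<Gamma>\<close> is its antisymmetrisation in \<open>y\<close> and
  \<open>z\<close>.\<close>

lemma EL_first:
  assumes "dst z = dst y" "dst x \<noteq> dst y"
  shows "g p (2 *\<^sub>R integrability k D g nabla (dst y) (frm y) (frm z) p) (frm x p)
        + g p (T p (frm y p) (frm z p) + tensor_adj g T p (frm z p) (frm y p)) (frm x p) = - el x y z"
proof -
  have dk: "dst y \<in> {1..k}" using lframe_index[OF E] by blast
  have ne: "x \<noteq> y" "x \<noteq> z" using assms by auto
  obtain m r where ms: "dst y = m" "dst z = m" "dst x = r" "m \<noteq> r" "r \<noteq> m" using assms by metis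
  show ?thesis
    unfolding el_coeff_def g_simps(1,3) sff_component[OF assms(2) dk] tensor_adj_eq[where T=T, OF lframe_pframe[OF E] p bilinear_T]
      christ_def[of nabla frm y z x p, symmetric] christ_def[of nabla frm z y x p, symmetric]
      tcomp_def[of T frm y z x p, symmetric] tcomp_def[of T frm z x y p, symmetric]
    using \<Gamma>_skew[of z x y] \<Gamma>_skew[of y x z] ne by (simp add: ms G_split)
qed

text \<open>On either side all Levi-Civita terms cancel in pairs by skewness; both are then
  multiples of the contorsion sum \<open>tau y z x + tau z x y\<close>.\<close>

lemma EL_distinct:
  assumes "dst y \<noteq> dst x" "dst z \<noteq> dst x" "dst z \<noteq> dst y"
  shows "g p (2 *\<^sub>R integrability_perp D g nabla (dst x) (frm y) (frm z) p) (frm x p)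
        + g p (sff_perp D g nabla (dst z) (frm y) (frm x) p + integrability_perp D g nabla (dst z) (frm y) (frm x) p) (frm z p)
        + 2 * g p (T p (frm z p) (frm x p)) (frm y p)
        - g p (sff_perp D g nabla (dst y) (frm z) (frm x) p + integrability_perp D g nabla (dst y) (frm z) (frm x) p) (frm y p)
        + 2 * g p (T p (frm y p) (frm z p)) (frm x p) = - 2 * el x y z"
proof -
  have dk: "dst i \<in> {1..k}" for i using lframe_index[OF E] by blast
  have ne: "x \<noteq> y" "x \<noteq> z" using assms by auto
  show ?thesis
    unfolding el_coeff_def g_simps(1,3) sff_perp_component[OF dk]
      christ_def[of nabla frm y z x p, symmetric] christ_def[of nabla frm z y x p, symmetric] christ_def[of nabla frm y x z p, symmetric]
      christ_def[of nabla frm x y z p, symmetric] christ_def[of nabla frm z x y p, symmetric] christ_def[of nabla frm x z y p, symmetric]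
      tcomp_def[of T frm y z x p, symmetric] tcomp_def[of T frm z x y p, symmetric]
    using assms ne assms[THEN not_sym] \<Gamma>_skew[of z x y] \<Gamma>_skew[of y x z] by (simp add: G_split field_simps)
qed

lemma critical_equations_iff: "critical_equations T E p \<longleftrightarrow> (\<forall>x y z. el x y z = 0)"
proof
  assume eqs: "critical_equations T E p"
  show "\<forall>x y z. el x y z = 0"
  proof (intro allI)
    fix x y z
    have dk: "dst i \<in> {1..k}" and si: "snd (\<beta> i) \<in> {1..n (dst i)}" for i using lframe_index[OF E] by blast+
    consider "dst y = dst x" "dst z = dst x" | "dst y = dst x" "dst z \<noteq> dst x" | "dst z = dst x" "dst y \<noteq> dst x"
      | "dst z = dst y" "dst x \<noteq> dst y" | "dst y \<noteq> dst x" "dst z \<noteq> dst x" "dst z \<noteq> dst y" by metis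
    then show "el x y z = 0"
    proof cases
      case 1
      have m: "snd (\<beta> y) \<in> {1..n (dst x)}" "snd (\<beta> z) \<in> {1..n (dst x)}" using si[of y] si[of z] 1 by simp_all
      show ?thesis
        using eqs[unfolded critical_equations_def, THEN bspec[OF _ dk[of x]], THEN conjunct1, THEN bspec[OF _ si[of x]],
            THEN bspec[OF _ m(1)], THEN bspec[OF _ m(2)]]
        unfolding EL_same[OF 1, symmetric] fe_def 1 by simp
    next
      case 2
      have m: "snd (\<beta> y) \<in> {1..n (dst x)}" "dst z \<in> {1..k} - {dst x}" using si[of y] dk[of z] 2 by simp_all
      show ?thesis
        using eqs[unfolded critical_equations_def, THEN bspec[OF _ dk[of x]], THEN conjunct2, THEN conjunct1,
            THEN bspec[OF _ m(2)], THEN bspec[OF _ si[of x]], THEN bspec[OF _ m(1)], THEN bspec[OF _ si[of z]]]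
        unfolding EL_last[OF 2, symmetric] fe_def 2 by simp
    next
      case 3
      have m: "snd (\<beta> z) \<in> {1..n (dst x)}" "dst y \<in> {1..k} - {dst x}" using si[of z] dk[of y] 3 by simp_all
      show ?thesis
        using eqs[unfolded critical_equations_def, THEN bspec[OF _ dk[of x]], THEN conjunct2, THEN conjunct2, THEN conjunct1,
            THEN bspec[OF _ m(2)], THEN bspec[OF _ si[of x]], THEN bspec[OF _ m(1)], THEN bspec[OF _ si[of y]]]
        unfolding EL_middle[OF 3, symmetric] fe_def 3 by simp
    next
      case 4
      \<comment> \<open>In this equation \<mu> is the distribution of \<open>y\<close> and
        \<open>z\<close>, and \<rho> is that of \<open>x\<close>.\<close>
      have m: "snd (\<beta> z) \<in> {1..n (dst y)}" "dst x \<in> {1..k} - {dst y}" using si[of z] dk[of x] 4 by simp_all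
      have "- el x y z = 0"
        using eqs[unfolded critical_equations_def, THEN bspec[OF _ dk[of y]], THEN conjunct2, THEN conjunct2, THEN conjunct2, THEN conjunct1,
            THEN bspec[OF _ m(2)], THEN bspec[OF _ si[of y]], THEN bspec[OF _ m(1)], THEN bspec[OF _ si[of x]]]
        unfolding EL_first[OF 4, symmetric] fe_def 4 by simp
      then show ?thesis by simp
    next
      case 5
      have m: "dst y \<in> {1..k} - {dst x}" "dst z \<in> {1..k} - {dst x, dst y}" using dk[of y] dk[of z] 5 by simp_all
      have "- 2 * el x y z = 0"
        using eqs[unfolded critical_equations_def, THEN bspec[OF _ dk[of x]], THEN conjunct2, THEN conjunct2, THEN conjunct2, THEN conjunct2,
            THEN bspec[OF _ m(1)], THEN bspec[OF _ m(2)], THEN bspec[OF _ si[of x]], THEN bspec[OF _ si[of y]], THEN bspec[OF _ si[of z]]]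
        unfolding EL_distinct[OF 5, symmetric] fe_def by simp
      then show ?thesis by simp
    qed
  qed
next
  assume EL0: "\<forall>x y z. el x y z = 0"
  have idx: "\<exists>x. dst x = \<mu> \<and> E \<mu> a = frm x" if \<mu>: "\<mu> \<in> {1..k}" and a: "a \<in> {1..n \<mu>}" for \<mu> a
  proof -
    obtain x where "\<beta> x = (\<mu>, a)" using lframe_index_surj[OF E \<mu> a] .
    then show ?thesis by (intro exI[of _ x]) (simp add: fe_def)
  qed
  show "critical_equations T E p"
    unfolding critical_equations_def
  proof (intro ballI conjI)
    fix \<mu> a b c assume \<mu>: "\<mu> \<in> {1..k}" and abc: "a \<in> {1..n \<mu>}" "b \<in> {1..n \<mu>}" "c \<in> {1..n \<mu>}"
    obtain x y z where h: "dst x = \<mu>" "E \<mu> a = frm x" "dst y = \<mu>" "E \<mu> b = frm y" "dst z = \<mu>" "E \<mu> c = frm z"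
      using idx[OF \<mu>] abc by metis
    show "g p (trace_perp A k D g \<mu> (tensor_adj g T) p - mean_curv_perp A k D g nabla \<mu> p) (E \<mu> c p) * g p (E \<mu> a p) (E \<mu> b p)
        + g p (trace_perp A k D g \<mu> T p + mean_curv_perp A k D g nabla \<mu> p) (E \<mu> b p) * g p (E \<mu> a p) (E \<mu> c p) = 0"
      using EL_same[of y x z] EL0 h by simp
  next
    fix \<mu> \<rho> a b i assume \<mu>: "\<mu> \<in> {1..k}" and \<rho>: "\<rho> \<in> {1..k} - {\<mu>}" and abc: "a \<in> {1..n \<mu>}" "b \<in> {1..n \<mu>}" "i \<in> {1..n \<rho>}"
    obtain x y z where h: "dst x = \<mu>" "E \<mu> a = frm x" "dst y = \<mu>" "E \<mu> b = frm y" "dst z = \<rho>" "E \<rho> i = frm z"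
      using idx[OF \<mu>] idx[of \<rho>] \<rho> abc by (metis DiffD1)
    have ne: "dst z \<noteq> dst x" using h \<rho> by simp
    show "g p (trace_perp A k D g \<mu> (tensor_adj g T) p + mean_curv A k D g nabla \<mu> p) (E \<rho> i p) * g p (E \<mu> a p) (E \<mu> b p)
        - g p (sff k D g nabla \<mu> (E \<mu> a) (E \<mu> b) p - integrability k D g nabla \<mu> (E \<mu> a) (E \<mu> b) p) (E \<rho> i p)
        - g p (T p (E \<rho> i p) (E \<mu> a p)) (E \<mu> b p) = 0"
      using EL_last[of y x z] EL0 h ne by simp
    show "g p (trace_perp A k D g \<mu> T p - mean_curv A k D g nabla \<mu> p) (E \<rho> i p) * g p (E \<mu> a p) (E \<mu> b p)
        + g p (sff k D g nabla \<mu> (E \<mu> b) (E \<mu> a) p + integrability k D g nabla \<mu> (E \<mu> b) (E \<mu> a) p) (E \<rho> i p)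
        - g p (T p (E \<rho> i p) (E \<mu> b p)) (E \<mu> a p) = 0"
      using EL_middle[of y x z] EL0 h ne by simp
    show "g p (2 *\<^sub>R integrability k D g nabla \<mu> (E \<mu> a) (E \<mu> b) p) (E \<rho> i p)
        + g p (T p (E \<mu> a p) (E \<mu> b p) + tensor_adj g T p (E \<mu> b p) (E \<mu> a p)) (E \<rho> i p) = 0"
      using EL_first[of y x z] EL0 h ne by simp
  next
    fix \<mu> \<rho> \<xi> a j l assume \<mu>: "\<mu> \<in> {1..k}" and \<rho>: "\<rho> \<in> {1..k} - {\<mu>}" and \<xi>: "\<xi> \<in> {1..k} - {\<mu>, \<rho>}"
      and abc: "a \<in> {1..n \<mu>}" "j \<in> {1..n \<rho>}" "l \<in> {1..n \<xi>}"
    obtain x y z where h: "dst x = \<mu>" "E \<mu> a = frm x" "dst y = \<rho>" "E \<rho> j = frm y" "dst z = \<xi>" "E \<xi> l = frm z"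
      using idx[OF \<mu>] idx[of \<rho>] idx[of \<xi>] \<rho> \<xi> abc by (metis DiffD1)
    have ne: "dst y \<noteq> dst x" "dst z \<noteq> dst x" "dst z \<noteq> dst y" using h \<rho> \<xi> by simp_all
    show "g p (2 *\<^sub>R integrability_perp D g nabla \<mu> (E \<rho> j) (E \<xi> l) p) (E \<mu> a p)
        + g p (sff_perp D g nabla \<xi> (E \<rho> j) (E \<mu> a) p + integrability_perp D g nabla \<xi> (E \<rho> j) (E \<mu> a) p) (E \<xi> l p)
        + 2 * g p (T p (E \<xi> l p) (E \<mu> a p)) (E \<rho> j p)
        - g p (sff_perp D g nabla \<rho> (E \<xi> l) (E \<mu> a) p + integrability_perp D g nabla \<rho> (E \<xi> l) (E \<mu> a) p) (E \<rho> j p)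
        + 2 * g p (T p (E \<rho> j p) (E \<xi> l p)) (E \<mu> a p) = 0"
      using EL_distinct[OF ne] EL0 h by simp
  qed
qed

end

end

section \<open>The first variation of the mixed scalar curvature\<close>

lemma smooth_on_Pair:
  assumes "open S" shows "smooth_on S (\<lambda>x. (t, x))"
proof -
  have "smooth_on S (\<lambda>x. (t, 0) + (0, x))"
    by (intro smooth_on_add smooth_on_const smooth_on_linear assms bounded_linear_Pair bounded_linear_zero bounded_linear_ident)
  then show ?thesis by simp
qed

lemma smooth_on_slice:
  fixes h :: "real \<times> (real ^ 'n::finite) \<Rightarrow> 'b::real_normed_vector"
  assumes "open I" "open U" "smooth_on (I \<times> U) h" "t \<in> I" shows "smooth_on U (\<lambda>x. h (t, x))"
  by (rule smooth_on_compose[OF assms(2) open_Times[OF assms(1,2)] _ smooth_on_Pair[OF assms(2)] assms(3)])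
     (use assms(4) in auto)

lemma smooth_on_snd_compose:
  fixes u :: "real ^ 'n::finite \<Rightarrow> 'b::real_normed_vector"
  assumes "open I" "open U" "smooth_on U u" shows "smooth_on (I \<times> U) (\<lambda>z :: real \<times> (real ^ 'n). u (snd z))"
  by (rule smooth_on_compose[OF open_Times[OF assms(1,2)] assms(2) _ _ assms(3)])
     (auto intro!: smooth_on_linear open_Times assms bounded_linear_snd)

lemma slice_derivatives:
  fixes h :: "real \<times> (real ^ 'n::finite) \<Rightarrow> 'b::real_normed_vector"
  assumes "smooth_on (I \<times> U) h" "t \<in> I" "x \<in> U"
  shows "((\<lambda>s. h (s, x)) has_vector_derivative frechet_derivative h (at (t, x)) (1, 0)) (at t)"
    and "((\<lambda>y. h (t, y)) has_derivative (\<lambda>v. frechet_derivative h (at (t, x)) (0, v))) (at x)"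
proof -
  have h: "(h has_derivative frechet_derivative h (at (t, x))) (at (t, x))"
    by (rule smooth_onD[OF assms(1)]) (use assms in simp)
  have 1: "((\<lambda>s. (s, x)) has_derivative (\<lambda>s. (s, 0))) (at t)" by (auto intro!: derivative_eq_intros)
  have 2: "((\<lambda>y. (t, y)) has_derivative (\<lambda>v. (0, v))) (at x)" by (auto intro!: derivative_eq_intros)
  have eq: "(\<lambda>s. frechet_derivative h (at (t, x)) (s, 0)) = (\<lambda>s. s *\<^sub>R frechet_derivative h (at (t, x)) (1, 0))"
  proof
    fix s
    have "s *\<^sub>R (1 :: real, 0 :: real ^ 'n) = (s, 0)" by simp
    with linear_scale[OF has_derivative_linear[OF h], of s "(1, 0)"]
    show "frechet_derivative h (at (t, x)) (s, 0) = s *\<^sub>R frechet_derivative h (at (t, x)) (1, 0)" by (simp only:)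
  qed
  have "((\<lambda>s. h (s, x)) has_derivative (\<lambda>s. frechet_derivative h (at (t, x)) (s, 0))) (at t)"
    using diff_chain_at[OF 1 h] by (simp add: o_def)
  from has_derivative_eq_rhs[OF this eq]
  show "((\<lambda>s. h (s, x)) has_vector_derivative frechet_derivative h (at (t, x)) (1, 0)) (at t)"
    unfolding has_vector_derivative_def .
  show "((\<lambda>y. h (t, y)) has_derivative (\<lambda>v. frechet_derivative h (at (t, x)) (0, v))) (at x)"
    using diff_chain_at[OF 2 h] by (simp add: o_def)
qed

text \<open>Symmetry of second derivatives on the product of time and space, in the directions
  \<open>(1, 0)\<close> and \<open>(0, v)\<close>.\<close>

lemma slice_derivatives_commute:
  fixes h :: "real \<times> (real ^ 'n::finite) \<Rightarrow> real"
  assumes I: "open I" and U: "open U" and h: "smooth_on (I \<times> U) h" and t: "t \<in> I" and x: "x \<in> U"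
  shows "((\<lambda>s. frechet_derivative (\<lambda>y. h (s, y)) (at x) v) has_real_derivative
     frechet_derivative (\<lambda>y. frechet_derivative h (at (t, y)) (1, 0)) (at x) v) (at t)"
proof -
  have eq: "frechet_derivative (\<lambda>y. h (s, y)) (at x) v = frechet_derivative h (at (s, x)) (0, v)" if "s \<in> I" for s
    using frechet_derivative_at[OF slice_derivatives(2)[OF h that x]] by metis
  have "((\<lambda>s. frechet_derivative h (at (s, x)) (0, v)) has_real_derivative
      frechet_derivative (\<lambda>z. frechet_derivative h (at z) (0, v)) (at (t, x)) (1, 0)) (at t)"
    using slice_derivatives(1)[OF smooth_on_deriv[OF h] t x]
    by (simp add: has_real_derivative_iff_has_vector_derivative)
  moreover have "frechet_derivative (\<lambda>z. frechet_derivative h (at z) (0, v)) (at (t, x)) (1, 0)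
      = frechet_derivative (\<lambda>z. frechet_derivative h (at z) (1, 0)) (at (t, x)) (0, v)"
    by (rule second_deriv_symmetric[OF open_Times[OF I U] _ h]) (use t x in simp)
  moreover have "frechet_derivative (\<lambda>z. frechet_derivative h (at z) (1, 0)) (at (t, x)) (0, v)
      = frechet_derivative (\<lambda>y. frechet_derivative h (at (t, y)) (1, 0)) (at x) v"
    using frechet_derivative_at[OF slice_derivatives(2)[OF smooth_on_deriv[OF h] t x]] by metis
  ultimately have "((\<lambda>s. frechet_derivative h (at (s, x)) (0, v)) has_real_derivative
      frechet_derivative (\<lambda>y. frechet_derivative h (at (t, y)) (1, 0)) (at x) v) (at t)" by simp
  then show ?thesis
    by (rule has_field_derivative_transform_within_open[OF _ I t]) (simp add: eq)
qed

context atlas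
begin

lemma smooth_tensor12_familyD:
  assumes "smooth_tensor12_family A r F" "c \<in> A"
  shows "smooth_on ({-r<..<r} \<times> snd c ` fst c) (\<lambda>z. to_coord A c (chart_inv c (snd z))
     (F (fst z) (chart_inv c (snd z)) (of_coord A c (chart_inv c (snd z)) v) (of_coord A c (chart_inv c (snd z)) w)))"
  using assms unfolding smooth_tensor12_family_def Let_def split_beta by blast

lemma smooth_tensor12_family_slice:
  assumes F: "smooth_tensor12_family A r F" and t: "t \<in> {-r<..<r}"
  shows "smooth_tensor12 A (F t)"
  unfolding smooth_tensor12_def Let_def
proof (intro conjI allI ballI)
  show "bilinear (F t p)" for p using F t unfolding smooth_tensor12_family_def by blast
  fix c v w assume c: "c \<in> A"
  show "smooth_on (snd c ` fst c) (\<lambda>x. to_coord A c (chart_inv c x)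
      (F t (chart_inv c x) (of_coord A c (chart_inv c x) v) (of_coord A c (chart_inv c x) w)))"
    using smooth_on_slice[OF _ chart_image_open[OF c] smooth_tensor12_familyD[OF F c] t] by simp
qed

definition tensor_velocity :: "(real \<Rightarrow> ('a, 'n) tensor12) \<Rightarrow> ('a, 'n) tensor12" where
  "tensor_velocity F p v w = vector_derivative (\<lambda>s. F s p v w) (at 0)"

text \<open>For fixed \<open>p\<close> the maps \<open>to_coord\<close> and \<open>of_coord\<close>
  do not depend on time, so the derivative is taken in chart coordinates and carried back
  linearly.\<close>

lemma family_vector_derivative:
  assumes F: "smooth_tensor12_family A r F" and t: "t \<in> {-r<..<r}" and c: "c \<in> A" "p \<in> fst c"
  shows "((\<lambda>s. F s p v w) has_vector_derivative of_coord A c p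
     (frechet_derivative (\<lambda>z. to_coord A c (chart_inv c (snd z))
     (F (fst z) (chart_inv c (snd z)) (of_coord A c (chart_inv c (snd z)) (to_coord A c p v))
       (of_coord A c (chart_inv c (snd z)) (to_coord A c p w)))) (at (t, snd c p)) (1, 0))) (at t)"
proof -
  have x: "snd c p \<in> snd c ` fst c" using c by blast
  have "bounded_linear (of_coord A c p)"
    using linear_of_coord[OF c] by (simp add: linear_conv_bounded_linear)
  from bounded_linear.has_vector_derivative[OF this slice_derivatives(1)[OF
      smooth_tensor12_familyD[OF F c(1), where v="to_coord A c p v" and w="to_coord A c p w"] t x]]
  show ?thesis by (simp add: chart_inv_left[OF c] of_to_coord[OF c])
qed

lemma tensor_velocity_derivative:
  assumes F: "smooth_tensor12_family A r F" and r: "r > 0"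
  shows "((\<lambda>s. F s p v w) has_vector_derivative tensor_velocity F p v w) (at 0)"
proof -
  have "0 \<in> {-r<..<r}" using r by simp
  from family_vector_derivative[OF F this chart_at, of p v w] show ?thesis
    unfolding tensor_velocity_def using differentiableI_vector vector_derivative_works by blast
qed

lemma smooth_tensor12_velocity:
  assumes F: "smooth_tensor12_family A r F" and r: "r > 0"
  shows "smooth_tensor12 A (tensor_velocity F)"
  unfolding smooth_tensor12_def Let_def
proof (intro conjI allI ballI)
  have b: "bilinear (F t p)" if "t \<in> {-r<..<r}" for t p using F that unfolding smooth_tensor12_family_def by blast
  \<comment> \<open>Derivatives at 0 of functions that agree for times near 0 coincide; this passes
    the bilinearity of each \<open>F t p\<close> on to the velocity.\<close>
  have uni: "a = b" if "((\<lambda>s. F s p u w) has_vector_derivative a) (at 0)"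
      "(f has_vector_derivative b) (at 0)" "\<And>s. s \<in> {-r<..<r} \<Longrightarrow> f s = F s p u w" for p u w a b f
  proof -
    have "((\<lambda>s. F s p u w) has_vector_derivative b) (at 0)"
      by (rule has_vector_derivative_transform_within_open[OF that(2) open_greaterThanLessThan]) (use r that(3) in auto)
    then show ?thesis using that(1) vector_derivative_unique_at by blast
  qed
  note vd = tensor_velocity_derivative[OF F r]
  show "bilinear (tensor_velocity F p)" for p
    unfolding bilinear_def
  proof (intro conjI allI linearI)
    fix u v w c
    show "tensor_velocity F p u (v + w) = tensor_velocity F p u v + tensor_velocity F p u w"
      by (rule uni[OF vd has_vector_derivative_add[OF vd vd]]) (simp add: bilinear_radd[OF b])
    show "tensor_velocity F p (v + w) u = tensor_velocity F p v u + tensor_velocity F p w u"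
      by (rule uni[OF vd has_vector_derivative_add[OF vd vd]]) (simp add: bilinear_ladd[OF b])
    show "tensor_velocity F p u (c *\<^sub>R v) = c *\<^sub>R tensor_velocity F p u v"
      by (rule uni[OF vd bounded_linear.has_vector_derivative[OF bounded_linear_scaleR_right vd]]) (simp add: bilinear_rmul[OF b])
    show "tensor_velocity F p (c *\<^sub>R v) u = c *\<^sub>R tensor_velocity F p v u"
      by (rule uni[OF vd bounded_linear.has_vector_derivative[OF bounded_linear_scaleR_right vd]]) (simp add: bilinear_lmul[OF b])
  qed
  fix c v w assume c: "c \<in> A"
  let ?h = "\<lambda>z. to_coord A c (chart_inv c (snd z))
     (F (fst z) (chart_inv c (snd z)) (of_coord A c (chart_inv c (snd z)) v) (of_coord A c (chart_inv c (snd z)) w))"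
  have "smooth_on (snd c ` fst c) (\<lambda>x. frechet_derivative ?h (at (0, x)) (1, 0))"
    by (rule smooth_on_slice[OF _ chart_image_open[OF c] smooth_on_deriv[OF smooth_tensor12_familyD[OF F c]]]) (use r in auto)
  then show "smooth_on (snd c ` fst c) (\<lambda>x. to_coord A c (chart_inv c x)
      (tensor_velocity F (chart_inv c x) (of_coord A c (chart_inv c x) v) (of_coord A c (chart_inv c x) w)))"
  proof (rule smooth_on_cong[OF chart_image_open[OF c], rotated])
    fix x assume x: "x \<in> snd c ` fst c"
    let ?p = "chart_inv c x"
    have p: "?p \<in> fst c" "snd c ?p = x" using chart_inv_in[OF c x] chart_inv_right[OF c x] by auto
    have "0 \<in> {-r<..<r}" using r by simp
    from family_vector_derivative[OF F this c p(1), of "of_coord A c ?p v" "of_coord A c ?p w"]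
    have "tensor_velocity F ?p (of_coord A c ?p v) (of_coord A c ?p w) = of_coord A c ?p (frechet_derivative ?h (at (0, x)) (1, 0))"
      unfolding tensor_velocity_def by (simp add: to_of_coord[OF c p(1)] p(2) vector_derivative_at)
    then show "frechet_derivative ?h (at (0, x)) (1, 0) = to_coord A c ?p (tensor_velocity F ?p (of_coord A c ?p v) (of_coord A c ?p w))"
      by (simp add: to_of_coord[OF c p(1)])
  qed
qed

lemma smooth_tensor12_line:
  assumes T: "smooth_tensor12 A T" and B: "smooth_tensor12 A B"
  shows "smooth_tensor12_family A r (\<lambda>t p v w. T p v w + t *\<^sub>R B p v w)"
  unfolding smooth_tensor12_family_def Let_def split_beta
proof (intro conjI allI ballI)
  have b: "bilinear (T p)" "bilinear (B p)" for p using T B by (auto simp: smooth_tensor12_def)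
  show "bilinear (\<lambda>v w. T p v w + t *\<^sub>R B p v w)" for p t
    unfolding bilinear_def
    by (auto intro!: linearI simp: bilinear_ladd[OF b(1)] bilinear_radd[OF b(1)] bilinear_lmul[OF b(1)] bilinear_rmul[OF b(1)]
      bilinear_ladd[OF b(2)] bilinear_radd[OF b(2)] bilinear_lmul[OF b(2)] bilinear_rmul[OF b(2)] algebra_simps)
  fix c v w assume c: "c \<in> A"
  let ?I = "{-r<..<r}" and ?U = "snd c ` fst c"
  have o: "open (?I \<times> ?U)" using chart_image_open[OF c] by (simp add: open_Times)
  let ?t = "\<lambda>T x. to_coord A c (chart_inv c x) (T (chart_inv c x) (of_coord A c (chart_inv c x) v) (of_coord A c (chart_inv c x) w))"
  have s: "smooth_on ?U (?t T)" if "smooth_tensor12 A T" for T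
    using that c unfolding smooth_tensor12_def Let_def by blast
  have f: "smooth_on (?I \<times> ?U) fst" by (rule smooth_on_linear[OF o bounded_linear_fst])
  have "smooth_on (?I \<times> ?U) (\<lambda>z. ?t T (snd z) + fst z *\<^sub>R ?t B (snd z))"
    by (rule smooth_on_add[OF o smooth_on_snd_compose[OF _ chart_image_open[OF c] s[OF T]]
        smooth_on_scaleR[OF o f smooth_on_snd_compose[OF _ chart_image_open[OF c] s[OF B]]]]) auto
  then show "smooth_on (?I \<times> ?U) (\<lambda>z. to_coord A c (chart_inv c (snd z)) (T (chart_inv c (snd z)) (of_coord A c (chart_inv c (snd z)) v)
      (of_coord A c (chart_inv c (snd z)) w) + fst z *\<^sub>R B (chart_inv c (snd z)) (of_coord A c (chart_inv c (snd z)) v) (of_coord A c (chart_inv c (snd z)) w)))"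
    by (rule smooth_on_cong[OF o, rotated])
       (use chart_inv_in[OF c] in \<open>auto simp: linear_add[OF linear_to_coord[OF c]] linear_scale[OF linear_to_coord[OF c]]\<close>)
qed

lemma tensor_velocity_line: "tensor_velocity (\<lambda>t p v w. T p v w + t *\<^sub>R B p v w) = B"
proof (intro ext)
  fix p v w
  have "((\<lambda>t. T p v w + t *\<^sub>R B p v w) has_vector_derivative B p v w) (at 0)"
    by (auto intro!: derivative_eq_intros)
  then show "tensor_velocity (\<lambda>t p v w. T p v w + t *\<^sub>R B p v w) p v w = B p v w"
    unfolding tensor_velocity_def by (rule vector_derivative_at)
qed

end

context metric_atlas
begin

lemma smooth_on_family_component:
  assumes F: "smooth_tensor12_family A r F" and e: "pframe W e \<epsilon>" and c: "c \<in> A"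
  shows "smooth_on ({-r<..<r} \<times> snd c ` (fst c \<inter> W)) (\<lambda>z. tcomp (F (fst z)) e i j l (chart_inv c (snd z)))"
proof -
  let ?I = "{-r<..<r}" and ?U = "snd c ` (fst c \<inter> W)"
  have W: "open W" and se: "smooth_field A W (e i)" for i using e by (auto simp: pframe_def)
  have U: "open ?U" by (rule open_chart_image[OF c W])
  have o: "open (?I \<times> ?U)" using U by (simp add: open_Times)
  have sub: "snd ` (?I \<times> ?U) \<subseteq> snd c ` fst c" by auto
  have se': "smooth_on (?I \<times> ?U) (\<lambda>z. field_coord A c (e i) (snd z))" for i
    by (rule smooth_on_snd_compose[OF _ U smooth_fieldD[OF se c]]) simp
  let ?p = "\<lambda>z :: real \<times> (real ^ 'n). chart_inv c (snd z)"
  have sF: "smooth_on (?I \<times> ?U) (\<lambda>z. to_coord A c (?p z) (F (fst z) (?p z) (of_coord A c (?p z) v) (of_coord A c (?p z) w)))" for v w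
    by (rule smooth_on_subset[OF smooth_tensor12_familyD[OF F c]]) auto
  have bF: "bilinear (F (fst z) (?p z))" if "z \<in> ?I \<times> ?U" for z
    using F that unfolding smooth_tensor12_family_def by auto
  have t: "smooth_on (?I \<times> ?U) (\<lambda>z. to_coord A c (?p z) (F (fst z) (?p z) (of_coord A c (?p z) (field_coord A c (e i) (snd z)))
      (of_coord A c (?p z) (field_coord A c (e j) (snd z)))))"
    by (rule smooth_on_tensor_coord[where \<pi>=snd and F="\<lambda>z. F (fst z) (?p z)", OF c o sub se' se' bF sF])
  have "smooth_on (?I \<times> ?U) (\<lambda>z. g (?p z) (of_coord A c (?p z) (to_coord A c (?p z) (F (fst z) (?p z)
      (of_coord A c (?p z) (field_coord A c (e i) (snd z))) (of_coord A c (?p z) (field_coord A c (e j) (snd z))))))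
      (of_coord A c (?p z) (field_coord A c (e l) (snd z))))"
    by (rule smooth_on_g_coord[where \<pi>=snd, OF c o smooth_on_linear[OF o bounded_linear_snd] sub t se'])
  then show ?thesis
    by (rule smooth_on_cong[OF o, rotated])
       (auto simp: tcomp_def field_coord_def chart_inv_left[OF c] of_to_coord[OF c])
qed

end

context multi_product
begin

definition mixed_curv :: "('a, 'n) tensor12 \<Rightarrow> 'a \<Rightarrow> real" where
  "mixed_curv T = mixed_scalar_curv A k n D g nabla T"

lemma mixed_curv_frame:
  fixes e
  assumes T: "smooth_tensor12 A T" and E: "lframe W E \<beta> \<epsilon>" and p: "p \<in> W"
  defines "e \<equiv> fe E \<beta>"
  shows "mixed_curv T p = (1/2) * (\<Sum>i\<in>UNIV. \<Sum>j\<in>UNIV. if fst (\<beta> i) = fst (\<beta> j) then 0 else \<epsilon> i * \<epsilon> j *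
     ((dir_deriv A (e j) (christ nabla e i i j) p + dir_deriv A (e j) (tcomp T e i i j) p)
      - (dir_deriv A (e i) (christ nabla e j i j) p + dir_deriv A (e i) (tcomp T e j i j) p)
      + (\<Sum>l\<in>UNIV. \<epsilon> l * ((christ nabla e i i l p + tcomp T e i i l p) * (christ nabla e j l j p + tcomp T e j l j p)
         - (christ nabla e j i l p + tcomp T e j i l p) * (christ nabla e i l j p + tcomp T e i l j p)
         + (christ nabla e i j l p - christ nabla e j i l p) * (christ nabla e l i j p + tcomp T e l i j p)))))"
proof -
  have pf: "pframe W e \<epsilon>" using lframe_pframe[OF E] by (simp add: e_def)
  have "dir_deriv A X (christ (nabla_bar nabla T) e i j l) p
      = dir_deriv A X (christ nabla e i j l) p + dir_deriv A X (tcomp T e i j l) p" for X i j l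
  proof -
    have "christ (nabla_bar nabla T) e i j l = (\<lambda>q. christ nabla e i j l q + tcomp T e i j l q)"
      by (rule ext) (rule christ_nabla_bar)
    then show ?thesis using dir_deriv_add[OF smooth_fun_christ[OF pf] smooth_fun_tcomp[OF pf T] p] by simp
  qed
  then show ?thesis
    unfolding mixed_curv_def mixed_scalar_curv_frame[OF T E p] e_def[symmetric] curv_bar_component[OF T pf p]
    by (simp only: christ_nabla_bar)
qed

text \<open>The derivative along \<open>B\<close> of the frame formula for the mixed curvature:
  products of connection coefficients follow the product rule, while the bracket coefficients belong
  to \<open>nabla\<close> and do not vary.\<close>

definition curv_variation where
  "curv_variation T B E \<beta> \<epsilon> p = (let e = fe E \<beta>; G = (\<lambda>i j l. christ (nabla_bar nabla T) e i j l p) in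
     (1/2) * (\<Sum>i\<in>UNIV. \<Sum>j\<in>UNIV. if fst (\<beta> i) = fst (\<beta> j) then 0 else \<epsilon> i * \<epsilon> j *
     (dir_deriv A (e j) (tcomp B e i i j) p - dir_deriv A (e i) (tcomp B e j i j) p
      + (\<Sum>l\<in>UNIV. \<epsilon> l * (tcomp B e i i l p * G j l j + G i i l * tcomp B e j l j p
         - tcomp B e j i l p * G i l j - G j i l * tcomp B e i l j p
         + (christ nabla e i j l p - christ nabla e j i l p) * tcomp B e l i j p)))))"

context
  fixes r F c W E \<beta> \<epsilon>
  assumes F: "smooth_tensor12_family A r F" and c: "c \<in> A" and E: "lframe W E \<beta> \<epsilon>"
begin

lemma family_dir_deriv:
  assumes "t \<in> {-r<..<r}" "x \<in> snd c ` (fst c \<inter> W)"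
  shows "dir_deriv A X (tcomp (F t) (fe E \<beta>) i j l) (chart_inv c x)
    = frechet_derivative (\<lambda>y. tcomp (F t) (fe E \<beta>) i j l (chart_inv c y)) (at x) (field_coord A c X x)"
proof -
  obtain q where q: "q \<in> fst c" "q \<in> W" "x = snd c q" using assms by auto
  show ?thesis
    using dir_deriv_chart[OF smooth_fun_tcomp[OF lframe_pframe[OF E] smooth_tensor12_family_slice[OF F assms(1)]] q(2) c q(1)]
    by (simp add: q(3) chart_inv_left[OF c q(1)] field_coord_def o_def)
qed

text \<open>Joint smoothness in time and position is stronger than smoothness of each slice; it is
  the source of the locally uniform bounds used under the integral sign.\<close>

lemma smooth_on_mixed_curv_family:
  "smooth_on ({-r<..<r} \<times> snd c ` (fst c \<inter> W)) (\<lambda>z. mixed_curv (F (fst z)) (chart_inv c (snd z)))"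
proof -
  let ?I = "{-r<..<r}" and ?U = "snd c ` (fst c \<inter> W)"
  let ?e = "fe E \<beta>"
  have pf: "pframe W ?e \<epsilon>" by (rule lframe_pframe[OF E])
  have W: "open W" and se: "smooth_field A W (?e i)" for i using pf by (auto simp: pframe_def)
  have U: "open ?U" by (rule open_chart_image[OF c W])
  have I: "open ?I" by simp
  have o: "open (?I \<times> ?U)" using U by (simp add: open_Times)
  let ?p = "\<lambda>z :: real \<times> (real ^ 'n). chart_inv c (snd z)"
  have ch: "smooth_on (?I \<times> ?U) (\<lambda>z. christ nabla ?e i j l (?p z))" for i j l
    using smooth_on_snd_compose[OF I U smooth_funD[OF smooth_fun_christ[OF pf] c]] by (simp add: o_def)
  have dch: "smooth_on (?I \<times> ?U) (\<lambda>z. dir_deriv A (?e m) (christ nabla ?e i j l) (?p z))" for i j l m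
    using smooth_on_snd_compose[OF I U smooth_funD[OF smooth_fun_dir_deriv[OF W smooth_fun_christ[OF pf] se] c]] by (simp add: o_def)
  have tc: "smooth_on (?I \<times> ?U) (\<lambda>z. tcomp (F (fst z)) ?e i j l (?p z))" for i j l
    by (rule smooth_on_family_component[OF F pf c])
  have dtc: "smooth_on (?I \<times> ?U) (\<lambda>z. dir_deriv A (?e m) (tcomp (F (fst z)) ?e i j l) (?p z))" for i j l m
  proof (rule smooth_on_cong[OF o])
    \<comment> \<open>The spatial derivative of a slice is the derivative of the joint function in a
      direction \<open>(0, v)\<close>, which is smooth in time as well.\<close>
    let ?h = "\<lambda>z. tcomp (F (fst z)) ?e i j l (?p z)"
    show "smooth_on (?I \<times> ?U) (\<lambda>z. \<Sum>s\<in>UNIV. field_coord A c (?e m) (snd z) $ s * frechet_derivative ?h (at z) (0, axis s 1))"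
      by (intro smooth_on_sum smooth_on_mult smooth_on_deriv tc o smooth_on_nth smooth_on_snd_compose[OF I U smooth_fieldD[OF se c]])
    fix z assume "z \<in> ?I \<times> ?U"
    then obtain t x where z: "z = (t, x)" "t \<in> ?I" "x \<in> ?U" by blast
    have d: "((\<lambda>y. tcomp (F t) ?e i j l (chart_inv c y)) has_derivative (\<lambda>v. frechet_derivative ?h (at (t, x)) (0, v))) (at x)"
      using slice_derivatives(2)[OF tc z(2,3)] by simp
    have "dir_deriv A (?e m) (tcomp (F t) ?e i j l) (chart_inv c x) = frechet_derivative ?h (at (t, x)) (0, field_coord A c (?e m) x)"
      unfolding family_dir_deriv[OF z(2,3)] frechet_derivative_at[OF d, symmetric] ..
    also have "\<dots> = (\<Sum>s\<in>UNIV. field_coord A c (?e m) x $ s *\<^sub>R frechet_derivative ?h (at (t, x)) (0, axis s 1))"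
      by (rule linear_axis_expansion[OF has_derivative_linear[OF d]])
    finally show "(\<Sum>s\<in>UNIV. field_coord A c (?e m) (snd z) $ s * frechet_derivative ?h (at z) (0, axis s 1))
        = dir_deriv A (?e m) (tcomp (F (fst z)) ?e i j l) (?p z)" by (simp add: z(1))
  qed
  \<comment> \<open>The case distinction sits in a constant factor, so that the smoothness rules for
    sums and products apply to the whole expression.\<close>
  let ?M = "\<lambda>z. (1/2) * (\<Sum>i\<in>UNIV. \<Sum>j\<in>UNIV. (if fst (\<beta> i) = fst (\<beta> j) then 0 else \<epsilon> i * \<epsilon> j) *
     ((dir_deriv A (?e j) (christ nabla ?e i i j) (?p z) + dir_deriv A (?e j) (tcomp (F (fst z)) ?e i i j) (?p z))
      - (dir_deriv A (?e i) (christ nabla ?e j i j) (?p z) + dir_deriv A (?e i) (tcomp (F (fst z)) ?e j i j) (?p z))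
      + (\<Sum>l\<in>UNIV. \<epsilon> l * ((christ nabla ?e i i l (?p z) + tcomp (F (fst z)) ?e i i l (?p z)) * (christ nabla ?e j l j (?p z) + tcomp (F (fst z)) ?e j l j (?p z))
         - (christ nabla ?e j i l (?p z) + tcomp (F (fst z)) ?e j i l (?p z)) * (christ nabla ?e i l j (?p z) + tcomp (F (fst z)) ?e i l j (?p z))
         + (christ nabla ?e i j l (?p z) - christ nabla ?e j i l (?p z)) * (christ nabla ?e l i j (?p z) + tcomp (F (fst z)) ?e l i j (?p z))))))"
  have M: "smooth_on (?I \<times> ?U) ?M"
    by (intro smooth_on_mult smooth_on_sum smooth_on_add smooth_on_diff smooth_on_const ch dch tc dtc o)
  show ?thesis
  proof (rule smooth_on_cong[OF o _ M])
    fix z assume z: "z \<in> ?I \<times> ?U"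
    then have q: "?p z \<in> W" using chart_inv_left[OF c] by auto
    have T: "smooth_tensor12 A (F (fst z))" by (rule smooth_tensor12_family_slice[OF F]) (use z in auto)
    show "?M z = mixed_curv (F (fst z)) (?p z)"
      unfolding mixed_curv_frame[OF T E q] by (intro arg_cong[where f="\<lambda>x. (1/2) * x"] sum.cong refl) simp
  qed
qed

lemma mixed_curv_first_variation:
  assumes r: "r > 0" and p: "p \<in> fst c" "p \<in> W"
  shows "((\<lambda>t. mixed_curv (F t) p) has_real_derivative curv_variation (F 0) (tensor_velocity F) E \<beta> \<epsilon> p) (at 0)"
proof -
  let ?I = "{-r<..<r}" and ?U = "snd c ` (fst c \<inter> W)" and ?x = "snd c p"
  let ?e = "fe E \<beta>" and ?B = "tensor_velocity F"
  have pf: "pframe W ?e \<epsilon>" by (rule lframe_pframe[OF E])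
  have W: "open W" and se: "smooth_field A W (?e i)" for i using pf by (auto simp: pframe_def)
  have U: "open ?U" by (rule open_chart_image[OF c W])
  have x: "?x \<in> ?U" using p by blast
  have I: "0 \<in> ?I" "open ?I" using r by auto
  have sB: "smooth_tensor12 A ?B" by (rule smooth_tensor12_velocity[OF F r])
  note tc = smooth_on_family_component[OF F pf c]
  have tcomp_deriv: "((\<lambda>t. tcomp (F t) ?e i j l q) has_real_derivative tcomp ?B ?e i j l q) (at 0)" for i j l q
  proof -
    have "bounded_linear (\<lambda>v. g q v (?e l q))"
      using bilinear_g[of q] by (simp add: bilinear_def linear_conv_bounded_linear)
    from bounded_linear.has_vector_derivative[OF this tensor_velocity_derivative[OF F r]]
    show ?thesis by (simp add: tcomp_def has_real_derivative_iff_has_vector_derivative)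
  qed
  \<comment> \<open>Differentiation in time commutes with differentiation along a frame vector, so
    the derivative terms vary into derivatives of the components of the velocity.\<close>
  have dir: "((\<lambda>t. dir_deriv A (?e m) (tcomp (F t) ?e i j l) p) has_real_derivative dir_deriv A (?e m) (tcomp ?B ?e i j l) p) (at 0)" for i j l m
  proof -
    let ?h = "\<lambda>z. tcomp (F (fst z)) ?e i j l (chart_inv c (snd z))"
    let ?v = "field_coord A c (?e m) ?x"
    have eq: "frechet_derivative ?h (at (0, y)) (1, 0) = tcomp ?B ?e i j l (chart_inv c y)" if "y \<in> ?U" for y
      using slice_derivatives(1)[OF tc I(1) that, of i j l] tcomp_deriv[of i j l "chart_inv c y"]
      by (auto simp: has_real_derivative_iff_has_vector_derivative intro: vector_derivative_unique_at)
    have sl: "smooth_on ?U (\<lambda>y. frechet_derivative ?h (at (0, y)) (1, 0))"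
      by (rule smooth_on_slice[OF I(2) U smooth_on_deriv[OF tc] I(1)])
    have "((\<lambda>s. frechet_derivative (\<lambda>y. ?h (s, y)) (at ?x) ?v) has_real_derivative
       frechet_derivative (\<lambda>y. frechet_derivative ?h (at (0, y)) (1, 0)) (at ?x) ?v) (at 0)"
      by (rule slice_derivatives_commute[OF I(2) U tc I(1) x])
    also have "frechet_derivative (\<lambda>y. frechet_derivative ?h (at (0, y)) (1, 0)) (at ?x)
        = frechet_derivative (\<lambda>y. tcomp ?B ?e i j l (chart_inv c y)) (at ?x)"
      by (rule frechet_derivative_cong_open[OF U x _ smooth_on_differentiable[OF sl x], symmetric]) (rule eq)
    also have "frechet_derivative (\<lambda>y. tcomp ?B ?e i j l (chart_inv c y)) (at ?x) ?v = dir_deriv A (?e m) (tcomp ?B ?e i j l) p"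
      using dir_deriv_chart[OF smooth_fun_tcomp[OF pf sB] p(2) c p(1)] by (simp add: field_coord_def chart_inv_left[OF c p(1)] o_def)
    finally show ?thesis
      by (rule has_field_derivative_transform_within_open[OF _ I(2,1)])
         (use family_dir_deriv[OF _ x] in \<open>simp add: chart_inv_left[OF c p(1)]\<close>)
  qed
  define C where "C = (\<lambda>t i j. if fst (\<beta> i) = fst (\<beta> j) then 0 else \<epsilon> i * \<epsilon> j *
     ((dir_deriv A (?e j) (christ nabla ?e i i j) p + dir_deriv A (?e j) (tcomp (F t) ?e i i j) p)
      - (dir_deriv A (?e i) (christ nabla ?e j i j) p + dir_deriv A (?e i) (tcomp (F t) ?e j i j) p)
      + (\<Sum>l\<in>UNIV. \<epsilon> l * ((christ nabla ?e i i l p + tcomp (F t) ?e i i l p) * (christ nabla ?e j l j p + tcomp (F t) ?e j l j p)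
         - (christ nabla ?e j i l p + tcomp (F t) ?e j i l p) * (christ nabla ?e i l j p + tcomp (F t) ?e i l j p)
         + (christ nabla ?e i j l p - christ nabla ?e j i l p) * (christ nabla ?e l i j p + tcomp (F t) ?e l i j p)))))"
  define G where "G = (\<lambda>i j l. christ (nabla_bar nabla (F 0)) ?e i j l p)"
  define C' where "C' = (\<lambda>i j. if fst (\<beta> i) = fst (\<beta> j) then 0 else \<epsilon> i * \<epsilon> j *
     (dir_deriv A (?e j) (tcomp ?B ?e i i j) p - dir_deriv A (?e i) (tcomp ?B ?e j i j) p
      + (\<Sum>l\<in>UNIV. \<epsilon> l * (tcomp ?B ?e i i l p * G j l j + G i i l * tcomp ?B ?e j l j p
         - tcomp ?B ?e j i l p * G i l j - G j i l * tcomp ?B ?e i l j p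
         + (christ nabla ?e i j l p - christ nabla ?e j i l p) * tcomp ?B ?e l i j p))))"
  have CC: "((\<lambda>t. C t i j) has_real_derivative C' i j) (at 0)" for i j
    unfolding C_def C'_def G_def christ_nabla_bar
    by (cases "fst (\<beta> i) = fst (\<beta> j)")
       (auto intro!: derivative_eq_intros dir tcomp_deriv sum.cong simp: algebra_simps)
  have "((\<lambda>t. (1/2) * (\<Sum>i\<in>UNIV. \<Sum>j\<in>UNIV. C t i j)) has_real_derivative (1/2) * (\<Sum>i\<in>UNIV. \<Sum>j\<in>UNIV. C' i j)) (at 0)"
    by (intro DERIV_cmult DERIV_sum CC)
  then have "((\<lambda>t. mixed_curv (F t) p) has_real_derivative (1/2) * (\<Sum>i\<in>UNIV. \<Sum>j\<in>UNIV. C' i j)) (at 0)"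
  proof (rule has_field_derivative_transform_within_open[OF _ I(2,1)])
    fix t assume t: "t \<in> ?I"
    show "(1/2) * (\<Sum>i\<in>UNIV. \<Sum>j\<in>UNIV. C t i j) = mixed_curv (F t) p"
      unfolding mixed_curv_frame[OF smooth_tensor12_family_slice[OF F t] E p(2)] C_def ..
  qed
  then show ?thesis unfolding curv_variation_def Let_def C'_def G_def .
qed

end

end

section \<open>The divergence theorem\<close>

text \<open>In the permutation expansion, a permutation other than the identity moves at least two
  points, so every product with one factor removed still contains an off-diagonal entry of the unit
  matrix. Only the identity contributes, and it gives the trace.\<close>

lemma has_derivative_det_at_identity:
  fixes N :: "'a::real_normed_vector \<Rightarrow> real ^ 'n ^ 'n"
  assumes N: "\<And>i j. ((\<lambda>y. N y $ i $ j) has_derivative (\<lambda>h. N' h i j)) (at x)" and id: "N x = mat 1"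
  shows "((\<lambda>y. det (N y)) has_derivative (\<lambda>h. \<Sum>i\<in>UNIV. N' h i i)) (at x)"
proof -
  let ?P = "{p. p permutes (UNIV :: 'n set)}"
  have "((\<lambda>y. det (N y)) has_derivative (\<lambda>h. \<Sum>p\<in>?P. of_int (sign p) *
      (\<Sum>i\<in>UNIV. N' h i (p i) * (\<Prod>j\<in>UNIV - {i}. N x $ j $ p j)))) (at x)"
    unfolding det_def by (intro has_derivative_sum has_derivative_mult_right has_derivative_prod N)
  moreover have "(\<Sum>p\<in>?P. of_int (sign p) * (\<Sum>i\<in>UNIV. N' h i (p i) * (\<Prod>j\<in>UNIV - {i}. N x $ j $ p j)))
      = (\<Sum>i\<in>UNIV. N' h i i)" for h
  proof -
    have z: "(\<Prod>j\<in>UNIV - {i}. N x $ j $ p j) = 0" if p: "p permutes (UNIV :: 'n set)" and ne: "p \<noteq> id" for p i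
    proof -
      have "\<exists>j. j \<noteq> i \<and> p j \<noteq> j"
      proof (rule ccontr)
        assume "\<not> (\<exists>j. j \<noteq> i \<and> p j \<noteq> j)"
        then have fixed: "p j = j" if "j \<noteq> i" for j using that by blast
        have "p i = i"
        proof (rule ccontr)
          assume "p i \<noteq> i"
          then have "p (p i) = p i" by (rule fixed)
          then show False using \<open>p i \<noteq> i\<close> permutes_inj[OF p] by (auto simp: inj_def)
        qed
        then have "p = id" using fixed by (metis eq_id_iff)
        then show False using ne by contradiction
      qed
      then obtain j where "j \<noteq> i" "p j \<noteq> j" by blast
      then show ?thesis by (intro prod_zero) (auto simp: id mat_def intro!: bexI[of _ j])
    qed
    have "(\<Sum>p\<in>?P. of_int (sign p) * (\<Sum>i\<in>UNIV. N' h i (p i) * (\<Prod>j\<in>UNIV - {i}. N x $ j $ p j)))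
       = (\<Sum>p\<in>?P. if p = id then \<Sum>i\<in>UNIV. N' h i i else 0)"
    proof (rule sum.cong[OF refl])
      fix p assume p: "p \<in> ?P"
      show "of_int (sign p) * (\<Sum>i\<in>UNIV. N' h i (p i) * (\<Prod>j\<in>UNIV - {i}. N x $ j $ p j))
          = (if p = id then \<Sum>i\<in>UNIV. N' h i i else 0)"
      proof (cases "p = id")
        case True then show ?thesis by (simp add: id mat_def sign_id)
      next
        case False then show ?thesis using p by (simp add: z)
      qed
    qed
    then show ?thesis using finite_permutations[OF finite, of "UNIV :: 'n set"] by (simp add: permutes_id)
  qed
  ultimately show ?thesis by simp
qed

text \<open>Jacobi's formula, reduced to the case of the unit matrix by multiplying with the
  constant inverse \<open>L\<close>.\<close>

lemma has_derivative_det_nonsingular: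
  fixes M :: "'a::real_normed_vector \<Rightarrow> real ^ 'n ^ 'n"
  assumes M: "\<And>i j. ((\<lambda>y. M y $ i $ j) has_derivative (\<lambda>h. M' h i j)) (at x)"
    and inv: "L ** M x = mat 1"
  shows "((\<lambda>y. det (M y)) has_derivative (\<lambda>h. det (M x) * (\<Sum>i\<in>UNIV. \<Sum>j\<in>UNIV. L $ i $ j * M' h j i))) (at x)"
proof -
  have d: "det L * det (M x) = 1" by (metis inv det_mul det_I)
  have "((\<lambda>y. det (L ** M y)) has_derivative (\<lambda>h. \<Sum>i\<in>UNIV. \<Sum>j\<in>UNIV. L $ i $ j * M' h j i)) (at x)"
    by (rule has_derivative_det_at_identity[where N="\<lambda>y. L ** M y" and N'="\<lambda>h i j. \<Sum>k\<in>UNIV. L $ i $ k * M' h k j", OF _ inv])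
       (simp add: matrix_matrix_mult_def, intro has_derivative_sum has_derivative_mult_right M)
  then have "((\<lambda>y. det (M x) * det (L ** M y)) has_derivative (\<lambda>h. det (M x) * (\<Sum>i\<in>UNIV. \<Sum>j\<in>UNIV. L $ i $ j * M' h j i))) (at x)"
    by (rule has_derivative_mult_right)
  moreover have "det (M x) * det (L ** M y) = det (M y)" for y
    using d by (simp add: det_mul mult.assoc[symmetric] mult.commute[of _ "det L"])
  ultimately show ?thesis by simp
qed

text \<open>The derivative of \<open>f\<close> is given in the logarithmic form in which Jacobi's
  formula provides it. Near \<open>x\<close> the sign \<open>s\<close> of \<open>f\<close> is
  constant, so the absolute value of \<open>f\<close> is \<open>s * f\<close> there.\<close>

lemma has_derivative_inverse_abs:
  fixes f :: "'a::real_normed_vector \<Rightarrow> real"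
  assumes f: "(f has_derivative (\<lambda>h. f x * f' h)) (at x)" and nz: "f x \<noteq> 0"
  shows "((\<lambda>y. inverse \<bar>f y\<bar>) has_derivative (\<lambda>h. - (inverse \<bar>f x\<bar> * f' h))) (at x)"
proof -
  define s where "s = sgn (f x)"
  have s: "s * f x = \<bar>f x\<bar>" "s \<noteq> 0" "s * \<bar>f x\<bar> = f x" using nz by (simp_all add: s_def sgn_if)
  have "((\<lambda>y. inverse (s * f y)) has_derivative (\<lambda>h. - (inverse (s * f x) * (s * (f x * f' h)) * inverse (s * f x)))) (at x)"
    by (rule Deriv.has_derivative_inverse[OF _ has_derivative_mult_right[OF f]]) (use s nz in simp)
  moreover have "inverse (s * f x) * (s * (f x * f' h)) * inverse (s * f x) = inverse \<bar>f x\<bar> * f' h" for h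
    using s nz by (simp add: field_simps)
  ultimately have d: "((\<lambda>y. inverse (s * f y)) has_derivative (\<lambda>h. - (inverse \<bar>f x\<bar> * f' h))) (at x)" by (simp only:)
  have "isCont (\<lambda>y. s * f y) x" using has_derivative_continuous[OF f] by (intro continuous_intros) auto
  moreover have pos: "s * f x > 0" using s nz by simp
  ultimately obtain r where r: "r > 0" "\<And>y. dist y x < r \<Longrightarrow> \<bar>s * f y - s * f x\<bar> < s * f x"
    unfolding continuous_at_eps_delta dist_real_def by metis
  define S where "S = ball x r"
  have S: "open S" "x \<in> S" "\<And>y. y \<in> S \<Longrightarrow> s * f y > 0"
    using r pos by (auto simp: S_def dist_commute abs_less_iff)
  show ?thesis
  proof (rule has_derivative_transform_within_open[OF d S(1,2)])
    fix y assume "y \<in> S"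
    then have "\<bar>s * f y\<bar> = s * f y" using S(3) by (simp add: less_imp_le)
    moreover have "\<bar>s * f y\<bar> = \<bar>f y\<bar>" using nz by (simp add: abs_mult s_def sgn_if)
    ultimately show "inverse (s * f y) = inverse \<bar>f y\<bar>" by simp
  qed
qed

text \<open>The divergence of \<open>v e\<^bsub>j\<^esub>\<close> with respect to the density \<open>1 / \<bar>det (e\<^bsub>1\<^esub>, \<dots>, e\<^bsub>n\<^esub>)\<bar>\<close>;
  \<open>L\<close> is the inverse of the matrix with columns \<open>e\<^bsub>i\<^esub>\<close>.\<close>

lemma divergence_frame_density:
  fixes e :: "'n::finite \<Rightarrow> real ^ 'n \<Rightarrow> real ^ 'n" and v :: "real ^ 'n \<Rightarrow> real"
  defines "M \<equiv> \<lambda>y. (\<chi> i j. e j y $ i)"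
  assumes e: "\<And>i. (e i has_derivative e' i) (at x)" and v: "(v has_derivative v') (at x)" and L: "L ** M x = mat 1"
  shows "(\<Sum>i\<in>UNIV. frechet_derivative (\<lambda>y. inverse \<bar>det (M y)\<bar> * v y * e j y $ i) (at x) (axis i 1))
      = inverse \<bar>det (M x)\<bar> * (v' (e j x) + v x * (\<Sum>i\<in>UNIV. (L *v (e' j (e i x) - e' i (e j x))) $ i))"
proof -
  have nz: "det (M x) \<noteq> 0" using L by (metis det_I det_mul mult_zero_right zero_neq_one)
  let ?\<omega> = "\<lambda>y. inverse \<bar>det (M y)\<bar>" and ?t = "\<lambda>h. \<Sum>i\<in>UNIV. \<Sum>k\<in>UNIV. L $ i $ k * e' i h $ k"
  have e_i: "((\<lambda>y. e j y $ i) has_derivative (\<lambda>h. e' j h $ i)) (at x)" for i j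
    by (rule bounded_linear.has_derivative[OF bounded_linear_vec_nth e])
  have "((\<lambda>y. det (M y)) has_derivative (\<lambda>h. det (M x) * ?t h)) (at x)"
    by (rule has_derivative_det_nonsingular[where M=M and M'="\<lambda>h i j. e' j h $ i", OF _ L]) (simp add: M_def e_i)
  then have \<omega>: "(?\<omega> has_derivative (\<lambda>h. - (?\<omega> x * ?t h))) (at x)"
    by (rule has_derivative_inverse_abs) (rule nz)
  have D: "((\<lambda>y. ?\<omega> y * v y * e j y $ i) has_derivative
     (\<lambda>h. ?\<omega> x * v x * e' j h $ i + (?\<omega> x * v' h + - (?\<omega> x * ?t h) * v x) * e j x $ i)) (at x)" for i
    by (intro has_derivative_mult \<omega> v e_i)
  have lin: "linear (e' i)" "linear v'" for i using has_derivative_linear e v by blast+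
  have tlin: "linear ?t"
    using lin by (intro linearI) (simp_all add: linear_add linear_scale algebra_simps sum.distrib sum_distrib_left)
  have ax: "(\<Sum>i\<in>UNIV. f (axis i 1) * w $ i) = f w" if "linear f" for f and w :: "real ^ 'n"
    using linear_axis_expansion[OF that, of w] by (simp add: mult.commute)
  \<comment> \<open>The trace of the derivative of \<open>e j\<close> is moved from the standard
    basis to the frame; \<open>L\<close> extracts frame components.\<close>
  have tr: "(\<Sum>i\<in>UNIV. e' j (axis i 1) $ i) = (\<Sum>i\<in>UNIV. (L *v e' j (e i x)) $ i)"
  proof -
    have inv_right: "M x ** L = mat 1" using L matrix_left_right_inverse by blast
    have "(\<Sum>i\<in>UNIV. (L *v e' j (e i x)) $ i) = (\<Sum>i\<in>UNIV. \<Sum>k\<in>UNIV. L $ i $ k * (\<Sum>m\<in>UNIV. e' j (axis m 1) $ k * e i x $ m))"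
    proof -
      have "e' j (e i x) $ k = (\<Sum>m\<in>UNIV. e' j (axis m 1) $ k * e i x $ m)" for i k
        using arg_cong[OF linear_axis_expansion[OF lin(1), of j "e i x"], of "\<lambda>u. u $ k"] by (simp add: mult.commute)
      then show ?thesis by (simp add: matrix_vector_mult_def)
    qed
    also have "\<dots> = (\<Sum>i\<in>UNIV. \<Sum>k\<in>UNIV. \<Sum>m\<in>UNIV. e' j (axis m 1) $ k * (M x $ m $ i * L $ i $ k))"
      by (intro sum.cong refl) (simp add: sum_distrib_left M_def mult_ac)
    also have "\<dots> = (\<Sum>k\<in>UNIV. \<Sum>i\<in>UNIV. \<Sum>m\<in>UNIV. e' j (axis m 1) $ k * (M x $ m $ i * L $ i $ k))" by (rule sum.swap)
    also have "\<dots> = (\<Sum>k\<in>UNIV. \<Sum>m\<in>UNIV. \<Sum>i\<in>UNIV. e' j (axis m 1) $ k * (M x $ m $ i * L $ i $ k))"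
      by (rule sum.cong[OF refl], rule sum.swap)
    also have "\<dots> = (\<Sum>k\<in>UNIV. \<Sum>m\<in>UNIV. e' j (axis m 1) $ k * (M x ** L) $ m $ k)"
      by (simp add: matrix_matrix_mult_def sum_distrib_left)
    also have "\<dots> = (\<Sum>k\<in>UNIV. e' j (axis k 1) $ k)"
      by (simp add: inv_right mat_def if_distrib cong: if_cong)
    finally show ?thesis by simp
  qed
  define \<tau> where "\<tau> = ?t"
  have t: "?t h = (\<Sum>i\<in>UNIV. (L *v e' i h) $ i)" for h by (simp add: matrix_vector_mult_def)
  have "(\<Sum>i\<in>UNIV. frechet_derivative (\<lambda>y. ?\<omega> y * v y * e j y $ i) (at x) (axis i 1))
     = (\<Sum>i\<in>UNIV. ?\<omega> x * v x * e' j (axis i 1) $ i) + (?\<omega> x * (\<Sum>i\<in>UNIV. v' (axis i 1) * e j x $ i)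
        - ?\<omega> x * v x * (\<Sum>i\<in>UNIV. ?t (axis i 1) * e j x $ i))"
  proof -
    have "(\<Sum>i\<in>UNIV. frechet_derivative (\<lambda>y. ?\<omega> y * v y * e j y $ i) (at x) (axis i 1))
      = (\<Sum>i\<in>UNIV. ?\<omega> x * v x * e' j (axis i 1) $ i + (?\<omega> x * v' (axis i 1) + - (?\<omega> x * \<tau> (axis i 1)) * v x) * e j x $ i)"
      unfolding frechet_derivative_at[OF D, symmetric] \<tau>_def ..
    also have "\<dots> = (\<Sum>i\<in>UNIV. ?\<omega> x * v x * e' j (axis i 1) $ i) + (?\<omega> x * (\<Sum>i\<in>UNIV. v' (axis i 1) * e j x $ i)
        - ?\<omega> x * v x * (\<Sum>i\<in>UNIV. \<tau> (axis i 1) * e j x $ i))"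
      unfolding sum_distrib_left sum.distrib[symmetric] sum_subtractf[symmetric]
      by (intro sum.cong refl) (simp add: algebra_simps)
    finally show ?thesis unfolding \<tau>_def .
  qed
  also have "\<dots> = ?\<omega> x * (v' (e j x) + v x * ((\<Sum>i\<in>UNIV. e' j (axis i 1) $ i) - ?t (e j x)))"
    unfolding ax[OF lin(2)] ax[OF tlin] sum_distrib_left[symmetric] by (simp add: algebra_simps)
  also have "\<dots> = ?\<omega> x * (v' (e j x) + v x * (\<Sum>i\<in>UNIV. (L *v (e' j (e i x) - e' i (e j x))) $ i))"
    unfolding tr t by (simp add: matrix_vector_mult_diff_distrib sum_subtractf)
  finally show "(\<Sum>i\<in>UNIV. frechet_derivative (\<lambda>y. ?\<omega> y * v y * e j y $ i) (at x) (axis i 1))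
      = ?\<omega> x * (v' (e j x) + v x * (\<Sum>i\<in>UNIV. (L *v (e' j (e i x) - e' i (e j x))) $ i))" .
qed

text \<open>Dominated convergence for the difference quotients, which the mean value theorem bounds
  by \<open>w\<close>. Measurability of \<open>f' 0\<close> is that of a limit along a sequence of
  times.\<close>

lemma has_derivative_integral:
  fixes f f' :: "real \<Rightarrow> 'a \<Rightarrow> real"
  assumes \<delta>: "\<delta> > 0" and int: "\<And>t. \<bar>t\<bar> < \<delta> \<Longrightarrow> integrable M (f t)"
    and d: "\<And>t x. \<bar>t\<bar> < \<delta> \<Longrightarrow> x \<in> space M \<Longrightarrow> ((\<lambda>s. f s x) has_real_derivative f' t x) (at t)"
    and b: "\<And>t x. \<bar>t\<bar> < \<delta> \<Longrightarrow> x \<in> space M \<Longrightarrow> \<bar>f' t x\<bar> \<le> w x" and w: "integrable M w"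
  shows "integrable M (f' 0)" "((\<lambda>t. integral\<^sup>L M (f t)) has_real_derivative integral\<^sup>L M (f' 0)) (at 0)"
proof -
  have lip: "\<bar>(f h x - f 0 x) / h\<bar> \<le> w x" if h: "h \<noteq> 0" "\<bar>h\<bar> < \<delta>" and x: "x \<in> space M" for h x
  proof -
    have "norm (f h x - f 0 x) \<le> w x * norm (h - 0)"
    proof (rule field_differentiable_bound[where S="{t. \<bar>t\<bar> < \<delta>}"])
      show "convex {t. \<bar>t\<bar> < \<delta>}"
      proof -
        have "{t. \<bar>t\<bar> < \<delta>} = {-\<delta><..<\<delta>}" by auto
        then show ?thesis by simp
      qed
      show "((\<lambda>s. f s x) has_field_derivative f' t x) (at t within {t. \<bar>t\<bar> < \<delta>})" if "t \<in> {t. \<bar>t\<bar> < \<delta>}" for t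
        using d[OF _ x, of t] that by (auto intro: has_field_derivative_at_within)
    qed (use b x h \<delta> in auto)
    then show ?thesis using h by (simp add: divide_simps)
  qed
  have meas: "f t \<in> borel_measurable M" if "\<bar>t\<bar> < \<delta>" for t using int[OF that] by simp
  have lim: "(\<lambda>n. (f (X n) x - f 0 x) / X n) \<longlonglongrightarrow> f' 0 x"
    if X: "\<And>n. X n \<noteq> 0" "X \<longlonglongrightarrow> 0" and x: "x \<in> space M" for X :: "nat \<Rightarrow> real" and x
  proof -
    have "((\<lambda>h. (f (0 + h) x - f 0 x) / h) \<longlongrightarrow> f' 0 x) (at 0)"
      using d[OF _ x, of 0] \<delta> by (simp add: DERIV_def)
    then show ?thesis using X unfolding tendsto_at_iff_sequentially by (auto simp: o_def)
  qed
  have dom: "integrable M (f' 0) \<and> (\<lambda>n. integral\<^sup>L M (\<lambda>x. (f (X n) x - f 0 x) / X n)) \<longlonglongrightarrow> integral\<^sup>L M (f' 0)"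
    if X: "\<And>n. X n \<noteq> 0" "\<And>n. \<bar>X n\<bar> < \<delta>" "X \<longlonglongrightarrow> 0" for X :: "nat \<Rightarrow> real"
  proof -
    have m: "(\<lambda>x. (f (X n) x - f 0 x) / X n) \<in> borel_measurable M" for n
      using meas[OF X(2)] meas[of 0] \<delta> by simp
    have m0: "f' 0 \<in> borel_measurable M"
      by (rule borel_measurable_LIMSEQ_real[OF lim[OF X(1,3)] m])
    have L: "AE x in M. (\<lambda>n. (f (X n) x - f 0 x) / X n) \<longlonglongrightarrow> f' 0 x"
      using lim[OF X(1,3)] by simp
    have B: "AE x in M. norm ((f (X n) x - f 0 x) / X n) \<le> w x" for n
      using lip[OF X(1,2)] by simp
    show ?thesis
      using integrable_dominated_convergence[OF m0 m w L B] integral_dominated_convergence[OF m0 m w L B] by blast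
  qed
  \<comment> \<open>A concrete sequence of nonzero times, all smaller than \<delta>; the shift by 2
    ensures this from the first term on.\<close>
  have X0: "(\<lambda>n. \<delta> / real (n + 2)) \<longlonglongrightarrow> 0" 
    by (rule LIMSEQ_ignore_initial_segment[OF lim_const_over_n])
  show "integrable M (f' 0)"
    using dom[OF _ _ X0] \<delta> by (simp add: divide_simps)
  show "((\<lambda>t. integral\<^sup>L M (f t)) has_real_derivative integral\<^sup>L M (f' 0)) (at 0)"
    unfolding DERIV_def tendsto_at_iff_sequentially
  proof (intro allI impI)
    fix X :: "nat \<Rightarrow> real" assume X: "\<forall>i. X i \<in> UNIV - {0}" "X \<longlonglongrightarrow> 0"
    then obtain N where N: "\<And>n. n \<ge> N \<Longrightarrow> \<bar>X n\<bar> < \<delta>"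
      using \<delta> unfolding LIMSEQ_iff by (metis diff_zero real_norm_def)
    let ?Y = "\<lambda>n. X (n + N)"
    have Y: "?Y n \<noteq> 0" "\<bar>?Y n\<bar> < \<delta>" for n using X(1) N by auto
    have Y0: "?Y \<longlonglongrightarrow> 0" using X(2) by (rule LIMSEQ_ignore_initial_segment)
    have "integral\<^sup>L M (\<lambda>x. (f (?Y n) x - f 0 x) / ?Y n) = (integral\<^sup>L M (f (0 + ?Y n)) - integral\<^sup>L M (f 0)) / ?Y n" for n
      using int[OF Y(2)] int[of 0] \<delta> by simp
    then have "(\<lambda>n. (integral\<^sup>L M (f (0 + ?Y n)) - integral\<^sup>L M (f 0)) / ?Y n) \<longlonglongrightarrow> integral\<^sup>L M (f' 0)"
      using dom[OF Y Y0] by (simp only:)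
    then show "((\<lambda>h. (integral\<^sup>L M (f (0 + h)) - integral\<^sup>L M (f 0)) / h) \<circ> X) \<longlonglongrightarrow> integral\<^sup>L M (f' 0)"
      unfolding o_def by (rule LIMSEQ_offset)
  qed
qed

text \<open>By translation invariance of Lebesgue measure the integral of
  \<open>H (x + t *\<^sub>R v)\<close> does not depend on \<open>t\<close>, and its derivative at 0
  is the integral of the directional derivative.\<close>

lemma integral_directional_derivative_zero:
  fixes H :: "real ^ 'n::finite \<Rightarrow> real"
  assumes H: "smooth_on UNIV H" and K: "compact K" and out: "\<And>x. x \<notin> K \<Longrightarrow> H x = 0"
  shows "integrable lborel (\<lambda>x. frechet_derivative H (at x) v)" "(\<integral>x. frechet_derivative H (at x) v \<partial>lborel) = 0"
proof -
  let ?D = "\<lambda>x. frechet_derivative H (at x) v"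
  have D: "((\<lambda>s. H (x + s *\<^sub>R v)) has_real_derivative ?D (x + t *\<^sub>R v)) (at t)" for x t
  proof -
    have l: "((\<lambda>s. x + s *\<^sub>R v) has_derivative (\<lambda>h. h *\<^sub>R v)) (at t)" by (auto intro!: derivative_eq_intros)
    have h: "(H has_derivative frechet_derivative H (at (x + t *\<^sub>R v))) (at (x + t *\<^sub>R v))" by (rule smooth_onD[OF H]) simp
    show ?thesis
      using diff_chain_at[OF l h] linear_scale[OF has_derivative_linear[OF h]]
      by (simp add: o_def has_field_derivative_def mult.commute[of _ "frechet_derivative H _ v"])
  qed
  have D0: "?D x = 0" if "x \<notin> K" for x
  proof -
    have "(H has_derivative (\<lambda>h. 0)) (at x)"
      by (rule has_derivative_transform_within_open[OF has_derivative_const[of 0], where s="- K"])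
         (use that out K in \<open>auto simp: compact_imp_closed\<close>)
    from frechet_derivative_at[OF this] show ?thesis by metis
  qed
  have cD: "continuous_on S ?D" for S using smooth_on_continuous[OF smooth_on_deriv[OF H]] continuous_on_subset by blast
  obtain C where C: "\<And>x. x \<in> K \<Longrightarrow> \<bar>?D x\<bar> \<le> C"
    using compact_imp_bounded[OF compact_continuous_image[OF cD K]] by (auto simp: bounded_iff)
  define C' where "C' = max C 0"
  have C': "\<bar>?D x\<bar> \<le> C'" for x using C[of x] D0[of x] by (cases "x \<in> K") (auto simp: C'_def)
  obtain R where R: "\<And>x. x \<in> K \<Longrightarrow> norm x \<le> R" using compact_imp_bounded[OF K] by (auto simp: bounded_iff)
  \<comment> \<open>For times below 1 in absolute value the translates of the support stay in this
    ball, which gives one dominating function.\<close>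
  let ?B = "cball 0 (R + norm v) :: (real ^ 'n) set"
  have far: "x + t *\<^sub>R v \<notin> K" if "x \<notin> ?B" "\<bar>t\<bar> < 1" for x t
  proof
    assume "x + t *\<^sub>R v \<in> K"
    then have "norm (x + t *\<^sub>R v) \<le> R" by (rule R)
    moreover have "norm x \<le> norm (x + t *\<^sub>R v) + norm (t *\<^sub>R v)"
      using norm_triangle_ineq4[of "x + t *\<^sub>R v" "t *\<^sub>R v"] by simp
    moreover have "norm (t *\<^sub>R v) \<le> norm v" using that(2) by (simp add: mult_left_le_one_le)
    ultimately show False using that(1) by simp
  qed
  have intH: "integrable lborel H"
  proof -
    have "integrable lborel (\<lambda>x. indicator K x *\<^sub>R H x)"
      by (rule borel_integrable_compact[OF K continuous_on_subset[OF smooth_on_continuous[OF H]]]) simp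
    moreover have "(\<lambda>x. indicator K x *\<^sub>R H x) = H"
    proof
      show "indicator K x *\<^sub>R H x = H x" for x using out[of x] by (cases "x \<in> K") auto
    qed
    ultimately show ?thesis by simp
  qed
  have shift: "integrable lborel (\<lambda>x. H (x + t *\<^sub>R v))" "(\<integral>x. H (x + t *\<^sub>R v) \<partial>lborel) = (\<integral>x. H x \<partial>lborel)" for t
  proof -
    have Hm: "H \<in> borel_measurable borel" using smooth_on_continuous[OF H] by (rule borel_measurable_continuous_onI)
    have d: "distr lborel borel ((+) (t *\<^sub>R v)) = lborel" by (rule lborel_distr_plus)
    have "integrable (distr lborel borel ((+) (t *\<^sub>R v))) H" unfolding d by (rule intH)
    then show "integrable lborel (\<lambda>x. H (x + t *\<^sub>R v))"
      by (subst (asm) integrable_distr_eq) (use Hm in \<open>auto simp: add.commute\<close>)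
    have "(\<integral>x. H x \<partial>distr lborel borel ((+) (t *\<^sub>R v))) = (\<integral>x. H (t *\<^sub>R v + x) \<partial>lborel)"
      by (rule integral_distr) (use Hm in auto)
    then show "(\<integral>x. H (x + t *\<^sub>R v) \<partial>lborel) = (\<integral>x. H x \<partial>lborel)" unfolding d by (simp add: add.commute)
  qed
  have w: "integrable lborel (\<lambda>x. indicator ?B x * C')"
    using borel_integrable_compact[of ?B "\<lambda>x. C'"] by simp
  have bd: "\<bar>?D (x + t *\<^sub>R v)\<bar> \<le> indicator ?B x * C'" if "\<bar>t\<bar> < 1" for t x
    using C'[of "x + t *\<^sub>R v"] D0[OF far[OF _ that], of x] by (auto simp: indicator_def)
  note di = has_derivative_integral[of 1 lborel "\<lambda>t x. H (x + t *\<^sub>R v)" "\<lambda>t x. ?D (x + t *\<^sub>R v)", OF _ shift(1) D bd w]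
  show "integrable lborel ?D" using di(1) by simp
  have "((\<lambda>t. \<integral>x. H x \<partial>lborel) has_real_derivative (\<integral>x. ?D x \<partial>lborel)) (at 0)"
    using di(2) by (simp add: shift(2))
  then show "(\<integral>x. ?D x \<partial>lborel) = 0" using DERIV_unique DERIV_const by blast
qed

section \<open>Integration over the manifold\<close>

context metric_atlas
begin

definition vol_density :: "('a, 'n) chart \<Rightarrow> real ^ 'n \<Rightarrow> real" where
  "vol_density c x = sqrt \<bar>det (\<chi> i j. let p = chart_inv c x in
     g p (of_coord A c p (axis i 1)) (of_coord A c p (axis j 1)))\<bar>"

definition frame_matrix :: "('a, 'n) chart \<Rightarrow> ('n \<Rightarrow> ('a, 'n) vfield) \<Rightarrow> real ^ 'n \<Rightarrow> real ^ 'n ^ 'n" where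
  "frame_matrix c e x = (\<chi> i j. field_coord A c (e j) x $ i)"

context
  fixes W e \<epsilon> c
  assumes e: "pframe W e \<epsilon>" and c: "c \<in> A" and Wc: "W \<subseteq> fst c"
begin

lemma frame_coord_point:
  assumes "x \<in> snd c ` W"
  shows "chart_inv c x \<in> W" "chart_inv c x \<in> fst c" "snd c (chart_inv c x) = x"
    "of_coord A c (chart_inv c x) (field_coord A c X x) = X (chart_inv c x)"
proof -
  obtain q where q: "q \<in> W" "x = snd c q" using assms by auto
  then have "q \<in> fst c" using Wc by auto
  then show "chart_inv c x \<in> W" "chart_inv c x \<in> fst c" "snd c (chart_inv c x) = x"
    "of_coord A c (chart_inv c x) (field_coord A c X x) = X (chart_inv c x)"
    using q by (simp_all add: chart_inv_left[OF c] field_coord_def of_to_coord[OF c])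
qed

text \<open>The matrix of the dual coframe: orthonormality gives the inverse of
  \<open>frame_matrix\<close> explicitly.\<close>

definition coframe_matrix :: "real ^ 'n \<Rightarrow> real ^ 'n ^ 'n" where
  "coframe_matrix x = (\<chi> i j. \<epsilon> i * g (chart_inv c x) (of_coord A c (chart_inv c x) (axis j 1)) (e i (chart_inv c x)))"

lemma coframe_apply:
  assumes x: "x \<in> snd c ` W"
  shows "(coframe_matrix x *v w) $ i = \<epsilon> i * g (chart_inv c x) (of_coord A c (chart_inv c x) w) (e i (chart_inv c x))"
proof -
  let ?p = "chart_inv c x"
  have "linear (\<lambda>w. g ?p (of_coord A c ?p w) (e i ?p))"
    by (rule linearI) (simp_all add: g_simps linear_add[OF linear_of_coord[OF c frame_coord_point(2)[OF x]]]
        linear_scale[OF linear_of_coord[OF c frame_coord_point(2)[OF x]]])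
  from linear_axis_expansion[OF this, of w] show ?thesis
    by (simp add: coframe_matrix_def matrix_vector_mult_def sum_distrib_left mult_ac)
qed

lemma coframe_frame:
  assumes x: "x \<in> snd c ` W"
  shows "coframe_matrix x ** frame_matrix c e x = mat 1"
proof -
  have o: "g (chart_inv c x) (e i (chart_inv c x)) (e j (chart_inv c x)) = (if i = j then \<epsilon> i else 0)" and n: "\<epsilon> i * \<epsilon> i = 1" for i j
    using e frame_coord_point(1)[OF x] by (auto simp: pframe_def)
  have "(coframe_matrix x ** frame_matrix c e x) $ i $ j = (coframe_matrix x *v field_coord A c (e j) x) $ i" for i j
    by (simp add: matrix_matrix_mult_def matrix_vector_mult_def frame_matrix_def)
  also have "\<dots> i j = (mat 1 :: real ^ 'n ^ 'n) $ i $ j" for i j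
    unfolding coframe_apply[OF x] frame_coord_point(4)[OF x] by (auto simp: o n mat_def)
  finally show ?thesis by (simp add: vec_eq_iff)
qed

text \<open>With \<open>?M\<close> the frame matrix and \<open>?G\<close> the Gram matrix of the
  coordinate vectors, the transpose of \<open>?M\<close> times \<open>?G\<close> times
  \<open>?M\<close> is the diagonal matrix of signs, so |det ?G| is the inverse square of |det ?M|.
  This identifies the metric density with the one in
  \<open>divergence_frame_density\<close>.\<close>

lemma vol_density_frame:
  assumes x: "x \<in> snd c ` W"
  shows "vol_density c x = inverse \<bar>det (frame_matrix c e x)\<bar>" "det (frame_matrix c e x) \<noteq> 0"
proof -
  let ?p = "chart_inv c x" and ?M = "frame_matrix c e x"
  let ?G = "(\<chi> i j. g ?p (of_coord A c ?p (axis i 1)) (of_coord A c ?p (axis j 1))) :: real ^ 'n ^ 'n"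
  have o: "g ?p (e i ?p) (e j ?p) = (if i = j then \<epsilon> i else 0)" and n: "\<epsilon> i * \<epsilon> i = 1" for i j
    using e frame_coord_point(1)[OF x] by (auto simp: pframe_def)
  have "(transpose ?M ** ?G ** ?M) $ i $ j = g ?p (e i ?p) (e j ?p)" for i j
  proof -
    have "g ?p (e i ?p) (e j ?p) = (\<Sum>k\<in>UNIV. \<Sum>l\<in>UNIV. (field_coord A c (e i) x $ k * field_coord A c (e j) x $ l) *
        g ?p (of_coord A c ?p (axis k 1)) (of_coord A c ?p (axis l 1)))"
      using bilinear_axis_expansion[OF bilinear_compose_linear[OF bilinear_g linear_of_coord[OF c frame_coord_point(2)[OF x]]],
          of ?p "field_coord A c (e i) x" "field_coord A c (e j) x"]
      by (simp add: frame_coord_point(4)[OF x])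
    also have "\<dots> = (\<Sum>l\<in>UNIV. \<Sum>k\<in>UNIV. (field_coord A c (e i) x $ k * field_coord A c (e j) x $ l) *
        g ?p (of_coord A c ?p (axis k 1)) (of_coord A c ?p (axis l 1)))" by (rule sum.swap)
    also have "\<dots> = (transpose ?M ** ?G ** ?M) $ i $ j"
      by (simp add: matrix_matrix_mult_def transpose_def frame_matrix_def sum_distrib_left mult_ac)
    finally show ?thesis by simp
  qed
  then have "det (transpose ?M ** ?G ** ?M) = (\<Prod>i\<in>UNIV. \<epsilon> i)"
    by (subst det_diagonal) (auto simp: o)
  moreover have "\<bar>\<Prod>i\<in>UNIV. \<epsilon> i\<bar> = 1"
  proof -
    have "\<bar>\<epsilon> i\<bar> = 1" for i using n[of i] by (simp add: square_eq_1_iff) auto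
    then show ?thesis by (simp add: abs_prod)
  qed
  ultimately have d: "\<bar>det ?M\<bar> * \<bar>det ?G\<bar> * \<bar>det ?M\<bar> = 1"
    unfolding det_mul det_transpose by (simp only: abs_mult[symmetric])
  then show nz: "det ?M \<noteq> 0" by auto
  have "\<bar>det ?G\<bar> = (inverse \<bar>det ?M\<bar>)\<^sup>2" using d nz by (simp add: field_simps power2_eq_square)
  then show "vol_density c x = inverse \<bar>det ?M\<bar>" by (simp add: vol_density_def Let_def)
qed

lemma frame_image_open: "open (snd c ` W)"
  using open_chart_image[OF c, of W] e Wc by (simp add: pframe_def Int_absorb1)

lemma smooth_on_det_frame: "smooth_on (snd c ` W) (\<lambda>x. det (frame_matrix c e x))"
proof -
  have s: "smooth_on (snd c ` W) (field_coord A c (e i))" for i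
    using smooth_fieldD[OF _ c, of W "e i"] e Wc by (simp add: pframe_def Int_absorb1)
  have p: "smooth_on (snd c ` W) (\<lambda>x. \<Prod>i\<in>I. frame_matrix c e x $ i $ q i)" if "finite I" for I q
    using that
  proof (induction I)
    case (insert i I)
    then show ?case
      by (simp add: frame_matrix_def, intro smooth_on_mult smooth_on_nth s frame_image_open)
         (simp_all add: frame_matrix_def)
  qed (simp add: smooth_on_const)
  show ?thesis
    unfolding det_def by (intro smooth_on_sum smooth_on_mult smooth_on_const p frame_image_open finite)
qed

text \<open>The determinant of the frame matrix has constant sign near each point, so the absolute
  value in the density is locally a constant factor.\<close>

lemma smooth_on_vol_density: "smooth_on (snd c ` W) (vol_density c)"
proof (rule smooth_on_local)
  fix x assume x: "x \<in> snd c ` W"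
  let ?d = "\<lambda>x. det (frame_matrix c e x)"
  define s where "s = sgn (?d x)"
  define N where "N = {y \<in> snd c ` W. s * ?d y > 0}"
  have cont: "continuous_on (snd c ` W) (\<lambda>y. s * ?d y)"
    by (intro continuous_intros smooth_on_continuous[OF smooth_on_det_frame])
  have "N = snd c ` W \<inter> (\<lambda>y. s * ?d y) -` {0<..}" by (auto simp: N_def)
  then have N: "open N"
    using continuous_open_preimage[OF cont frame_image_open open_greaterThan[of 0]] by simp
  have xN: "x \<in> N" using x vol_density_frame(2)[OF x] by (simp add: N_def s_def sgn_if)
  have sN: "smooth_on N (\<lambda>y. s * ?d y)"
    by (intro smooth_on_mult N smooth_on_const smooth_on_subset[OF smooth_on_det_frame]) (auto simp: N_def)
  have "smooth_on N (vol_density c)"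
  proof (rule smooth_on_cong[OF N _ smooth_on_inverse[OF N sN]])
    fix y assume y: "y \<in> N"
    then show "s * ?d y \<noteq> 0" by (auto simp: N_def)
    have "\<bar>?d y\<bar> = \<bar>s * ?d y\<bar>" using vol_density_frame(2)[OF x] by (simp add: abs_mult s_def sgn_if)
    then show "inverse (s * ?d y) = vol_density c y"
      using y vol_density_frame(1)[of y] by (simp add: N_def)
  qed
  then show "\<exists>N. open N \<and> x \<in> N \<and> smooth_on N (vol_density c)" using N xN by blast
qed

end

end

context levi_civita_atlas
begin

text \<open>The bracket trace in \<open>divergence_frame_density\<close> becomes a sum of
  Christoffel symbols: the bracket of \<open>e i\<close> and \<open>e j\<close> pairs with
  \<open>e i\<close> to \<open>\<Gamma> i j i - \<Gamma> j i i\<close>, where skewness kills the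
  second symbol and turns the first into \<open>- \<Gamma> i i j\<close>.\<close>

lemma divergence_frame_coord:
  assumes e: "pframe W e \<epsilon>" and c: "c \<in> A" and Wc: "W \<subseteq> fst c" and q: "q \<in> W" and v: "smooth_fun A W v"
  shows "(\<Sum>i\<in>UNIV. frechet_derivative (\<lambda>y. vol_density c y * v (chart_inv c y) * field_coord A c (e j) y $ i) (at (snd c q)) (axis i 1))
    = vol_density c (snd c q) * (dir_deriv A (e j) v q - v q * (\<Sum>i\<in>UNIV. \<epsilon> i * christ nabla e i i j q))"
proof -
  let ?x = "snd c q" and ?U = "snd c ` W"
  let ?ec = "\<lambda>j. field_coord A c (e j)"
  have W: "open W" and se: "smooth_field A W (e i)" for i using e by (auto simp: pframe_def)
  have qc: "q \<in> fst c" using q Wc by auto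
  have x: "?x \<in> ?U" using q by auto
  have U: "open ?U" by (rule frame_image_open[OF e c Wc])
  have Ueq: "snd c ` (fst c \<inter> W) = ?U" using Wc by (simp add: Int_absorb1)
  have sec: "smooth_on ?U (?ec i)" for i using smooth_fieldD[OF se c] Ueq by simp
  have sv: "smooth_on ?U (\<lambda>y. v (chart_inv c y))" using smooth_funD[OF v c] Ueq by (simp add: o_def)
  note fm = frame_matrix_def[of c e]
  have eq: "vol_density c y = inverse \<bar>det (\<chi> i j. ?ec j y $ i)\<bar>" if "y \<in> ?U" for y
    using vol_density_frame(1)[OF e c Wc that] by (simp add: fm)
  have cong: "frechet_derivative (\<lambda>y. vol_density c y * v (chart_inv c y) * ?ec j y $ i) (at ?x)
     = frechet_derivative (\<lambda>y. inverse \<bar>det (\<chi> i j. ?ec j y $ i)\<bar> * v (chart_inv c y) * ?ec j y $ i) (at ?x)" for i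
  proof (rule frechet_derivative_cong_open[OF U x, symmetric])
    show "(\<lambda>y. vol_density c y * v (chart_inv c y) * ?ec j y $ i) differentiable (at ?x)"
      by (rule smooth_on_differentiable[OF _ x])
         (intro smooth_on_mult smooth_on_nth U sec sv smooth_on_vol_density[OF e c Wc])
  qed (simp add: eq)
  have L: "coframe_matrix e \<epsilon> c ?x ** (\<chi> i j. ?ec j ?x $ i) = mat 1"
    using coframe_frame[OF e c Wc x] by (simp add: fm)
  have vd: "frechet_derivative (\<lambda>y. v (chart_inv c y)) (at ?x) (?ec j ?x) = dir_deriv A (e j) v q"
    using dir_deriv_chart[OF v q c qc] by (simp add: field_coord_def chart_inv_left[OF c qc] o_def)
  have br: "(coframe_matrix e \<epsilon> c ?x *v (frechet_derivative (?ec j) (at ?x) (?ec i ?x) - frechet_derivative (?ec i) (at ?x) (?ec j ?x))) $ i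
     = - (\<epsilon> i * christ nabla e i i j q)" for i
  proof -
    have "frechet_derivative (?ec j) (at ?x) (?ec i ?x) - frechet_derivative (?ec i) (at ?x) (?ec j ?x)
        = to_coord A c q (lie_bracket A (e i) (e j) q)"
      unfolding lie_bracket_chart[OF W q se se c qc] by (simp add: field_coord_def chart_inv_left[OF c qc])
    then have "(coframe_matrix e \<epsilon> c ?x *v (frechet_derivative (?ec j) (at ?x) (?ec i ?x) - frechet_derivative (?ec i) (at ?x) (?ec j ?x))) $ i
        = \<epsilon> i * g q (lie_bracket A (e i) (e j) q) (e i q)"
      by (simp add: coframe_apply[OF e c Wc x] chart_inv_left[OF c qc] of_to_coord[OF c qc])
    also have "\<dots> = \<epsilon> i * (christ nabla e i j i q - christ nabla e j i i q)"
      unfolding nabla_torsion_free[OF W se se q] christ_def g_simps ..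
    also have "\<dots> = - (\<epsilon> i * christ nabla e i i j q)"
      using christ_skew[OF e q, of i j i] christ_skew[OF e q, of j i i] by simp
    finally show ?thesis .
  qed
  have D: "(?ec i has_derivative frechet_derivative (?ec i) (at ?x)) (at ?x)" for i by (rule smooth_onD[OF sec x])
  have Dv: "((\<lambda>y. v (chart_inv c y)) has_derivative frechet_derivative (\<lambda>y. v (chart_inv c y)) (at ?x)) (at ?x)"
    by (rule smooth_onD[OF sv x])
  show ?thesis
    unfolding cong divergence_frame_density[where e="?ec" and v="\<lambda>y. v (chart_inv c y)", OF D Dv L] br vd eq[OF x] chart_inv_left[OF c qc]
    by (simp add: sum_negf)
qed

end

locale volume_atlas = levi_civita_atlas A g nabla
  for A :: "('a::{t2_space,second_countable_topology}, 'n::finite) chart set" and g and nabla :: "('a, 'n) connection" +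
  fixes vol :: "'a measure"
  assumes volume: "volume_measure A g vol"
begin

lemma sets_vol: "sets vol = sets borel" and space_vol: "space vol = UNIV"
proof -
  show "sets vol = sets borel" using volume by (simp add: volume_measure_def)
  from sets_eq_imp_space_eq[OF this] show "space vol = UNIV" by simp
qed

lemma measurable_vol: "borel_measurable vol = borel_measurable borel"
  by (rule measurable_cong_sets[OF sets_vol refl])

context
  fixes W e \<epsilon> c
  assumes e: "pframe W e \<epsilon>" and c: "c \<in> A" and Wc: "W \<subseteq> fst c"
begin

text \<open>A change of variables as an equality of measures: \<open>vol\<close> restricted to
  \<open>W\<close> is the image, under the inverse chart, of Lebesgue measure with the metric
  density. \<open>volume_measure\<close> says this for Borel subsets of the chart domain.\<close>

lemma vol_integral_chart:
  fixes f :: "'a \<Rightarrow> real"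
  assumes f: "f \<in> borel_measurable borel" and out: "\<And>q. q \<notin> W \<Longrightarrow> f q = 0"
  shows "integrable vol f \<longleftrightarrow> integrable lborel (\<lambda>x. indicator (snd c ` W) x * vol_density c x * f (chart_inv c x))"
    and "integral\<^sup>L vol f = (\<integral>x. indicator (snd c ` W) x * vol_density c x * f (chart_inv c x) \<partial>lborel)"
proof -
  let ?U = "snd c ` W"
  have W: "open W" using e by (simp add: pframe_def)
  have U: "open ?U" by (rule frame_image_open[OF e c Wc])
  \<comment> \<open>The inverse chart must be a total measurable map to push a measure forward; its
    value outside \<open>?U\<close> is immaterial because \<delta> vanishes there.\<close>
  define \<phi> where "\<phi> = (\<lambda>x. if x \<in> ?U then chart_inv c x else undefined)"
  define \<delta> where "\<delta> = (\<lambda>x. indicator ?U x * vol_density c x)"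
  have \<phi>_iff: "x \<in> ?U \<Longrightarrow> \<phi> x \<in> S \<longleftrightarrow> x \<in> snd c ` (W \<inter> S)" for x S
    using frame_coord_point[OF e c Wc] by (auto simp: \<phi>_def chart_inv_left[OF c] subsetD[OF Wc])
  have \<phi>m: "\<phi> \<in> borel_measurable borel"
  proof (rule borel_measurableI)
    fix S :: "'a set" assume S: "open S"
    have "\<phi> -` S \<inter> space borel = snd c ` (W \<inter> S) \<union> (if undefined \<in> S then - ?U else {})"
      using \<phi>_iff by (auto simp: \<phi>_def split: if_splits)
    moreover have "open (snd c ` (W \<inter> S))"
      using open_chart_image[OF c, of "W \<inter> S"] W S Wc by (simp add: open_Int Int_absorb1 le_infI1)
    ultimately show "\<phi> -` S \<inter> space borel \<in> sets borel" using U by auto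
  qed
  have \<delta>m: "\<delta> \<in> borel_measurable borel"
    using borel_measurable_continuous_on_indicator[OF borel_open[OF U] smooth_on_continuous[OF smooth_on_vol_density[OF e c Wc]]]
    by (simp add: \<delta>_def)
  have \<delta>0: "\<delta> x \<ge> 0" for x by (simp add: \<delta>_def vol_density_def)
  have eq: "density vol (\<lambda>q. ennreal (indicator W q)) = distr (density lborel (\<lambda>x. ennreal (\<delta> x))) borel \<phi>"
  proof (rule measure_eqI)
    show "sets (density vol (\<lambda>q. ennreal (indicator W q))) = sets (distr (density lborel (\<lambda>x. ennreal (\<delta> x))) borel \<phi>)"
      by (simp add: sets_vol)
    fix S assume "S \<in> sets (density vol (\<lambda>q. ennreal (indicator W q)))"
    then have S: "S \<in> sets borel" "S \<in> sets vol" by (simp_all add: sets_vol)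
    have WS: "W \<inter> S \<in> sets borel" using W S by auto
    have Wv: "W \<in> sets vol" using W by (simp add: sets_vol)
    have "emeasure (density vol (\<lambda>q. ennreal (indicator W q))) S = (\<integral>\<^sup>+q. ennreal (indicator W q) * indicator S q \<partial>vol)"
      by (rule emeasure_density) (use Wv S in auto)
    also have "\<dots> = (\<integral>\<^sup>+q. indicator (W \<inter> S) q \<partial>vol)"
      by (rule nn_integral_cong) (simp split: split_indicator)
    also have "\<dots> = emeasure vol (W \<inter> S)" using WS by (intro nn_integral_indicator) (simp add: sets_vol)
    also have "\<dots> = (\<integral>\<^sup>+x\<in>snd c ` (W \<inter> S). ennreal (vol_density c x) \<partial>lborel)"
    proof -
      have "W \<inter> S \<subseteq> fst c" using Wc by auto
      then show ?thesis using volume c WS unfolding volume_measure_def vol_density_def by blast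
    qed
    also have "\<dots> = (\<integral>\<^sup>+x. ennreal (\<delta> x) * indicator (\<phi> -` S) x \<partial>lborel)"
    proof (rule nn_integral_cong)
      fix x
      show "ennreal (vol_density c x) * indicator (snd c ` (W \<inter> S)) x = ennreal (\<delta> x) * indicator (\<phi> -` S) x"
        using \<phi>_iff[of x S] by (cases "x \<in> ?U") (auto simp: \<delta>_def split: split_indicator)
    qed
    also have "\<dots> = emeasure (density lborel (\<lambda>x. ennreal (\<delta> x))) (\<phi> -` S)"
      by (rule emeasure_density[symmetric]) (use \<delta>m measurable_sets[OF \<phi>m S(1)] in auto)
    also have "\<dots> = emeasure (distr (density lborel (\<lambda>x. ennreal (\<delta> x))) borel \<phi>) S"
      by (subst emeasure_distr) (use \<phi>m S in auto)
    finally show "emeasure (density vol (\<lambda>q. ennreal (indicator W q))) S = emeasure (distr (density lborel (\<lambda>x. ennreal (\<delta> x))) borel \<phi>) S" .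
  qed
  have ind: "(\<lambda>q. indicator W q) \<in> borel_measurable vol"
    unfolding measurable_vol by (rule borel_measurable_indicator[OF borel_open[OF W]])
  have fv: "f \<in> borel_measurable vol" using f by (simp add: measurable_vol)
  have f1: "(\<lambda>q. indicator W q * f q) = f"
  proof
    show "indicator W q * f q = f q" for q using out[of q] by (cases "q \<in> W") auto
  qed
  have d1: "integral\<^sup>L (density vol (\<lambda>q. ennreal (indicator W q))) f = integral\<^sup>L vol f"
    "integrable (density vol (\<lambda>q. ennreal (indicator W q))) f = integrable vol f"
    using integral_real_density[OF ind _ fv] integrable_real_density[OF ind _ fv] by (simp_all add: f1)
  have \<phi>d: "\<phi> \<in> measurable (density lborel (\<lambda>x. ennreal (\<delta> x))) borel" using \<phi>m by simp
  have f\<phi>: "(\<lambda>x. f (\<phi> x)) \<in> borel_measurable lborel" using measurable_compose[OF \<phi>m f] by simp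
  have \<delta>l: "\<delta> \<in> borel_measurable lborel" using \<delta>m by simp
  have d2: "integral\<^sup>L (distr (density lborel (\<lambda>x. ennreal (\<delta> x))) borel \<phi>) f = (\<integral>x. \<delta> x * f (\<phi> x) \<partial>lborel)"
    "integrable (distr (density lborel (\<lambda>x. ennreal (\<delta> x))) borel \<phi>) f = integrable lborel (\<lambda>x. \<delta> x * f (\<phi> x))"
    using integral_distr[OF \<phi>d f] integrable_distr_eq[OF \<phi>d f] integral_real_density[OF \<delta>l _ f\<phi>] integrable_real_density[OF \<delta>l _ f\<phi>] \<delta>0
    by simp_all
  have same: "(\<lambda>x. \<delta> x * f (\<phi> x)) = (\<lambda>x. indicator ?U x * vol_density c x * f (chart_inv c x))"
    by (auto simp: \<delta>_def \<phi>_def indicator_def)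
  show "integrable vol f \<longleftrightarrow> integrable lborel (\<lambda>x. indicator ?U x * vol_density c x * f (chart_inv c x))"
    using d1(2) d2(2) unfolding eq same by simp
  show "integral\<^sup>L vol f = (\<integral>x. indicator ?U x * vol_density c x * f (chart_inv c x) \<partial>lborel)"
    using d1(1) d2(1) unfolding eq same by simp
qed

text \<open>In the chart the integrand, times the density, is a combination of coordinate
  derivatives of compactly supported functions, each with integral zero.\<close>

lemma frame_divergence_theorem:
  assumes v: "\<And>j. smooth_fun A W (v j)" and K: "compact K" "K \<subseteq> W" and out: "\<And>j q. q \<in> W - K \<Longrightarrow> v j q = 0"
  defines "F \<equiv> \<lambda>q. if q \<in> W then \<Sum>j\<in>UNIV. \<epsilon> j * (dir_deriv A (e j) (v j) q - v j q * (\<Sum>i\<in>UNIV. \<epsilon> i * christ nabla e i i j q)) else 0"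
  shows "integrable vol F" "integral\<^sup>L vol F = 0"
proof -
  let ?U = "snd c ` W"
  have W: "open W" and se: "smooth_field A W (e i)" for i using e by (auto simp: pframe_def)
  have U: "open ?U" by (rule frame_image_open[OF e c Wc])
  have Ueq: "snd c ` (fst c \<inter> W) = ?U" using Wc by (simp add: Int_absorb1)
  define h where "h = (\<lambda>i j y. vol_density c y * v j (chart_inv c y) * field_coord A c (e j) y $ i)"
  \<comment> \<open>Extension by 0; it is smooth on the whole space because \<open>h\<close> already
    vanishes outside the compact image of \<open>K\<close>.\<close>
  define H where "H = (\<lambda>i j y. if y \<in> ?U then h i j y else 0)"
  have Kc: "K \<subseteq> fst c" using K Wc by auto
  have cK: "compact (snd c ` K)"
    by (rule compact_continuous_image[OF continuous_on_subset[OF chart_continuous[OF c] Kc] K(1)])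
  have sh: "smooth_on ?U (h i j)" for i j
    unfolding h_def
    using smooth_fieldD[OF se c] smooth_funD[OF v c] smooth_on_vol_density[OF e c Wc] U
    by (intro smooth_on_mult smooth_on_nth) (simp_all add: Ueq o_def)
  have H0: "H i j y = 0" if "y \<notin> snd c ` K" for i j y
  proof (cases "y \<in> ?U")
    case True
    then obtain q where q: "q \<in> W" "y = snd c q" by auto
    then have "q \<in> W - K" using that by auto
    then show ?thesis using out[of q j] q Wc by (auto simp: H_def h_def chart_inv_left[OF c])
  qed (simp add: H_def)
  have oK: "open (- (snd c ` K))" using cK by (simp add: compact_imp_closed open_Compl)
  have sH: "smooth_on UNIV (H i j)" for i j
  proof (rule smooth_on_local)
    fix y
    show "\<exists>N. open N \<and> y \<in> N \<and> smooth_on N (H i j)"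
    proof (cases "y \<in> ?U")
      case True
      have "smooth_on ?U (H i j)" by (rule smooth_on_cong[OF U _ sh]) (simp add: H_def)
      then show ?thesis using U True by blast
    next
      case False
      then have "y \<in> - (snd c ` K)" using K by auto
      moreover have "smooth_on (- (snd c ` K)) (H i j)"
        by (rule smooth_on_cong[OF oK _ smooth_on_const[of _ 0]]) (use H0 in auto)
      ultimately show ?thesis using oK by blast
    qed
  qed
  have DH: "frechet_derivative (H i j) (at y) = frechet_derivative (h i j) (at y)" if "y \<in> ?U" for i j y
    by (rule frechet_derivative_cong_open[OF U that _ smooth_on_differentiable[OF sh that]]) (simp add: H_def)
  have DH0: "frechet_derivative (H i j) (at y) w = 0" if "y \<notin> ?U" for i j y w
  proof -
    have "y \<in> - (snd c ` K)" using that K by auto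
    then have "(H i j has_derivative (\<lambda>w. 0)) (at y)"
      by (rule has_derivative_transform_within_open[OF has_derivative_const[of 0] oK]) (use H0 in auto)
    from frechet_derivative_at[OF this] show ?thesis by metis
  qed
  have sumH: "indicator ?U y * vol_density c y * F (chart_inv c y)
     = (\<Sum>j\<in>UNIV. \<Sum>i\<in>UNIV. \<epsilon> j * frechet_derivative (H i j) (at y) (axis i 1))" for y
  proof (cases "y \<in> ?U")
    case True
    then obtain q where q: "q \<in> W" "y = snd c q" by auto
    have qc: "chart_inv c y = q" using q Wc by (auto simp: chart_inv_left[OF c])
    have "(\<Sum>i\<in>UNIV. frechet_derivative (H i j) (at y) (axis i 1))
       = vol_density c y * (dir_deriv A (e j) (v j) q - v j q * (\<Sum>i\<in>UNIV. \<epsilon> i * christ nabla e i i j q))" for j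
      unfolding DH[OF True] h_def using divergence_frame_coord[OF e c Wc q(1) v] q(2) by simp
    then have "(\<Sum>j\<in>UNIV. \<epsilon> j * (\<Sum>i\<in>UNIV. frechet_derivative (H i j) (at y) (axis i 1))) = vol_density c y * F q"
      using q(1) by (simp add: F_def sum_distrib_left mult_ac)
    then show ?thesis using True by (simp add: qc sum_distrib_left)
  qed (simp add: DH0)
  have z: "integrable lborel (\<lambda>y. frechet_derivative (H i j) (at y) (axis i 1))"
    "(\<integral>y. frechet_derivative (H i j) (at y) (axis i 1) \<partial>lborel) = 0" for i j
    by (rule integral_directional_derivative_zero[OF sH cK H0]; assumption)+
  have F0: "F q = 0" if "q \<notin> W" for q using that by (simp add: F_def)
  have Fm: "F \<in> borel_measurable borel"
  proof -
    let ?F = "\<lambda>q. \<Sum>j\<in>UNIV. \<epsilon> j * (dir_deriv A (e j) (v j) q - v j q * (\<Sum>i\<in>UNIV. \<epsilon> i * christ nabla e i i j q))"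
    have "smooth_fun A W ?F"
      by (intro smooth_fun_sum smooth_fun_mult smooth_fun_diff smooth_fun_const smooth_fun_dir_deriv v se smooth_fun_christ[OF e] W)
    from borel_measurable_continuous_on_indicator[OF borel_open[OF W] continuous_on_smooth_fun[OF W this]]
    have "(\<lambda>q. indicator W q *\<^sub>R ?F q) \<in> borel_measurable borel" .
    moreover have "(\<lambda>q. indicator W q *\<^sub>R ?F q) = F" by (auto simp: F_def indicator_def)
    ultimately show ?thesis by simp
  qed
  have chart: "integrable vol F \<longleftrightarrow> integrable lborel (\<lambda>x. indicator ?U x * vol_density c x * F (chart_inv c x))"
    "integral\<^sup>L vol F = (\<integral>x. indicator ?U x * vol_density c x * F (chart_inv c x) \<partial>lborel)"
    by (rule vol_integral_chart[OF Fm]; erule F0)+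
  have zi: "integrable lborel (\<lambda>y. \<Sum>j\<in>UNIV. \<Sum>i\<in>UNIV. \<epsilon> j * frechet_derivative (H i j) (at y) (axis i 1))"
    by (intro Bochner_Integration.integrable_sum integrable_mult_right z(1))
  then show "integrable vol F"
    using chart(1) by (simp only: sumH)
  have "integral\<^sup>L vol F = (\<Sum>j\<in>UNIV. \<Sum>i\<in>UNIV. \<epsilon> j * (\<integral>y. frechet_derivative (H i j) (at y) (axis i 1) \<partial>lborel))"
    using chart(2) z(1)
    by (simp add: sumH Bochner_Integration.integral_sum integrable_mult_right Bochner_Integration.integrable_sum)
  then show "integral\<^sup>L vol F = 0" by (simp add: z(2))
qed

text \<open>The integral could vanish only if the integrand in the chart were zero almost
  everywhere, but by continuity it is positive on a ball.\<close>

lemma vol_positive: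
  fixes f :: "'a \<Rightarrow> real"
  assumes f: "continuous_on W f" and f0: "\<And>q. q \<in> W \<Longrightarrow> f q \<ge> 0" and p: "p \<in> W" "f p > 0"
    and out: "\<And>q. q \<notin> W \<Longrightarrow> f q = 0" and int: "integrable vol f"
  shows "integral\<^sup>L vol f > 0"
proof -
  let ?U = "snd c ` W"
  have W: "open W" using e by (simp add: pframe_def)
  have U: "open ?U" by (rule frame_image_open[OF e c Wc])
  have fm: "f \<in> borel_measurable borel" using borel_measurable_integrable[OF int] by (simp add: measurable_vol)
  let ?h = "\<lambda>x. indicator ?U x * vol_density c x * f (chart_inv c x)"
  have chart: "integrable vol f \<longleftrightarrow> integrable lborel ?h" "integral\<^sup>L vol f = integral\<^sup>L lborel ?h"
    by (rule vol_integral_chart[OF fm]; erule out)+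
  have hi: "integrable lborel ?h" using int chart(1) by simp
  have h0: "?h x \<ge> 0" for x
    using f0 frame_coord_point(1)[OF e c Wc] by (auto simp: indicator_def vol_density_def)
  note chart(2)
  moreover have "integral\<^sup>L lborel ?h \<ge> 0" using h0 by simp
  moreover have "integral\<^sup>L lborel ?h \<noteq> 0"
  proof
    assume "integral\<^sup>L lborel ?h = 0"
    then have ae: "AE x in lborel. ?h x = 0" using integral_nonneg_eq_0_iff_AE[OF hi] h0 by simp
    have cont: "continuous_on ?U (\<lambda>x. f (chart_inv c x))"
    proof (rule continuous_on_compose2[OF f])
      show "continuous_on ?U (chart_inv c)"
        by (rule continuous_on_subset[OF chart_inv_continuous[OF c]]) (use Wc in auto)
      show "chart_inv c ` ?U \<subseteq> W" using frame_coord_point(1)[OF e c Wc] by auto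
    qed
    define N where "N = ?U \<inter> (\<lambda>x. f (chart_inv c x)) -` {0<..}"
    have "open N" unfolding N_def by (rule continuous_open_preimage[OF cont U open_greaterThan])
    moreover have "snd c p \<in> N" using p Wc by (auto simp: N_def chart_inv_left[OF c])
    ultimately obtain r where r: "r > 0" "ball (snd c p) r \<subseteq> N" using openE by blast
    have pos: "?h x > 0" if "x \<in> N" for x
    proof -
      have "x \<in> ?U" "f (chart_inv c x) > 0" using that by (auto simp: N_def)
      then show ?thesis using vol_density_frame[OF e c Wc, of x] by simp
    qed
    have "AE x in lborel. x \<notin> ball (snd c p) r" using ae
      by eventually_elim (use pos r(2) in force)
    then have "emeasure lborel (ball (snd c p) r) = 0"
      by (subst (asm) AE_iff_measurable[OF _ refl]) (auto simp: ball_def)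
    moreover have "emeasure lborel (ball (snd c p) r) > 0"
      using r(1) by (simp add: emeasure_ball unit_ball_vol_pos ennreal_less_zero_iff zero_less_mult_iff)
    ultimately show False by simp
  qed
  ultimately show ?thesis by linarith
qed

end

end

section \<open>Critical contorsion tensors\<close>

context atlas
begin

lemma smooth_tensor12_scale:
  assumes B: "smooth_tensor12 A B" and \<psi>: "smooth_fun A UNIV \<psi>"
  shows "smooth_tensor12 A (\<lambda>p v w. \<psi> p *\<^sub>R B p v w)"
  unfolding smooth_tensor12_def Let_def
proof (intro conjI allI ballI)
  have b: "bilinear (B p)" for p using B by (simp add: smooth_tensor12_def)
  show "bilinear (\<lambda>v w. \<psi> p *\<^sub>R B p v w)" for p
    unfolding bilinear_def
    by (auto intro!: linearI simp: bilinear_ladd[OF b] bilinear_radd[OF b] bilinear_lmul[OF b] bilinear_rmul[OF b] algebra_simps)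
  fix c v w assume c: "c \<in> A"
  let ?U = "snd c ` fst c"
  let ?b = "\<lambda>x. to_coord A c (chart_inv c x) (B (chart_inv c x) (of_coord A c (chart_inv c x) v) (of_coord A c (chart_inv c x) w))"
  have sb: "smooth_on ?U ?b" using B c unfolding smooth_tensor12_def Let_def by blast
  have s\<psi>: "smooth_on ?U (\<lambda>x. \<psi> (chart_inv c x))" using smooth_funD[OF \<psi> c] by (simp add: o_def)
  show "smooth_on ?U (\<lambda>x. to_coord A c (chart_inv c x) (\<psi> (chart_inv c x) *\<^sub>R B (chart_inv c x) (of_coord A c (chart_inv c x) v) (of_coord A c (chart_inv c x) w)))"
    by (rule smooth_on_cong[OF chart_image_open[OF c] _ smooth_on_scaleR[OF chart_image_open[OF c] s\<psi> sb]])
       (use chart_inv_in[OF c] in \<open>auto simp: linear_scale[OF linear_to_coord[OF c]]\<close>)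
qed

end

context multi_product
begin

section \<open>The first variation as divergence plus Euler-Lagrange term\<close>

definition EL where
  "EL T E \<beta> \<epsilon> p = el_coeff \<epsilon> (\<lambda>i. fst (\<beta> i)) (\<lambda>x y z. christ (nabla_bar nabla T) (fe E \<beta>) x y z p)
     (\<lambda>x y z. christ nabla (fe E \<beta>) x y z p)"

text \<open>Up to the sign \<open>\<epsilon> j\<close>, the coefficient of \<open>e j\<close> in the
  field whose divergence is split off: it collects the components of \<open>B\<close> that
  \<open>curv_variation\<close> differentiates along \<open>e j\<close>.\<close>

definition div_field where
  "div_field B E \<beta> \<epsilon> j q = (\<Sum>a\<in>UNIV. (if fst (\<beta> a) = fst (\<beta> j) then 0 else \<epsilon> a) * (tcomp B (fe E \<beta>) a a j q - tcomp B (fe E \<beta>) a j a q))"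

lemma smooth_fun_div_field:
  assumes E: "lframe W E \<beta> \<epsilon>" and B: "smooth_tensor12 A B"
  shows "smooth_fun A W (div_field B E \<beta> \<epsilon> j)"
proof -
  have W: "open W" using lframe_pframe[OF E] by (simp add: pframe_def)
  show ?thesis
    unfolding div_field_def[abs_def]
    by (intro smooth_fun_sum smooth_fun_mult smooth_fun_diff smooth_fun_const smooth_fun_tcomp[OF lframe_pframe[OF E] B] W)
qed

lemma smooth_fun_EL:
  assumes E: "lframe W E \<beta> \<epsilon>" and T: "smooth_tensor12 A T"
  shows "smooth_fun A W (\<lambda>p. EL T E \<beta> \<epsilon> p x y z)"
proof -
  note pf = lframe_pframe[OF E]
  have W: "open W" using pf by (simp add: pframe_def)
  have I: "smooth_fun A W (\<lambda>p. if b then f p else h p)" if "smooth_fun A W f" "smooth_fun A W h" for b f h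
    using that by (cases b) auto
  show ?thesis
    unfolding EL_def el_coeff_def christ_nabla_bar
    by (intro smooth_fun_add smooth_fun_diff smooth_fun_mult smooth_fun_sum smooth_fun_const I
        smooth_fun_christ[OF pf] smooth_fun_tcomp[OF pf T] W)
qed

text \<open>The derivative terms are completed to divergences by the Christoffel traces
  \<open>S j\<close>, and \<open>first_variation_algebra\<close> absorbs what this adds.\<close>

lemma curv_variation_eq:
  assumes E: "lframe W E \<beta> \<epsilon>" and p: "p \<in> W" and B: "smooth_tensor12 A B"
  defines "S \<equiv> \<lambda>j. \<Sum>i\<in>UNIV. \<epsilon> i * christ nabla (fe E \<beta>) i i j p"
  shows "2 * curv_variation T B E \<beta> \<epsilon> p =
     (\<Sum>j\<in>UNIV. \<epsilon> j * (dir_deriv A (fe E \<beta> j) (div_field B E \<beta> \<epsilon> j) p - div_field B E \<beta> \<epsilon> j p * S j))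
   + (\<Sum>x\<in>UNIV. \<Sum>y\<in>UNIV. \<Sum>z\<in>UNIV. \<epsilon> x * \<epsilon> y * \<epsilon> z * EL T E \<beta> \<epsilon> p x y z * tcomp B (fe E \<beta>) x y z p)"
proof -
  let ?e = "fe E \<beta>" and ?G = "\<lambda>i j l. christ (nabla_bar nabla T) (fe E \<beta>) i j l p" and ?\<Gamma> = "\<lambda>i j l. christ nabla (fe E \<beta>) i j l p"
  let ?B = "\<lambda>i j l. tcomp B (fe E \<beta>) i j l p"
  define \<delta> where "\<delta> = (\<lambda>i j. if fst (\<beta> i) = fst (\<beta> j) then 0 else 1::real)"
  have if\<delta>: "(if fst (\<beta> i) = fst (\<beta> j) then 0 else r) = \<delta> i j * r" for i j r by (simp add: \<delta>_def)
  note pf = lframe_pframe[OF E]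
  have W: "open W" using pf by (simp add: pframe_def)
  have n: "\<epsilon> i * \<epsilon> i = 1" for i using pf by (simp add: pframe_def)
  note sB = smooth_fun_tcomp[OF pf B]
  have dd: "dir_deriv A X (div_field B E \<beta> \<epsilon> j) p = (\<Sum>a\<in>UNIV. \<delta> a j * \<epsilon> a * (dir_deriv A X (tcomp B ?e a a j) p - dir_deriv A X (tcomp B ?e a j a) p))" for X j
  proof -
    have df: "dir_deriv A X (\<lambda>q. c * (f q - h q)) p = c * (dir_deriv A X f p - dir_deriv A X h p)"
      if "smooth_fun A W f" "smooth_fun A W h" for f h c
    proof -
      have m: "smooth_fun A W (\<lambda>q. (-1) * h q)" by (intro smooth_fun_mult smooth_fun_const W that)
      have "dir_deriv A X (\<lambda>q. f q + (-1) * h q) p = dir_deriv A X f p - dir_deriv A X h p"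
        using dir_deriv_add[OF that(1) m p] dir_deriv_cmult[OF that(2) p, of X "-1"] by simp
      moreover have "smooth_fun A W (\<lambda>q. f q + (-1) * h q)" by (intro smooth_fun_add W that m)
      ultimately show ?thesis using dir_deriv_cmult[OF _ p, of "\<lambda>q. f q + (-1) * h q" X c] by simp
    qed
    show ?thesis
      unfolding div_field_def[abs_def] if\<delta>
      by (subst dir_deriv_sum[OF W p])
         (auto intro!: smooth_fun_mult smooth_fun_diff smooth_fun_const sB W sum.cong simp: df[OF sB sB])
  qed
  have split: "2 * curv_variation T B E \<beta> \<epsilon> p =
      (\<Sum>i\<in>UNIV. \<Sum>j\<in>UNIV. \<delta> i j * (\<epsilon> i * \<epsilon> j) * (dir_deriv A (?e j) (tcomp B ?e i i j) p))
    - (\<Sum>i\<in>UNIV. \<Sum>j\<in>UNIV. \<delta> i j * (\<epsilon> i * \<epsilon> j) * (dir_deriv A (?e i) (tcomp B ?e j i j) p))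
    + (\<Sum>a\<in>UNIV. \<Sum>b\<in>UNIV. if fst (\<beta> a) = fst (\<beta> b) then 0 else \<epsilon> a * \<epsilon> b * (\<Sum>c\<in>UNIV. \<epsilon> c *
            (?B a a c * ?G b c b + ?G a a c * ?B b c b - ?B b a c * ?G a c b - ?G b a c * ?B a c b + (?\<Gamma> a b c - ?\<Gamma> b a c) * ?B c a b)))"
    unfolding curv_variation_def Let_def if\<delta> sum.distrib[symmetric] sum_subtractf[symmetric]
    by (simp only: mult.assoc[symmetric], simp) (intro sum.cong refl, simp add: algebra_simps)
  \<comment> \<open>Exchanging \<open>i\<close> and \<open>j\<close> makes both derivative sums
    differentiate along \<open>e j\<close>.\<close>
  have sw: "(\<Sum>i\<in>UNIV. \<Sum>j\<in>UNIV. \<delta> i j * (\<epsilon> i * \<epsilon> j) * (dir_deriv A (?e i) (tcomp B ?e j i j) p))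
     = (\<Sum>i\<in>UNIV. \<Sum>j\<in>UNIV. \<delta> i j * (\<epsilon> i * \<epsilon> j) * (dir_deriv A (?e j) (tcomp B ?e i j i) p))"
    by (subst sum.swap, intro sum.cong refl) (simp add: \<delta>_def mult_ac)
  have divs: "(\<Sum>j\<in>UNIV. \<epsilon> j * dir_deriv A (?e j) (div_field B E \<beta> \<epsilon> j) p) =
      (\<Sum>i\<in>UNIV. \<Sum>j\<in>UNIV. \<delta> i j * (\<epsilon> i * \<epsilon> j) * (dir_deriv A (?e j) (tcomp B ?e i i j) p))
    - (\<Sum>i\<in>UNIV. \<Sum>j\<in>UNIV. \<delta> i j * (\<epsilon> i * \<epsilon> j) * (dir_deriv A (?e j) (tcomp B ?e i j i) p))"
  proof -
    have "(\<Sum>j\<in>UNIV. \<epsilon> j * dir_deriv A (?e j) (div_field B E \<beta> \<epsilon> j) p) =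
      (\<Sum>j\<in>UNIV. \<Sum>i\<in>UNIV. \<delta> i j * (\<epsilon> i * \<epsilon> j) * (dir_deriv A (?e j) (tcomp B ?e i i j) p) - \<delta> i j * (\<epsilon> i * \<epsilon> j) * (dir_deriv A (?e j) (tcomp B ?e i j i) p))"
      unfolding dd sum_distrib_left by (intro sum.cong refl) (simp add: algebra_simps)
    also have "\<dots> = (\<Sum>i\<in>UNIV. \<Sum>j\<in>UNIV. \<delta> i j * (\<epsilon> i * \<epsilon> j) * (dir_deriv A (?e j) (tcomp B ?e i i j) p) - \<delta> i j * (\<epsilon> i * \<epsilon> j) * (dir_deriv A (?e j) (tcomp B ?e i j i) p))"
      by (rule sum.swap)
    finally show ?thesis by (simp add: sum_subtractf)
  qed
  have alg: "(\<Sum>a\<in>UNIV. \<Sum>b\<in>UNIV. if fst (\<beta> a) = fst (\<beta> b) then 0 else \<epsilon> a * \<epsilon> b * (\<Sum>c\<in>UNIV. \<epsilon> c *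
            (?B a a c * ?G b c b + ?G a a c * ?B b c b - ?B b a c * ?G a c b - ?G b a c * ?B a c b + (?\<Gamma> a b c - ?\<Gamma> b a c) * ?B c a b)))
     + (\<Sum>j\<in>UNIV. \<epsilon> j * (div_field B E \<beta> \<epsilon> j p * S j))
     = (\<Sum>x\<in>UNIV. \<Sum>y\<in>UNIV. \<Sum>z\<in>UNIV. \<epsilon> x * \<epsilon> y * \<epsilon> z * EL T E \<beta> \<epsilon> p x y z * ?B x y z)"
  proof -
    have "div_field B E \<beta> \<epsilon> j p = (\<Sum>a\<in>UNIV. if fst (\<beta> a) = fst (\<beta> j) then 0 else \<epsilon> a * (?B a a j - ?B a j a))" for j
      unfolding div_field_def by (intro sum.cong refl) auto
    then show ?thesis
      using first_variation_algebra[where d="\<lambda>i. fst (\<beta> i)" and B="?B" and G="?G" and \<Gamma>="?\<Gamma>", OF n] unfolding S_def EL_def by (simp only:)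
  qed
  show ?thesis
    unfolding split sw alg[symmetric] right_diff_distrib sum_subtractf divs by simp
qed

text \<open>The first variation as a global function, free of frames, so that it can be integrated
  over \<Omega>; \<open>curv_variation\<close> is its expression in each local frame.\<close>

definition variation where
  "variation T B q = deriv (\<lambda>t. mixed_curv (\<lambda>p v w. T p v w + t *\<^sub>R B p v w) q) 0"

lemma variation_frame:
  assumes T: "smooth_tensor12 A T" and B: "smooth_tensor12 A B" and E: "lframe W E \<beta> \<epsilon>" and p: "p \<in> W"
  shows "variation T B p = curv_variation T B E \<beta> \<epsilon> p"
proof -
  have "((\<lambda>t. mixed_curv (\<lambda>p v w. T p v w + t *\<^sub>R B p v w) p) has_real_derivative
     curv_variation (\<lambda>p v w. T p v w + 0 *\<^sub>R B p v w) (tensor_velocity (\<lambda>t p v w. T p v w + t *\<^sub>R B p v w)) E \<beta> \<epsilon> p) (at 0)"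
    by (rule mixed_curv_first_variation[OF smooth_tensor12_line[OF T B, of 1] chart_at(1) E _ chart_at(2) p]) simp
  then show ?thesis unfolding variation_def tensor_velocity_line by (simp add: DERIV_imp_deriv)
qed

lemma frame_domain_exists:
  assumes k: "k \<ge> 1"
  obtains W E \<beta> \<epsilon> c where "p \<in> W" "lframe W E \<beta> \<epsilon>" "c \<in> A" "W \<subseteq> fst c"
proof -
  obtain W0 E where E: "p \<in> W0" "open W0" "adapted_frame A k n D g W0 E" using adapted_frame_exists .
  obtain W' \<beta> \<epsilon> where W': "p \<in> W'" "lframe W' E \<beta> \<epsilon>" using adapted_frame_lframe[OF E(3,1) k] by metis
  let ?W = "W' \<inter> fst (chart_at A p)"
  have "open W'" using lframe_pframe[OF W'(2)] by (simp add: pframe_def)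
  then have "lframe ?W E \<beta> \<epsilon>"
    by (intro lframe_subset[OF W'(2)] open_Int chart_dom_open[OF chart_at(1)]) auto
  moreover have "p \<in> ?W" using W'(1) chart_at(2) by blast
  ultimately show thesis using that[of ?W E \<beta> \<epsilon> "chart_at A p"] chart_at(1) by blast
qed

lemma tcomp_zero: "B q = (\<lambda>v w. 0) \<Longrightarrow> tcomp B e i j l q = 0"
  by (simp add: tcomp_def g_simps)

text \<open>\<open>curv_variation\<close> contains first derivatives of \<open>B\<close>, so
  \<open>B\<close> is required to vanish near \<open>p\<close> and not only at
  \<open>p\<close>.\<close>

lemma variation_zero:
  assumes T: "smooth_tensor12 A T" and B: "smooth_tensor12 A B" and k: "k \<ge> 1"
    and N: "open N" "p \<in> N" and zero: "\<And>q. q \<in> N \<Longrightarrow> B q = (\<lambda>v w. 0)"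
  shows "variation T B p = 0"
proof -
  obtain W E \<beta> \<epsilon> c where W: "p \<in> W" and E: "lframe W E \<beta> \<epsilon>" using frame_domain_exists[OF k] by metis
  have "dir_deriv A X (tcomp B (fe E \<beta>) i j l) p = 0" for X i j l
  proof -
    have "dir_deriv A X (\<lambda>q. 0) p = dir_deriv A X (tcomp B (fe E \<beta>) i j l) p"
      by (rule dir_deriv_cong[OF N _ smooth_fun_const refl]) (simp add: tcomp_zero zero)
    then show ?thesis by (simp add: dir_deriv_const)
  qed
  moreover have "tcomp B (fe E \<beta>) i j l p = 0" for i j l by (rule tcomp_zero) (rule zero[OF N(2)])
  ultimately show ?thesis
    unfolding variation_frame[OF T B E W] curv_variation_def Let_def by (simp cong: if_cong)
qed

text \<open>In a frame, \<open>curv_variation\<close> is linear in the components of the direction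
  and their derivatives. Additivity is what allows a variation to be split by bump
  functions.\<close>

lemma variation_add:
  assumes T: "smooth_tensor12 A T" and B: "smooth_tensor12 A B" and B1: "smooth_tensor12 A B1" and B2: "smooth_tensor12 A B2"
    and k: "k \<ge> 1" and eq: "\<And>p v w. B p v w = B1 p v w + B2 p v w"
  shows "variation T B p = variation T B1 p + variation T B2 p"
proof -
  obtain W E \<beta> \<epsilon> c where p: "p \<in> W" and E: "lframe W E \<beta> \<epsilon>" using frame_domain_exists[OF k] by metis
  note pf = lframe_pframe[OF E]
  have t: "tcomp B e i j l = (\<lambda>q. tcomp B1 e i j l q + tcomp B2 e i j l q)" for e i j l
    by (rule ext) (simp add: tcomp_def eq g_simps)
  have d: "dir_deriv A X (tcomp B (fe E \<beta>) i j l) p = dir_deriv A X (tcomp B1 (fe E \<beta>) i j l) p + dir_deriv A X (tcomp B2 (fe E \<beta>) i j l) p" for X i j l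
    unfolding t by (rule dir_deriv_add[OF smooth_fun_tcomp[OF pf B1] smooth_fun_tcomp[OF pf B2] p])
  show ?thesis
    unfolding variation_frame[OF T B E p] variation_frame[OF T B1 E p] variation_frame[OF T B2 E p] curv_variation_def Let_def
      distrib_left[symmetric] sum.distrib[symmetric]
    by (intro arg_cong[where f="\<lambda>x. (1/2) * x"] sum.cong refl)
       (simp only: d, simp add: t algebra_simps sum.distrib sum_subtractf)
qed

lemma smooth_fun_mixed_curv:
  assumes T: "smooth_tensor12 A T" and E: "lframe W E \<beta> \<epsilon>"
  shows "smooth_fun A W (mixed_curv T)"
proof -
  note pf = lframe_pframe[OF E]
  let ?e = "fe E \<beta>"
  have W: "open W" and se: "smooth_field A W (?e i)" for i using pf by (auto simp: pframe_def)
  note sc = smooth_fun_christ[OF pf] and st = smooth_fun_tcomp[OF pf T]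
  have I: "smooth_fun A W (\<lambda>p. if b then f p else h p)" if "smooth_fun A W f" "smooth_fun A W h" for b f h
    using that by (cases b) auto
  show ?thesis
    by (rule smooth_fun_cong[OF W mixed_curv_frame[OF T E, symmetric]], assumption)
       (intro smooth_fun_add smooth_fun_diff smooth_fun_mult smooth_fun_sum smooth_fun_const I smooth_fun_dir_deriv sc st se W)
qed

lemma continuous_mixed_curv:
  assumes T: "smooth_tensor12 A T" and k: "k \<ge> 1"
  shows "continuous_on UNIV (mixed_curv T)"
proof (rule continuous_at_imp_continuous_on, rule ballI)
  fix p
  obtain W E \<beta> \<epsilon> c where p: "p \<in> W" and E: "lframe W E \<beta> \<epsilon>" using frame_domain_exists[OF k] by metis
  have W: "open W" using lframe_pframe[OF E] by (simp add: pframe_def)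
  show "isCont (mixed_curv T) p"
    using continuous_on_smooth_fun[OF W smooth_fun_mixed_curv[OF T E]] W p by (simp add: continuous_on_eq_continuous_at)
qed

section \<open>Uniform bounds for families of contorsion tensors\<close>

text \<open>In a chart the mixed curvature and its time derivative are jointly continuous, so on a
  product neighbourhood they exceed their absolute values at time 0 and position \<open>p\<close> by
  at most 1.\<close>

lemma family_local_bound:
  assumes F: "smooth_tensor12_family A r F" and r: "r > 0" and k: "k \<ge> 1"
  shows "\<exists>N \<delta> C. open N \<and> p \<in> N \<and> \<delta> > 0 \<and> (\<forall>q\<in>N. \<forall>t. \<bar>t\<bar> < \<delta> \<longrightarrow>
     \<bar>mixed_curv (F t) q\<bar> \<le> C \<and> \<bar>deriv (\<lambda>s. mixed_curv (F s) q) t\<bar> \<le> C \<and>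
     ((\<lambda>s. mixed_curv (F s) q) has_real_derivative deriv (\<lambda>s. mixed_curv (F s) q) t) (at t))"
proof -
  obtain W E \<beta> \<epsilon> c where p: "p \<in> W" and E: "lframe W E \<beta> \<epsilon>" and c: "c \<in> A" "W \<subseteq> fst c" using frame_domain_exists[OF k] by metis
  let ?I = "{-r<..<r}" and ?U = "snd c ` (fst c \<inter> W)" and ?x = "snd c p"
  define \<Psi> where "\<Psi> = (\<lambda>z :: real \<times> (real ^ 'n). mixed_curv (F (fst z)) (chart_inv c (snd z)))"
  have s\<Psi>: "smooth_on (?I \<times> ?U) \<Psi>" unfolding \<Psi>_def by (rule smooth_on_mixed_curv_family[OF F c(1) E])
  have W: "open W" using lframe_pframe[OF E] by (simp add: pframe_def)
  have U: "open ?U" by (rule open_chart_image[OF c(1) W])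
  have x: "?x \<in> ?U" using p c by auto
  have o: "open (?I \<times> ?U)" "(0, ?x) \<in> ?I \<times> ?U" using U x r by (auto simp: open_Times)
  let ?D = "\<lambda>z. frechet_derivative \<Psi> (at z) (1, 0)"
  have c1: "isCont \<Psi> (0, ?x)" and c2: "isCont ?D (0, ?x)"
    using bspec[OF smooth_on_continuous[OF s\<Psi>, unfolded continuous_on_eq_continuous_at[OF o(1)]] o(2)]
      bspec[OF smooth_on_continuous[OF smooth_on_deriv[OF s\<Psi>], unfolded continuous_on_eq_continuous_at[OF o(1)]] o(2)] .
  obtain \<rho>0 where \<rho>0: "\<rho>0 > 0" "ball (0, ?x) \<rho>0 \<subseteq> ?I \<times> ?U" using o openE by blast
  obtain \<rho>1 where \<rho>1: "\<rho>1 > 0" "\<And>z. dist z (0, ?x) < \<rho>1 \<Longrightarrow> \<bar>\<Psi> z - \<Psi> (0, ?x)\<bar> < 1"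
    using c1 unfolding continuous_at_eps_delta dist_real_def by (metis zero_less_one)
  obtain \<rho>2 where \<rho>2: "\<rho>2 > 0" "\<And>z. dist z (0, ?x) < \<rho>2 \<Longrightarrow> \<bar>?D z - ?D (0, ?x)\<bar> < 1"
    using c2 unfolding continuous_at_eps_delta dist_real_def by (metis zero_less_one)
  define \<rho> where "\<rho> = min \<rho>0 (min \<rho>1 \<rho>2)"
  have \<rho>: "\<rho> > 0" using \<rho>0 \<rho>1 \<rho>2 by (simp add: \<rho>_def)
  define C where "C = \<bar>\<Psi> (0, ?x)\<bar> + \<bar>?D (0, ?x)\<bar> + 1"
  \<comment> \<open>Half the radius in each factor, because the distance in the product is at most
    the sum of the two distances.\<close>
  define N where "N = chart_inv c ` (?U \<inter> ball ?x (\<rho> / 2))"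
  have "open N" unfolding N_def by (rule open_chart_preimage[OF c(1)]) (use U in \<open>auto simp: open_Int\<close>)
  moreover have "p \<in> N"
  proof -
    have "p \<in> fst c" using p c by blast
    then show ?thesis unfolding N_def
      by (intro image_eqI[of _ _ ?x]) (simp_all add: chart_inv_left[OF c(1)] x \<rho>)
  qed
  moreover have "\<bar>mixed_curv (F t) q\<bar> \<le> C \<and> \<bar>deriv (\<lambda>s. mixed_curv (F s) q) t\<bar> \<le> C \<and>
     ((\<lambda>s. mixed_curv (F s) q) has_real_derivative deriv (\<lambda>s. mixed_curv (F s) q) t) (at t)" if q: "q \<in> N" and t: "\<bar>t\<bar> < \<rho> / 2" for q t
  proof -
    obtain y where y': "y \<in> ?U" "y \<in> ball ?x (\<rho> / 2)" "q = chart_inv c y" using q unfolding N_def by blast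
    have y: "y \<in> ?U" "dist y ?x < \<rho> / 2" "q = chart_inv c y" using y' by (simp_all only: mem_ball dist_commute)
    have "dist (t, y) (0, ?x) \<le> dist t 0 + dist y ?x"
      using sqrt_sum_squares_le_sum_abs[of t "dist y ?x"] by (simp add: dist_Pair_Pair)
    then have near: "dist (t, y) (0, ?x) < \<rho>" using t y(2) by simp
    then have "(t, y) \<in> ?I \<times> ?U" using \<rho>0(2) by (auto simp: \<rho>_def dist_commute)
    then have ty: "t \<in> ?I" "y \<in> ?U" by auto
    have d: "((\<lambda>s. mixed_curv (F s) q) has_real_derivative ?D (t, y)) (at t)"
      using slice_derivatives(1)[OF s\<Psi> ty] by (simp add: \<Psi>_def y(3) has_real_derivative_iff_has_vector_derivative)
    have "\<bar>\<Psi> (t, y)\<bar> \<le> C" "\<bar>?D (t, y)\<bar> \<le> C"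
      using \<rho>1(2)[of "(t, y)"] \<rho>2(2)[of "(t, y)"] near by (auto simp: C_def \<rho>_def)
    moreover have "\<Psi> (t, y) = mixed_curv (F t) q" by (simp add: \<Psi>_def y(3))
    ultimately show ?thesis using d unfolding DERIV_imp_deriv[OF d] by simp
  qed
  ultimately show ?thesis using \<rho> by (intro exI[of _ N] exI[of _ "\<rho> / 2"] exI[of _ C]) auto
qed

lemma family_uniform_bound:
  assumes F: "smooth_tensor12_family A r F" and r: "r > 0" and k: "k \<ge> 1" and K: "compact K"
  obtains \<delta> C where "\<delta> > 0" "\<And>q t. q \<in> K \<Longrightarrow> \<bar>t\<bar> < \<delta> \<Longrightarrow> \<bar>mixed_curv (F t) q\<bar> \<le> C"
    "\<And>q t. q \<in> K \<Longrightarrow> \<bar>t\<bar> < \<delta> \<Longrightarrow> \<bar>deriv (\<lambda>s. mixed_curv (F s) q) t\<bar> \<le> C"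
    "\<And>q t. q \<in> K \<Longrightarrow> \<bar>t\<bar> < \<delta> \<Longrightarrow> ((\<lambda>s. mixed_curv (F s) q) has_real_derivative deriv (\<lambda>s. mixed_curv (F s) q) t) (at t)"
proof -
  let ?P = "\<lambda>\<delta> C q t. \<bar>mixed_curv (F t) q\<bar> \<le> C \<and> \<bar>deriv (\<lambda>s. mixed_curv (F s) q) t\<bar> \<le> C \<and>
     ((\<lambda>s. mixed_curv (F s) q) has_real_derivative deriv (\<lambda>s. mixed_curv (F s) q) t) (at t)"
  obtain N \<delta> C where N: "\<And>p. open (N p)" "\<And>p. p \<in> N p" "\<And>p. \<delta> p > (0::real)"
    and P: "\<And>p q t. q \<in> N p \<Longrightarrow> \<bar>t\<bar> < \<delta> p \<Longrightarrow> ?P (\<delta> p) (C p) q t"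
    using family_local_bound[OF F r k] by metis
  obtain S where S: "S \<subseteq> K" "finite S" "K \<subseteq> (\<Union>p\<in>S. N p)"
    by (rule compactE_image[OF K, of K N]) (use N in auto)
  \<comment> \<open>The inserted 1 and 0 give the minimum and the maximum a meaning when
    \<open>S\<close> is empty.\<close>
  define \<delta>' where "\<delta>' = Min (insert 1 (\<delta> ` S))"
  define C' where "C' = Max (insert 0 (C ` S))"
  have \<delta>': "\<delta>' > 0" "\<And>p. p \<in> S \<Longrightarrow> \<delta>' \<le> \<delta> p" using S(2) N(3) by (auto simp: \<delta>'_def)
  have C': "C p \<le> C'" if "p \<in> S" for p using S(2) that by (auto simp: C'_def)
  have Q: "?P \<delta>' C' q t" if q: "q \<in> K" and t: "\<bar>t\<bar> < \<delta>'" for q t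
  proof -
    obtain p where p: "p \<in> S" "q \<in> N p" using S(3) q by blast
    have "\<bar>t\<bar> < \<delta> p" using \<delta>'(2)[OF p(1)] t by simp
    from P[OF p(2) this] C'[OF p(1)] show ?thesis by auto
  qed
  show thesis by (rule that[OF \<delta>'(1)]) (use Q in auto)
qed

end

locale multi_product_volume = multi_product A g nabla k n D + volume_atlas A g nabla vol
  for A :: "('a::{t2_space,second_countable_topology}, 'n::finite) chart set" and g and nabla :: "('a, 'n) connection"
    and k n D and vol :: "'a measure" +
  assumes k: "k \<ge> 1"
begin

text \<open>\<open>volume_measure\<close> describes \<open>vol\<close> on Borel subsets of single
  chart domains. Finiteness is therefore obtained on chart balls, where the continuous density is
  integrable, and summed over a finite cover.\<close>

lemma vol_compact_finite:
  assumes K: "compact K" shows "emeasure vol K < \<infinity>"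
proof -
  have "\<exists>N. open N \<and> p \<in> N \<and> emeasure vol N < \<infinity>" for p
  proof -
    obtain W E \<beta> \<epsilon> c where p: "p \<in> W" and E: "lframe W E \<beta> \<epsilon>" and c: "c \<in> A" "W \<subseteq> fst c" using frame_domain_exists[OF k] by metis
    note pf = lframe_pframe[OF E]
    let ?U = "snd c ` W"
    have U: "open ?U" by (rule frame_image_open[OF pf c])
    have "snd c p \<in> ?U" using p by blast
    then obtain s where s: "s > 0" "cball (snd c p) s \<subseteq> ?U" using U open_contains_cball by blast
    let ?B = "ball (snd c p) s"
    have BU: "?B \<subseteq> ?U" using s(2) ball_subset_cball by blast
    define N where "N = chart_inv c ` ?B"
    have Uc: "?U \<subseteq> snd c ` fst c" using c by auto
    have N: "open N" unfolding N_def by (rule open_chart_preimage[OF c(1)]) (use BU Uc in auto)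
    have NW: "N \<subseteq> W" unfolding N_def using BU frame_coord_point(1)[OF pf c] by auto
    have pN: "p \<in> N" unfolding N_def using s(1) p c by (intro image_eqI[of _ _ "snd c p"]) (auto simp: chart_inv_left[OF c(1)])
    have iff: "chart_inv c x \<in> N \<longleftrightarrow> x \<in> ?B" if "x \<in> ?U" for x
    proof
      assume "chart_inv c x \<in> N"
      then obtain y where y: "y \<in> ?B" "chart_inv c x = chart_inv c y" by (auto simp: N_def)
      then have "x = y" using frame_coord_point(3)[OF pf c, of x] frame_coord_point(3)[OF pf c, of y] that BU by auto
      then show "x \<in> ?B" using y by simp
    qed (auto simp: N_def)
    have "integrable lborel (\<lambda>x. indicator (cball (snd c p) s) x *\<^sub>R vol_density c x)"
      by (rule borel_integrable_compact[OF compact_cball])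
         (rule continuous_on_subset[OF smooth_on_continuous[OF smooth_on_vol_density[OF pf c]] s(2)])
    then have "integrable lborel (\<lambda>x. indicator ?B x *\<^sub>R (indicator (cball (snd c p) s) x *\<^sub>R vol_density c x))"
      by (rule integrable_mult_indicator[rotated]) simp
    moreover have "(\<lambda>x. indicator ?B x *\<^sub>R (indicator (cball (snd c p) s) x *\<^sub>R vol_density c x))
        = (\<lambda>x. indicator ?U x * vol_density c x * indicator N (chart_inv c x))"
      using iff BU by (auto simp: indicator_def fun_eq_iff)
    ultimately have "integrable lborel (\<lambda>x. indicator ?U x * vol_density c x * indicator N (chart_inv c x))" by simp
    moreover have "integrable vol (indicator N :: 'a \<Rightarrow> real) \<longleftrightarrow> integrable lborel (\<lambda>x. indicator ?U x * vol_density c x * indicator N (chart_inv c x))"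
      by (rule vol_integral_chart(1)[OF pf c]) (use N NW in \<open>auto simp: indicator_def\<close>)
    ultimately have "integrable vol (indicator N :: 'a \<Rightarrow> real)" by simp
    then have "emeasure vol N < \<infinity>" by (simp add: integrable_indicator_iff space_vol)
    then show ?thesis using N pN by blast
  qed
  then obtain N where N: "\<And>p. open (N p)" "\<And>p. p \<in> N p" "\<And>p. emeasure vol (N p) < \<infinity>" by metis
  obtain S where S: "S \<subseteq> K" "finite S" "K \<subseteq> (\<Union>p\<in>S. N p)"
    by (rule compactE_image[OF K, of K N]) (use N in auto)
  have m: "N p \<in> sets vol" for p using N(1) by (simp add: sets_vol)
  have "emeasure vol K \<le> emeasure vol (\<Union>p\<in>S. N p)"
    by (rule emeasure_mono[OF S(3)]) (use m S(2) in auto)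
  also have "\<dots> \<le> (\<Sum>p\<in>S. emeasure vol (N p))" by (rule emeasure_subadditive_finite) (use S m in auto)
  also have "\<dots> < \<infinity>" using S(2) N(3) by (simp add: ennreal_sum_less_top)
  finally show ?thesis .
qed

section \<open>Differentiation of the action\<close>

text \<open>On \<Omega>, which has finite volume because its closure is compact, one constant
  dominates both the integrand and its time derivative.\<close>

lemma action_derivative:
  assumes F: "smooth_tensor12_family A r F" and r: "r > 0" and \<Omega>: "open \<Omega>" "compact (closure \<Omega>)"
  shows "integrable vol (\<lambda>p. indicator \<Omega> p * variation (F 0) (tensor_velocity F) p)"
    and "((\<lambda>t. action A k n D g nabla vol \<Omega> (F t)) has_real_derivative
        (\<integral>p. indicator \<Omega> p * variation (F 0) (tensor_velocity F) p \<partial>vol)) (at 0)"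
proof -
  obtain \<delta> C where \<delta>: "\<delta> > 0" and C: "\<And>q t. q \<in> closure \<Omega> \<Longrightarrow> \<bar>t\<bar> < \<delta> \<Longrightarrow> \<bar>mixed_curv (F t) q\<bar> \<le> C"
    "\<And>q t. q \<in> closure \<Omega> \<Longrightarrow> \<bar>t\<bar> < \<delta> \<Longrightarrow> \<bar>deriv (\<lambda>s. mixed_curv (F s) q) t\<bar> \<le> C"
    "\<And>q t. q \<in> closure \<Omega> \<Longrightarrow> \<bar>t\<bar> < \<delta> \<Longrightarrow> ((\<lambda>s. mixed_curv (F s) q) has_real_derivative deriv (\<lambda>s. mixed_curv (F s) q) t) (at t)"
    using family_uniform_bound[OF F r k \<Omega>(2)] by metis
  define \<delta>' where "\<delta>' = min \<delta> r"
  have \<delta>': "\<delta>' > 0" using \<delta> r by (simp add: \<delta>'_def)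
  have sub: "q \<in> \<Omega> \<Longrightarrow> q \<in> closure \<Omega>" for q using closure_subset by blast
  have \<Omega>v: "\<Omega> \<in> sets vol" using \<Omega>(1) by (simp add: sets_vol)
  have "emeasure vol \<Omega> \<le> emeasure vol (closure \<Omega>)"
    by (rule emeasure_mono[OF closure_subset]) (simp add: sets_vol)
  also have "\<dots> < \<infinity>" by (rule vol_compact_finite[OF \<Omega>(2)])
  finally have fin: "emeasure vol \<Omega> < \<infinity>" .
  have w: "integrable vol (\<lambda>p. indicator \<Omega> p * C)"
    using fin \<Omega>v by (intro integrable_mult_left) (simp add: integrable_indicator_iff)
  have int: "integrable vol (\<lambda>p. indicator \<Omega> p * mixed_curv (F t) p)" if t: "\<bar>t\<bar> < \<delta>'" for t
  proof (rule Bochner_Integration.integrable_bound[OF w])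
    have "t \<in> {-r<..<r}" using t by (auto simp: \<delta>'_def)
    then have "mixed_curv (F t) \<in> borel_measurable borel"
      using continuous_mixed_curv[OF smooth_tensor12_family_slice[OF F] k] borel_measurable_continuous_onI by blast
    then show "(\<lambda>p. indicator \<Omega> p * mixed_curv (F t) p) \<in> borel_measurable vol"
      using \<Omega>(1) unfolding measurable_vol by (intro borel_measurable_times borel_measurable_indicator) auto
    show "AE p in vol. norm (indicator \<Omega> p * mixed_curv (F t) p) \<le> norm (indicator \<Omega> p * C)"
    proof (rule AE_I2)
      fix p
      show "norm (indicator \<Omega> p * mixed_curv (F t) p) \<le> norm (indicator \<Omega> p * C)"
        using C(1)[OF sub, of p t] t by (cases "p \<in> \<Omega>") (auto simp: \<delta>'_def)
    qed
  qed
  have d: "((\<lambda>s. indicator \<Omega> p * mixed_curv (F s) p) has_real_derivative indicator \<Omega> p * deriv (\<lambda>s. mixed_curv (F s) p) t) (at t)"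
    if "\<bar>t\<bar> < \<delta>'" for t p
    using C(3)[OF sub, of p t] that by (cases "p \<in> \<Omega>") (auto simp: \<delta>'_def)
  have b: "\<bar>indicator \<Omega> p * deriv (\<lambda>s. mixed_curv (F s) p) t\<bar> \<le> indicator \<Omega> p * C" if "\<bar>t\<bar> < \<delta>'" for t p
    using C(2)[OF sub, of p t] that by (cases "p \<in> \<Omega>") (auto simp: \<delta>'_def)
  note di = has_derivative_integral[of \<delta>' vol "\<lambda>t p. indicator \<Omega> p * mixed_curv (F t) p"
      "\<lambda>t p. indicator \<Omega> p * deriv (\<lambda>s. mixed_curv (F s) p) t" "\<lambda>p. indicator \<Omega> p * C", OF \<delta>' int d b w]
  have T: "smooth_tensor12 A (F 0)" and B: "smooth_tensor12 A (tensor_velocity F)"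
    using smooth_tensor12_family_slice[OF F, of 0] smooth_tensor12_velocity[OF F r] r by auto
  \<comment> \<open>Both sides are \<open>curv_variation\<close> in the direction of the same
    velocity: the family and the straight line with that velocity have the same first
    variation.\<close>
  have v: "deriv (\<lambda>s. mixed_curv (F s) p) 0 = variation (F 0) (tensor_velocity F) p" for p
  proof -
    obtain W E \<beta> \<epsilon> c where p: "p \<in> W" and E: "lframe W E \<beta> \<epsilon>" and c: "c \<in> A" "W \<subseteq> fst c" using frame_domain_exists[OF k] by metis
    have "p \<in> fst c" using p c by auto
    from mixed_curv_first_variation[OF F c(1) E r this p] show ?thesis
      by (simp add: variation_frame[OF T B E p] DERIV_imp_deriv)
  qed
  show "integrable vol (\<lambda>p. indicator \<Omega> p * variation (F 0) (tensor_velocity F) p)" using di(1) by (simp add: v)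
  show "((\<lambda>t. action A k n D g nabla vol \<Omega> (F t)) has_real_derivative
        (\<integral>p. indicator \<Omega> p * variation (F 0) (tensor_velocity F) p \<partial>vol)) (at 0)"
    using di(2)[unfolded v] by (simp add: action_def set_lebesgue_integral_def mixed_curv_def)
qed

text \<open>Integrability is an equivalence because the two directions of the theorem start from
  opposite ends: if the equations hold then \<open>R\<close> is zero, and if the contorsion is
  critical then the variation is known to be integrable.\<close>

lemma variation_integral_local:
  assumes T: "smooth_tensor12 A T" and B: "smooth_tensor12 A B" and E: "lframe W E \<beta> \<epsilon>" and c: "c \<in> A" "W \<subseteq> fst c"
    and K: "compact K" "K \<subseteq> W" and out: "\<And>q. q \<notin> K \<Longrightarrow> B q = (\<lambda>v w. 0)"
  defines "R \<equiv> \<lambda>p. if p \<in> W then \<Sum>x\<in>UNIV. \<Sum>y\<in>UNIV. \<Sum>z\<in>UNIV. \<epsilon> x * \<epsilon> y * \<epsilon> z * EL T E \<beta> \<epsilon> p x y z * tcomp B (fe E \<beta>) x y z p else 0"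
  shows "integrable vol (variation T B) \<longleftrightarrow> integrable vol R"
    and "integrable vol R \<Longrightarrow> 2 * integral\<^sup>L vol (variation T B) = integral\<^sup>L vol R"
proof -
  note pf = lframe_pframe[OF E]
  let ?F = "\<lambda>q. if q \<in> W then \<Sum>j\<in>UNIV. \<epsilon> j * (dir_deriv A (fe E \<beta> j) (div_field B E \<beta> \<epsilon> j) q
      - div_field B E \<beta> \<epsilon> j q * (\<Sum>i\<in>UNIV. \<epsilon> i * christ nabla (fe E \<beta>) i i j q)) else 0"
  have v0: "div_field B E \<beta> \<epsilon> j q = 0" if "q \<in> W - K" for j q
    using out[of q] that by (simp add: div_field_def tcomp_zero)
  have F: "integrable vol ?F" "integral\<^sup>L vol ?F = 0"
    by (rule frame_divergence_theorem[OF pf c, where v="div_field B E \<beta> \<epsilon>", OF smooth_fun_div_field[OF E B] K]; erule v0)+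
  have eq: "2 * variation T B p = ?F p + R p" for p
  proof (cases "p \<in> W")
    case True
    then show ?thesis using curv_variation_eq[OF E True B, of T] by (simp add: variation_frame[OF T B E True] R_def)
  next
    case False
    have "variation T B p = 0"
      by (rule variation_zero[OF T B k, of "- K"]) (use False K out in \<open>auto simp: compact_imp_closed open_Compl\<close>)
    then show ?thesis using False by (simp add: R_def)
  qed
  have v: "variation T B = (\<lambda>p. (?F p + R p) / 2)" using eq by (intro ext) (simp add: eq[symmetric])
  have R: "R = (\<lambda>p. 2 * variation T B p - ?F p)" using eq by (intro ext) simp
  show iff: "integrable vol (variation T B) \<longleftrightarrow> integrable vol R"
  proof
    assume "integrable vol (variation T B)"
    then show "integrable vol R" unfolding R using F(1) by (intro Bochner_Integration.integrable_diff integrable_mult_right)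
  next
    assume "integrable vol R"
    then show "integrable vol (variation T B)" unfolding v using F(1) by (intro integrable_divide Bochner_Integration.integrable_add)
  qed
  assume i: "integrable vol R"
  then have "integral\<^sup>L vol (\<lambda>p. 2 * variation T B p) = integral\<^sup>L vol ?F + integral\<^sup>L vol R"
    unfolding eq by (rule Bochner_Integration.integral_add[OF F(1)])
  then show "2 * integral\<^sup>L vol (variation T B) = integral\<^sup>L vol R" using F(2) by simp
qed

text \<open>Induction over the frame domains that cover the support, one peeled off at a time: the
  part of \<open>B\<close> multiplied by \<open>\<psi> i\<close> lives in one domain, where the
  divergence integrates to zero, and the rest vanishes on \<open>U i\<close>, where
  \<open>\<psi> i\<close> is 1, so the remaining domains cover its support.\<close>

lemma variation_integral_zero:
  assumes T: "smooth_tensor12 A T" and EL0: "\<And>W E \<beta> \<epsilon> p x y z. lframe W E \<beta> \<epsilon> \<Longrightarrow> p \<in> W \<Longrightarrow> EL T E \<beta> \<epsilon> p x y z = 0"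
    and B: "smooth_tensor12 A B" and K: "compact K" and out: "\<And>q. q \<notin> K \<Longrightarrow> B q = (\<lambda>v w. 0)"
  shows "integral\<^sup>L vol (variation T B) = 0"
proof -
  have "\<exists>\<psi> U L W E \<beta> \<epsilon> c. open U \<and> p \<in> U \<and> smooth_fun A UNIV \<psi> \<and> (\<forall>q\<in>U. \<psi> q = 1) \<and> compact L \<and> L \<subseteq> W \<and> (\<forall>q. q \<notin> L \<longrightarrow> \<psi> q = 0) \<and>
     lframe W E \<beta> \<epsilon> \<and> c \<in> A \<and> W \<subseteq> fst c" for p
  proof -
    obtain W E \<beta> \<epsilon> c where p: "p \<in> W" and E: "lframe W E \<beta> \<epsilon>" and c: "c \<in> A" "W \<subseteq> fst c" using frame_domain_exists[OF k] by metis
    note pf = lframe_pframe[OF E]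
    let ?U = "snd c ` W"
    have U: "open ?U" by (rule frame_image_open[OF pf c])
    have Uc: "?U \<subseteq> snd c ` fst c" using c by auto
    have "snd c p \<in> ?U" using p by blast
    then obtain s where s: "s > 0" "cball (snd c p) s \<subseteq> ?U" using U open_contains_cball by blast
    have s2: "0 < s / 2" "s / 2 < s" using s by auto
    obtain \<psi> where \<psi>: "smooth_fun A UNIV \<psi>" "\<And>q. q \<in> chart_inv c ` cball (snd c p) (s / 2) \<Longrightarrow> \<psi> q = 1"
      "\<And>q. q \<notin> chart_inv c ` cball (snd c p) s \<Longrightarrow> \<psi> q = 0"
      using bump_exists[OF c(1) s2 order_trans[OF s(2) Uc]] by metis
    have "open (chart_inv c ` ball (snd c p) (s / 2))"
      by (rule open_chart_preimage[OF c(1) open_ball]) (use s Uc in force)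
    moreover have "p \<in> chart_inv c ` ball (snd c p) (s / 2)"
      using s2(1) p c by (intro image_eqI[of _ _ "snd c p"]) (auto simp: chart_inv_left[OF c(1)])
    moreover have "compact (chart_inv c ` cball (snd c p) s)"
      by (rule compact_continuous_image[OF continuous_on_subset[OF chart_inv_continuous[OF c(1)] order_trans[OF s(2) Uc]] compact_cball])
    moreover have "chart_inv c ` cball (snd c p) s \<subseteq> W" using s(2) frame_coord_point(1)[OF pf c] by auto
    moreover have "\<forall>q\<in>chart_inv c ` ball (snd c p) (s / 2). \<psi> q = 1" using \<psi>(2) by auto
    ultimately show ?thesis using \<psi>(1,3) E c by blast
  qed
  then obtain \<psi> U L W E \<beta> \<epsilon> c where U: "\<And>p. open (U p)" "\<And>p. p \<in> U p" and \<psi>: "\<And>p. smooth_fun A UNIV (\<psi> p)" "\<And>p q. q \<in> U p \<Longrightarrow> \<psi> p q = 1"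
    and L: "\<And>p. compact (L p)" "\<And>p. L p \<subseteq> W p" "\<And>p q. q \<notin> L p \<Longrightarrow> \<psi> p q = 0"
    and E: "\<And>p. lframe (W p) (E p) (\<beta> p) (\<epsilon> p)" "\<And>p. c p \<in> A" "\<And>p. W p \<subseteq> fst (c p)" by metis
  have main: "integrable vol (variation T B) \<and> integral\<^sup>L vol (variation T B) = 0"
    if "finite I" "smooth_tensor12 A B" "compact K" "\<And>q. q \<notin> K \<Longrightarrow> B q = (\<lambda>v w. 0)" "K \<subseteq> (\<Union>p\<in>I. U p)" for I B K
    using that
  proof (induction I arbitrary: B K)
    case empty
    have "B q = (\<lambda>v w. 0)" for q using empty(3,4) by auto
    then have "variation T B = (\<lambda>p. 0)" by (intro ext) (rule variation_zero[OF T empty(1) k open_UNIV UNIV_I])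
    then show ?case by simp
  next
    case (insert i I)
    let ?B1 = "\<lambda>p v w. \<psi> i p *\<^sub>R B p v w" and ?B2 = "\<lambda>p v w. (1 - \<psi> i p) *\<^sub>R B p v w"
    have B1: "smooth_tensor12 A ?B1" and B2: "smooth_tensor12 A ?B2"
      by (intro smooth_tensor12_scale insert.prems(1) \<psi> smooth_fun_diff smooth_fun_const open_UNIV)+
    have z1: "?B1 q = (\<lambda>v w. 0)" if "q \<notin> L i" for q using L(3)[OF that] by simp
    note loc = variation_integral_local[OF T B1 E(1)[of i] E(2)[of i] E(3)[of i] L(1)[of i] L(2)[of i]]
    have R0: "(\<lambda>p. if p \<in> W i then \<Sum>x\<in>UNIV. \<Sum>y\<in>UNIV. \<Sum>z\<in>UNIV. \<epsilon> i x * \<epsilon> i y * \<epsilon> i z * EL T (E i) (\<beta> i) (\<epsilon> i) p x y z * tcomp ?B1 (fe (E i) (\<beta> i)) x y z p else 0) = (\<lambda>p. 0)"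
      using EL0[OF E(1)] by auto
    have v1: "integrable vol (variation T ?B1)" "integral\<^sup>L vol (variation T ?B1) = 0"
      using loc(1)[OF z1] loc(2)[OF z1] unfolding R0 by auto
    have KU: "compact (K - U i)" using insert.prems(2) U(1) by (rule compact_diff)
    have "?B2 q = (\<lambda>v w. 0)" if "q \<notin> K - U i" for q
      using that insert.prems(3)[of q] \<psi>(2)[of q i] by (cases "q \<in> K") auto
    from insert.IH[OF B2 KU this] insert.prems(4)
    have v2: "integrable vol (variation T ?B2)" "integral\<^sup>L vol (variation T ?B2) = 0" by auto
    have "variation T B = (\<lambda>p. variation T ?B1 p + variation T ?B2 p)"
      by (rule ext, rule variation_add[OF T insert.prems(1) B1 B2 k]) (simp add: algebra_simps)
    then show ?case using v1 v2 by simp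
  qed
  obtain S where "S \<subseteq> K" "finite S" "K \<subseteq> (\<Union>p\<in>S. U p)"
    by (rule compactE_image[OF K, of K U]) (use U in auto)
  with main[OF _ B K out] show ?thesis by blast
qed

lemma critical_if_EL_zero:
  assumes T: "smooth_tensor12 A T" and EL0: "\<And>W E \<beta> \<epsilon> p x y z. lframe W E \<beta> \<epsilon> \<Longrightarrow> p \<in> W \<Longrightarrow> EL T E \<beta> \<epsilon> p x y z = 0"
  shows "critical_contorsion A k n D g nabla vol T"
  unfolding critical_contorsion_def
proof (intro allI impI, elim conjE)
  fix \<Omega> r F
  assume \<Omega>: "open \<Omega>" "compact (closure \<Omega>)" and r: "0 < (r::real)" and F: "smooth_tensor12_family A r F" "F 0 = T"
    and supp: "\<forall>t\<in>{-r<..<r}. closure {p. \<exists>v w. vector_derivative (\<lambda>s. F s p v w) (at t) \<noteq> 0} \<subseteq> \<Omega>"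
  let ?B = "tensor_velocity F"
  \<comment> \<open>The support of the velocity at time 0: a closed set inside the compact closure
    of \<Omega>, hence compact.\<close>
  define K where "K = closure {p. \<exists>v w. ?B p v w \<noteq> 0}"
  have K\<Omega>: "K \<subseteq> \<Omega>" using supp r unfolding K_def tensor_velocity_def by auto
  have "compact (closure \<Omega> \<inter> K)" using \<Omega>(2) by (rule compact_Int_closed) (simp add: K_def)
  moreover have "closure \<Omega> \<inter> K = K" using K\<Omega> closure_subset by blast
  ultimately have K: "compact K" by simp
  have out: "?B q = (\<lambda>v w. 0)" if "q \<notin> K" for q
    using that closure_subset[of "{p. \<exists>v w. ?B p v w \<noteq> 0}"] unfolding K_def by (intro ext) blast
  have B: "smooth_tensor12 A ?B" by (rule smooth_tensor12_velocity[OF F(1) r])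
  have oK: "open (- K)" by (simp add: K_def open_Compl)
  have "variation T ?B p = 0" if "p \<notin> \<Omega>" for p
  proof (rule variation_zero[OF T B k oK])
    show "p \<in> - K" using that K\<Omega> by blast
  qed (rule out, simp)
  then have "(\<lambda>p. indicator \<Omega> p * variation (F 0) ?B p) = variation T ?B"
    by (intro ext) (auto simp: F(2) indicator_def)
  then show "((\<lambda>t. action A k n D g nabla vol \<Omega> (F t)) has_real_derivative 0) (at 0)"
    using action_derivative(2)[OF F(1) r \<Omega>] variation_integral_zero[OF T EL0 B K out] by simp
qed

end

context metric_atlas
begin

section \<open>From criticality to the equations\<close>

text \<open>The fields are smooth only on \<open>W\<close>. Near points of \<open>K\<close> the
  formula is smooth because \<open>K\<close> lies in the open set \<open>W\<close>, and off the
  closed set \<open>K\<close> it is identically 0.\<close>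

lemma smooth_tensor12_bump:
  assumes W: "open W" and X: "smooth_field A W X" and Y: "smooth_field A W Y" and Z: "smooth_field A W Z"
    and \<psi>: "smooth_fun A UNIV \<psi>" and K: "closed K" "K \<subseteq> W" and out: "\<And>q. q \<notin> K \<Longrightarrow> \<psi> q = 0"
  shows "smooth_tensor12 A (\<lambda>q v w. (\<psi> q * g q v (X q) * g q w (Y q)) *\<^sub>R Z q)"
  unfolding smooth_tensor12_def Let_def
proof (intro conjI allI ballI)
  show "bilinear (\<lambda>v w. (\<psi> q * g q v (X q) * g q w (Y q)) *\<^sub>R Z q)" for q
    unfolding bilinear_def by (auto intro!: linearI simp: g_simps algebra_simps)
  fix c v w assume c: "c \<in> A"
  let ?t = "\<lambda>x. to_coord A c (chart_inv c x) ((\<psi> (chart_inv c x) * g (chart_inv c x) (of_coord A c (chart_inv c x) v) (X (chart_inv c x)) *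
      g (chart_inv c x) (of_coord A c (chart_inv c x) w) (Y (chart_inv c x))) *\<^sub>R Z (chart_inv c x))"
  show "smooth_on (snd c ` fst c) ?t"
  proof (rule smooth_on_local)
    fix x assume x: "x \<in> snd c ` fst c"
    show "\<exists>N. open N \<and> x \<in> N \<and> smooth_on N ?t"
    proof (cases "chart_inv c x \<in> K")
      case True
      let ?S = "snd c ` (fst c \<inter> W)"
      have S: "open ?S" by (rule open_chart_image[OF c W])
      have Sc: "?S \<subseteq> snd c ` fst c" by blast
      have "x = snd c (chart_inv c x)" using chart_inv_right[OF c x] by simp
      then have xS: "x \<in> ?S" using chart_inv_in[OF c x] True K(2) by blast
      have i: "(\<lambda>x. x) ` ?S \<subseteq> snd c ` fst c" by blast
      have id: "smooth_on ?S (\<lambda>x. x)" by (rule smooth_on_linear[OF S bounded_linear_ident])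
      have sg: "smooth_on ?S (\<lambda>x. g (chart_inv c x) (of_coord A c (chart_inv c x) v) (of_coord A c (chart_inv c x) (field_coord A c X x)))"
        if "smooth_field A W X" for v X
        by (rule smooth_on_g_coord[OF c S id i smooth_on_const smooth_fieldD[OF that c]])
      have s\<psi>: "smooth_on ?S (\<lambda>x. \<psi> (chart_inv c x))"
        using smooth_on_subset[OF smooth_funD[OF \<psi> c], of ?S] by (auto simp: o_def)
      have "smooth_on ?S ?t"
      proof (rule smooth_on_cong[OF S])
        show "smooth_on ?S (\<lambda>x. (\<psi> (chart_inv c x) * g (chart_inv c x) (of_coord A c (chart_inv c x) v) (of_coord A c (chart_inv c x) (field_coord A c X x)) *
            g (chart_inv c x) (of_coord A c (chart_inv c x) w) (of_coord A c (chart_inv c x) (field_coord A c Y x))) *\<^sub>R field_coord A c Z x)"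
          by (intro smooth_on_scaleR smooth_on_mult s\<psi> sg X Y smooth_fieldD[OF Z c] S)
        fix y assume "y \<in> ?S"
        then have y: "chart_inv c y \<in> fst c" using chart_inv_in[OF c] by blast
        show "(\<psi> (chart_inv c y) * g (chart_inv c y) (of_coord A c (chart_inv c y) v) (of_coord A c (chart_inv c y) (field_coord A c X y)) *
            g (chart_inv c y) (of_coord A c (chart_inv c y) w) (of_coord A c (chart_inv c y) (field_coord A c Y y))) *\<^sub>R field_coord A c Z y = ?t y"
          by (simp add: field_coord_def of_to_coord[OF c y] linear_scale[OF linear_to_coord[OF c y]])
      qed
      then show ?thesis using S xS by blast
    next
      case False
      let ?S = "snd c ` (fst c \<inter> - K)"
      have S: "open ?S" by (rule open_chart_image[OF c]) (use K in \<open>simp add: open_Compl\<close>)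
      have "x = snd c (chart_inv c x)" using chart_inv_right[OF c x] by simp
      then have xS: "x \<in> ?S" using chart_inv_in[OF c x] False by blast
      have "smooth_on ?S ?t"
      proof (rule smooth_on_cong[OF S _ smooth_on_const[of _ 0]])
        fix y assume "y \<in> ?S"
        then obtain q where q: "q \<in> fst c" "q \<notin> K" "y = snd c q" by blast
        then have y: "chart_inv c y = q" by (simp add: chart_inv_left[OF c])
        show "0 = ?t y" by (simp add: y out[OF q(2)] linear_0[OF linear_to_coord[OF c q(1)]])
      qed
      then show ?thesis using S xS by blast
    qed
  qed
qed

end

context multi_product_volume
begin

text \<open>Criticality is applied to the line \<open>T + t * B\<close>, whose velocity is
  \<open>B\<close> at all times, so the support condition is met.\<close>

lemma action_stationary_integral:
  assumes crit: "critical_contorsion A k n D g nabla vol T" and T: "smooth_tensor12 A T" and B: "smooth_tensor12 A B"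
    and \<Omega>: "open \<Omega>" "connected \<Omega>" "compact (closure \<Omega>)" and K: "closed K" "K \<subseteq> \<Omega>" and out: "\<And>q. q \<notin> K \<Longrightarrow> B q = (\<lambda>v w. 0)"
  shows "integrable vol (variation T B)" "integral\<^sup>L vol (variation T B) = 0"
proof -
  let ?F = "\<lambda>t p v w. T p v w + t *\<^sub>R B p v w"
  have F: "smooth_tensor12_family A 1 ?F" by (rule smooth_tensor12_line[OF T B])
  have F0: "?F 0 = T" by simp
  have one: "(1::real) > 0" by simp
  have v: "vector_derivative (\<lambda>s. ?F s p v w) (at t) = B p v w" for p v w t
    by (rule vector_derivative_at) (auto intro!: derivative_eq_intros)
  have "{p. \<exists>v w. B p v w \<noteq> 0} \<subseteq> K"
  proof
    fix q assume "q \<in> {p. \<exists>v w. B p v w \<noteq> 0}"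
    then have "B q \<noteq> (\<lambda>v w. 0)" by auto
    then show "q \<in> K" using out by blast
  qed
  then have "closure {p. \<exists>v w. B p v w \<noteq> 0} \<subseteq> \<Omega>" using K closure_minimal by blast
  then have "((\<lambda>t. action A k n D g nabla vol \<Omega> (?F t)) has_real_derivative 0) (at 0)"
    using crit[unfolded critical_contorsion_def, rule_format, of \<Omega> 1 ?F] \<Omega> F F0 by (simp add: v)
  note d = DERIV_unique[OF this action_derivative(2)[OF F one \<Omega>(1,3)]]
  have oK: "open (- K)" using K(1) by (simp add: open_Compl)
  have z: "variation T B p = 0" if "p \<notin> \<Omega>" for p
  proof (rule variation_zero[OF T B k oK])
    show "p \<in> - K" using that K(2) by blast
  qed (rule out, simp)
  have e: "(\<lambda>p. indicator \<Omega> p * variation (?F 0) (tensor_velocity ?F) p) = variation T B"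
    using z by (intro ext) (auto simp: F0 tensor_velocity_line indicator_def)
  show "integrable vol (variation T B)" using action_derivative(1)[OF F one \<Omega>(1,3)] unfolding e .
  show "integral\<^sup>L vol (variation T B) = 0" using d unfolding e by simp
qed

lemma EL_zero_if_critical:
  assumes crit: "critical_contorsion A k n D g nabla vol T" and T: "smooth_tensor12 A T"
    and E0: "lframe W0 E \<beta> \<epsilon>" and p: "p \<in> W0"
  shows "EL T E \<beta> \<epsilon> p x0 y0 z0 = 0"
proof (rule ccontr)
  assume neq: "EL T E \<beta> \<epsilon> p x0 y0 z0 \<noteq> 0"
  define c where "c = chart_at A p"
  have c: "c \<in> A" "p \<in> fst c" unfolding c_def by (rule chart_at)+
  \<comment> \<open>The sign makes the coefficient positive on a neighbourhood \<open>W\<close> of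
    \<open>p\<close>, so the integrand below does not change sign.\<close>
  define s where "s = sgn (EL T E \<beta> \<epsilon> p x0 y0 z0)"
  let ?L = "\<lambda>q. s * EL T E \<beta> \<epsilon> q x0 y0 z0"
  let ?W1 = "W0 \<inter> fst c"
  have W1: "open ?W1" using lframe_pframe[OF E0] chart_dom_open[OF c(1)] by (auto simp: pframe_def)
  have E1: "lframe ?W1 E \<beta> \<epsilon>" by (rule lframe_subset[OF E0 W1]) simp
  have sL: "smooth_fun A ?W1 ?L" by (intro smooth_fun_mult smooth_fun_const smooth_fun_EL[OF E1 T] W1)
  define W where "W = {q \<in> ?W1. \<forall>i\<in>{()}. ?L q > 0}"
  have W: "open W" unfolding W_def by (rule open_smooth_fun_positive[OF W1]) (auto intro: sL)
  have WW1: "W \<subseteq> ?W1" by (auto simp: W_def)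
  have E: "lframe W E \<beta> \<epsilon>" by (rule lframe_subset[OF E1 W WW1])
  have Wc: "W \<subseteq> fst c" using WW1 by blast
  have pos: "?L q > 0" if "q \<in> W" for q using that by (simp add: W_def)
  have pW: "p \<in> W" using p c(2) neq by (simp add: W_def s_def sgn_mult_self_eq mult_sgn_abs sgn_real_def)
  note pf = lframe_pframe[OF E]
  let ?U = "snd c ` W" and ?x = "snd c p" and ?e = "fe E \<beta>"
  have U: "open ?U" by (rule frame_image_open[OF pf c(1) Wc])
  have Uc: "?U \<subseteq> snd c ` fst c" using Wc by blast
  have "?x \<in> ?U" using pW by blast
  then obtain r where r: "r > 0" "cball ?x r \<subseteq> ?U" using U open_contains_cball by blast
  \<comment> \<open>Three nested radii: the bump is 1 up to \<open>r1\<close> and supported within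
    \<open>r2\<close>, and the open ball of radius \<open>r\<close> gives a connected domain
    \<Omega> with compact closure.\<close>
  define r1 where "r1 = r / 3"
  define r2 where "r2 = 2 * r / 3"
  have rr: "0 < r1" "r1 < r2" "r2 < r" using r(1) by (auto simp: r1_def r2_def)
  have sub: "cball ?x r2 \<subseteq> ?U" "ball ?x r \<subseteq> ?U" using r rr by (auto simp: subset_iff)
  obtain \<psi> where \<psi>: "smooth_fun A UNIV \<psi>" "\<And>q. 0 \<le> \<psi> q" "\<And>q. q \<in> chart_inv c ` cball ?x r1 \<Longrightarrow> \<psi> q = 1"
    "\<And>q. q \<notin> chart_inv c ` cball ?x r2 \<Longrightarrow> \<psi> q = 0"
    using bump_exists[OF c(1) rr(1,2) order_trans[OF sub(1) Uc]] by metis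
  define K where "K = chart_inv c ` cball ?x r2"
  define \<Omega> where "\<Omega> = chart_inv c ` ball ?x r"
  have cont: "continuous_on ?U (chart_inv c)"
    by (rule continuous_on_subset[OF chart_inv_continuous[OF c(1)] Uc])
  have K: "compact K" unfolding K_def
    by (rule compact_continuous_image[OF continuous_on_subset[OF cont sub(1)] compact_cball])
  have K': "closed K" using K by (rule compact_imp_closed)
  have KW: "K \<subseteq> W" unfolding K_def using sub(1) frame_coord_point(1)[OF pf c(1) Wc] by blast
  have "cball ?x r2 \<subseteq> ball ?x r" using rr(3) by (auto simp: subset_iff)
  then have K\<Omega>: "K \<subseteq> \<Omega>" unfolding K_def \<Omega>_def by blast
  have \<Omega>1: "open \<Omega>" unfolding \<Omega>_def by (rule open_chart_preimage[OF c(1) open_ball order_trans[OF sub(2) Uc]])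
  have \<Omega>2: "connected \<Omega>" unfolding \<Omega>_def
    by (rule connected_continuous_image[OF continuous_on_subset[OF cont sub(2)] connected_ball])
  have "compact (chart_inv c ` cball ?x r)"
    by (rule compact_continuous_image[OF continuous_on_subset[OF cont r(2)] compact_cball])
  moreover have "\<Omega> \<subseteq> chart_inv c ` cball ?x r" unfolding \<Omega>_def by (intro image_mono ball_subset_cball)
  ultimately have \<Omega>3: "compact (closure \<Omega>)"
    using closure_minimal compact_imp_closed compact_Int_closed closed_closure by (metis Int_absorb1)
  \<comment> \<open>The frame tensor dual to the indices \<open>x0\<close>, \<open>y0\<close>,
    \<open>z0\<close>, times the bump and the sign: on \<open>W\<close> all its other frame
    components vanish.\<close>
  define B where "B = (\<lambda>q v w. (s * \<psi> q * g q v (?e x0 q) * g q w (?e y0 q)) *\<^sub>R ?e z0 q)"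
  have se: "smooth_field A W (?e i)" for i using pf by (simp add: pframe_def)
  have \<psi>0: "s * \<psi> q = 0" if "q \<notin> K" for q using \<psi>(4) that by (simp add: K_def)
  have B: "smooth_tensor12 A B"
    unfolding B_def
    by (rule smooth_tensor12_bump[OF W se se se _ K' KW \<psi>0]) (intro smooth_fun_mult smooth_fun_const \<psi>(1) open_UNIV)
  have out: "B q = (\<lambda>v w. 0)" if "q \<notin> K" for q using \<psi>0[OF that] by (intro ext) (auto simp: B_def)
  note van = action_stationary_integral[OF crit T B \<Omega>1 \<Omega>2 \<Omega>3 K' K\<Omega> out]
  let ?R = "\<lambda>p. if p \<in> W then \<Sum>x\<in>UNIV. \<Sum>y\<in>UNIV. \<Sum>z\<in>UNIV. \<epsilon> x * \<epsilon> y * \<epsilon> z * EL T E \<beta> \<epsilon> p x y z * tcomp B (fe E \<beta>) x y z p else 0"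
  note loc = variation_integral_local[OF T B E c(1) Wc K KW out]
  have R: "integrable vol ?R" using loc(1) van(1) by blast
  have R0: "integral\<^sup>L vol ?R = 0" using loc(2)[OF _ R] van(2) by simp
  let ?f = "\<lambda>q. if q \<in> W then \<psi> q * ?L q else 0"
  have f: "?R = ?f"
  proof
    fix q
    show "?R q = ?f q"
    proof (cases "q \<in> W")
      case True
      have ep: "\<epsilon> i * \<epsilon> i = 1" for i using pf by (simp add: pframe_def)
      have on: "g q (?e i q) (?e j q) = (if i = j then \<epsilon> i else 0)" for i j using pf True by (simp add: pframe_def)
      have summand: "\<epsilon> x * \<epsilon> y * \<epsilon> z * EL T E \<beta> \<epsilon> q x y z * tcomp B ?e x y z q
          = (if x = x0 then if y = y0 then if z = z0 then \<psi> q * ?L q else 0 else 0 else 0)" for x y z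
      proof -
        have "tcomp B ?e x y z q = s * \<psi> q * g q (?e x q) (?e x0 q) * g q (?e y q) (?e y0 q) * g q (?e z0 q) (?e z q)"
          by (simp add: tcomp_def B_def g_simps)
        \<comment> \<open>Each of the three signs occurs twice, once as a weight and once in the
          component of \<open>B\<close>, so all of them disappear.\<close>
        moreover have "\<epsilon> x * \<epsilon> y * \<epsilon> z * a * (b * \<epsilon> x * \<epsilon> y * \<epsilon> z) = a * b" for a b
        proof -
          have "\<epsilon> x * \<epsilon> y * \<epsilon> z * a * (b * \<epsilon> x * \<epsilon> y * \<epsilon> z) = a * b * (\<epsilon> x * \<epsilon> x) * (\<epsilon> y * \<epsilon> y) * (\<epsilon> z * \<epsilon> z)" by (simp only: mult_ac)
          then show ?thesis by (simp only: ep mult_1_right)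
        qed
        ultimately show ?thesis by (auto simp: on)
      qed
      have "(\<Sum>i\<in>UNIV. if b then f i else 0) = (if b then \<Sum>i\<in>UNIV. f i else 0)" for b and f :: "'n \<Rightarrow> real" by simp
      then show ?thesis using True unfolding summand by simp
    qed simp
  qed
  have "0 < integral\<^sup>L vol ?f"
  proof (rule vol_positive[OF pf c(1) Wc])
    have "continuous_on W (\<lambda>q. \<psi> q * ?L q)"
      by (intro continuous_on_smooth_fun[OF W] smooth_fun_mult W smooth_fun_subset[OF \<psi>(1)] smooth_fun_subset[OF sL WW1]) simp
    then show "continuous_on W ?f" by (rule continuous_on_eq) simp
    show "0 \<le> ?f q" if "q \<in> W" for q using that pos[OF that] \<psi>(2)[of q] by simp
    show "p \<in> W" by (rule pW)
    have "p = chart_inv c ?x" using chart_inv_left[OF c] by simp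
    then have "\<psi> p = 1" using \<psi>(3)[of p] rr(1) by (metis centre_in_cball image_eqI less_imp_le)
    then show "0 < ?f p" using pos[OF pW] pW by simp
    show "integrable vol ?f" using R unfolding f .
  qed simp
  then show False using R0 unfolding f by simp
qed

lemma critical_iff_critical_equations:
  assumes T: "smooth_tensor12 A T"
  shows "critical_contorsion A k n D g nabla vol T \<longleftrightarrow>
    (\<forall>W E. adapted_frame A k n D g W E \<longrightarrow> (\<forall>p\<in>W. critical_equations T E p))"
proof (intro iffI allI impI ballI)
  fix W E p assume crit: "critical_contorsion A k n D g nabla vol T" and E: "adapted_frame A k n D g W E" and p: "p \<in> W"
  obtain W' \<beta> \<epsilon> where W': "p \<in> W'" "lframe W' E \<beta> \<epsilon>" using adapted_frame_lframe[OF E p k] by metis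
  show "critical_equations T E p"
    unfolding critical_equations_iff[OF T W'(2,1)]
    using EL_zero_if_critical[OF crit T W'(2,1)] by (simp add: EL_def)
next
  assume eq: "\<forall>W E. adapted_frame A k n D g W E \<longrightarrow> (\<forall>p\<in>W. critical_equations T E p)"
  show "critical_contorsion A k n D g nabla vol T"
  proof (rule critical_if_EL_zero[OF T])
    fix W E \<beta> \<epsilon> p x y z assume E: "lframe W E \<beta> \<epsilon>" and p: "p \<in> W"
    have "critical_equations T E p" using eq E p by (auto simp: lframe_def)
    then show "EL T E \<beta> \<epsilon> p x y z = 0" unfolding critical_equations_iff[OF T E p] by (simp add: EL_def)
  qed
qed

end

theorem proposition3:
  fixes A :: "('a::{t2_space,second_countable_topology}, 'n::finite) chart set"
    and k :: nat
    and n :: "nat \<Rightarrow> nat"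
    and D :: "nat \<Rightarrow> 'a \<Rightarrow> (real ^ 'n) set"
    and g :: "('a, 'n) metric"
    and nabla :: "('a, 'n) connection"
    and vol :: "'a measure"
    and \<TT> :: "('a, 'n) tensor12"
  assumes manifold: "smooth_atlas A" "connected (UNIV :: 'a set)"
    and k: "k \<ge> 2"
    and dist: "almost_multi_product A k n D"
    and metric: "adapted_metric A k D g"
    and nabla: "levi_civita A g nabla"
    and vol: "volume_measure A g vol"
    and contorsion: "smooth_tensor12 A \<TT>"
  defines "h \<equiv> sff k D g nabla"
    and "T \<equiv> integrability k D g nabla"
    and "H \<equiv> mean_curv A k D g nabla"
    and "ht \<equiv> sff_perp D g nabla"
    and "Tt \<equiv> integrability_perp D g nabla"
    and "Ht \<equiv> mean_curv_perp A k D g nabla"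
    and "Tr \<equiv> \<lambda>\<mu>. trace_perp A k D g \<mu> \<TT>"
    and "Tr_adj \<equiv> \<lambda>\<mu>. trace_perp A k D g \<mu> (tensor_adj g \<TT>)"
  shows "critical_contorsion A k n D g nabla vol \<TT> \<longleftrightarrow>
    (\<forall>W E. adapted_frame A k n D g W E \<longrightarrow> (\<forall>p\<in>W. \<forall>\<mu>\<in>{1..k}.
      (\<forall>a\<in>{1..n \<mu>}. \<forall>b\<in>{1..n \<mu>}. \<forall>c\<in>{1..n \<mu>}.
          g p (Tr_adj \<mu> p - Ht \<mu> p) (E \<mu> c p) * g p (E \<mu> a p) (E \<mu> b p)
        + g p (Tr \<mu> p + Ht \<mu> p) (E \<mu> b p) * g p (E \<mu> a p) (E \<mu> c p) = 0) \<and>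
      (\<forall>\<rho>\<in>{1..k} - {\<mu>}. \<forall>a\<in>{1..n \<mu>}. \<forall>b\<in>{1..n \<mu>}. \<forall>i\<in>{1..n \<rho>}.
          g p (Tr_adj \<mu> p + H \<mu> p) (E \<rho> i p) * g p (E \<mu> a p) (E \<mu> b p)
        - g p (h \<mu> (E \<mu> a) (E \<mu> b) p - T \<mu> (E \<mu> a) (E \<mu> b) p) (E \<rho> i p)
        - g p (\<TT> p (E \<rho> i p) (E \<mu> a p)) (E \<mu> b p) = 0) \<and>
      (\<forall>\<rho>\<in>{1..k} - {\<mu>}. \<forall>a\<in>{1..n \<mu>}. \<forall>b\<in>{1..n \<mu>}. \<forall>i\<in>{1..n \<rho>}.
          g p (Tr \<mu> p - H \<mu> p) (E \<rho> i p) * g p (E \<mu> a p) (E \<mu> b p)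
        + g p (h \<mu> (E \<mu> b) (E \<mu> a) p + T \<mu> (E \<mu> b) (E \<mu> a) p) (E \<rho> i p)
        - g p (\<TT> p (E \<rho> i p) (E \<mu> b p)) (E \<mu> a p) = 0) \<and>
      (\<forall>\<rho>\<in>{1..k} - {\<mu>}. \<forall>a\<in>{1..n \<mu>}. \<forall>b\<in>{1..n \<mu>}. \<forall>i\<in>{1..n \<rho>}.
          g p (2 *\<^sub>R T \<mu> (E \<mu> a) (E \<mu> b) p) (E \<rho> i p)
        + g p (\<TT> p (E \<mu> a p) (E \<mu> b p) + tensor_adj g \<TT> p (E \<mu> b p) (E \<mu> a p)) (E \<rho> i p) = 0) \<and>
      (\<forall>\<rho>\<in>{1..k} - {\<mu>}. \<forall>\<xi>\<in>{1..k} - {\<mu>, \<rho>}.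
        \<forall>a\<in>{1..n \<mu>}. \<forall>j\<in>{1..n \<rho>}. \<forall>l\<in>{1..n \<xi>}.
          g p (2 *\<^sub>R Tt \<mu> (E \<rho> j) (E \<xi> l) p) (E \<mu> a p)
        + g p (ht \<xi> (E \<rho> j) (E \<mu> a) p + Tt \<xi> (E \<rho> j) (E \<mu> a) p) (E \<xi> l p)
        + 2 * g p (\<TT> p (E \<xi> l p) (E \<mu> a p)) (E \<rho> j p)
        - g p (ht \<rho> (E \<xi> l) (E \<mu> a) p + Tt \<rho> (E \<xi> l) (E \<mu> a) p) (E \<rho> j p)
        + 2 * g p (\<TT> p (E \<rho> j p) (E \<xi> l p)) (E \<mu> a p) = 0)))"
proof -
  interpret multi_product_volume A g nabla k n D vol
    by unfold_locales (use manifold k dist metric nabla vol in \<open>auto simp: adapted_metric_def\<close>)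
  show ?thesis
    unfolding critical_iff_critical_equations[OF contorsion] critical_equations_def h_def T_def H_def ht_def Tt_def Ht_def Tr_def Tr_adj_def
    by (rule refl)
qed

end
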